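(* Let $\mathbb F$ be a field of characteristic $0$. (a) Let $\widetilde{\mathscr P}$ be a conformal operad. Then the collection of superspaces $\mathscr P(n)=\widetilde{\mathscr P}(n)/\partial\widetilde{\mathscr P}(n)$, $n\ge0$, is naturally a linear operad, with composition maps $$\bar f(\bar g_1\otimes\cdots\otimes\bar g_n)=\overline{f_{0,\dots,0}(g_1\otimes\cdots\otimes g_n)},$$ for $\bar f\in\mathscr P(n)$, $\bar g_i\in\mathscr P(m_i)$, with $f\in\widetilde{\mathscr P}(n)$, $g_i\in\widetilde{\mathscr P}(m_i)$ any representatives, and with the right action of $S_n$ on $\mathscr P(n)$ induced by that on $\widetilde{\mathscr P}(n)$. If $\widetilde{\mathscr P}$ is a unital conformal operad, then $\mathscr P$ is a unital operad, with the same unit element $1\in\mathscr P(1)=\widetilde{\mathscr P}(1)/\partial\widetilde{\mathscr P}(1)$. (b) Let $\widetilde{\mathscr P}$ be a conformal pseudo operad. Then the collection $\mathscr P(n)=\widetilde{\mathscr P}(n)/\partial\widetilde{\mathscr P}(n)$, $n\geq 0$, is naturally a linear pseudo operad, with products $\bar f\circ_i\bar g=\overline{f\circ^i_0g}$ (for any representatives $f\in\widetilde{\mathscr P}(n)$, $g\in\widetilde{\mathscr P}(m)$ of $\bar f,\bar g$) and the induced right action of $S_n$. (c) Let $\widetilde{\mathscr P}$ be a conformal pseudo operad and $\mathscr P=\widetilde{\mathscr P}/\partial\widetilde{\mathscr P}$ the pseudo operad of (b). There is a canonical surjective homomorphism of $\mathbb Z_{\ge-1}$-graded Lie superalgebras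 $$\widetilde W(\widetilde{\mathscr P})/\partial\widetilde W(\widetilde{\mathscr P})\twoheadrightarrow W(\mathscr P),$$ induced by the quotient maps $\widetilde{\mathscr P}(n)\to\mathscr P(n)$, which restricts to an isomorphism $\widetilde W_n/\partial\widetilde W_n\simeq W_n$ in degree $n$ provided that $\partial$ has zero kernel on $\widetilde{\mathscr P}(n+1)$, or that $n=0$. Moreover there is a Lie superalgebra action of $W(\mathscr P)$ on $\widetilde W(\widetilde{\mathscr P})$, compatible with this map and preserving the gradings, given by $$[\bar f,g]:=\tilde f\,\Box_0\,g-(-1)^{p(\tilde f)p(g)}\,g\,\Box_{-\partial}\tilde f\in\widetilde W_{m+n},$$ for $\bar f\in W_m$, $g\in\widetilde W_n$, and any $\tilde f\in\widetilde W_m$ representing a preimage of $\bar f$ under the map above.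
   Context: Superspaces are over $\mathbb F$; $p$ is parity; $S_0$ is trivial. Permutations: $\sigma\in S_n$ acts by $\sigma(v_1\otimes\cdots\otimes v_n)=\epsilon_v(\sigma)v_{\sigma^{-1}(1)}\otimes\cdots\otimes v_{\sigma^{-1}(n)}$, $\epsilon_v(\sigma)=\prod_{i<j,\sigma(i)>\sigma(j)}(-1)^{p(v_i)p(v_j)}$. $\sigma(\tau_1,\dots,\tau_n)\in S_{m_1+\dots+m_n}$ ($\tau_i\in S_{m_i}$) applies $\tau_i$ to the $i$-th block of $m_i$ factors, and then permutes the $n$ blocks via $\sigma$. $\sigma\circ_i\tau=\sigma(1,\dots,1,\tau,1,\dots,1)\in S_{n+m-1}$ with $\tau\in S_m$ in position $i$ and the other entries in $S_1$. $S_{m,n}\subset S_{m+n}$: $(m,n)$-shuffles ($\sigma(1)<\dots<\sigma(m)$, $\sigma(m+1)<\dots<\sigma(m+n)$), empty if $m<0$ or $n<0$, $S_{n,0}=S_{0,n}=\{1\}$. For $m_1,\dots,m_n$ put $M_j=\sum_{k\le j}m_k$. Given $h_1,\dots,h_{M_n}$ put $H_i=h_{M_{i-1}+1}\otimes\dots\otimes h_{M_i}$ and $\pm=(-1)^{\sum_{i<j}p(g_j)p(H_i)}$. Conformal operad: superspaces $\widetilde{\mathscr P}(n)$, $n\ge0$, with even endomorphism $\partial$, right linear parity preserving action $f\mapsto f^\sigma$ of $S_n$ commuting with $\partial$, and parity preserving linear composition maps ($n\ge1$, $m_i\ge0$) $\widetilde{\mathscr P}(n)\otimes\widetilde{\mathscr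 P}(m_1)\otimes\dots\otimes\widetilde{\mathscr P}(m_n)\to\widetilde{\mathscr P}(M_n)[\lambda_1,\dots,\lambda_n]$, $f\otimes g_1\otimes\cdots\otimes g_n\mapsto f_{\lambda_1,\dots,\lambda_n}(g_1\otimes\dots\otimes g_n)$, satisfying: - $(\partial f)_{\lambda_1,\dots,\lambda_n}(g_1\otimes\cdots\otimes g_n)=(\partial+\lambda_1+\dots+\lambda_n)f_{\lambda_1,\dots,\lambda_n}(g_1\otimes\cdots\otimes g_n)$, and $f_{\lambda_1,\dots,\lambda_n}(\cdots\partial g_i\cdots)=-\lambda_if_{\lambda_1,\dots,\lambda_n}(g_1\otimes\cdots\otimes g_n)$; - $\big(f_{\lambda_1,\dots,\lambda_n}(g_1\otimes\cdots\otimes g_n)\big)_{\mu_1,\dots,\mu_{M_n}}(h_1\otimes\cdots\otimes h_{M_n})=\pm f_{\lambda_1+\Gamma_1,\dots,\lambda_n+\Gamma_n}\big((g_1)_{\mu_1,\dots,\mu_{M_1}}(H_1)\otimes\cdots\otimes(g_n)_{\mu_{M_{n-1}+1},\dots,\mu_{M_n}}(H_n)\big)$, with $\Gamma_i=\sum_{j=M_{i-1}+1}^{M_i}\mu_j$; - $(f^\sigma)_{\lambda_1,\dots,\lambda_n}(g_1^{\tau_1}\otimes\cdots\otimes g_n^{\tau_n})=\big(f_{\lambda_{\sigma^{-1}(1)},\dots,\lambda_{\sigma^{-1}(n)}}(\sigma(g_1\otimes\cdots\otimes g_n))\big)^{\sigma(\tau_1,\dots,\tau_n)}$. It is unital if there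 is $1\in\widetilde{\mathscr P}(1)/\partial\widetilde{\mathscr P}(1)$ such that for any representative $\widetilde1\in\widetilde{\mathscr P}(1)$: $\widetilde1_{-\partial}(f)=f$ and $f_{0,\dots,0}(\widetilde1\otimes\dots\otimes\widetilde1)=f$ for $f\in\widetilde{\mathscr P}(n)$. A linear (symmetric, super) operad is the analogous structure $\mathscr P$ with no $\partial$ and no $\lambda$'s: composition maps $\mathscr P(n)\otimes\mathscr P(m_1)\otimes\dots\otimes\mathscr P(m_n)\to\mathscr P(M_n)$ with $(f(g_1\otimes\cdots\otimes g_n))(h_1\otimes\cdots\otimes h_{M_n})=\pm f(g_1(H_1)\otimes\cdots\otimes g_n(H_n))$ and $f^\sigma(g_1^{\tau_1}\otimes\cdots\otimes g_n^{\tau_n})=(f(\sigma(g_1\otimes\cdots\otimes g_n)))^{\sigma(\tau_1,\dots,\tau_n)}$; it is unital if there is $1\in\mathscr P(1)$ with $f(1\otimes\dots\otimes1)=1(f)=f$. Conformal pseudo operad: superspaces $\widetilde{\mathscr P}(n)$, $n\ge0$, with even $\partial$, parity preserving right $S_n$-action commuting with $\partial$, and parity preserving bilinear products $\circ^i_\lambda:\widetilde{\mathscr P}(n)\times\widetilde{\mathscr P}(m)\to\widetilde{\mathscr P}(n+m-1)[\lambda]$, $1\le i\le n$, with ($f\in\widetilde{\mathscr P}(n)$, $g\in\widetilde{\mathscr P}(m)$, $h\in\widetilde{\mathscr P}(\ell)$): $(\partial f)\circ^i_\lambda g=(\lambda+\partial)(f\circ^i_\lambda g)$; $f\circ^i_\lambda(\partial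 g)=-\lambda f\circ^i_\lambda g$; $(f\circ^i_\lambda g)\circ^j_\mu h=(-1)^{p(g)p(h)}(f\circ^j_\mu h)\circ^{\ell+i-1}_\lambda g$ for $1\le j<i$; $(f\circ^i_\lambda g)\circ^j_\mu h=f\circ^i_{\lambda+\mu}(g\circ^{j-i+1}_\mu h)$ for $i\le j<i+m$; $f^\sigma\circ^i_\lambda g^\tau=(f\circ^{\sigma(i)}_\lambda g)^{\sigma\circ_i\tau}$. A linear pseudo operad is the analogous structure without $\partial$ and $\lambda,\mu$ (products $\circ_i:\mathscr P(n)\times\mathscr P(m)\to\mathscr P(n+m-1)$ with the same associativity and equivariance conditions). For a pseudo operad $\mathscr P$: $W(\mathscr P)=\bigoplus_{n\ge-1}W_n$, $W_n=\mathscr P(n+1)^{S_{n+1}}$, is a $\mathbb Z$-graded Lie superalgebra with $[f,g]=f\Box g-(-1)^{p(f)p(g)}g\Box f$, $f\Box g=\sum_{\sigma\in S_{m+1,n}}(f\circ_1g)^{\sigma^{-1}}$ for $f\in W_n$, $g\in W_m$. For a conformal pseudo operad: $\widetilde W(\widetilde{\mathscr P})=\bigoplus_{n\ge-1}\widetilde W_n$, $\widetilde W_n=\widetilde{\mathscr P}(n+1)^{S_{n+1}}$, is a $\mathbb Z_{\geq -1}$-graded Lie conformal superalgebra with $[f_\lambda g]=f\Box_\lambda g-(-1)^{p(f)p(g)}g\Box_{-\lambda-\partial}f$, $f\Box_\lambda g=\sum_{\sigma\in S_{m+1,n}}(f\circ^1_{-\lambda-\partial}g)^{\sigma^{-1}}$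 for $f\in\widetilde W_n$, $g\in\widetilde W_m$ ($\partial$ moved to the left and applied to coefficients). Then $\widetilde W/\partial\widetilde W$ is a Lie superalgebra with bracket $[\bar a,\bar b]=\overline{[a_\lambda b]|_{\lambda=0}}$, and it acts on $\widetilde W$ by $\bar a(b)=[a_\lambda b]|_{\lambda=0}$. Compatibility of the action of $W(\mathscr P)$ means that its pullback along $\widetilde W/\partial\widetilde W\to W(\mathscr P)$ is this action. *)

theory Defs
  imports "HOL-Library.Multiset" "HOL-Library.Z2" "HOL-Combinatorics.Permutations" "HOL-Algebra.UnivPoly"
begin

section \<open>Superspaces\<close>

definition char_zero :: "('k, 'm) ring_scheme \<Rightarrow> bool" where
  "char_zero K \<longleftrightarrow> (\<forall>n::nat. n > 0 \<longrightarrow> [n] \<cdot>\<^bsub>K\<^esub> \<one>\<^bsub>K\<^esub> \<noteq> \<zero>\<^bsub>K\<^esub>)"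

text \<open>Parities live in the field \<open>bit\<close> with two elements. The multiplicative fields inherited from
  the record \<open>module\<close> carry no meaning.\<close>

record ('k, 'a) superspace = "('k, 'a) module" +
  hpart :: "bit \<Rightarrow> 'a set"

locale superspace = field K + module K V
  for K :: "('k, 'm) ring_scheme" (structure) and V :: "('k, 'a, 'z) superspace_scheme" (structure) +
  assumes hpart_submodule: "submodule (hpart V p) K V"
    and hpart_disjoint: "hpart V 0 \<inter> hpart V 1 = {\<zero>\<^bsub>V\<^esub>}"
    and hpart_sum: "hpart V 0 <+>\<^bsub>V\<^esub> hpart V 1 = carrier V"

definition lin_map ::
  "('k, 'm) ring_scheme \<Rightarrow> ('k, 'a, 'y) module_scheme \<Rightarrow> ('k, 'b, 'z) module_scheme \<Rightarrow> ('a \<Rightarrow> 'b) \<Rightarrow> bool" where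
  "lin_map K V W \<phi> \<longleftrightarrow>
     \<phi> \<in> carrier V \<rightarrow> carrier W \<and>
     (\<forall>x\<in>carrier V. \<forall>y\<in>carrier V. \<phi> (x \<oplus>\<^bsub>V\<^esub> y) = \<phi> x \<oplus>\<^bsub>W\<^esub> \<phi> y) \<and>
     (\<forall>c\<in>carrier K. \<forall>x\<in>carrier V. \<phi> (c \<odot>\<^bsub>V\<^esub> x) = c \<odot>\<^bsub>W\<^esub> \<phi> x)"

definition even_map ::
  "('k, 'm) ring_scheme \<Rightarrow> ('k, 'a, 'y) superspace_scheme \<Rightarrow> ('k, 'b, 'z) superspace_scheme \<Rightarrow> ('a \<Rightarrow> 'b) \<Rightarrow> bool" where
  "even_map K V W \<phi> \<longleftrightarrow> lin_map K V W \<phi> \<and> (\<forall>p. \<phi> ` hpart V p \<subseteq> hpart W p)"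

text \<open>\<open>signed V p v\<close> is $(-1)^p v$.\<close>

definition signed :: "('a, 'z) ring_scheme \<Rightarrow> bit \<Rightarrow> 'a \<Rightarrow> 'a" where
  "signed V p v = (if p = 1 then \<ominus>\<^bsub>V\<^esub> v else v)"

definition hproj :: "('k, 'a, 'z) superspace_scheme \<Rightarrow> bit \<Rightarrow> 'a \<Rightarrow> 'a" where
  "hproj V p v = (THE x. x \<in> hpart V p \<and> (\<exists>y\<in>hpart V (p + 1). v = x \<oplus>\<^bsub>V\<^esub> y))"

definition squot :: "('k, 'a, 'z) superspace_scheme \<Rightarrow> 'a set \<Rightarrow> ('k, 'a set) superspace" where
  "squot V H =
     \<lparr>carrier = a_rcosets\<^bsub>V\<^esub> H, mult = undefined, one = undefined, zero = H, add = set_add V,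
      smult = (\<lambda>c X. \<Union>x\<in>X. H +>\<^bsub>V\<^esub> (c \<odot>\<^bsub>V\<^esub> x)),
      hpart = (\<lambda>p. (\<lambda>x. H +>\<^bsub>V\<^esub> x) ` hpart V p)\<rparr>"


section \<open>Polynomials with coefficients in a superspace\<close>

text \<open>An element of $V[x_i : i \in I]$ is its coefficient function on monomials, a monomial being a
  multiset of variables (as in \<open>HOL-Algebra.Indexed_Polynomials\<close>, which however requires the
  coefficients to form a ring). An element of $V[\lambda]$ is its coefficient sequence, in \<open>up V\<close>.\<close>

definition mpolys :: "('a, 'z) ring_scheme \<Rightarrow> 'v set \<Rightarrow> ('v multiset \<Rightarrow> 'a) set" where
  "mpolys V I = {R. (\<forall>\<alpha>. R \<alpha> \<in> carrier V) \<and> finite {\<alpha>. R \<alpha> \<noteq> \<zero>\<^bsub>V\<^esub>} \<and>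
                    (\<forall>\<alpha>. R \<alpha> \<noteq> \<zero>\<^bsub>V\<^esub> \<longrightarrow> set_mset \<alpha> \<subseteq> I)}"

definition var_times :: "('a, 'z) ring_scheme \<Rightarrow> 'v \<Rightarrow> ('v multiset \<Rightarrow> 'a) \<Rightarrow> 'v multiset \<Rightarrow> 'a" where
  "var_times V v R = (\<lambda>\<alpha>. if v \<in># \<alpha> then R (\<alpha> - {#v#}) else \<zero>\<^bsub>V\<^esub>)"

text \<open>Multiplication by the linear form $\sum_{v \in S} v$.\<close>

definition form_times :: "('a, 'z) ring_scheme \<Rightarrow> 'v set \<Rightarrow> ('v multiset \<Rightarrow> 'a) \<Rightarrow> 'v multiset \<Rightarrow> 'a" where
  "form_times V S R = (\<lambda>\<alpha>. \<Oplus>\<^bsub>V\<^esub>v\<in>S. var_times V v R \<alpha>)"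

text \<open>For a polynomial in variables $\nu_i$ whose coefficients \<open>Q \<gamma>\<close> are themselves polynomials,
  substitute $\nu_i = \sum_{v \in S_i} v$.\<close>

definition subst_forms ::
  "('a, 'z) ring_scheme \<Rightarrow> (nat \<Rightarrow> 'v set) \<Rightarrow> (nat multiset \<Rightarrow> 'v multiset \<Rightarrow> 'a) \<Rightarrow> 'v multiset \<Rightarrow> 'a" where
  "subst_forms V S Q = (\<lambda>\<alpha>. \<Oplus>\<^bsub>V\<^esub>\<gamma>\<in>{\<gamma>. \<exists>\<beta>. Q \<gamma> \<beta> \<noteq> \<zero>\<^bsub>V\<^esub>}.
     fold (\<lambda>i. form_times V (S i)) (sorted_list_of_multiset \<gamma>) (Q \<gamma>) \<alpha>)"

text \<open>\<open>eval_neg V d Q\<close> is $Q(-d) = \sum_a (-d)^a Q_a$ in $V$; \<open>subst_neg V d Q\<close> is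
  $Q(-\lambda-d) = \sum_a (-\lambda-d)^a Q_a$ in $V[\lambda]$, and \<open>neg_times V d\<close> is the operator
  $-\lambda-d$ on $V[\lambda]$.\<close>

definition eval_neg :: "('a, 'z) ring_scheme \<Rightarrow> ('a \<Rightarrow> 'a) \<Rightarrow> (nat \<Rightarrow> 'a) \<Rightarrow> 'a" where
  "eval_neg V d Q = (\<Oplus>\<^bsub>V\<^esub>a\<in>{a. Q a \<noteq> \<zero>\<^bsub>V\<^esub>}. ((\<lambda>x. \<ominus>\<^bsub>V\<^esub> d x) ^^ a) (Q a))"

definition neg_times :: "('a, 'z) ring_scheme \<Rightarrow> ('a \<Rightarrow> 'a) \<Rightarrow> (nat \<Rightarrow> 'a) \<Rightarrow> nat \<Rightarrow> 'a" where
  "neg_times V d R = (\<lambda>k. \<ominus>\<^bsub>V\<^esub> ((if k = 0 then \<zero>\<^bsub>V\<^esub> else R (k - 1)) \<oplus>\<^bsub>V\<^esub> d (R k)))"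

definition subst_neg :: "('a, 'z) ring_scheme \<Rightarrow> ('a \<Rightarrow> 'a) \<Rightarrow> (nat \<Rightarrow> 'a) \<Rightarrow> nat \<Rightarrow> 'a" where
  "subst_neg V d Q = (\<lambda>k. \<Oplus>\<^bsub>V\<^esub>a\<in>{a. Q a \<noteq> \<zero>\<^bsub>V\<^esub>}.
     (neg_times V d ^^ a) (\<lambda>j. if j = 0 then Q a else \<zero>\<^bsub>V\<^esub>) k)"


section \<open>Permutations and blocks\<close>

text \<open>Positions, blocks and variables are numbered from 1, so the \<open>i\<close>-th entry of a list \<open>xs\<close> is
  \<open>xs ! (i - 1)\<close>. \<open>psum ms j\<close> is $M_j = m_1 + \dots + m_j$.\<close>

definition psum :: "nat list \<Rightarrow> nat \<Rightarrow> nat" where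
  "psum ms j = sum_list (take j ms)"

definition block :: "nat list \<Rightarrow> nat \<Rightarrow> 'x list \<Rightarrow> 'x list" where
  "block ms i xs = take (ms ! (i - 1)) (drop (psum ms (i - 1)) xs)"

definition block_sums :: "nat list \<Rightarrow> nat list \<Rightarrow> nat list" where
  "block_sums ms ls = map (\<lambda>i. sum_list (block ms i ls)) [1..<Suc (length ms)]"

definition tensor_perm :: "(nat \<Rightarrow> nat) \<Rightarrow> 'x list \<Rightarrow> 'x list" where
  "tensor_perm \<sigma> xs = map (\<lambda>i. xs ! (inv_into UNIV \<sigma> i - 1)) [1..<Suc (length xs)]"

text \<open>\<open>koszul \<sigma> ps\<close> is the exponent of the sign $\epsilon_v(\sigma)$ for factors of parities \<open>ps\<close>.\<close>

definition koszul :: "(nat \<Rightarrow> nat) \<Rightarrow> bit list \<Rightarrow> bit" where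
  "koszul \<sigma> ps = (\<Sum>(i, j)\<in>{(i, j). 1 \<le> i \<and> i < j \<and> j \<le> length ps \<and> \<sigma> i > \<sigma> j}. ps ! (i - 1) * ps ! (j - 1))"

text \<open>$\sigma(\tau_1,\dots,\tau_n)$: the factor at position \<open>r\<close> of block \<open>i\<close> moves to position
  \<open>\<tau>\<^sub>i r\<close> of that block, which itself is moved behind all blocks \<open>k\<close> with \<open>\<sigma> k < \<sigma> i\<close>.
  The \<open>LEAST\<close> below is the number of the block that contains \<open>a\<close>.\<close>

definition block_perm :: "(nat \<Rightarrow> nat) \<Rightarrow> nat list \<Rightarrow> (nat \<Rightarrow> nat) list \<Rightarrow> nat \<Rightarrow> nat" where
  "block_perm \<sigma> ms \<tau>s a =
     (if a \<in> {1..sum_list ms}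
      then let i = (LEAST i. a \<le> psum ms i)
           in (\<Sum>k\<in>{k\<in>{1..length ms}. \<sigma> k < \<sigma> i}. ms ! (k - 1)) + (\<tau>s ! (i - 1)) (a - psum ms (i - 1))
      else a)"

text \<open>$\sigma \circ_i \tau$ for $\sigma \in S_n$, $\tau \in S_m$.\<close>

definition circ_perm :: "nat \<Rightarrow> nat \<Rightarrow> nat \<Rightarrow> (nat \<Rightarrow> nat) \<Rightarrow> (nat \<Rightarrow> nat) \<Rightarrow> nat \<Rightarrow> nat" where
  "circ_perm n m i \<sigma> \<tau> = block_perm \<sigma> ((replicate n 1)[i - 1 := m]) ((replicate n id)[i - 1 := \<tau>])"

definition shuffle_perms :: "int \<Rightarrow> int \<Rightarrow> (nat \<Rightarrow> nat) set" where
  "shuffle_perms m n = {\<sigma>. 0 \<le> m \<and> 0 \<le> n \<and> \<sigma> permutes {1..nat (m + n)} \<and>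
     strict_mono_on {1..nat m} \<sigma> \<and> strict_mono_on {nat m + 1..nat (m + n)} \<sigma>}"


section \<open>Sequences of superspaces with symmetric group actions\<close>

text \<open>\<open>act S n \<sigma> f\<close> is $f^\sigma$ for $f$ of arity \<open>n\<close>. The arity is an explicit argument because the
  carriers of different arities share one type and may overlap.\<close>

record ('k, 'a) symm_seq =
  sp :: "nat \<Rightarrow> ('k, 'a) superspace"
  act :: "nat \<Rightarrow> (nat \<Rightarrow> nat) \<Rightarrow> 'a \<Rightarrow> 'a"

locale symm_seq =
  fixes K :: "('k, 'm) ring_scheme" and S :: "('k, 'a, 'z) symm_seq_scheme"
  assumes superspace_sp: "superspace K (sp S n)"
    and act_even: "\<sigma> permutes {1..n} \<Longrightarrow> even_map K (sp S n) (sp S n) (act S n \<sigma>)"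
    and act_id: "f \<in> carrier (sp S n) \<Longrightarrow> act S n id f = f"
    and act_comp: "\<lbrakk>\<sigma> permutes {1..n}; \<tau> permutes {1..n}; f \<in> carrier (sp S n)\<rbrakk>
      \<Longrightarrow> act S n (\<sigma> \<circ> \<tau>) f = act S n \<tau> (act S n \<sigma> f)"

record ('k, 'a) diff_symm_seq = "('k, 'a) symm_seq" +
  dd :: "nat \<Rightarrow> 'a \<Rightarrow> 'a"

locale diff_symm_seq = symm_seq K S
  for K :: "('k, 'm) ring_scheme" and S :: "('k, 'a, 'z) diff_symm_seq_scheme" +
  assumes dd_even: "even_map K (sp S n) (sp S n) (dd S n)"
    and act_dd: "\<lbrakk>\<sigma> permutes {1..n}; f \<in> carrier (sp S n)\<rbrakk> \<Longrightarrow> act S n \<sigma> (dd S n f) = dd S n (act S n \<sigma> f)"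

definition args :: "('k, 'a, 'z) symm_seq_scheme \<Rightarrow> nat list \<Rightarrow> 'a list \<Rightarrow> bool" where
  "args S ms gs \<longleftrightarrow> length gs = length ms \<and> (\<forall>i<length ms. gs ! i \<in> carrier (sp S (ms ! i)))"

definition hargs :: "('k, 'a, 'z) symm_seq_scheme \<Rightarrow> nat list \<Rightarrow> bit list \<Rightarrow> 'a list \<Rightarrow> bool" where
  "hargs S ms ps gs \<longleftrightarrow> length ps = length ms \<and> length gs = length ms \<and>
     (\<forall>i<length ms. gs ! i \<in> hpart (sp S (ms ! i)) (ps ! i))"

definition act_args :: "('k, 'a, 'z) symm_seq_scheme \<Rightarrow> nat list \<Rightarrow> (nat \<Rightarrow> nat) list \<Rightarrow> 'a list \<Rightarrow> 'a list" where
  "act_args S ms \<tau>s gs = map (\<lambda>i. act S (ms ! (i - 1)) (\<tau>s ! (i - 1)) (gs ! (i - 1))) [1..<Suc (length ms)]"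

text \<open>The exponent $\sum_{i<j} p(g_j) p(H_i)$, for \<open>g\<close>'s of parities \<open>ps\<close> and \<open>h\<close>'s of parities \<open>qs\<close>.\<close>

definition assoc_sign :: "nat list \<Rightarrow> bit list \<Rightarrow> bit list \<Rightarrow> bit" where
  "assoc_sign ms ps qs =
     (\<Sum>(i, j)\<in>{(i, j). 1 \<le> i \<and> i < j \<and> j \<le> length ms}. ps ! (j - 1) * sum_list (block ms i qs))"


section \<open>Linear operads\<close>

text \<open>\<open>opcomp P [m\<^sub>1,\<dots>,m\<^sub>n] f [g\<^sub>1,\<dots>,g\<^sub>n]\<close> is $f(g_1 \otimes \dots \otimes g_n)$, where
  \<open>g\<^sub>i\<close> has arity \<open>m\<^sub>i\<close>. Composition maps are given for $n \ge 1$ only, but the associativity axiom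
  involves terms $g_i(H_i)$ with $m_i = 0$, which stand for $g_i$; \<open>opcomp_nullary\<close> (and
  \<open>ccomp_nullary\<close> below) fixes this convention, under which the other axioms are trivial for
  $n = 0$.\<close>

record ('k, 'a) linear_operad = "('k, 'a) symm_seq" +
  opcomp :: "nat list \<Rightarrow> 'a \<Rightarrow> 'a list \<Rightarrow> 'a"

locale linear_operad = symm_seq K P
  for K :: "('k, 'm) ring_scheme" and P :: "('k, 'a, 'z) linear_operad_scheme" +
  assumes opcomp_lin_left: "args P ms gs
      \<Longrightarrow> lin_map K (sp P (length ms)) (sp P (sum_list ms)) (\<lambda>f. opcomp P ms f gs)"
    and opcomp_lin_right: "\<lbrakk>f \<in> carrier (sp P (length ms)); args P ms gs; i < length ms\<rbrakk>
      \<Longrightarrow> lin_map K (sp P (ms ! i)) (sp P (sum_list ms)) (\<lambda>x. opcomp P ms f (gs[i := x]))"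
    and opcomp_parity: "\<lbrakk>f \<in> hpart (sp P (length ms)) p; hargs P ms ps gs\<rbrakk>
      \<Longrightarrow> opcomp P ms f gs \<in> hpart (sp P (sum_list ms)) (p + sum_list ps)"
    and opcomp_nullary: "f \<in> carrier (sp P 0) \<Longrightarrow> opcomp P [] f [] = f"
    and opcomp_assoc: "\<lbrakk>f \<in> carrier (sp P (length ms)); hargs P ms ps gs;
        length ls = sum_list ms; hargs P ls qs hs\<rbrakk>
      \<Longrightarrow> opcomp P ls (opcomp P ms f gs) hs =
          signed (sp P (sum_list ls)) (assoc_sign ms ps qs)
            (opcomp P (block_sums ms ls) f
               (map (\<lambda>i. opcomp P (block ms i ls) (gs ! (i - 1)) (block ms i hs)) [1..<Suc (length ms)]))"
    and opcomp_equivariant: "\<lbrakk>f \<in> carrier (sp P (length ms)); hargs P ms ps gs; \<sigma> permutes {1..length ms};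
        length \<tau>s = length ms; \<And>i. i < length ms \<Longrightarrow> (\<tau>s ! i) permutes {1..ms ! i}\<rbrakk>
      \<Longrightarrow> opcomp P ms (act P (length ms) \<sigma> f) (act_args P ms \<tau>s gs) =
          signed (sp P (sum_list ms)) (koszul \<sigma> ps)
            (act P (sum_list ms) (block_perm \<sigma> ms \<tau>s)
               (opcomp P (tensor_perm \<sigma> ms) f (tensor_perm \<sigma> gs)))"

definition is_operad_unit :: "('k, 'a, 'z) linear_operad_scheme \<Rightarrow> 'a \<Rightarrow> bool" where
  "is_operad_unit P u \<longleftrightarrow> u \<in> carrier (sp P 1) \<and>
     (\<forall>n. \<forall>f\<in>carrier (sp P n). opcomp P (replicate n 1) f (replicate n u) = f \<and> opcomp P [n] u [f] = f)"


section \<open>Conformal operads\<close>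

text \<open>\<open>ccomp P [m\<^sub>1,\<dots>,m\<^sub>n] f [g\<^sub>1,\<dots>,g\<^sub>n]\<close> is the polynomial
  $f_{\lambda_1,\dots,\lambda_n}(g_1 \otimes \dots \otimes g_n)$, with \<open>\<lambda>\<^sub>i\<close> represented by the
  variable \<open>i\<close>; its value at $\lambda_1 = \dots = \lambda_n = 0$ is the coefficient at \<open>{#}\<close>.\<close>

record ('k, 'a) conformal_operad = "('k, 'a) diff_symm_seq" +
  ccomp :: "nat list \<Rightarrow> 'a \<Rightarrow> 'a list \<Rightarrow> nat multiset \<Rightarrow> 'a"

text \<open>In the associativity axiom the variables \<open>\<lambda>\<^sub>i\<close>, \<open>\<mu>\<^sub>j\<close> are \<open>Inl i\<close>, \<open>Inr j\<close>.\<close>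

definition lam_part :: "(nat + nat) multiset \<Rightarrow> nat multiset" where
  "lam_part \<alpha> = image_mset projl (filter_mset isl \<alpha>)"

definition mu_part :: "(nat + nat) multiset \<Rightarrow> nat multiset" where
  "mu_part \<alpha> = image_mset projr (filter_mset (\<lambda>v. \<not> isl v) \<alpha>)"

text \<open>The part of a monomial that involves the variables of block \<open>i\<close>, which are renumbered from 1.\<close>

definition block_part :: "nat list \<Rightarrow> nat \<Rightarrow> nat multiset \<Rightarrow> nat multiset" where
  "block_part ms i \<beta> = image_mset (\<lambda>j. j - psum ms (i - 1)) (filter_mset (\<lambda>j. psum ms (i - 1) < j \<and> j \<le> psum ms i) \<beta>)"

text \<open>The coefficient at $\nu^\gamma$ of
  $f_{\nu_1,\dots,\nu_n}((g_1)_{\mu_1,\dots,\mu_{M_1}}(H_1) \otimes \dots \otimes (g_n)_{\mu_{M_{n-1}+1},\dots,\mu_{M_n}}(H_n))$,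
  as a polynomial in the \<open>\<mu>\<^sub>j\<close>. The blocks involve disjoint sets of variables, so each monomial in the
  \<open>\<mu>\<^sub>j\<close> arises from exactly one choice of a monomial for every block.\<close>

definition nested_comp ::
  "('k, 'a, 'z) conformal_operad_scheme \<Rightarrow> nat list \<Rightarrow> nat list \<Rightarrow> 'a \<Rightarrow> 'a list \<Rightarrow> 'a list
     \<Rightarrow> nat multiset \<Rightarrow> (nat + nat) multiset \<Rightarrow> 'a" where
  "nested_comp P ms ls f gs hs \<gamma> \<beta> =
     (if set_mset \<beta> \<subseteq> Inr ` {1..sum_list ms}
      then ccomp P (block_sums ms ls) f
             (map (\<lambda>i. ccomp P (block ms i ls) (gs ! (i - 1)) (block ms i hs) (block_part ms i (mu_part \<beta>)))
                  [1..<Suc (length ms)]) \<gamma>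
      else \<zero>\<^bsub>sp P (sum_list ls)\<^esub>)"

locale conformal_operad = diff_symm_seq K P
  for K :: "('k, 'm) ring_scheme" and P :: "('k, 'a, 'z) conformal_operad_scheme" +
  assumes ccomp_poly: "\<lbrakk>f \<in> carrier (sp P (length ms)); args P ms gs\<rbrakk>
      \<Longrightarrow> ccomp P ms f gs \<in> mpolys (sp P (sum_list ms)) {1..length ms}"
    and ccomp_lin_left: "args P ms gs
      \<Longrightarrow> lin_map K (sp P (length ms)) (sp P (sum_list ms)) (\<lambda>f. ccomp P ms f gs \<alpha>)"
    and ccomp_lin_right: "\<lbrakk>f \<in> carrier (sp P (length ms)); args P ms gs; i < length ms\<rbrakk>
      \<Longrightarrow> lin_map K (sp P (ms ! i)) (sp P (sum_list ms)) (\<lambda>x. ccomp P ms f (gs[i := x]) \<alpha>)"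
    and ccomp_parity: "\<lbrakk>f \<in> hpart (sp P (length ms)) p; hargs P ms ps gs\<rbrakk>
      \<Longrightarrow> ccomp P ms f gs \<alpha> \<in> hpart (sp P (sum_list ms)) (p + sum_list ps)"
    and ccomp_nullary: "f \<in> carrier (sp P 0)
      \<Longrightarrow> ccomp P [] f [] = (\<lambda>\<alpha>. if \<alpha> = {#} then f else \<zero>\<^bsub>sp P 0\<^esub>)"
    and ccomp_dd_left: "\<lbrakk>f \<in> carrier (sp P (length ms)); args P ms gs\<rbrakk>
      \<Longrightarrow> ccomp P ms (dd P (length ms) f) gs \<alpha> =
          dd P (sum_list ms) (ccomp P ms f gs \<alpha>)
          \<oplus>\<^bsub>sp P (sum_list ms)\<^esub> form_times (sp P (sum_list ms)) {1..length ms} (ccomp P ms f gs) \<alpha>"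
    and ccomp_dd_right: "\<lbrakk>f \<in> carrier (sp P (length ms)); args P ms gs; i \<in> {1..length ms}\<rbrakk>
      \<Longrightarrow> ccomp P ms f (gs[i - 1 := dd P (ms ! (i - 1)) (gs ! (i - 1))]) \<alpha> =
          \<ominus>\<^bsub>sp P (sum_list ms)\<^esub> var_times (sp P (sum_list ms)) i (ccomp P ms f gs) \<alpha>"
    and ccomp_assoc: "\<lbrakk>f \<in> carrier (sp P (length ms)); hargs P ms ps gs;
        length ls = sum_list ms; hargs P ls qs hs\<rbrakk>
      \<Longrightarrow> ccomp P ls (ccomp P ms f gs (lam_part \<kappa>)) hs (mu_part \<kappa>) =
          signed (sp P (sum_list ls)) (assoc_sign ms ps qs)
            (subst_forms (sp P (sum_list ls))
               (\<lambda>i. insert (Inl i) (Inr ` {psum ms (i - 1)<..psum ms i}))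
               (nested_comp P ms ls f gs hs) \<kappa>)"
      \<comment> \<open>the coefficient at the monomial \<open>\<kappa>\<close> in the \<open>\<lambda>\<^sub>i\<close> and \<open>\<mu>\<^sub>j\<close>; the substitution is $\nu_i = \lambda_i + \Gamma_i$\<close>
    and ccomp_equivariant: "\<lbrakk>f \<in> carrier (sp P (length ms)); hargs P ms ps gs; \<sigma> permutes {1..length ms};
        length \<tau>s = length ms; \<And>i. i < length ms \<Longrightarrow> (\<tau>s ! i) permutes {1..ms ! i}\<rbrakk>
      \<Longrightarrow> ccomp P ms (act P (length ms) \<sigma> f) (act_args P ms \<tau>s gs) \<alpha> =
          signed (sp P (sum_list ms)) (koszul \<sigma> ps)
            (act P (sum_list ms) (block_perm \<sigma> ms \<tau>s)
               (ccomp P (tensor_perm \<sigma> ms) f (tensor_perm \<sigma> gs) (image_mset \<sigma> \<alpha>)))"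
      \<comment> \<open>on the right, the \<open>k\<close>-th variable is $\lambda_{\sigma^{-1}(k)}$, so $\lambda_j$ is variable number $\sigma(j)$\<close>


section \<open>Pseudo operads\<close>

text \<open>\<open>pcomp P n m i f g\<close> is $f \circ_i g$ for $f$ of arity \<open>n\<close> and $g$ of arity \<open>m\<close>;
  \<open>cpcomp P n m i f g\<close> is the coefficient sequence of $f \circ^i_\lambda g$.\<close>

record ('k, 'a) linear_pseudo_operad = "('k, 'a) symm_seq" +
  pcomp :: "nat \<Rightarrow> nat \<Rightarrow> nat \<Rightarrow> 'a \<Rightarrow> 'a \<Rightarrow> 'a"

locale linear_pseudo_operad = symm_seq K P
  for K :: "('k, 'm) ring_scheme" and P :: "('k, 'a, 'z) linear_pseudo_operad_scheme" +
  assumes pcomp_lin_left: "\<lbrakk>i \<in> {1..n}; g \<in> carrier (sp P m)\<rbrakk>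
      \<Longrightarrow> lin_map K (sp P n) (sp P (n + m - 1)) (\<lambda>f. pcomp P n m i f g)"
    and pcomp_lin_right: "\<lbrakk>i \<in> {1..n}; f \<in> carrier (sp P n)\<rbrakk>
      \<Longrightarrow> lin_map K (sp P m) (sp P (n + m - 1)) (\<lambda>g. pcomp P n m i f g)"
    and pcomp_parity: "\<lbrakk>i \<in> {1..n}; f \<in> hpart (sp P n) p; g \<in> hpart (sp P m) q\<rbrakk>
      \<Longrightarrow> pcomp P n m i f g \<in> hpart (sp P (n + m - 1)) (p + q)"
    and pcomp_assoc_par: "\<lbrakk>1 \<le> j; j < i; i \<le> n; f \<in> carrier (sp P n); g \<in> hpart (sp P m) q; h \<in> hpart (sp P l) r\<rbrakk>
      \<Longrightarrow> pcomp P (n + m - 1) l j (pcomp P n m i f g) h =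
          signed (sp P (n + m + l - 2)) (q * r)
            (pcomp P (n + l - 1) m (l + i - 1) (pcomp P n l j f h) g)"
    and pcomp_assoc_seq: "\<lbrakk>1 \<le> i; i \<le> n; i \<le> j; j < i + m; f \<in> carrier (sp P n); g \<in> carrier (sp P m); h \<in> carrier (sp P l)\<rbrakk>
      \<Longrightarrow> pcomp P (n + m - 1) l j (pcomp P n m i f g) h =
          pcomp P n (m + l - 1) i f (pcomp P m l (j + 1 - i) g h)"
    and pcomp_equivariant: "\<lbrakk>i \<in> {1..n}; f \<in> carrier (sp P n); g \<in> carrier (sp P m); \<sigma> permutes {1..n}; \<tau> permutes {1..m}\<rbrakk>
      \<Longrightarrow> pcomp P n m i (act P n \<sigma> f) (act P m \<tau> g) =
          act P (n + m - 1) (circ_perm n m i \<sigma> \<tau>) (pcomp P n m (\<sigma> i) f g)"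

record ('k, 'a) conformal_pseudo_operad = "('k, 'a) diff_symm_seq" +
  cpcomp :: "nat \<Rightarrow> nat \<Rightarrow> nat \<Rightarrow> 'a \<Rightarrow> 'a \<Rightarrow> nat \<Rightarrow> 'a"

locale conformal_pseudo_operad = diff_symm_seq K P
  for K :: "('k, 'm) ring_scheme" and P :: "('k, 'a, 'z) conformal_pseudo_operad_scheme" +
  assumes cpcomp_poly: "\<lbrakk>i \<in> {1..n}; f \<in> carrier (sp P n); g \<in> carrier (sp P m)\<rbrakk>
      \<Longrightarrow> cpcomp P n m i f g \<in> up (sp P (n + m - 1))"
    and cpcomp_lin_left: "\<lbrakk>i \<in> {1..n}; g \<in> carrier (sp P m)\<rbrakk>
      \<Longrightarrow> lin_map K (sp P n) (sp P (n + m - 1)) (\<lambda>f. cpcomp P n m i f g a)"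
    and cpcomp_lin_right: "\<lbrakk>i \<in> {1..n}; f \<in> carrier (sp P n)\<rbrakk>
      \<Longrightarrow> lin_map K (sp P m) (sp P (n + m - 1)) (\<lambda>g. cpcomp P n m i f g a)"
    and cpcomp_parity: "\<lbrakk>i \<in> {1..n}; f \<in> hpart (sp P n) p; g \<in> hpart (sp P m) q\<rbrakk>
      \<Longrightarrow> cpcomp P n m i f g a \<in> hpart (sp P (n + m - 1)) (p + q)"
    and cpcomp_dd_left: "\<lbrakk>i \<in> {1..n}; f \<in> carrier (sp P n); g \<in> carrier (sp P m)\<rbrakk>
      \<Longrightarrow> cpcomp P n m i (dd P n f) g a =
          (if a = 0 then \<zero>\<^bsub>sp P (n + m - 1)\<^esub> else cpcomp P n m i f g (a - 1))
          \<oplus>\<^bsub>sp P (n + m - 1)\<^esub> dd P (n + m - 1) (cpcomp P n m i f g a)"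
    and cpcomp_dd_right: "\<lbrakk>i \<in> {1..n}; f \<in> carrier (sp P n); g \<in> carrier (sp P m)\<rbrakk>
      \<Longrightarrow> cpcomp P n m i f (dd P m g) a =
          \<ominus>\<^bsub>sp P (n + m - 1)\<^esub> (if a = 0 then \<zero>\<^bsub>sp P (n + m - 1)\<^esub> else cpcomp P n m i f g (a - 1))"
    and cpcomp_assoc_par: "\<lbrakk>1 \<le> j; j < i; i \<le> n; f \<in> carrier (sp P n); g \<in> hpart (sp P m) q; h \<in> hpart (sp P l) r\<rbrakk>
      \<Longrightarrow> cpcomp P (n + m - 1) l j (cpcomp P n m i f g a) h b =
          signed (sp P (n + m + l - 2)) (q * r)
            (cpcomp P (n + l - 1) m (l + i - 1) (cpcomp P n l j f h b) g a)"
    and cpcomp_assoc_seq: "\<lbrakk>1 \<le> i; i \<le> n; i \<le> j; j < i + m; f \<in> carrier (sp P n); g \<in> carrier (sp P m); h \<in> carrier (sp P l)\<rbrakk>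
      \<Longrightarrow> cpcomp P (n + m - 1) l j (cpcomp P n m i f g a) h b =
          (\<Oplus>\<^bsub>sp P (n + m + l - 2)\<^esub>d\<in>{..b}. [((a + b - d) choose a)] \<cdot>\<^bsub>sp P (n + m + l - 2)\<^esub>
             cpcomp P n (m + l - 1) i f (cpcomp P m l (j + 1 - i) g h d) (a + b - d))"
      \<comment> \<open>the coefficient at $\lambda^a \mu^b$ of $f \circ^i_{\lambda+\mu} (g \circ^{j-i+1}_\mu h)$: the summand
        $(\lambda+\mu)^c \mu^d$ contributes for $c + d = a + b$, with binomial coefficient $\binom{c}{a}$\<close>
    and cpcomp_equivariant: "\<lbrakk>i \<in> {1..n}; f \<in> carrier (sp P n); g \<in> carrier (sp P m); \<sigma> permutes {1..n}; \<tau> permutes {1..m}\<rbrakk>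
      \<Longrightarrow> cpcomp P n m i (act P n \<sigma> f) (act P m \<tau> g) a =
          act P (n + m - 1) (circ_perm n m i \<sigma> \<tau>) (cpcomp P n m (\<sigma> i) f g a)"


section \<open>Quotients by the derivation\<close>

definition dcls :: "('k, 'a, 'z) diff_symm_seq_scheme \<Rightarrow> nat \<Rightarrow> 'a \<Rightarrow> 'a set" where
  "dcls S n f = (dd S n ` carrier (sp S n)) +>\<^bsub>sp S n\<^esub> f"

definition dquot :: "('k, 'a, 'z) diff_symm_seq_scheme \<Rightarrow> nat \<Rightarrow> ('k, 'a set) superspace" where
  "dquot S n = squot (sp S n) (dd S n ` carrier (sp S n))"

text \<open>As in \<open>rcoset_mult\<close>, an operation on cosets is the union of the cosets obtained from all
  representatives; this is a single coset exactly if the choice of representatives does not matter.\<close>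

definition quot_act :: "('k, 'a, 'z) diff_symm_seq_scheme \<Rightarrow> nat \<Rightarrow> (nat \<Rightarrow> nat) \<Rightarrow> 'a set \<Rightarrow> 'a set" where
  "quot_act S n \<sigma> X = (\<Union>f\<in>X. dcls S n (act S n \<sigma> f))"

definition quot_operad :: "('k, 'a, 'z) conformal_operad_scheme \<Rightarrow> ('k, 'a set) linear_operad" where
  "quot_operad P =
     \<lparr>sp = dquot P, act = quot_act P,
      opcomp = (\<lambda>ms X Ys. \<Union>f\<in>X. \<Union>gs\<in>listset Ys. dcls P (sum_list ms) (ccomp P ms f gs {#}))\<rparr>"

definition quot_pseudo_operad :: "('k, 'a, 'z) conformal_pseudo_operad_scheme \<Rightarrow> ('k, 'a set) linear_pseudo_operad" where
  "quot_pseudo_operad P =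
     \<lparr>sp = dquot P, act = quot_act P,
      pcomp = (\<lambda>n m i X Y. \<Union>f\<in>X. \<Union>g\<in>Y. dcls P (n + m - 1) (cpcomp P n m i f g 0))\<rparr>"

definition is_conformal_unit :: "('k, 'a, 'z) conformal_operad_scheme \<Rightarrow> 'a set \<Rightarrow> bool" where
  "is_conformal_unit P U \<longleftrightarrow> U \<in> carrier (dquot P 1) \<and>
     (\<forall>u\<in>U. \<forall>n. \<forall>f\<in>carrier (sp P n).
        eval_neg (sp P n) (dd P n) (\<lambda>a. ccomp P [n] u [f] (replicate_mset a 1)) = f \<and>
        ccomp P (replicate n 1) f (replicate n u) {#} = f)"


section \<open>Graded Lie superalgebras\<close>

record ('k, 'a) graded_lsa = "('k, 'a) superspace" +
  brk :: "'a \<Rightarrow> 'a \<Rightarrow> 'a"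
  deg :: "int \<Rightarrow> 'a set"

text \<open>Lie superalgebras over a field of characteristic 0, graded by the integers $\ge -1$: the
  components of degree less than $-1$ vanish.\<close>

locale graded_lsa = superspace K L
  for K :: "('k, 'm) ring_scheme" (structure) and L :: "('k, 'a, 'z) graded_lsa_scheme" (structure) +
  assumes brk_lin_left: "y \<in> carrier L \<Longrightarrow> lin_map K L L (\<lambda>x. brk L x y)"
    and brk_lin_right: "x \<in> carrier L \<Longrightarrow> lin_map K L L (\<lambda>y. brk L x y)"
    and brk_parity: "\<lbrakk>x \<in> hpart L p; y \<in> hpart L q\<rbrakk> \<Longrightarrow> brk L x y \<in> hpart L (p + q)"
    and brk_skew: "\<lbrakk>x \<in> hpart L p; y \<in> hpart L q\<rbrakk> \<Longrightarrow> brk L x y = \<ominus>\<^bsub>L\<^esub> signed L (p * q) (brk L y x)"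
    and brk_jacobi: "\<lbrakk>x \<in> hpart L p; y \<in> hpart L q; z \<in> carrier L\<rbrakk>
      \<Longrightarrow> brk L x (brk L y z) = brk L (brk L x y) z \<oplus>\<^bsub>L\<^esub> signed L (p * q) (brk L y (brk L x z))"
    and deg_submodule: "submodule (deg L n) K L"
    and deg_super: "x \<in> deg L n \<Longrightarrow> \<exists>y\<in>deg L n \<inter> hpart L 0. \<exists>z\<in>deg L n \<inter> hpart L 1. x = y \<oplus>\<^bsub>L\<^esub> z"
    and deg_direct_sum: "x \<in> carrier L \<Longrightarrow>
      \<exists>!c. (\<forall>n. c n \<in> deg L n) \<and> finite {n. c n \<noteq> \<zero>\<^bsub>L\<^esub>} \<and> x = (\<Oplus>\<^bsub>L\<^esub>n\<in>{n. c n \<noteq> \<zero>\<^bsub>L\<^esub>}. c n)"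
    and deg_lower: "n < -1 \<Longrightarrow> deg L n = {\<zero>\<^bsub>L\<^esub>}"
    and deg_brk: "\<lbrakk>x \<in> deg L m; y \<in> deg L n\<rbrakk> \<Longrightarrow> brk L x y \<in> deg L (m + n)"

definition graded_lsa_hom ::
  "('k, 'm) ring_scheme \<Rightarrow> ('k, 'a, 'y) graded_lsa_scheme \<Rightarrow> ('k, 'b, 'z) graded_lsa_scheme \<Rightarrow> ('a \<Rightarrow> 'b) \<Rightarrow> bool" where
  "graded_lsa_hom K L M \<phi> \<longleftrightarrow> graded_lsa K L \<and> graded_lsa K M \<and> even_map K L M \<phi> \<and>
     (\<forall>x\<in>carrier L. \<forall>y\<in>carrier L. \<phi> (brk L x y) = brk M (\<phi> x) (\<phi> y)) \<and>
     (\<forall>n. \<phi> ` deg L n \<subseteq> deg M n)"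

definition lsa_action ::
  "('k, 'm) ring_scheme \<Rightarrow> ('k, 'a, 'y) graded_lsa_scheme \<Rightarrow> ('k, 'b, 'z) superspace_scheme \<Rightarrow> ('a \<Rightarrow> 'b \<Rightarrow> 'b) \<Rightarrow> bool" where
  "lsa_action K L V \<rho> \<longleftrightarrow> graded_lsa K L \<and> superspace K V \<and>
     (\<forall>v\<in>carrier V. lin_map K L V (\<lambda>x. \<rho> x v)) \<and>
     (\<forall>x\<in>carrier L. lin_map K V V (\<rho> x)) \<and>
     (\<forall>p q. \<forall>x\<in>hpart L p. \<forall>v\<in>hpart V q. \<rho> x v \<in> hpart V (p + q)) \<and>
     (\<forall>p q. \<forall>x\<in>hpart L p. \<forall>y\<in>hpart L q. \<forall>v\<in>carrier V.
        \<rho> (brk L x y) v = \<rho> x (\<rho> y v) \<ominus>\<^bsub>V\<^esub> signed V (p * q) (\<rho> y (\<rho> x v)))"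


section \<open>The direct sum of the spaces of invariants\<close>

text \<open>\<open>ar n\<close> is the arity of the elements of degree \<open>n\<close>.\<close>

definition ar :: "int \<Rightarrow> nat" where
  "ar n = nat (n + 1)"

definition invariants :: "('k, 'a, 'z) symm_seq_scheme \<Rightarrow> nat \<Rightarrow> 'a set" where
  "invariants S n = {f \<in> carrier (sp S n). \<forall>\<sigma>. \<sigma> permutes {1..n} \<longrightarrow> act S n \<sigma> f = f}"

definition W_carrier :: "('k, 'a, 'z) symm_seq_scheme \<Rightarrow> (int \<Rightarrow> 'a) set" where
  "W_carrier S = {w \<in> (\<Pi>\<^sub>E n\<in>{-1..}. invariants S (ar n)). finite {n\<in>{-1..}. w n \<noteq> \<zero>\<^bsub>sp S (ar n)\<^esub>}}"

definition W_space :: "('k, 'a, 'z) symm_seq_scheme \<Rightarrow> ('k, int \<Rightarrow> 'a) superspace" where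
  "W_space S =
     \<lparr>carrier = W_carrier S, mult = undefined, one = undefined,
      zero = (\<lambda>n\<in>{-1..}. \<zero>\<^bsub>sp S (ar n)\<^esub>),
      add = (\<lambda>v w. \<lambda>n\<in>{-1..}. v n \<oplus>\<^bsub>sp S (ar n)\<^esub> w n),
      smult = (\<lambda>c w. \<lambda>n\<in>{-1..}. c \<odot>\<^bsub>sp S (ar n)\<^esub> w n),
      hpart = (\<lambda>p. {w \<in> W_carrier S. \<forall>n\<ge>-1. w n \<in> hpart (sp S (ar n)) p})\<rparr>"

definition W_deg :: "('k, 'a, 'z) symm_seq_scheme \<Rightarrow> int \<Rightarrow> (int \<Rightarrow> 'a) set" where
  "W_deg S n = {w \<in> W_carrier S. \<forall>k\<ge>-1. k \<noteq> n \<longrightarrow> w k = \<zero>\<^bsub>sp S (ar k)\<^esub>}"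

definition W_inj :: "('k, 'a, 'z) symm_seq_scheme \<Rightarrow> int \<Rightarrow> 'a \<Rightarrow> int \<Rightarrow> 'a" where
  "W_inj S n f = (\<lambda>k\<in>{-1..}. if k = n then f else \<zero>\<^bsub>sp S (ar k)\<^esub>)"

text \<open>\<open>box P n m f g\<close> is $f \Box g$ for \<open>f\<close>, \<open>g\<close> of degrees \<open>n\<close>, \<open>m\<close>. The brackets are defined on
  homogeneous elements and extended bilinearly, by summing over the parities of the components.\<close>

definition box :: "('k, 'a, 'z) linear_pseudo_operad_scheme \<Rightarrow> int \<Rightarrow> int \<Rightarrow> 'a \<Rightarrow> 'a \<Rightarrow> 'a" where
  "box P n m f g = (\<Oplus>\<^bsub>sp P (ar (n + m))\<^esub>\<sigma>\<in>shuffle_perms (m + 1) n.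
     act P (ar (n + m)) (inv_into UNIV \<sigma>) (pcomp P (ar n) (ar m) 1 f g))"

definition box_brk :: "('k, 'a, 'z) linear_pseudo_operad_scheme \<Rightarrow> int \<Rightarrow> int \<Rightarrow> 'a \<Rightarrow> 'a \<Rightarrow> 'a" where
  "box_brk P n m f g = (\<Oplus>\<^bsub>sp P (ar (n + m))\<^esub>p\<in>UNIV. \<Oplus>\<^bsub>sp P (ar (n + m))\<^esub>q\<in>UNIV.
     let f' = hproj (sp P (ar n)) p f; g' = hproj (sp P (ar m)) q g
     in box P n m f' g' \<ominus>\<^bsub>sp P (ar (n + m))\<^esub> signed (sp P (ar (n + m))) (p * q) (box P m n g' f'))"

definition W_alg :: "('k, 'a, 'z) linear_pseudo_operad_scheme \<Rightarrow> ('k, int \<Rightarrow> 'a) graded_lsa" where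
  "W_alg P = superspace.extend (W_space P) (graded_lsa.fields
     (\<lambda>v w. \<lambda>k\<in>{-1..}. \<Oplus>\<^bsub>sp P (ar k)\<^esub>n\<in>{-1..k + 1}. box_brk P n (k - n) (v n) (w (k - n)))
     (W_deg P))"

text \<open>\<open>cbox P n m f g\<close> is $f \Box_\lambda g$, \<open>cbox_brk P n m f g\<close> is $[f_\lambda g]$, and
  \<open>lambda_brk\<close> is the $\lambda$-bracket of the whole direct sum, all given by coefficient sequences.\<close>

definition cbox :: "('k, 'a, 'z) conformal_pseudo_operad_scheme \<Rightarrow> int \<Rightarrow> int \<Rightarrow> 'a \<Rightarrow> 'a \<Rightarrow> nat \<Rightarrow> 'a" where
  "cbox P n m f g = (\<lambda>a. \<Oplus>\<^bsub>sp P (ar (n + m))\<^esub>\<sigma>\<in>shuffle_perms (m + 1) n.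
     act P (ar (n + m)) (inv_into UNIV \<sigma>)
       (subst_neg (sp P (ar (n + m))) (dd P (ar (n + m))) (cpcomp P (ar n) (ar m) 1 f g) a))"

definition cbox_brk :: "('k, 'a, 'z) conformal_pseudo_operad_scheme \<Rightarrow> int \<Rightarrow> int \<Rightarrow> 'a \<Rightarrow> 'a \<Rightarrow> nat \<Rightarrow> 'a" where
  "cbox_brk P n m f g = (\<lambda>a. \<Oplus>\<^bsub>sp P (ar (n + m))\<^esub>p\<in>UNIV. \<Oplus>\<^bsub>sp P (ar (n + m))\<^esub>q\<in>UNIV.
     let f' = hproj (sp P (ar n)) p f; g' = hproj (sp P (ar m)) q g
     in cbox P n m f' g' a \<ominus>\<^bsub>sp P (ar (n + m))\<^esub>
        signed (sp P (ar (n + m))) (p * q)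
          (subst_neg (sp P (ar (n + m))) (dd P (ar (n + m))) (cbox P m n g' f') a))"

definition lambda_brk ::
  "('k, 'a, 'z) conformal_pseudo_operad_scheme \<Rightarrow> (int \<Rightarrow> 'a) \<Rightarrow> (int \<Rightarrow> 'a) \<Rightarrow> nat \<Rightarrow> int \<Rightarrow> 'a" where
  "lambda_brk P v w = (\<lambda>a. \<lambda>k\<in>{-1..}. \<Oplus>\<^bsub>sp P (ar k)\<^esub>n\<in>{-1..k + 1}. cbox_brk P n (k - n) (v n) (w (k - n)) a)"

definition W_dd :: "('k, 'a, 'z) diff_symm_seq_scheme \<Rightarrow> (int \<Rightarrow> 'a) \<Rightarrow> int \<Rightarrow> 'a" where
  "W_dd S w = (\<lambda>n\<in>{-1..}. dd S (ar n) (w n))"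

definition W_cls :: "('k, 'a, 'z) diff_symm_seq_scheme \<Rightarrow> (int \<Rightarrow> 'a) \<Rightarrow> (int \<Rightarrow> 'a) set" where
  "W_cls S w = (W_dd S ` W_carrier S) +>\<^bsub>W_space S\<^esub> w"

definition W_quot_alg :: "('k, 'a, 'z) conformal_pseudo_operad_scheme \<Rightarrow> ('k, (int \<Rightarrow> 'a) set) graded_lsa" where
  "W_quot_alg P = superspace.extend (squot (W_space P) (W_dd P ` W_carrier P)) (graded_lsa.fields
     (\<lambda>X Y. \<Union>v\<in>X. \<Union>w\<in>Y. W_cls P (lambda_brk P v w 0))
     (\<lambda>n. W_cls P ` W_deg P n))"

end

theory Submission
  imports Defs
begin

text \<open>Setting all variables to $0$ in a conformal operad, or in a conformal pseudo operad, gives an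
operation for which $\partial f$ in the first place contributes $\partial$ of the result and
$\partial g$ in any other place contributes $0$. So it descends to $\widetilde{\mathscr P}/\partial
\widetilde{\mathscr P}$, and each axiom of an operad is the constant term of the corresponding
conformal axiom. The one relation that is not of this form is $\widetilde 1_{-\partial}(f) = f$ for
the unit; but substituting $-\partial$ or $0$ for $\lambda$ gives the same class modulo the image of
$\partial$ (\<open>endo.eval_mod\<close>).

For the Lie superalgebras, let first \<open>P\<close> be a linear pseudo operad in characteristic $0$. On
invariants, $f \Box g$ is, up to a nonzero integer factor, the sum of $(f \circ_1 g)^\sigma$ over all
permutations, because each coset of a Young subgroup fixing $f \circ_1 g$ contains exactly one shuffle.
Products of three elements then become full symmetrizations of iterated partial compositions; the
sequential ones cancel in the associator, and the parallel ones that remain are symmetric in the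
last two arguments (\<open>associator_symm\<close>). So $\Box$ is a right pre-Lie product, and its commutator
satisfies the super Jacobi identity (\<open>pre_lie_jacobi\<close>, \<open>box_brk_jacobi\<close>).

The action in the third part needs no second computation. In a conformal pseudo operad put
$f \cdot g = f \circ^i_0 g$ and $f * g = f \circ^i_{-\partial} g$. The products
$(f,u) \circ_i (g,v) = (f \cdot g, f * v + u \cdot g)$ make the pairs of elements of
$\widetilde{\mathscr P}$ a linear pseudo operad (\<open>R_pseudo\<close>), a semidirect product in which the
second components form an ideal with zero multiplication. In the Lie superalgebra of this pseudo
operad, the bracket of $(f,0)$ with $(0,g)$ has as its second component exactly
$f \Box_0 g - (-1)^{p(f)p(g)} g \Box_{-\partial} f = [f_\lambda g]|_{\lambda=0}$, since $\Box_\lambda$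
is defined with $-\lambda-\partial$ in place of $\lambda$ (\<open>cbox_values\<close>, \<open>box_brk_R\<close>).
So the Jacobi identity in the semidirect product says that the operators $[f_\lambda\,\cdot\,]|_{\lambda=0}$
represent the bracket of the elements $(f,0)$, and that one agrees with $[f_\lambda g]|_{\lambda=0}$
modulo the image of $\partial$.

It remains to compare $\widetilde W/\partial\widetilde W$ with $W$. In characteristic $0$ an invariant
of the quotient lifts to an invariant, and an invariant in the image of $\partial$ is $\partial$ of an
invariant: average over the symmetric group. Hence the canonical map is bijective in every degree, and
the Lie superalgebra structure of $W$ can be transported along it (\<open>graded_lsa_transport\<close>). Since
moreover $[\partial f_\lambda g] = -\lambda [f_\lambda g]$ vanishes at $\lambda = 0$, the operators above
depend only on the class of $f$ and define the action of $W$.\<close>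

section \<open>Parities and finite sums\<close>

declare add_bit_eq_xor [simp del] mult_bit_eq_and [simp del]

lemma bit_one_one [simp]: "(1 :: bit) + 1 = 0" "(p :: bit) + p = 0"
  by (simp_all add: add_bit_eq_xor)

lemma bit_UNIV: "(UNIV :: bit set) = {0, 1}"
  by (auto intro: bit.exhaust)

lemma bit_one_or: "(p :: bit) = 0 \<or> p = 1"
  by (cases p) auto

lemma UN_const_eq: "\<lbrakk>a \<in> A; \<And>x. x \<in> A \<Longrightarrow> f x = c\<rbrakk> \<Longrightarrow> (\<Union>x\<in>A. f x) = c"
  by auto

lemma module_abelian: "module K V \<Longrightarrow> abelian_group V"
  by (rule module.axioms(2))

lemma superspace_module: "superspace K V \<Longrightarrow> module K V"
  by (simp add: superspace_def)

lemma superspace_abelian: "superspace K V \<Longrightarrow> abelian_group V"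
  by (rule module_abelian[OF superspace_module])

lemma neg_zero: "abelian_group V \<Longrightarrow> \<ominus>\<^bsub>V\<^esub> \<zero>\<^bsub>V\<^esub> = \<zero>\<^bsub>V\<^esub>"
  by (intro abelian_group.minus_equality) (simp_all add: abelian_group.axioms(1) abelian_monoid.zero_closed abelian_monoid.l_zero)

lemma finsum_single:
  assumes "abelian_group V" "finite A" "a \<in> A" "f a \<in> carrier V"
    "\<And>x. x \<in> A \<Longrightarrow> x \<noteq> a \<Longrightarrow> f x = \<zero>\<^bsub>V\<^esub>"
  shows "finsum V f A = f a"
proof -
  interpret V: abelian_group V by fact
  have "finsum V f A = finsum V f (insert a (A - {a}))" using assms by (simp add: insert_absorb)
  also have "\<dots> = f a \<oplus>\<^bsub>V\<^esub> finsum V f (A - {a})"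
    using assms by (intro V.finsum_insert) (auto simp: Pi_def)
  also have "finsum V f (A - {a}) = \<zero>\<^bsub>V\<^esub>"
    using assms by (intro V.add.finprod_one_eqI) auto
  finally show ?thesis using assms by simp
qed

lemma finsum_const_nat:
  assumes "abelian_group V" "finite A" "x \<in> carrier V"
  shows "(\<Oplus>\<^bsub>V\<^esub>a\<in>A. x) = [card A] \<cdot>\<^bsub>V\<^esub> x"
proof -
  interpret V: abelian_group V by fact
  show ?thesis using V.add.finprod_const[OF assms(3), of A] by simp
qed

section \<open>Linear maps\<close>

lemma lin_mapI:
  assumes "\<And>x. x \<in> carrier V \<Longrightarrow> f x \<in> carrier W"
    "\<And>x y. \<lbrakk>x \<in> carrier V; y \<in> carrier V\<rbrakk> \<Longrightarrow> f (x \<oplus>\<^bsub>V\<^esub> y) = f x \<oplus>\<^bsub>W\<^esub> f y"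
    "\<And>c x. \<lbrakk>c \<in> carrier K; x \<in> carrier V\<rbrakk> \<Longrightarrow> f (c \<odot>\<^bsub>V\<^esub> x) = c \<odot>\<^bsub>W\<^esub> f x"
  shows "lin_map K V W f"
  using assms by (auto simp: lin_map_def)

lemma lin_map_cong: "(\<And>x. x \<in> carrier V \<Longrightarrow> f x = g x) \<Longrightarrow> module K V \<Longrightarrow> lin_map K V W f \<longleftrightarrow> lin_map K V W g"
proof -
  assume eq: "\<And>x. x \<in> carrier V \<Longrightarrow> f x = g x" and "module K V"
  then interpret V: module K V by simp
  show ?thesis using eq unfolding lin_map_def by (simp add: Pi_iff)
qed

lemma lin_map_closed: "\<lbrakk>lin_map K V W f; x \<in> carrier V\<rbrakk> \<Longrightarrow> f x \<in> carrier W"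
  by (auto simp: lin_map_def)

lemma lin_map_add: "\<lbrakk>lin_map K V W f; x \<in> carrier V; y \<in> carrier V\<rbrakk> \<Longrightarrow> f (x \<oplus>\<^bsub>V\<^esub> y) = f x \<oplus>\<^bsub>W\<^esub> f y"
  by (auto simp: lin_map_def)

lemma lin_map_smult: "\<lbrakk>lin_map K V W f; c \<in> carrier K; x \<in> carrier V\<rbrakk> \<Longrightarrow> f (c \<odot>\<^bsub>V\<^esub> x) = c \<odot>\<^bsub>W\<^esub> f x"
  by (auto simp: lin_map_def)

locale lin_hom = V: module K V + W: module K W
  for K :: "('k, 'm) ring_scheme" and V :: "('k, 'a, 'y) module_scheme" and W :: "('k, 'b, 'z) module_scheme" +
  fixes f :: "'a \<Rightarrow> 'b"
  assumes lin: "lin_map K V W f"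
begin

lemma closed: "x \<in> carrier V \<Longrightarrow> f x \<in> carrier W"
  by (rule lin_map_closed[OF lin])

lemma add: "\<lbrakk>x \<in> carrier V; y \<in> carrier V\<rbrakk> \<Longrightarrow> f (x \<oplus>\<^bsub>V\<^esub> y) = f x \<oplus>\<^bsub>W\<^esub> f y"
  by (rule lin_map_add[OF lin])

lemma zero: "f \<zero>\<^bsub>V\<^esub> = \<zero>\<^bsub>W\<^esub>"
proof -
  have "f (\<zero>\<^bsub>K\<^esub> \<odot>\<^bsub>V\<^esub> \<zero>\<^bsub>V\<^esub>) = \<zero>\<^bsub>K\<^esub> \<odot>\<^bsub>W\<^esub> f \<zero>\<^bsub>V\<^esub>"
    by (rule lin_map_smult[OF lin]) auto
  then show ?thesis by (simp add: closed)
qed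

lemma neg: "x \<in> carrier V \<Longrightarrow> f (\<ominus>\<^bsub>V\<^esub> x) = \<ominus>\<^bsub>W\<^esub> f x"
proof -
  assume x: "x \<in> carrier V"
  have "f (\<ominus>\<^bsub>V\<^esub> x) \<oplus>\<^bsub>W\<^esub> f x = \<zero>\<^bsub>W\<^esub>"
    using x by (simp add: add[symmetric] zero V.M.l_neg)
  then show ?thesis using x by (metis W.M.minus_equality V.M.a_inv_closed closed)
qed

lemma minus: "\<lbrakk>x \<in> carrier V; y \<in> carrier V\<rbrakk> \<Longrightarrow> f (x \<ominus>\<^bsub>V\<^esub> y) = f x \<ominus>\<^bsub>W\<^esub> f y"
  by (simp add: a_minus_def add neg)

lemma signed: "x \<in> carrier V \<Longrightarrow> f (signed V p x) = signed W p (f x)"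
  by (simp add: signed_def neg)

lemma sum: "\<lbrakk>\<And>a. a \<in> A \<Longrightarrow> g a \<in> carrier V\<rbrakk> \<Longrightarrow> f (\<Oplus>\<^bsub>V\<^esub>a\<in>A. g a) = (\<Oplus>\<^bsub>W\<^esub>a\<in>A. f (g a))"
proof (cases "finite A")
  case True
  show "\<lbrakk>\<And>a. a \<in> A \<Longrightarrow> g a \<in> carrier V\<rbrakk> \<Longrightarrow> ?thesis" using True
  proof (induction A rule: finite_induct)
    case empty then show ?case by (simp add: zero)
  next
    case (insert x F)
    then show ?case by (simp add: Pi_def add closed)
  qed
next
  case False then show ?thesis by (simp add: zero)
qed

lemma nat_mult: "x \<in> carrier V \<Longrightarrow> f ([(n::nat)] \<cdot>\<^bsub>V\<^esub> x) = [n] \<cdot>\<^bsub>W\<^esub> f x"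
  by (induction n) (auto simp: zero add closed)

end

lemma lin_homI: "\<lbrakk>superspace K V; superspace K W; lin_map K V W f\<rbrakk> \<Longrightarrow> lin_hom K V W f"
  by (simp add: lin_hom_def lin_hom_axioms_def superspace_module)

lemma lin_map_id: "lin_map K V V (\<lambda>x. x)"
  by (auto simp: lin_map_def)

lemma lin_map_compose: "\<lbrakk>lin_map K V W f; lin_map K U V g\<rbrakk> \<Longrightarrow> lin_map K U W (\<lambda>x. f (g x))"
  by (auto simp: lin_map_def Pi_iff)

lemma lin_map_0: "module K W \<Longrightarrow> lin_map K V W (\<lambda>x. \<zero>\<^bsub>W\<^esub>)"
proof -
  assume "module K W"
  then interpret W: module K W .
  show ?thesis by (intro lin_mapI) auto
qed

lemma lin_map_plus:
  assumes "module K W" "lin_map K V W f" "lin_map K V W g"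
  shows "lin_map K V W (\<lambda>x. f x \<oplus>\<^bsub>W\<^esub> g x)"
proof -
  interpret W: module K W by fact
  show ?thesis using assms(2,3)
    by (intro lin_mapI) (auto simp: lin_map_closed lin_map_add lin_map_smult W.a_ac W.smult_r_distr)
qed

lemma lin_map_neg:
  assumes "module K W" "lin_map K V W f"
  shows "lin_map K V W (\<lambda>x. \<ominus>\<^bsub>W\<^esub> f x)"
proof -
  interpret W: module K W by fact
  show ?thesis using assms(2)
    by (intro lin_mapI) (auto simp: lin_map_closed lin_map_add lin_map_smult W.M.minus_add W.smult_r_minus)
qed

lemma lin_map_minus:
  assumes "module K W" "lin_map K V W f" "lin_map K V W g"
  shows "lin_map K V W (\<lambda>x. f x \<ominus>\<^bsub>W\<^esub> g x)"
  unfolding a_minus_def by (intro lin_map_plus lin_map_neg assms)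

lemma lin_map_signed: "\<lbrakk>module K W; lin_map K V W f\<rbrakk> \<Longrightarrow> lin_map K V W (\<lambda>x. signed W p (f x))"
  by (cases "p = 1") (simp_all add: signed_def lin_map_neg)

lemma lin_map_sum:
  assumes "module K W" "\<And>a. a \<in> A \<Longrightarrow> lin_map K V W (f a)" "module K V"
  shows "lin_map K V W (\<lambda>x. \<Oplus>\<^bsub>W\<^esub>a\<in>A. f a x)"
proof -
  interpret W: module K W by fact
  show ?thesis
  proof (cases "finite A")
    case True
    then show ?thesis using assms(2)
    proof (induction A rule: finite_induct)
      case empty then show ?case by (simp add: lin_map_0 assms(1))
    next
      case (insert a A)
      then have *: "lin_map K V W (\<lambda>x. f a x \<oplus>\<^bsub>W\<^esub> (\<Oplus>\<^bsub>W\<^esub>a\<in>A. f a x))"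
        by (intro lin_map_plus assms(1)) auto
      have sum: "(\<Oplus>\<^bsub>W\<^esub>a\<in>insert a A. f a x) = f a x \<oplus>\<^bsub>W\<^esub> (\<Oplus>\<^bsub>W\<^esub>a\<in>A. f a x)" if "x \<in> carrier V" for x
        using insert that lin_map_closed by (intro W.finsum_insert) (fastforce simp: Pi_def)+
      show ?case
        by (rule iffD2[OF lin_map_cong[OF sum assms(3)] *])
    qed
  next
    case False then show ?thesis by (simp add: lin_map_0 assms(1))
  qed
qed

section \<open>Superspaces\<close>

lemma superspaceI:
  assumes "field K" "module K V"
    and sub: "\<And>p. submodule (hpart V p) K V"
    and disj: "\<And>x. \<lbrakk>x \<in> hpart V 0; x \<in> hpart V 1\<rbrakk> \<Longrightarrow> x = \<zero>\<^bsub>V\<^esub>"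
    and dec: "\<And>x. x \<in> carrier V \<Longrightarrow> \<exists>y\<in>hpart V 0. \<exists>z\<in>hpart V 1. x = y \<oplus>\<^bsub>V\<^esub> z"
  shows "superspace K V"
proof -
  interpret V: module K V by fact
  have sc: "hpart V p \<subseteq> carrier V" "\<zero>\<^bsub>V\<^esub> \<in> hpart V p" for p
    using V.submoduleE(1)[OF sub] subgroup.one_closed[OF submodule.axioms(1)[OF sub]] by auto
  have "(\<Union>h\<in>hpart V 0. \<Union>k\<in>hpart V 1. {h \<oplus>\<^bsub>V\<^esub> k}) = carrier V"
    using sc dec by (auto intro!: V.M.a_closed)
  then show ?thesis
    unfolding superspace_def superspace_axioms_def set_add_def'
    using assms sc by auto
qed

context superspace
begin

lemma hpart_closed: "x \<in> hpart V p \<Longrightarrow> x \<in> carrier V"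
  using submoduleE(1)[OF hpart_submodule] by auto

lemma hpart_zero: "\<zero>\<^bsub>V\<^esub> \<in> hpart V p"
  using subgroup.one_closed[OF submodule.axioms(1)[OF hpart_submodule]] by simp

lemma hpart_add: "\<lbrakk>x \<in> hpart V p; y \<in> hpart V p\<rbrakk> \<Longrightarrow> x \<oplus>\<^bsub>V\<^esub> y \<in> hpart V p"
  by (rule submoduleE(5)[OF hpart_submodule])

lemma hpart_neg: "x \<in> hpart V p \<Longrightarrow> \<ominus>\<^bsub>V\<^esub> x \<in> hpart V p"
  by (rule submoduleE(3)[OF hpart_submodule])

lemma hpart_minus: "\<lbrakk>x \<in> hpart V p; y \<in> hpart V p\<rbrakk> \<Longrightarrow> x \<ominus>\<^bsub>V\<^esub> y \<in> hpart V p"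
  by (simp add: a_minus_def hpart_add hpart_neg)

lemma hpart_smult: "\<lbrakk>c \<in> carrier K; x \<in> hpart V p\<rbrakk> \<Longrightarrow> c \<odot>\<^bsub>V\<^esub> x \<in> hpart V p"
  by (rule submoduleE(4)[OF hpart_submodule])

lemma hpart_signed: "x \<in> hpart V p \<Longrightarrow> signed V q x \<in> hpart V p"
  by (simp add: signed_def hpart_neg)

lemma hpart_sum_mem: "(\<And>a. a \<in> A \<Longrightarrow> f a \<in> hpart V p) \<Longrightarrow> (\<Oplus>\<^bsub>V\<^esub>a\<in>A. f a) \<in> hpart V p"
proof (cases "finite A")
  case True
  show "(\<And>a. a \<in> A \<Longrightarrow> f a \<in> hpart V p) \<Longrightarrow> ?thesis" using True
  proof (induction A rule: finite_induct)
    case (insert x F)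
    then have "finsum V f (insert x F) = f x \<oplus>\<^bsub>V\<^esub> finsum V f F"
      by (intro finsum_insert) (auto intro: hpart_closed[of _ p])
    with insert show ?case by (simp add: hpart_add)
  qed (simp add: hpart_zero)
qed (simp add: hpart_zero)

lemma signed_closed: "x \<in> carrier V \<Longrightarrow> signed V p x \<in> carrier V"
  by (simp add: signed_def)

lemma signed_signed: "x \<in> carrier V \<Longrightarrow> signed V p (signed V q x) = signed V (p + q) x"
proof -
  assume x: "x \<in> carrier V"
  consider "p = 0" | "q = 0" | "p = 1" "q = 1" using bit_one_or by blast
  then show ?thesis
  proof cases
    case 3 then show ?thesis using x by (simp only: bit_one_one signed_def) simp
  qed (use x in \<open>simp_all add: signed_def\<close>)
qed

lemma signed_zero: "signed V p \<zero>\<^bsub>V\<^esub> = \<zero>\<^bsub>V\<^esub>"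
  by (simp add: signed_def)

lemma hpart_both: "\<lbrakk>x \<in> hpart V p; x \<in> hpart V (p + 1)\<rbrakk> \<Longrightarrow> x = \<zero>\<^bsub>V\<^esub>"
proof -
  assume "x \<in> hpart V p" "x \<in> hpart V (p + 1)"
  then have "x \<in> hpart V 0 \<inter> hpart V 1" by (cases p) simp_all
  then show ?thesis unfolding hpart_disjoint by simp
qed

lemma hpart_decomp:
  assumes "v \<in> carrier V"
  obtains x y where "x \<in> hpart V p" "y \<in> hpart V (p + 1)" "v = x \<oplus>\<^bsub>V\<^esub> y"
proof -
  have "v \<in> hpart V 0 <+>\<^bsub>V\<^esub> hpart V 1" using assms hpart_sum by simp
  then obtain x y where xy: "x \<in> hpart V 0" "y \<in> hpart V 1" "v = x \<oplus>\<^bsub>V\<^esub> y"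
    unfolding set_add_def' by auto
  then have "v = y \<oplus>\<^bsub>V\<^esub> x" by (simp add: hpart_closed M.a_comm)
  with xy that[of x y] that[of y x] show ?thesis by (cases p) simp_all
qed

lemma hproj_sum_eq:
  assumes "x \<in> hpart V p" "y \<in> hpart V (p + 1)"
  shows "hproj V p (x \<oplus>\<^bsub>V\<^esub> y) = x"
  unfolding hproj_def
proof (rule the_equality)
  fix x' assume "x' \<in> hpart V p \<and> (\<exists>y'\<in>hpart V (p + 1). x \<oplus>\<^bsub>V\<^esub> y = x' \<oplus>\<^bsub>V\<^esub> y')"
  then obtain y' where *: "x' \<in> hpart V p" "y' \<in> hpart V (p + 1)" "x \<oplus>\<^bsub>V\<^esub> y = x' \<oplus>\<^bsub>V\<^esub> y'"
    by auto
  note c = hpart_closed[OF *(1)] hpart_closed[OF *(2)] hpart_closed[OF assms(1)] hpart_closed[OF assms(2)]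
  have "x' \<ominus>\<^bsub>V\<^esub> x = y \<ominus>\<^bsub>V\<^esub> y'"
  proof -
    have "x' \<ominus>\<^bsub>V\<^esub> x = ((x' \<oplus>\<^bsub>V\<^esub> y') \<ominus>\<^bsub>V\<^esub> y') \<ominus>\<^bsub>V\<^esub> x"
      using c by (simp add: a_minus_def M.a_ac M.r_neg)
    also have "\<dots> = ((x \<oplus>\<^bsub>V\<^esub> y) \<ominus>\<^bsub>V\<^esub> y') \<ominus>\<^bsub>V\<^esub> x" using * by simp
    also have "\<dots> = (y \<ominus>\<^bsub>V\<^esub> y') \<oplus>\<^bsub>V\<^esub> (x \<ominus>\<^bsub>V\<^esub> x)"
      using c by (simp add: a_minus_def M.a_ac)
    finally show ?thesis using c by (simp add: a_minus_def M.r_neg)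
  qed
  then have "x' \<ominus>\<^bsub>V\<^esub> x = \<zero>\<^bsub>V\<^esub>"
    using assms * by (intro hpart_both[of _ p]) (metis hpart_minus)+
  then have "\<ominus>\<^bsub>V\<^esub> (\<ominus>\<^bsub>V\<^esub> x) = x'" using c by (intro M.minus_equality) (simp_all add: a_minus_def)
  then show "x' = x" using c by simp
qed (use assms in auto)

lemma hproj_mem: "v \<in> carrier V \<Longrightarrow> hproj V p v \<in> hpart V p"
  by (erule hpart_decomp[of _ p]) (simp add: hproj_sum_eq)

lemma hproj_closed: "v \<in> carrier V \<Longrightarrow> hproj V p v \<in> carrier V"
  by (rule hpart_closed[OF hproj_mem])

lemma hproj_same: "v \<in> hpart V p \<Longrightarrow> hproj V p v = v"
  using hproj_sum_eq[of v p "\<zero>\<^bsub>V\<^esub>"] by (simp add: hpart_zero hpart_closed)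

lemma hproj_other: "v \<in> hpart V p \<Longrightarrow> q \<noteq> p \<Longrightarrow> hproj V q v = \<zero>\<^bsub>V\<^esub>"
  using hproj_sum_eq[of "\<zero>\<^bsub>V\<^esub>" q v] bit_one_or[of p] bit_one_or[of q]
  by (auto simp: hpart_zero hpart_closed)

lemma hproj_both: "v \<in> carrier V \<Longrightarrow> v = hproj V p v \<oplus>\<^bsub>V\<^esub> hproj V (p + 1) v"
proof (erule hpart_decomp[of _ p])
  fix x y assume *: "x \<in> hpart V p" "y \<in> hpart V (p + 1)" "v = x \<oplus>\<^bsub>V\<^esub> y"
  then have "hproj V (p + 1) (y \<oplus>\<^bsub>V\<^esub> x) = y" by (intro hproj_sum_eq) (auto simp: add.assoc)
  moreover have "hproj V p v = x" using * by (simp add: hproj_sum_eq)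
  moreover have "v = y \<oplus>\<^bsub>V\<^esub> x" using * by (simp add: hpart_closed M.a_comm)
  ultimately show ?thesis using * by simp
qed

lemma hproj_01: "v \<in> carrier V \<Longrightarrow> v = hproj V 0 v \<oplus>\<^bsub>V\<^esub> hproj V 1 v"
  using hproj_both[of v 0] by simp

lemma hproj_lin: "lin_map K V V (hproj V p)"
proof (rule lin_mapI)
  fix v w assume v: "v \<in> carrier V" and w: "w \<in> carrier V"
  obtain x y where x: "x \<in> hpart V p" "y \<in> hpart V (p + 1)" "v = x \<oplus>\<^bsub>V\<^esub> y" using hpart_decomp[OF v] .
  obtain x' y' where x': "x' \<in> hpart V p" "y' \<in> hpart V (p + 1)" "w = x' \<oplus>\<^bsub>V\<^esub> y'" using hpart_decomp[OF w] .
  have "v \<oplus>\<^bsub>V\<^esub> w = (x \<oplus>\<^bsub>V\<^esub> x') \<oplus>\<^bsub>V\<^esub> (y \<oplus>\<^bsub>V\<^esub> y')"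
    using x x' by (simp add: hpart_closed M.a_ac)
  then show "hproj V p (v \<oplus>\<^bsub>V\<^esub> w) = hproj V p v \<oplus>\<^bsub>V\<^esub> hproj V p w"
    using x x' by (simp add: hproj_sum_eq hpart_add)
next
  fix c v assume c: "c \<in> carrier K" and v: "v \<in> carrier V"
  obtain x y where x: "x \<in> hpart V p" "y \<in> hpart V (p + 1)" "v = x \<oplus>\<^bsub>V\<^esub> y" using hpart_decomp[OF v] .
  then show "hproj V p (c \<odot>\<^bsub>V\<^esub> v) = c \<odot>\<^bsub>V\<^esub> hproj V p v"
    using c by (simp add: hproj_sum_eq hpart_smult smult_r_distr hpart_closed)
qed (rule hproj_closed)

end

lemma hproj_even_map:
  assumes "superspace K V" "superspace K W" "even_map K V W \<phi>" "v \<in> carrier V"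
  shows "\<phi> (hproj V p v) = hproj W p (\<phi> v)"
proof -
  interpret V: superspace K V by fact
  interpret W: superspace K W by fact
  have lin: "lin_map K V W \<phi>" using assms(3) by (simp add: even_map_def)
  obtain x y where x: "x \<in> hpart V p" "y \<in> hpart V (p + 1)" "v = x \<oplus>\<^bsub>V\<^esub> y"
    using V.hpart_decomp[OF assms(4)] .
  then have "\<phi> x \<in> hpart W p" "\<phi> y \<in> hpart W (p + 1)" using assms(3) by (auto simp: even_map_def)
  then show ?thesis using x by (simp add: lin_map_add[OF lin] V.hpart_closed V.hproj_sum_eq W.hproj_sum_eq)
qed

lemma even_map_lin: "even_map K V W f \<Longrightarrow> lin_map K V W f"
  by (simp add: even_map_def)

lemma even_map_hpart: "\<lbrakk>even_map K V W f; x \<in> hpart V p\<rbrakk> \<Longrightarrow> f x \<in> hpart W p"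
  by (auto simp: even_map_def)

text \<open>All the superspace axioms of \<open>W\<close> follow from those of \<open>V\<close> through the surjection \<open>q\<close>. Only
the directness of the sum of the two parts needs that the kernel of \<open>q\<close> is graded.\<close>

lemma superspace_image:
  assumes "superspace K V"
    and car: "carrier W = q ` carrier V" and zero: "\<zero>\<^bsub>W\<^esub> = q \<zero>\<^bsub>V\<^esub>"
    and add: "\<And>x y. \<lbrakk>x \<in> carrier V; y \<in> carrier V\<rbrakk> \<Longrightarrow> q x \<oplus>\<^bsub>W\<^esub> q y = q (x \<oplus>\<^bsub>V\<^esub> y)"
    and smult: "\<And>c x. \<lbrakk>c \<in> carrier K; x \<in> carrier V\<rbrakk> \<Longrightarrow> c \<odot>\<^bsub>W\<^esub> q x = q (c \<odot>\<^bsub>V\<^esub> x)"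
    and hp: "\<And>p. hpart W p = q ` hpart V p"
    and ker: "\<And>x p. \<lbrakk>x \<in> carrier V; q x = q \<zero>\<^bsub>V\<^esub>\<rbrakk> \<Longrightarrow> q (hproj V p x) = q \<zero>\<^bsub>V\<^esub>"
  shows "superspace K W" "even_map K V W q"
proof -
  interpret V: superspace K V by fact
  have mod: "module K W"
  proof (rule moduleI)
    show "abelian_group W"
    proof (rule abelian_groupI)
      fix x assume "x \<in> carrier W"
      then obtain v where "v \<in> carrier V" "x = q v" using car by auto
      then show "\<exists>y\<in>carrier W. y \<oplus>\<^bsub>W\<^esub> x = \<zero>\<^bsub>W\<^esub>"
        using car zero by (intro bexI[of _ "q (\<ominus>\<^bsub>V\<^esub> v)"]) (auto simp: add V.M.l_neg)
    qed (auto simp: car zero add V.M.a_ac)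
  qed (auto simp: car zero add smult V.smult_l_distr V.smult_r_distr V.smult_assoc1 domain.axioms(1)[OF field.axioms(1)[OF V.field_axioms]])
  then interpret W: module K W .
  have neg: "\<ominus>\<^bsub>W\<^esub> q x = q (\<ominus>\<^bsub>V\<^esub> x)" if "x \<in> carrier V" for x
    using that by (intro W.M.minus_equality) (auto simp: add V.M.l_neg zero car)
  show "superspace K W"
  proof (rule superspaceI)
    show "field K" by (rule V.field_axioms)
    show "submodule (hpart W p) K W" for p
    proof (rule W.submoduleI)
      show "\<And>a. a \<in> hpart W p \<Longrightarrow> \<ominus>\<^bsub>W\<^esub> a \<in> hpart W p"
        by (auto simp: hp neg V.hpart_closed V.hpart_neg)
    qed (auto simp: hp car zero V.hpart_closed V.hpart_zero add smult V.hpart_add V.hpart_smult)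
    fix x assume "x \<in> hpart W 0" "x \<in> hpart W 1"
    then obtain u v where uv: "u \<in> hpart V 0" "v \<in> hpart V 1" "x = q u" "x = q v" by (auto simp: hp)
    note c = V.hpart_closed[OF uv(1)] V.hpart_closed[OF uv(2)]
    have "q (u \<ominus>\<^bsub>V\<^esub> v) = q u \<ominus>\<^bsub>W\<^esub> q v" using c by (simp add: a_minus_def add neg)
    also have "\<dots> = \<zero>\<^bsub>W\<^esub>" using uv c by (simp add: a_minus_def W.M.r_neg car)
    finally have "q (hproj V 0 (u \<ominus>\<^bsub>V\<^esub> v)) = q \<zero>\<^bsub>V\<^esub>" using ker c zero by simp
    moreover have "hproj V 0 (u \<ominus>\<^bsub>V\<^esub> v) = u"
      unfolding a_minus_def using uv by (intro V.hproj_sum_eq) (auto simp: V.hpart_neg)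
    ultimately show "x = \<zero>\<^bsub>W\<^esub>" using uv zero by simp
  next
    fix x assume "x \<in> carrier W"
    then obtain v where v: "v \<in> carrier V" "x = q v" using car by auto
    then have "x = q (hproj V 0 v) \<oplus>\<^bsub>W\<^esub> q (hproj V 1 v)"
      using V.hproj_01[of v] by (simp add: add V.hproj_closed)
    then show "\<exists>y\<in>hpart W 0. \<exists>z\<in>hpart W 1. x = y \<oplus>\<^bsub>W\<^esub> z"
      using V.hproj_mem[OF v(1)] by (auto simp: hp)
  qed (rule mod)
  show "even_map K V W q"
    by (auto simp: even_map_def hp car add smult intro!: lin_mapI)
qed

text \<open>A submodule that contains the homogeneous components of its elements is what one can divide a
superspace by.\<close>

locale graded_submodule = superspace K V + submodule H K V
  for K :: "('k, 'm) ring_scheme" (structure) and V :: "('k, 'a, 'z) superspace_scheme" (structure) and H +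
  assumes hproj_H: "x \<in> H \<Longrightarrow> hproj V p x \<in> H"
begin

sublocale abelian_subgroup H V
  by (rule abelian_subgroupI3) (simp_all add: additive_subgroup_def subgroup_axioms M.abelian_group_axioms)

abbreviation "cl x \<equiv> H +>\<^bsub>V\<^esub> x"

lemma cl_eq_iff: "\<lbrakk>x \<in> carrier V; y \<in> carrier V\<rbrakk> \<Longrightarrow> cl x = cl y \<longleftrightarrow> x \<ominus>\<^bsub>V\<^esub> y \<in> H"
  unfolding a_minus_def a_rcos_module[symmetric] using a_repr_independence' a_rcos_self by metis

lemma mem_cl_iff: "x \<in> carrier V \<Longrightarrow> y \<in> cl x \<longleftrightarrow> y \<in> carrier V \<and> cl y = cl x"
proof (rule iffI)
  assume x: "x \<in> carrier V" and y: "y \<in> cl x"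
  show "y \<in> carrier V \<and> cl y = cl x"
    by (rule conjI[OF a_elemrcos_carrier[OF x y] a_repr_independence'[OF y x, symmetric]])
next
  assume *: "y \<in> carrier V \<and> cl y = cl x"
  then have "y \<in> carrier V" by (rule conjunct1)
  then have "y \<in> cl y" by (rule a_rcos_self)
  also have "cl y = cl x" using * by (rule conjunct2)
  finally show "y \<in> cl x" .
qed

lemma cl_add: "\<lbrakk>x \<in> carrier V; y \<in> carrier V\<rbrakk> \<Longrightarrow> cl x <+>\<^bsub>V\<^esub> cl y = cl (x \<oplus>\<^bsub>V\<^esub> y)"
  by (rule a_rcos_sum)

lemma cl_smult:
  assumes "c \<in> carrier K" "x \<in> carrier V"
  shows "(\<Union>y\<in>cl x. cl (c \<odot>\<^bsub>V\<^esub> y)) = cl (c \<odot>\<^bsub>V\<^esub> x)"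
proof -
  have "cl (c \<odot>\<^bsub>V\<^esub> y) = cl (c \<odot>\<^bsub>V\<^esub> x)" if "y \<in> cl x" for y
  proof -
    have y: "y \<in> carrier V" "y \<ominus>\<^bsub>V\<^esub> x \<in> H" using that assms mem_cl_iff cl_eq_iff by auto
    have "c \<odot>\<^bsub>V\<^esub> y \<ominus>\<^bsub>V\<^esub> c \<odot>\<^bsub>V\<^esub> x = c \<odot>\<^bsub>V\<^esub> (y \<ominus>\<^bsub>V\<^esub> x)"
      using y assms by (simp add: a_minus_def smult_r_distr smult_r_minus)
    then show ?thesis using y assms by (simp add: cl_eq_iff)
  qed
  with a_rcos_self[OF assms(2)] show ?thesis by (rule UN_const_eq)
qed

lemma cl_zero: "cl \<zero>\<^bsub>V\<^esub> = H"
  by (metis a_subset M.a_coset_add_zero)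

lemma squot_superspace: "superspace K (squot V H)" and squot_even: "even_map K V (squot V H) cl"
proof -
  have 1: "superspace K V" ..
  have 2: "carrier (squot V H) = cl ` carrier V"
    by (auto simp: squot_def A_RCOSETS_def')
  have 3: "cl (hproj V p x) = cl \<zero>\<^bsub>V\<^esub>" if "x \<in> carrier V" "cl x = cl \<zero>\<^bsub>V\<^esub>" for x p
  proof -
    have "x \<in> H" using that cl_eq_iff[of x "\<zero>\<^bsub>V\<^esub>"] by (simp add: a_minus_def neg_zero[OF M.abelian_group_axioms])
    then show ?thesis using that cl_eq_iff[of "hproj V p x" "\<zero>\<^bsub>V\<^esub>"] by (simp add: a_minus_def hproj_H hproj_closed neg_zero[OF M.abelian_group_axioms])
  qed
  note * = superspace_image[OF 1 2 _ _ _ _ 3]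
  show "superspace K (squot V H)"
    by (rule *) (simp_all add: squot_def cl_zero cl_add cl_smult)
  show "even_map K V (squot V H) cl"
    by (rule *) (simp_all add: squot_def cl_zero cl_add cl_smult)
qed

lemma squot_carrier: "carrier (squot V H) = cl ` carrier V"
  by (auto simp: squot_def A_RCOSETS_def')

lemma squot_hpart: "hpart (squot V H) p = cl ` hpart V p"
  by (simp add: squot_def)

end

lemma graded_submodule_image:
  assumes "superspace K V" "even_map K V V d"
  shows "graded_submodule K V (d ` carrier V)"
proof -
  interpret V: superspace K V by fact
  have lin: "lin_map K V V d" using assms by (simp add: even_map_def)
  interpret d: lin_hom K V V d by (intro lin_homI assms lin)
  show ?thesis
  proof (intro graded_submodule.intro graded_submodule_axioms.intro)
    show "submodule (d ` carrier V) K V"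
    proof (rule V.submoduleI)
      show "\<zero>\<^bsub>V\<^esub> \<in> d ` carrier V" using d.zero by (metis V.M.zero_closed image_eqI)
      show "\<And>a. a \<in> d ` carrier V \<Longrightarrow> \<ominus>\<^bsub>V\<^esub> a \<in> d ` carrier V"
        by (auto simp: d.neg[symmetric])
      show "\<And>a b. a \<in> d ` carrier V \<Longrightarrow> b \<in> d ` carrier V \<Longrightarrow> a \<oplus>\<^bsub>V\<^esub> b \<in> d ` carrier V"
        by (auto simp: d.add[symmetric])
      show "\<And>c x. c \<in> carrier K \<Longrightarrow> x \<in> d ` carrier V \<Longrightarrow> c \<odot>\<^bsub>V\<^esub> x \<in> d ` carrier V"
        by (auto simp: lin_map_smult[OF lin, symmetric])
    qed (auto simp: d.closed)
    fix x p assume "x \<in> d ` carrier V"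
    then obtain y where "y \<in> carrier V" "x = d y" by auto
    then have "hproj V p x = d (hproj V p y)" using hproj_even_map[OF assms(1,1,2)] by simp
    then show "hproj V p x \<in> d ` carrier V" using \<open>y \<in> carrier V\<close> by (simp add: V.hproj_closed)
  qed (use assms in auto)
qed

section \<open>Substituting $-\partial$ for the variable\<close>

lemma up_mem: "Q \<in> up V \<Longrightarrow> Q i \<in> carrier V"
  by (auto simp: up_def)

lemma up_bound:
  assumes "Q \<in> up V" obtains N where "\<And>i. i > N \<Longrightarrow> Q i = \<zero>\<^bsub>V\<^esub>"
  using assms by (auto simp: up_def bound_def)

lemma upI: "\<lbrakk>\<And>i. Q i \<in> carrier V; \<And>i. i > N \<Longrightarrow> Q i = \<zero>\<^bsub>V\<^esub>\<rbrakk> \<Longrightarrow> Q \<in> up V"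
  by (auto simp: up_def bound_def)

text \<open>Multiplication by the variable, on coefficient sequences.\<close>

definition shift :: "('a, 'z) ring_scheme \<Rightarrow> (nat \<Rightarrow> 'a) \<Rightarrow> nat \<Rightarrow> 'a" where
  "shift V R = (\<lambda>k. if k = 0 then \<zero>\<^bsub>V\<^esub> else R (k - 1))"

definition monom0 :: "('a, 'z) ring_scheme \<Rightarrow> 'a \<Rightarrow> nat \<Rightarrow> 'a" where
  "monom0 V x = (\<lambda>j. if j = 0 then x else \<zero>\<^bsub>V\<^esub>)"

locale endo = V: module K V for K :: "('k, 'm) ring_scheme" and V :: "('k, 'a, 'y) module_scheme" +
  fixes d :: "'a \<Rightarrow> 'a"
  assumes d_lin: "lin_map K V V d"
begin

sublocale d: lin_hom K V V d
  by (simp add: lin_hom_def lin_hom_axioms_def V.module_axioms d_lin)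

abbreviation "nd \<equiv> (\<lambda>x. \<ominus>\<^bsub>V\<^esub> d x)"

lemma nd_lin: "lin_map K V V nd"
  by (rule lin_map_neg[OF V.module_axioms d_lin])

lemma nd_pow_lin: "lin_map K V V (nd ^^ a)"
proof (induction a)
  case 0 show ?case by (simp add: lin_map_def)
next
  case (Suc a)
  show ?case using lin_map_compose[OF nd_lin Suc] by (simp add: o_def)
qed

lemma nd_hom: "lin_hom K V V nd" and nd_pow_hom: "lin_hom K V V (nd ^^ a)"
  by (simp_all add: lin_hom_def lin_hom_axioms_def V.module_axioms nd_lin nd_pow_lin)

lemma nd_pow_closed: "x \<in> carrier V \<Longrightarrow> (nd ^^ a) x \<in> carrier V"
  by (rule lin_map_closed[OF nd_pow_lin])

lemma nd_pow_zero: "(nd ^^ a) \<zero>\<^bsub>V\<^esub> = \<zero>\<^bsub>V\<^esub>"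
  by (rule lin_hom.zero[OF nd_pow_hom])

lemma eval_upto:
  assumes "\<And>i. Q i \<in> carrier V" "\<And>i. i > N \<Longrightarrow> Q i = \<zero>\<^bsub>V\<^esub>"
  shows "eval_neg V d Q = (\<Oplus>\<^bsub>V\<^esub>a\<in>{..N}. (nd ^^ a) (Q a))"
  unfolding eval_neg_def
proof (rule V.M.add.finprod_mono_neutral_cong_left)
  show "{a. Q a \<noteq> \<zero>\<^bsub>V\<^esub>} \<subseteq> {..N}" using assms(2) by (auto simp: not_less[symmetric])
qed (auto simp: assms nd_pow_zero nd_pow_closed)

lemma eval_closed: "Q \<in> up V \<Longrightarrow> eval_neg V d Q \<in> carrier V"
  unfolding eval_neg_def by (intro V.M.finsum_closed) (auto simp: nd_pow_closed up_mem)

lemma up_add: "\<lbrakk>Q \<in> up V; R \<in> up V\<rbrakk> \<Longrightarrow> (\<lambda>i. Q i \<oplus>\<^bsub>V\<^esub> R i) \<in> up V"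
proof -
  assume Q: "Q \<in> up V" and R: "R \<in> up V"
  obtain N N' where N: "\<And>i. i > N \<Longrightarrow> Q i = \<zero>\<^bsub>V\<^esub>" "\<And>i. i > N' \<Longrightarrow> R i = \<zero>\<^bsub>V\<^esub>"
    using up_bound[OF Q] up_bound[OF R] by metis
  show ?thesis
    by (rule upI[of _ _ "max N N'"]) (use Q R N in \<open>auto simp: up_mem\<close>)
qed

lemma up_zero: "(\<lambda>i. \<zero>\<^bsub>V\<^esub>) \<in> up V"
  by (rule upI[of _ _ 0]) auto

lemma up_map:
  assumes "lin_hom K V W f" "Q \<in> up V" shows "(\<lambda>i. f (Q i)) \<in> up W"
proof -
  interpret f: lin_hom K V W f by fact
  obtain N where "\<And>i. i > N \<Longrightarrow> Q i = \<zero>\<^bsub>V\<^esub>" using up_bound[OF assms(2)] by metis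
  then show ?thesis by (intro upI[of _ _ N]) (auto simp: f.zero f.closed up_mem[OF assms(2)])
qed

lemma up_sum: "\<lbrakk>finite A; \<And>a. a \<in> A \<Longrightarrow> Q a \<in> up V\<rbrakk> \<Longrightarrow> (\<lambda>i. \<Oplus>\<^bsub>V\<^esub>a\<in>A. Q a i) \<in> up V"
proof (induction A rule: finite_induct)
  case (insert x A)
  then have "(\<lambda>i. \<Oplus>\<^bsub>V\<^esub>a\<in>insert x A. Q a i) = (\<lambda>i. Q x i \<oplus>\<^bsub>V\<^esub> (\<Oplus>\<^bsub>V\<^esub>a\<in>A. Q a i))"
    by (intro ext V.M.finsum_insert) (auto simp: up_mem)
  then show ?case using insert by (simp add: up_add)
qed (simp add: up_zero)

lemma eval_add:
  assumes Q: "Q \<in> up V" and R: "R \<in> up V"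
  shows "eval_neg V d (\<lambda>i. Q i \<oplus>\<^bsub>V\<^esub> R i) = eval_neg V d Q \<oplus>\<^bsub>V\<^esub> eval_neg V d R"
proof -
  obtain N1 N2 where N12: "\<And>i. i > N1 \<Longrightarrow> Q i = \<zero>\<^bsub>V\<^esub>" "\<And>i. i > N2 \<Longrightarrow> R i = \<zero>\<^bsub>V\<^esub>"
    using up_bound[OF Q] up_bound[OF R] by metis
  define N where "N = max N1 N2"
  have N: "\<And>i. i > N \<Longrightarrow> Q i = \<zero>\<^bsub>V\<^esub>" "\<And>i. i > N \<Longrightarrow> R i = \<zero>\<^bsub>V\<^esub>"
    using N12 by (auto simp: N_def)
  have "eval_neg V d (\<lambda>i. Q i \<oplus>\<^bsub>V\<^esub> R i) = (\<Oplus>\<^bsub>V\<^esub>a\<in>{..N}. (nd ^^ a) (Q a \<oplus>\<^bsub>V\<^esub> R a))"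
    by (rule eval_upto) (use Q R N in \<open>auto simp: up_mem\<close>)
  also have "\<dots> = (\<Oplus>\<^bsub>V\<^esub>a\<in>{..N}. (nd ^^ a) (Q a) \<oplus>\<^bsub>V\<^esub> (nd ^^ a) (R a))"
    using Q R by (intro V.M.finsum_cong') (auto simp: lin_map_add[OF nd_pow_lin] up_mem nd_pow_closed)
  also have "\<dots> = (\<Oplus>\<^bsub>V\<^esub>a\<in>{..N}. (nd ^^ a) (Q a)) \<oplus>\<^bsub>V\<^esub> (\<Oplus>\<^bsub>V\<^esub>a\<in>{..N}. (nd ^^ a) (R a))"
    using Q R by (intro V.M.finsum_addf) (auto simp: up_mem nd_pow_closed)
  also have "\<dots> = eval_neg V d Q \<oplus>\<^bsub>V\<^esub> eval_neg V d R"
    using eval_upto[of Q N] eval_upto[of R N] Q R N by (simp add: up_mem)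
  finally show ?thesis .
qed

lemma eval_zero: "eval_neg V d (\<lambda>i. \<zero>\<^bsub>V\<^esub>) = \<zero>\<^bsub>V\<^esub>"
  by (simp add: eval_neg_def)

lemma eval_sum: "\<lbrakk>finite A; \<And>a. a \<in> A \<Longrightarrow> Q a \<in> up V\<rbrakk>
  \<Longrightarrow> eval_neg V d (\<lambda>i. \<Oplus>\<^bsub>V\<^esub>a\<in>A. Q a i) = (\<Oplus>\<^bsub>V\<^esub>a\<in>A. eval_neg V d (Q a))"
proof (induction A rule: finite_induct)
  case (insert x A)
  then have *: "(\<lambda>i. \<Oplus>\<^bsub>V\<^esub>a\<in>insert x A. Q a i) = (\<lambda>i. Q x i \<oplus>\<^bsub>V\<^esub> (\<Oplus>\<^bsub>V\<^esub>a\<in>A. Q a i))"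
    by (intro ext V.M.finsum_insert) (auto simp: up_mem)
  have "eval_neg V d (\<lambda>i. \<Oplus>\<^bsub>V\<^esub>a\<in>insert x A. Q a i) = eval_neg V d (Q x) \<oplus>\<^bsub>V\<^esub> (\<Oplus>\<^bsub>V\<^esub>a\<in>A. eval_neg V d (Q a))"
    unfolding * using insert by (subst eval_add) (auto intro: up_sum)
  also have "\<dots> = (\<Oplus>\<^bsub>V\<^esub>a\<in>insert x A. eval_neg V d (Q a))"
    using insert by (intro V.M.finsum_insert[symmetric]) (auto intro: eval_closed)
  finally show ?case .
qed (simp add: eval_zero)

lemma eval_monom0: "x \<in> carrier V \<Longrightarrow> eval_neg V d (monom0 V x) = x"
  using eval_upto[of "monom0 V x" 0] by (simp add: monom0_def)

lemma up_monom0: "x \<in> carrier V \<Longrightarrow> monom0 V x \<in> up V"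
  by (rule upI[of _ _ 0]) (auto simp: monom0_def)

lemma up_shift: "R \<in> up V \<Longrightarrow> shift V R \<in> up V"
proof -
  assume R: "R \<in> up V"
  obtain N where N: "\<And>i. i > N \<Longrightarrow> R i = \<zero>\<^bsub>V\<^esub>" using up_bound[OF R] by metis
  show ?thesis by (rule upI[of _ _ "Suc N"]) (use R N in \<open>auto simp: shift_def up_mem\<close>)
qed

lemma eval_shift:
  assumes R: "R \<in> up V" shows "eval_neg V d (shift V R) = \<ominus>\<^bsub>V\<^esub> d (eval_neg V d R)"
proof -
  obtain N where N: "\<And>i. i > N \<Longrightarrow> R i = \<zero>\<^bsub>V\<^esub>" using up_bound[OF R] by metis
  have "eval_neg V d (shift V R) = (\<Oplus>\<^bsub>V\<^esub>a\<in>{..Suc N}. (nd ^^ a) (shift V R a))"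
    by (rule eval_upto) (use up_shift[OF R] N in \<open>auto simp: up_mem\<close>, auto simp: shift_def)
  also have "\<dots> = (\<Oplus>\<^bsub>V\<^esub>a\<in>{..N}. (nd ^^ Suc a) (shift V R (Suc a))) \<oplus>\<^bsub>V\<^esub> (nd ^^ 0) (shift V R 0)"
    by (rule V.M.finsum_Suc2) (use up_shift[OF R] in \<open>auto simp: up_mem simp del: funpow.simps intro: nd_pow_closed\<close>)
  also have "\<dots> = (\<Oplus>\<^bsub>V\<^esub>a\<in>{..N}. nd ((nd ^^ a) (R a)))"
    using R nd_pow_closed[OF up_mem[OF R]] d.closed by (simp add: shift_def Pi_def)
  also have "\<dots> = nd (\<Oplus>\<^bsub>V\<^esub>a\<in>{..N}. (nd ^^ a) (R a))"
    by (rule lin_hom.sum[OF nd_hom, symmetric]) (use R in \<open>auto simp: up_mem nd_pow_closed\<close>)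
  also have "(\<Oplus>\<^bsub>V\<^esub>a\<in>{..N}. (nd ^^ a) (R a)) = eval_neg V d R"
    by (rule eval_upto[symmetric]) (use R N in \<open>auto simp: up_mem\<close>)
  finally show ?thesis .
qed

lemma shift_pow: "(shift V ^^ n) R k = (if n \<le> k then R (k - n) else \<zero>\<^bsub>V\<^esub>)"
proof (induction n arbitrary: k)
  case (Suc n)
  then show ?case by (cases k) (auto simp: shift_def)
qed simp

lemma up_shift_pow: "R \<in> up V \<Longrightarrow> (shift V ^^ n) R \<in> up V"
  by (induction n) (auto intro: up_shift)

lemma eval_shift_pow: "R \<in> up V \<Longrightarrow> eval_neg V d ((shift V ^^ n) R) = (nd ^^ n) (eval_neg V d R)"
  by (induction n) (auto simp: eval_shift up_shift_pow)

end

text \<open>Evaluation at $-\partial$ is natural: a linear map that intertwines the two endomorphisms may be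
applied coefficient by coefficient.\<close>

lemma eval_map:
  assumes "endo K V d" "endo K W d'" "lin_map K V W f"
    and comm: "\<And>x. x \<in> carrier V \<Longrightarrow> f (d x) = d' (f x)" and Q: "Q \<in> up V"
  shows "f (eval_neg V d Q) = eval_neg W d' (\<lambda>i. f (Q i))"
proof -
  interpret V: endo K V d by fact
  interpret W: endo K W d' by fact
  interpret f: lin_hom K V W f
    by (simp add: lin_hom_def lin_hom_axioms_def V.V.module_axioms W.V.module_axioms assms)
  obtain N where N: "\<And>i. i > N \<Longrightarrow> Q i = \<zero>\<^bsub>V\<^esub>" using up_bound[OF Q] by metis
  have pow: "f ((V.nd ^^ a) x) = (W.nd ^^ a) (f x)" if "x \<in> carrier V" for a x
    using that by (induction a) (auto simp: f.neg comm V.nd_pow_closed V.d.closed)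
  have "f (eval_neg V d Q) = f (\<Oplus>\<^bsub>V\<^esub>a\<in>{..N}. (V.nd ^^ a) (Q a))"
    using V.eval_upto[of Q N] Q N by (simp add: up_mem)
  also have "\<dots> = (\<Oplus>\<^bsub>W\<^esub>a\<in>{..N}. f ((V.nd ^^ a) (Q a)))"
    by (rule f.sum) (use Q in \<open>auto simp: up_mem V.nd_pow_closed\<close>)
  also have "\<dots> = (\<Oplus>\<^bsub>W\<^esub>a\<in>{..N}. (W.nd ^^ a) (f (Q a)))"
    using Q by (intro W.V.M.finsum_cong') (auto simp: pow up_mem W.nd_pow_closed f.closed)
  also have "\<dots> = eval_neg W d' (\<lambda>i. f (Q i))"
    by (rule W.eval_upto[symmetric]) (use Q N in \<open>auto simp: up_mem f.closed f.zero\<close>)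
  finally show ?thesis .
qed

context endo
begin

lemma endo: "endo K V d" ..

lemma eval_lin_map:
  assumes U: "module K U" and up: "\<And>x. x \<in> carrier U \<Longrightarrow> Q x \<in> up V"
    and lin: "\<And>i. lin_map K U V (\<lambda>x. Q x i)"
  shows "lin_map K U V (\<lambda>x. eval_neg V d (Q x))"
proof (rule lin_mapI)
  interpret U: module K U by fact
  fix x y assume xy: "x \<in> carrier U" "y \<in> carrier U"
  have "Q (x \<oplus>\<^bsub>U\<^esub> y) = (\<lambda>i. Q x i \<oplus>\<^bsub>V\<^esub> Q y i)"
    by (rule ext) (rule lin_map_add[OF lin xy])
  then show "eval_neg V d (Q (x \<oplus>\<^bsub>U\<^esub> y)) = eval_neg V d (Q x) \<oplus>\<^bsub>V\<^esub> eval_neg V d (Q y)"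
    using eval_add[OF up up] xy by simp
next
  fix c x assume c: "c \<in> carrier K" and x: "x \<in> carrier U"
  have "Q (c \<odot>\<^bsub>U\<^esub> x) = (\<lambda>i. c \<odot>\<^bsub>V\<^esub> Q x i)"
    by (rule ext) (rule lin_map_smult[OF lin c x])
  then have "eval_neg V d (Q (c \<odot>\<^bsub>U\<^esub> x)) = eval_neg V d (\<lambda>i. c \<odot>\<^bsub>V\<^esub> Q x i)"
    by simp
  also have "\<dots> = c \<odot>\<^bsub>V\<^esub> eval_neg V d (Q x)"
  proof (rule eval_map[OF endo endo, symmetric, where f="\<lambda>x. c \<odot>\<^bsub>V\<^esub> x"])
    show "lin_map K V V ((\<odot>\<^bsub>V\<^esub>) c)"
      using c by (intro lin_mapI) (auto simp: V.smult_r_distr V.smult_assoc1[symmetric] V.R.m_comm)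
  qed (use c x lin_map_smult[OF d_lin] up in auto)
  finally show "eval_neg V d (Q (c \<odot>\<^bsub>U\<^esub> x)) = c \<odot>\<^bsub>V\<^esub> eval_neg V d (Q x)" .
qed (use up eval_closed in auto)

lemma eval_d: "Q \<in> up V \<Longrightarrow> d (eval_neg V d Q) = eval_neg V d (\<lambda>i. d (Q i))"
  by (rule eval_map[OF endo endo d_lin]) auto

lemma up_neg: "Q \<in> up V \<Longrightarrow> (\<lambda>i. \<ominus>\<^bsub>V\<^esub> Q i) \<in> up V"
  by (intro up_map[of V "\<lambda>x. \<ominus>\<^bsub>V\<^esub> x"])
    (auto simp: lin_hom_def lin_hom_axioms_def V.module_axioms intro: lin_map_neg lin_map_id)

lemma eval_neg': "Q \<in> up V \<Longrightarrow> eval_neg V d (\<lambda>i. \<ominus>\<^bsub>V\<^esub> Q i) = \<ominus>\<^bsub>V\<^esub> eval_neg V d Q"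
  by (intro eval_map[OF endo endo, symmetric, where f="\<lambda>x. \<ominus>\<^bsub>V\<^esub> x"])
    (auto intro: lin_map_neg lin_map_id V.module_axioms simp: d.neg)

lemma neg_times_eq: "neg_times V d R = (\<lambda>k. \<ominus>\<^bsub>V\<^esub> (shift V R k \<oplus>\<^bsub>V\<^esub> d (R k)))"
  by (simp add: neg_times_def shift_def)

lemma up_neg_times: "R \<in> up V \<Longrightarrow> neg_times V d R \<in> up V"
  unfolding neg_times_eq by (intro up_neg up_add up_shift up_map[of V d] d.lin_hom_axioms)

text \<open>The operation \<open>neg_times\<close> is multiplication by $-\lambda-\partial$, a factor that vanishes at
$\lambda = -\partial$.\<close>

lemma eval_neg_times: "R \<in> up V \<Longrightarrow> eval_neg V d (neg_times V d R) = \<zero>\<^bsub>V\<^esub>"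
proof -
  assume R: "R \<in> up V"
  have dR: "(\<lambda>k. d (R k)) \<in> up V" by (intro up_map[of V d] d.lin_hom_axioms R)
  have "eval_neg V d (neg_times V d R) = \<ominus>\<^bsub>V\<^esub> (\<ominus>\<^bsub>V\<^esub> d (eval_neg V d R) \<oplus>\<^bsub>V\<^esub> d (eval_neg V d R))"
    unfolding neg_times_eq using R dR by (simp add: eval_neg' eval_add eval_shift up_add up_shift eval_d)
  also have "\<dots> = \<zero>\<^bsub>V\<^esub>"
    using eval_closed[OF R] d.closed by (simp add: V.M.l_neg neg_zero V.M.abelian_group_axioms)
  finally show ?thesis .
qed

lemma up_neg_times_pow: "R \<in> up V \<Longrightarrow> (neg_times V d ^^ a) R \<in> up V"
  by (induction a) (auto intro: up_neg_times)

lemma subst_neg_alt: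
  "subst_neg V d Q = (\<lambda>k. \<Oplus>\<^bsub>V\<^esub>a\<in>{a. Q a \<noteq> \<zero>\<^bsub>V\<^esub>}. (neg_times V d ^^ a) (monom0 V (Q a)) k)"
  by (simp add: subst_neg_def monom0_def)

lemma finite_support: "Q \<in> up V \<Longrightarrow> finite {a. Q a \<noteq> \<zero>\<^bsub>V\<^esub>}"
  by (erule up_bound) (metis (mono_tags, lifting) finite_nat_set_iff_bounded_le mem_Collect_eq not_le_imp_less)

lemma subst_neg_up: "Q \<in> up V \<Longrightarrow> subst_neg V d Q \<in> up V"
  unfolding subst_neg_alt by (intro up_sum up_neg_times_pow up_monom0 finite_support) (auto simp: up_mem)

text \<open>Substituting $-\lambda-\partial$ and then $\lambda = -\partial$ amounts to $\lambda = 0$.\<close>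

lemma eval_subst_neg:
  assumes Q: "Q \<in> up V" shows "eval_neg V d (subst_neg V d Q) = Q 0"
proof -
  have "eval_neg V d (subst_neg V d Q) =
    (\<Oplus>\<^bsub>V\<^esub>a\<in>{a. Q a \<noteq> \<zero>\<^bsub>V\<^esub>}. eval_neg V d ((neg_times V d ^^ a) (monom0 V (Q a))))"
    unfolding subst_neg_alt using Q
    by (intro eval_sum finite_support up_neg_times_pow up_monom0) (auto simp: up_mem)
  also have "\<dots> = (\<Oplus>\<^bsub>V\<^esub>a\<in>{a. Q a \<noteq> \<zero>\<^bsub>V\<^esub>}. if a = 0 then Q 0 else \<zero>\<^bsub>V\<^esub>)"
  proof (rule V.M.finsum_cong')
    fix a assume "a \<in> {a. Q a \<noteq> \<zero>\<^bsub>V\<^esub>}"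
    show "eval_neg V d ((neg_times V d ^^ a) (monom0 V (Q a))) = (if a = 0 then Q 0 else \<zero>\<^bsub>V\<^esub>)"
    proof (cases a)
      case (Suc b)
      then show ?thesis using Q by (simp add: eval_neg_times up_neg_times_pow up_monom0 up_mem)
    qed (simp add: eval_monom0 up_mem[OF Q])
  qed (use Q in \<open>auto simp: up_mem\<close>)
  also have "\<dots> = Q 0"
  proof (cases "Q 0 = \<zero>\<^bsub>V\<^esub>")
    case True
    then show ?thesis by (intro trans[OF V.M.add.finprod_one_eqI]) auto
  next
    case False
    then show ?thesis
      using finsum_single[OF V.M.abelian_group_axioms finite_support[OF Q], of 0 "\<lambda>a. if a = 0 then Q 0 else \<zero>\<^bsub>V\<^esub>"]
      by (simp add: up_mem[OF Q])
  qed
  finally show ?thesis .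
qed

text \<open>At $\lambda = 0$ the substitute $-\lambda-\partial$ is $-\partial$.\<close>

lemma subst_neg_0:
  assumes Q: "Q \<in> up V" shows "subst_neg V d Q 0 = eval_neg V d Q"
proof -
  have *: "(neg_times V d ^^ a) R 0 = (nd ^^ a) (R 0)" if "R \<in> up V" for a R
    using that
    by (induction a) (simp_all add: neg_times_def d.closed up_mem nd_pow_closed)
  show ?thesis
    unfolding subst_neg_alt eval_neg_def using Q
    by (intro V.M.finsum_cong') (auto simp: * up_monom0 up_mem nd_pow_closed, simp add: monom0_def)
qed

end

section \<open>Permutations\<close>

lemma psum_0 [simp]: "psum ms 0 = 0"
  by (simp add: psum_def)

lemma psum_Suc: "i < length ms \<Longrightarrow> psum ms (Suc i) = psum ms i + ms ! i"
  by (simp add: psum_def take_Suc_conv_app_nth)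

lemma psum_step: "i \<in> {1..length ms} \<Longrightarrow> psum ms i = psum ms (i - 1) + ms ! (i - 1)"
  by (cases i) (auto simp: psum_Suc)

lemma psum_length: "psum ms (length ms) = sum_list ms"
  by (simp add: psum_def)

lemma psum_mono: "i \<le> j \<Longrightarrow> psum ms i \<le> psum ms j"
proof -
  assume "i \<le> j"
  then obtain d where "j = i + d" using le_Suc_ex by blast
  then show ?thesis by (simp add: psum_def take_add)
qed

lemma psum_sum: "j \<le> length ms \<Longrightarrow> psum ms j = (\<Sum>k\<in>{1..j}. ms ! (k - 1))"
  by (induction j) (auto simp: psum_Suc)

text \<open>Every position is the position \<open>r\<close> of a block \<open>i\<close>. With this description of positions,
\<open>block_perm\<close> is easy to evaluate.\<close>

lemma block_index:
  assumes "a \<in> {1..sum_list ms}"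
  obtains i r where "i \<in> {1..length ms}" "r \<in> {1..ms ! (i - 1)}" "a = psum ms (i - 1) + r"
proof -
  define i where "i = (LEAST i. a \<le> psum ms i)"
  have ex: "a \<le> psum ms (length ms)" using assms by (simp add: psum_length)
  have i: "a \<le> psum ms i" unfolding i_def by (rule LeastI[of _ "length ms"]) (rule ex)
  have "i \<le> length ms" unfolding i_def by (rule Least_le) (rule ex)
  have "i \<noteq> 0" using i assms by (intro notI) simp
  have "\<not> a \<le> psum ms (i - 1)"
    using not_less_Least[of "i - 1" "\<lambda>i. a \<le> psum ms i"] \<open>i \<noteq> 0\<close> by (simp add: i_def)
  moreover have "psum ms i = psum ms (i - 1) + ms ! (i - 1)"
    using psum_step[of i ms] \<open>i \<noteq> 0\<close> \<open>i \<le> length ms\<close> by simp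
  ultimately have "a - psum ms (i - 1) \<in> {1..ms ! (i - 1)}" "a = psum ms (i - 1) + (a - psum ms (i - 1))"
    using i by auto
  then show ?thesis using that[of i "a - psum ms (i - 1)"] \<open>i \<noteq> 0\<close> \<open>i \<le> length ms\<close> by auto
qed

lemma block_least:
  assumes "i \<in> {1..length ms}" "r \<in> {1..ms ! (i - 1)}"
  shows "(LEAST j. psum ms (i - 1) + r \<le> psum ms j) = i" "psum ms (i - 1) + r \<in> {1..sum_list ms}"
proof -
  have 1: "psum ms i = psum ms (i - 1) + ms ! (i - 1)"
    using psum_step[of i ms] assms by simp
  show "(LEAST j. psum ms (i - 1) + r \<le> psum ms j) = i"
  proof (rule Least_equality)
    show "psum ms (i - 1) + r \<le> psum ms i" using 1 assms by simp
    fix j assume j: "psum ms (i - 1) + r \<le> psum ms j"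
    show "i \<le> j"
    proof (rule ccontr)
      assume "\<not> i \<le> j"
      then have "psum ms j \<le> psum ms (i - 1)" by (intro psum_mono) simp
      then show False using j assms by simp
    qed
  qed
  have "psum ms i \<le> sum_list ms" using psum_mono[of i "length ms" ms] assms by (simp add: psum_length)
  then show "psum ms (i - 1) + r \<in> {1..sum_list ms}" using 1 assms by simp
qed

text \<open>\<open>boff \<sigma> ms i\<close> is the number of positions in front of the image of block \<open>i\<close>, once the
blocks of sizes \<open>ms\<close> have been permuted by \<open>\<sigma>\<close>.\<close>

definition boff :: "(nat \<Rightarrow> nat) \<Rightarrow> nat list \<Rightarrow> nat \<Rightarrow> nat" where
  "boff \<sigma> ms i = (\<Sum>k\<in>{k\<in>{1..length ms}. \<sigma> k < \<sigma> i}. ms ! (k - 1))"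

lemma block_perm_at:
  assumes "i \<in> {1..length ms}" "r \<in> {1..ms ! (i - 1)}"
  shows "block_perm \<sigma> ms \<tau>s (psum ms (i - 1) + r) = boff \<sigma> ms i + (\<tau>s ! (i - 1)) r"
  using block_least[OF assms] by (simp add: block_perm_def boff_def Let_def)

lemma boff_less:
  assumes "i \<in> {1..length ms}" "j \<in> {1..length ms}" "\<sigma> i < \<sigma> j"
  shows "boff \<sigma> ms i + ms ! (i - 1) \<le> boff \<sigma> ms j"
proof -
  have "boff \<sigma> ms i + ms ! (i - 1) = (\<Sum>k\<in>insert i {k\<in>{1..length ms}. \<sigma> k < \<sigma> i}. ms ! (k - 1))"
    by (subst sum.insert) (auto simp: boff_def)
  also have "\<dots> \<le> boff \<sigma> ms j"
    unfolding boff_def by (rule sum_mono2) (use assms in auto)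
  finally show ?thesis .
qed

lemma boff_le:
  assumes "i \<in> {1..length ms}"
  shows "boff \<sigma> ms i + ms ! (i - 1) \<le> sum_list ms"
proof -
  have "boff \<sigma> ms i + ms ! (i - 1) = (\<Sum>k\<in>insert i {k\<in>{1..length ms}. \<sigma> k < \<sigma> i}. ms ! (k - 1))"
    by (subst sum.insert) (auto simp: boff_def)
  also have "\<dots> \<le> (\<Sum>k\<in>{1..length ms}. ms ! (k - 1))"
    by (rule sum_mono2) (use assms in auto)
  also have "\<dots> = sum_list ms" using psum_sum[of "length ms" ms] by (simp add: psum_length)
  finally show ?thesis .
qed

text \<open>The images of different blocks are disjoint intervals, ordered as \<open>\<sigma>\<close> orders the blocks, so it is
enough that each \<open>\<tau>\<close> permutes its own block.\<close>

lemma block_perm_permutes: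
  assumes \<sigma>: "\<sigma> permutes {1..length ms}" and len: "length \<tau>s = length ms"
    and \<tau>: "\<And>i. i < length ms \<Longrightarrow> (\<tau>s ! i) permutes {1..ms ! i}"
  shows "block_perm \<sigma> ms \<tau>s permutes {1..sum_list ms}"
proof (rule bij_imp_permutes)
  let ?p = "block_perm \<sigma> ms \<tau>s"
  have \<tau>': "(\<tau>s ! (i - 1)) permutes {1..ms ! (i - 1)}" if "i \<in> {1..length ms}" for i
    using \<tau>[of "i - 1"] that by auto
  have maps: "?p a \<in> {1..sum_list ms}" if a: "a \<in> {1..sum_list ms}" for a
  proof -
    obtain i r where ir: "i \<in> {1..length ms}" "r \<in> {1..ms ! (i - 1)}" "a = psum ms (i - 1) + r"
      using block_index[OF a] .
    have "(\<tau>s ! (i - 1)) r \<in> {1..ms ! (i - 1)}" using permutes_in_image[OF \<tau>'[OF ir(1)]] ir(2) by blast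
    then show ?thesis using block_perm_at[OF ir(1,2)] boff_le[OF ir(1), of \<sigma>] ir by simp
  qed
  have inj: "inj_on ?p {1..sum_list ms}"
  proof (rule inj_onI)
    fix a b assume a: "a \<in> {1..sum_list ms}" and b: "b \<in> {1..sum_list ms}" and eq: "?p a = ?p b"
    obtain i r where ir: "i \<in> {1..length ms}" "r \<in> {1..ms ! (i - 1)}" "a = psum ms (i - 1) + r"
      using block_index[OF a] .
    obtain j s where js: "j \<in> {1..length ms}" "s \<in> {1..ms ! (j - 1)}" "b = psum ms (j - 1) + s"
      using block_index[OF b] .
    have r: "(\<tau>s ! (i - 1)) r \<in> {1..ms ! (i - 1)}" using permutes_in_image[OF \<tau>'[OF ir(1)]] ir(2) by blast
    have s: "(\<tau>s ! (j - 1)) s \<in> {1..ms ! (j - 1)}" using permutes_in_image[OF \<tau>'[OF js(1)]] js(2) by blast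
    have e: "boff \<sigma> ms i + (\<tau>s ! (i - 1)) r = boff \<sigma> ms j + (\<tau>s ! (j - 1)) s"
      using eq block_perm_at[OF ir(1,2)] block_perm_at[OF js(1,2)] ir js by simp
    have "\<sigma> i = \<sigma> j"
    proof (rule ccontr)
      assume "\<sigma> i \<noteq> \<sigma> j"
      then consider "\<sigma> i < \<sigma> j" | "\<sigma> j < \<sigma> i" by linarith
      then show False
      proof cases
        case 1 then show False using boff_less[OF ir(1) js(1) 1] e r s by simp
      next
        case 2 then show False using boff_less[OF js(1) ir(1) 2] e r s by simp
      qed
    qed
    then have ij: "i = j" using permutes_inj[OF \<sigma>] by (auto dest: injD)
    then have "(\<tau>s ! (i - 1)) r = (\<tau>s ! (i - 1)) s" using e by simp
    then have "r = s" using permutes_inj[OF \<tau>'[OF ir(1)]] by (auto dest: injD)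
    then show "a = b" using ij ir js by simp
  qed
  show "bij_betw ?p {1..sum_list ms} {1..sum_list ms}"
    unfolding bij_betw_def using inj maps endo_inj_surj[of "{1..sum_list ms}" ?p] by blast
  show "\<And>x. x \<notin> {1..sum_list ms} \<Longrightarrow> ?p x = x"
    by (simp only: block_perm_def if_False)
qed

subsection \<open>Partial composition of permutations\<close>

lemma sum_list_circ:
  assumes "i \<in> {1..n}" shows "sum_list ((replicate n 1)[i - 1 := m]) = n + m - (1 :: nat)"
  using assms by (subst sum_list_update) (auto simp: sum_list_replicate)

lemma psum_circ:
  assumes "i \<in> {1..n}" "j \<le> n"
  shows "psum ((replicate n 1)[i - 1 := m]) j = (if j < i then j else j + m - (1 :: nat))"
proof (cases "j < i")
  case True
  then show ?thesis using assms by (simp add: psum_def sum_list_replicate min_def)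
next
  case False
  then have "take j ((replicate n 1)[i - 1 := m]) = (replicate j (1::nat))[i - 1 := m]"
    using assms by (simp add: take_update_swap min_def)
  then show ?thesis using False assms sum_list_circ[of i j m] by (simp add: psum_def)
qed

lemma circ_perm_permutes:
  assumes "i \<in> {1..n}" "\<sigma> permutes {1..n}" "\<tau> permutes {1..m}"
  shows "circ_perm n m i \<sigma> \<tau> permutes {1..n + m - 1}"
proof -
  have "block_perm \<sigma> ((replicate n 1)[i - 1 := m]) ((replicate n id)[i - 1 := \<tau>])
    permutes {1..sum_list ((replicate n 1)[i - 1 := m])}"
    by (rule block_perm_permutes) (use assms in \<open>auto simp: nth_list_update permutes_id\<close>)
  then show ?thesis unfolding circ_perm_def sum_list_circ[OF assms(1)] .
qed

lemma permutes_range_Suc: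
  assumes "\<sigma> permutes {1..n}" "j \<in> {1..n}" shows "1 \<le> \<sigma> j" "\<sigma> j \<le> n"
  using permutes_in_image[OF assms(1)] assms(2) by auto

lemma boff_circ:
  assumes i: "i \<in> {1..n}" and \<sigma>: "\<sigma> permutes {1..n}" and j: "j \<in> {1..n}"
  shows "boff \<sigma> ((replicate n 1)[i - 1 := m]) j = (if \<sigma> i < \<sigma> j then \<sigma> j + m - 2 else \<sigma> j - 1)"
proof -
  have S: "card {k\<in>{1..n}. \<sigma> k < \<sigma> j} = \<sigma> j - 1"
  proof -
    have "\<sigma> ` {k\<in>{1..n}. \<sigma> k < \<sigma> j} = {1..<\<sigma> j}"
    proof (intro equalityI subsetI)
      fix x assume "x \<in> {1..<\<sigma> j}"
      moreover have "\<sigma> j \<le> n" using permutes_range_Suc[OF \<sigma> j] by simp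
      ultimately have "x \<in> \<sigma> ` {1..n}" using permutes_image[OF \<sigma>] by auto
      then show "x \<in> \<sigma> ` {k\<in>{1..n}. \<sigma> k < \<sigma> j}" using \<open>x \<in> {1..<\<sigma> j}\<close> by auto
    qed (use permutes_range_Suc[OF \<sigma>] in auto)
    moreover have "card (\<sigma> ` {k\<in>{1..n}. \<sigma> k < \<sigma> j}) = card {k\<in>{1..n}. \<sigma> k < \<sigma> j}"
      by (rule card_image) (meson permutes_inj[OF \<sigma>] inj_on_subset subset_UNIV)
    ultimately show ?thesis by simp
  qed
  have nth: "((replicate n 1)[i - 1 := m]) ! (k - 1) = (if k = i then m else 1)" if "k \<in> {1..n}" for k
    using that i by (auto simp: nth_list_update)
  have b: "boff \<sigma> ((replicate n 1)[i - 1 := m]) j = (\<Sum>k\<in>{k\<in>{1..n}. \<sigma> k < \<sigma> j}. if k = i then m else 1)"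
    unfolding boff_def using nth by (intro sum.cong) auto
  show ?thesis
  proof (cases "\<sigma> i < \<sigma> j")
    case True
    have "(\<Sum>k\<in>{k\<in>{1..n}. \<sigma> k < \<sigma> j}. if k = i then m else 1) =
      m + (\<Sum>k\<in>{k\<in>{1..n}. \<sigma> k < \<sigma> j} - {i}. if k = i then m else 1)"
      by (subst sum.remove[of _ i]) (use True i in auto)
    also have "(\<Sum>k\<in>{k\<in>{1..n}. \<sigma> k < \<sigma> j} - {i}. if k = i then m else 1) = card ({k\<in>{1..n}. \<sigma> k < \<sigma> j} - {i})"
      by simp
    also have "\<dots> = card {k\<in>{1..n}. \<sigma> k < \<sigma> j} - 1"
      by (rule card_Diff_singleton) (use True i in auto)
    also have "\<dots> = \<sigma> j - 2" unfolding S by simp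
    finally show ?thesis using True b permutes_range_Suc[OF \<sigma> i] by simp
  next
    case False
    then have "(\<Sum>k\<in>{k\<in>{1..n}. \<sigma> k < \<sigma> j}. if k = i then m else 1) = (\<Sum>k\<in>{k\<in>{1..n}. \<sigma> k < \<sigma> j}. 1)"
      by (intro sum.cong) auto
    then show ?thesis using b False S by simp
  qed
qed

text \<open>The values of $\sigma \circ_i \tau$ inside and outside the block that \<open>\<tau>\<close> acts on.\<close>

lemma circ_perm_inside:
  assumes i: "i \<in> {1..n}" and \<sigma>: "\<sigma> permutes {1..n}" and r: "r \<in> {1..m}"
  shows "circ_perm n m i \<sigma> \<tau> (i - 1 + r) = \<sigma> i - 1 + \<tau> r"
  using block_perm_at[of i "(replicate n 1)[i - 1 := m]" r \<sigma> "(replicate n id)[i - 1 := \<tau>]"] assms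
    psum_circ[OF i, of "i - 1"] boff_circ[OF i \<sigma> i]
  by (auto simp: circ_perm_def)

lemma circ_perm_outside:
  assumes i: "i \<in> {1..n}" and \<sigma>: "\<sigma> permutes {1..n}" and j: "j \<in> {1..n}" "j \<noteq> i"
  shows "circ_perm n m i \<sigma> \<tau> (if j < i then j else j + m - 1) = (if \<sigma> j < \<sigma> i then \<sigma> j else \<sigma> j + m - 1)"
proof -
  have ne: "\<sigma> j \<noteq> \<sigma> i" using permutes_inj[OF \<sigma>] j by (auto dest: injD)
  have nth: "(replicate n 1)[i - 1 := m] ! (j - 1) = 1" "(replicate n id)[i - 1 := \<tau>] ! (j - 1) = id"
    using i j by (auto simp: nth_list_update)
  have "block_perm \<sigma> ((replicate n 1)[i - 1 := m]) ((replicate n id)[i - 1 := \<tau>])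
    (psum ((replicate n 1)[i - 1 := m]) (j - 1) + 1) = boff \<sigma> ((replicate n 1)[i - 1 := m]) j + 1"
    by (subst block_perm_at) (use nth j in auto)
  moreover have "psum ((replicate n 1)[i - 1 := m]) (j - 1) + 1 = (if j < i then j else j + m - 1)"
    using psum_circ[OF i, of "j - 1" m] i j by auto
  moreover have "boff \<sigma> ((replicate n 1)[i - 1 := m]) j + 1 = (if \<sigma> j < \<sigma> i then \<sigma> j else \<sigma> j + m - 1)"
    using boff_circ[OF i \<sigma> j(1), of m] ne permutes_range_Suc[OF \<sigma> j(1)] permutes_range_Suc[OF \<sigma> i] by auto
  ultimately show ?thesis by (simp add: circ_perm_def)
qed

text \<open>The permutations preserving the first \<open>b\<close> positions are the $\sigma \circ_1 \tau$ with
$\sigma(1) = 1$. By equivariance they fix $f \circ_1 g$ for invariant \<open>f\<close> and \<open>g\<close>.\<close>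

lemma young_circ_perm:
  assumes y: "y permutes {1..a + b - 1}" and yb: "y ` {1..b} = {1..b}" and a: "1 \<le> (a :: nat)"
  obtains \<sigma> \<tau> where "\<sigma> permutes {1..a}" "\<sigma> 1 = 1" "\<tau> permutes {1..b}" "circ_perm a b 1 \<sigma> \<tau> = y"
proof -
  have inj: "inj y" by (rule permutes_inj[OF y])
  define \<tau> where "\<tau> = (\<lambda>r. if r \<in> {1..b} then y r else r)"
  define \<sigma> where "\<sigma> = (\<lambda>j. if j \<in> {2..a} then y (j + b - 1) + 1 - b else j)"
  have \<tau>: "\<tau> permutes {1..b}"
  proof (rule bij_imp_permutes)
    show "bij_betw \<tau> {1..b} {1..b}"
    proof -
      have "\<tau> ` {1..b} = y ` {1..b}" by (intro image_cong) (auto simp: \<tau>_def)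
      moreover have "inj_on \<tau> {1..b}" using inj by (intro inj_onI) (auto simp: \<tau>_def dest: injD)
      ultimately show ?thesis unfolding bij_betw_def by (simp only: yb simp_thms)
    qed
  qed (auto simp: \<tau>_def)
  have big: "y x \<in> {b + 1..a + b - 1}" if "x \<in> {b + 1..a + b - 1}" for x
  proof -
    have "y x \<in> {1..a + b - 1}" using permutes_in_image[OF y] that by auto
    moreover have "y x \<notin> {1..b}"
    proof
      assume "y x \<in> {1..b}"
      then have "y x \<in> y ` {1..b}" by (simp only: yb)
      then have "x \<in> {1..b}" by (simp only: inj_image_mem_iff[OF inj])
      then show False using that by simp
    qed
    ultimately show ?thesis by auto
  qed
  have \<sigma>: "\<sigma> permutes {1..a}"
  proof (rule bij_imp_permutes)
    have m: "\<sigma> j \<in> {2..a}" if "j \<in> {2..a}" for j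
    proof -
      have "j + b - 1 \<in> {b + 1..a + b - 1}" using that by auto
      from big[OF this] show ?thesis using that unfolding \<sigma>_def by (simp, linarith)
    qed
    have "inj_on \<sigma> {1..a}"
    proof (rule inj_onI)
      fix j k assume jk: "j \<in> {1..a}" "k \<in> {1..a}" "\<sigma> j = \<sigma> k"
      have 1: "\<sigma> 1 = 1" by (simp add: \<sigma>_def)
      show "j = k"
      proof (cases "j = 1 \<or> k = 1")
        case True then show ?thesis using jk 1 m[of j] m[of k] by force
      next
        case False
        then have jk2: "j \<in> {2..a}" "k \<in> {2..a}" using jk by auto
        then have "j + b - 1 \<in> {b + 1..a + b - 1}" "k + b - 1 \<in> {b + 1..a + b - 1}" by auto
        then have "b < y (j + b - 1)" "b < y (k + b - 1)"
          using big by (fastforce simp del: One_nat_def)+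
        moreover have "y (j + b - 1) + 1 - b = y (k + b - 1) + 1 - b"
          using jk(3) jk2 by (simp add: \<sigma>_def)
        ultimately have "y (j + b - 1) = y (k + b - 1)" by linarith
        then have "j + b - 1 = k + b - 1" using inj by (auto dest: injD)
        then show "j = k" using jk2 by auto
      qed
    qed
    moreover have "\<sigma> ` {1..a} \<subseteq> {1..a}"
    proof (rule image_subsetI)
      fix j assume "j \<in> {1..a}"
      then show "\<sigma> j \<in> {1..a}" using m[of j] by (cases "j = 1") (auto simp: \<sigma>_def)
    qed
    ultimately show "bij_betw \<sigma> {1..a} {1..a}"
      unfolding bij_betw_def using endo_inj_surj[of "{1..a}" \<sigma>] by blast
  next
    fix j assume "j \<notin> {1..a}" then show "\<sigma> j = j" by (auto simp: \<sigma>_def)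
  qed
  have \<sigma>1: "\<sigma> 1 = 1" by (simp add: \<sigma>_def)
  have "circ_perm a b 1 \<sigma> \<tau> = y"
  proof
    fix x
    consider "x \<in> {1..b}" | "x \<in> {b + 1..a + b - 1}" | "x \<notin> {1..a + b - 1}" by fastforce
    then show "circ_perm a b 1 \<sigma> \<tau> x = y x"
    proof cases
      case 1
      then show ?thesis using circ_perm_inside[of 1 a \<sigma> x b \<tau>] \<sigma> \<sigma>1 a by (simp add: \<tau>_def)
    next
      case 2
      define j where "j = x + 1 - b"
      have j: "j \<in> {2..a}" "j + b - 1 = x" using 2 by (auto simp: j_def)
      have "\<sigma> j = y x + 1 - b" "\<sigma> j \<noteq> 0" using j big[OF 2] by (auto simp: \<sigma>_def)
      then show ?thesis using circ_perm_outside[of 1 a \<sigma> j b \<tau>] \<sigma> \<sigma>1 a j big[OF 2] by simp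
    next
      case 3
      then show ?thesis
        using permutes_not_in[OF circ_perm_permutes[of 1 a \<sigma> \<tau> b] 3] permutes_not_in[OF y 3] \<sigma> \<tau> a by auto
    qed
  qed
  then show ?thesis using that \<sigma> \<tau> \<sigma>1 by blast
qed

subsection \<open>Shuffles\<close>

lemma strict_mono_on_image_unique:
  fixes f g :: "nat \<Rightarrow> nat"
  assumes "strict_mono_on A f" "strict_mono_on A g" "finite A" "f ` A = g ` A" "x \<in> A"
  shows "f x = g x"
proof -
  let ?xs = "sorted_list_of_set A"
  have srt: "sorted_wrt (<) (map h ?xs)" if "strict_mono_on A h" for h :: "nat \<Rightarrow> nat"
    unfolding sorted_wrt_map
    by (rule sorted_wrt_mono_rel[of _ "(<)"]) (use that \<open>finite A\<close> in \<open>auto simp: strict_mono_on_def\<close>)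
  have "map f ?xs = map g ?xs"
    by (rule sorted_distinct_set_unique)
      (use srt[OF assms(1)] srt[OF assms(2)] assms(3,4) in \<open>auto simp: strict_sorted_iff\<close>)
  then show ?thesis using assms(3,5) by (auto simp: map_eq_conv)
qed

text \<open>\<open>shuf k b\<close> is the set of shuffles $S_{b,k-b}$, with both parameters natural numbers, and
\<open>young k b\<close> is the Young subgroup $S_b \times S_{k-b}$ of $S_k$.\<close>

definition shuf :: "nat \<Rightarrow> nat \<Rightarrow> (nat \<Rightarrow> nat) set" where
  "shuf k b = {\<sigma>. \<sigma> permutes {1..k} \<and> strict_mono_on {1..b} \<sigma> \<and> strict_mono_on {b + 1..k} \<sigma>}"

definition young :: "nat \<Rightarrow> nat \<Rightarrow> (nat \<Rightarrow> nat) set" where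
  "young k b = {y. y permutes {1..k} \<and> y ` {1..b} = {1..b}}"

lemma shuffle_perms_shuf: "b \<le> k \<Longrightarrow> shuffle_perms (int b) (int (k - b)) = shuf k b"
  unfolding shuffle_perms_def shuf_def by (simp add: nat_int_add of_nat_diff)

lemma complement_image:
  assumes "\<sigma> permutes {1..k :: nat}" "b \<le> k" shows "\<sigma> ` {b + 1..k} = {1..k} - \<sigma> ` {1..b}"
proof -
  have "{b + 1..k} = {1..k} - {1..b}" using assms(2) by auto
  then show ?thesis using permutes_image[OF assms(1)] permutes_inj[OF assms(1)]
    by (metis image_set_diff)
qed

text \<open>An increasing map on a finite set is determined by its image.\<close>

lemma shuf_unique:
  assumes s: "\<sigma> \<in> shuf k b" "\<sigma>' \<in> shuf k b" and b: "b \<le> k" and im: "\<sigma> ` {1..b} = \<sigma>' ` {1..b}"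
  shows "\<sigma> = \<sigma>'"
proof
  fix x
  consider "x \<in> {1..b}" | "x \<in> {b + 1..k}" | "x \<notin> {1..k}" by fastforce
  then show "\<sigma> x = \<sigma>' x"
  proof cases
    case 1 then show ?thesis using s im by (intro strict_mono_on_image_unique[of "{1..b}"]) (auto simp: shuf_def)
  next
    case 2
    have "\<sigma> ` {b + 1..k} = \<sigma>' ` {b + 1..k}"
      using complement_image[of \<sigma> k b] complement_image[of \<sigma>' k b] s b im by (simp add: shuf_def)
    with 2 show ?thesis using s by (intro strict_mono_on_image_unique[of "{b + 1..k}"]) (auto simp: shuf_def)
  next
    case 3 then show ?thesis using s by (auto simp: shuf_def permutes_not_in)
  qed
qed

lemma shuf_exists:
  assumes A: "A \<subseteq> {1..k}" "card A = b" and b: "b \<le> k"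
  obtains \<sigma> where "\<sigma> \<in> shuf k b" "\<sigma> ` {1..b} = A"
proof -
  define B where "B = {1..k} - A"
  have fin: "finite A" "finite B" using A finite_subset[OF A(1)] by (auto simp: B_def)
  have cB: "card B = k - b" using A fin by (simp add: B_def card_Diff_subset)
  define \<sigma> where "\<sigma> = (\<lambda>i. if i \<in> {1..b} then sorted_list_of_set A ! (i - 1)
    else if i \<in> {b + 1..k} then sorted_list_of_set B ! (i - (b + 1)) else i)"
  have e: "(\<lambda>i. sorted_list_of_set C ! (i - m)) ` {m..<m + card C} = C" if "finite C" for C :: "nat set" and m
  proof -
    have "(\<lambda>i. sorted_list_of_set C ! (i - m)) ` {m..<m + card C} = (!) (sorted_list_of_set C) ` {0..<card C}"
    proof -
      have "{0..<card C} = (\<lambda>i. i - m) ` {m..<m + card C}"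
        by (auto simp: image_iff intro!: bexI[of _ "_ + m"])
      then show ?thesis by (simp add: image_image)
    qed
    also have "\<dots> = set (sorted_list_of_set C)"
      by (metis atLeast_upt length_sorted_list_of_set list.set_map map_nth set_upt)
    finally show ?thesis using that by simp
  qed
  have imA: "\<sigma> ` {1..b} = A"
  proof -
    have "\<sigma> ` {1..b} = (\<lambda>i. sorted_list_of_set A ! (i - 1)) ` {1..<1 + card A}"
      using A by (intro image_cong) (auto simp: \<sigma>_def)
    then show ?thesis using e[OF fin(1), of 1] by simp
  qed
  have imB: "\<sigma> ` {b + 1..k} = B"
  proof -
    have "\<sigma> ` {b + 1..k} = (\<lambda>i. sorted_list_of_set B ! (i - (b + 1))) ` {b + 1..<b + 1 + card B}"
      using cB b by (intro image_cong) (auto simp: \<sigma>_def)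
    then show ?thesis using e[OF fin(2), of "b + 1"] by simp
  qed
  have "{1..k} = {1..b} \<union> {b + 1..k}" using b by auto
  then have im: "\<sigma> ` {1..k} = {1..k}" using imA imB A by (auto simp: B_def image_Un)
  have perm: "\<sigma> permutes {1..k}"
  proof (rule bij_imp_permutes)
    show "bij_betw \<sigma> {1..k} {1..k}"
      unfolding bij_betw_def using im finite_surj_inj[of "{1..k}" \<sigma>] by simp
  qed (use b in \<open>auto simp: \<sigma>_def\<close>)
  have srt: "sorted_list_of_set C ! i < sorted_list_of_set C ! j" if "i < j" "j < card C" for i j and C :: "nat set"
    using that sorted_wrt_nth_less[of "(<)" "sorted_list_of_set C" i j] by simp
  have "strict_mono_on {1..b} \<sigma>"
    unfolding strict_mono_on_def using A by (auto simp: \<sigma>_def intro!: srt)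
  moreover have "strict_mono_on {b + 1..k} \<sigma>"
    unfolding strict_mono_on_def using cB by (auto simp: \<sigma>_def intro!: srt)
  ultimately show ?thesis using that[of \<sigma>] perm imA by (simp add: shuf_def)
qed

text \<open>The shuffles represent the left cosets of the Young subgroup.\<close>

lemma shuf_young_bij:
  assumes b: "b \<le> k"
  shows "bij_betw (\<lambda>(\<sigma>, y). \<sigma> \<circ> y) (shuf k b \<times> young k b) {\<pi>. \<pi> permutes {1..k}}"
  unfolding bij_betw_def
proof (intro conjI equalityI subsetI)
  show "inj_on (\<lambda>(\<sigma>, y). \<sigma> \<circ> y) (shuf k b \<times> young k b)"
  proof (rule inj_onI, clarify)
    fix \<sigma> y \<sigma>' y' assume *: "\<sigma> \<in> shuf k b" "y \<in> young k b" "\<sigma>' \<in> shuf k b" "y' \<in> young k b" "\<sigma> \<circ> y = \<sigma>' \<circ> y'"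
    have "\<sigma> ` y ` {1..b} = \<sigma>' ` y' ` {1..b}" using *(5) by (metis image_comp)
    then have eq: "\<sigma> = \<sigma>'" using * b by (intro shuf_unique) (auto simp: young_def)
    have "inj \<sigma>" using * by (auto simp: shuf_def dest: permutes_inj)
    moreover have "\<sigma> (y x) = \<sigma> (y' x)" for x using fun_cong[OF *(5), of x] eq by simp
    ultimately have "y = y'" by (intro ext) (auto dest: injD)
    with eq show "\<sigma> = \<sigma>' \<and> y = y'" by simp
  qed
next
  fix \<pi> assume "\<pi> \<in> (\<lambda>(\<sigma>, y). \<sigma> \<circ> y) ` (shuf k b \<times> young k b)"
  then show "\<pi> \<in> {\<pi>. \<pi> permutes {1..k}}" by (auto simp: shuf_def young_def intro: permutes_compose)
next
  fix \<pi> assume "\<pi> \<in> {\<pi>. \<pi> permutes {1..k}}"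
  then have \<pi>: "\<pi> permutes {1..k}" by simp
  have "\<pi> ` {1..b} \<subseteq> {1..k}" using permutes_image[OF \<pi>] b by (metis atLeastatMost_subset_iff image_mono order_refl)
  moreover have "card (\<pi> ` {1..b}) = b" using permutes_inj_on[OF \<pi>] by (subst card_image) auto
  ultimately obtain \<sigma> where \<sigma>: "\<sigma> \<in> shuf k b" "\<sigma> ` {1..b} = \<pi> ` {1..b}" using shuf_exists b by metis
  then have \<sigma>p: "\<sigma> permutes {1..k}" by (simp add: shuf_def)
  have "inv_into UNIV \<sigma> ` \<pi> ` {1..b} = {1..b}" using \<sigma> permutes_inj[OF \<sigma>p] by (metis image_inv_f_f)
  then have "inv_into UNIV \<sigma> \<circ> \<pi> \<in> young k b"
    using permutes_compose[OF \<pi> permutes_inv[OF \<sigma>p]] by (simp add: young_def image_comp)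
  moreover have "\<pi> = \<sigma> \<circ> (inv_into UNIV \<sigma> \<circ> \<pi>)" using permutes_inv_o(1)[OF \<sigma>p] by (simp add: o_assoc)
  ultimately show "\<pi> \<in> (\<lambda>(\<sigma>, y). \<sigma> \<circ> y) ` (shuf k b \<times> young k b)" using \<sigma>(1)
    by (intro image_eqI[where x = "(\<sigma>, inv_into UNIV \<sigma> \<circ> \<pi>)"]) simp_all
qed

lemma card_shuf: "b \<le> k \<Longrightarrow> card (shuf k b) = k choose b"
proof -
  assume b: "b \<le> k"
  have "bij_betw (\<lambda>\<sigma>. \<sigma> ` {1..b}) (shuf k b) {A. A \<subseteq> {1..k} \<and> card A = b}"
    unfolding bij_betw_def
  proof (intro conjI equalityI subsetI)
    show "inj_on (\<lambda>\<sigma>. \<sigma> ` {1..b}) (shuf k b)" by (rule inj_onI) (rule shuf_unique[OF _ _ b])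
  next
    fix A assume "A \<in> (\<lambda>\<sigma>. \<sigma> ` {1..b}) ` shuf k b"
    then obtain \<sigma> where \<sigma>: "\<sigma> permutes {1..k}" "A = \<sigma> ` {1..b}" by (auto simp: shuf_def)
    have "\<sigma> ` {1..b} \<subseteq> {1..k}" using permutes_image[OF \<sigma>(1)] b by (metis atLeastatMost_subset_iff image_mono order_refl)
    moreover have "card (\<sigma> ` {1..b}) = b" using permutes_inj_on[OF \<sigma>(1)] by (subst card_image) auto
    ultimately show "A \<in> {A. A \<subseteq> {1..k} \<and> card A = b}" using \<sigma> by simp
  next
    fix A assume "A \<in> {A. A \<subseteq> {1..k} \<and> card A = b}"
    then show "A \<in> (\<lambda>\<sigma>. \<sigma> ` {1..b}) ` shuf k b" using shuf_exists b by (metis (mono_tags, lifting) image_eqI mem_Collect_eq)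
  qed
  then show ?thesis using n_subsets[of "{1..k}" b] by (simp add: bij_betw_same_card)
qed

lemma card_young: assumes b: "b \<le> k" shows "card (young k b) = fact b * fact (k - b)"
proof -
  have "card (shuf k b) * card (young k b) = card {\<pi>. \<pi> permutes {1..k}}"
    using bij_betw_same_card[OF shuf_young_bij[OF b]] by (simp add: card_cartesian_product)
  also have "\<dots> = fact k" by (rule card_permutations) auto
  also have "\<dots> = (fact b * fact (k - b)) * (k choose b)"
    using binomial_fact_lemma[OF b] by simp
  finally have "(k choose b) * card (young k b) = (k choose b) * (fact b * fact (k - b))"
    by (simp add: card_shuf[OF b] mult.commute)
  moreover have "k choose b \<noteq> 0" using b by simp
  ultimately show ?thesis by simp
qed

lemma finite_young: "finite (young k b)" and finite_shuf: "finite (shuf k b)"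
  unfolding young_def shuf_def by (rule finite_subset[OF _ finite_permutations[of "{1..k}"]]; auto)+

section \<open>Quotients by the derivation\<close>

text \<open>All terms of positive degree of $Q(-\partial)$ lie in the image of $\partial$.\<close>

lemma (in endo) eval_mod:
  assumes Q: "Q \<in> up V"
  shows "\<exists>z\<in>carrier V. eval_neg V d Q = Q 0 \<oplus>\<^bsub>V\<^esub> d z"
proof -
  define R where "R = (\<lambda>i. Q (Suc i))"
  obtain N where N: "\<And>i. i > N \<Longrightarrow> Q i = \<zero>\<^bsub>V\<^esub>" using up_bound[OF Q] by metis
  have R: "R \<in> up V" by (rule upI[of _ _ N]) (use Q N in \<open>auto simp: R_def up_mem\<close>)
  have "Q i = monom0 V (Q 0) i \<oplus>\<^bsub>V\<^esub> shift V R i" for i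
    by (cases i) (auto simp: monom0_def shift_def R_def up_mem[OF Q])
  then have "Q = (\<lambda>i. monom0 V (Q 0) i \<oplus>\<^bsub>V\<^esub> shift V R i)" by (rule ext)
  then have "eval_neg V d Q = eval_neg V d (\<lambda>i. monom0 V (Q 0) i \<oplus>\<^bsub>V\<^esub> shift V R i)" by (rule arg_cong)
  also have "\<dots> = Q 0 \<oplus>\<^bsub>V\<^esub> \<ominus>\<^bsub>V\<^esub> d (eval_neg V d R)"
    using R Q by (simp add: eval_add up_monom0 up_shift eval_monom0 eval_shift up_mem)
  finally show ?thesis
    by (intro bexI[of _ "\<ominus>\<^bsub>V\<^esub> eval_neg V d R"]) (auto simp: d.neg eval_closed R)
qed

context diff_symm_seq
begin

lemma sp_module: "module K (sp S n)" and sp_abelian: "abelian_group (sp S n)"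
  using superspace_sp[of n] by (auto intro: superspace_module superspace_abelian)

lemma dd_lin: "lin_map K (sp S n) (sp S n) (dd S n)"
  using dd_even by (simp add: even_map_def)

lemma dd_closed: "x \<in> carrier (sp S n) \<Longrightarrow> dd S n x \<in> carrier (sp S n)"
  by (rule lin_map_closed[OF dd_lin])

lemma dd_endo: "endo K (sp S n) (dd S n)"
  by (simp add: endo_def endo_axioms_def sp_module dd_lin)

lemma act_lin: "\<sigma> permutes {1..n} \<Longrightarrow> lin_map K (sp S n) (sp S n) (act S n \<sigma>)"
  using act_even by (simp add: even_map_def)

lemma act_closed: "\<lbrakk>\<sigma> permutes {1..n}; x \<in> carrier (sp S n)\<rbrakk> \<Longrightarrow> act S n \<sigma> x \<in> carrier (sp S n)"
  by (rule lin_map_closed[OF act_lin])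

lemma graded_submodule_dd: "graded_submodule K (sp S n) (dd S n ` carrier (sp S n))"
  by (rule graded_submodule_image[OF superspace_sp dd_even])

lemma dquot_superspace: "superspace K (dquot S n)"
  unfolding dquot_def by (rule graded_submodule.squot_superspace[OF graded_submodule_dd])

lemma dcls_even: "even_map K (sp S n) (dquot S n) (dcls S n)"
  unfolding dquot_def dcls_def using graded_submodule.squot_even[OF graded_submodule_dd] by simp

lemma dcls_lin: "lin_map K (sp S n) (dquot S n) (dcls S n)"
  using dcls_even by (simp add: even_map_def)

lemma dcls_hom: "lin_hom K (sp S n) (dquot S n) (dcls S n)"
  by (rule lin_homI[OF superspace_sp dquot_superspace dcls_lin])

lemma dquot_carrier: "carrier (dquot S n) = dcls S n ` carrier (sp S n)"
  unfolding dquot_def dcls_def by (rule graded_submodule.squot_carrier[OF graded_submodule_dd])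

lemma dquot_hpart: "hpart (dquot S n) p = dcls S n ` hpart (sp S n) p"
  unfolding dquot_def dcls_def by (rule graded_submodule.squot_hpart[OF graded_submodule_dd])

lemma dcls_closed: "x \<in> carrier (sp S n) \<Longrightarrow> dcls S n x \<in> carrier (dquot S n)"
  by (simp add: dquot_carrier)

lemma dcls_eq_iff: "\<lbrakk>x \<in> carrier (sp S n); y \<in> carrier (sp S n)\<rbrakk>
  \<Longrightarrow> dcls S n x = dcls S n y \<longleftrightarrow> (\<exists>z\<in>carrier (sp S n). x = y \<oplus>\<^bsub>sp S n\<^esub> dd S n z)"
proof -
  assume x: "x \<in> carrier (sp S n)" and y: "y \<in> carrier (sp S n)"
  interpret V: abelian_group "sp S n" by (rule sp_abelian)
  have "x \<ominus>\<^bsub>sp S n\<^esub> y = w \<longleftrightarrow> x = y \<oplus>\<^bsub>sp S n\<^esub> w" if "w \<in> carrier (sp S n)" for w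
    using x y that by (auto simp: a_minus_def V.a_ac V.r_neg V.r_neg1 V.r_neg2)
  then show ?thesis
    unfolding dcls_def graded_submodule.cl_eq_iff[OF graded_submodule_dd x y]
    using dd_closed by (auto simp: image_iff)
qed

lemma dcls_add_dd: "\<lbrakk>x \<in> carrier (sp S n); z \<in> carrier (sp S n)\<rbrakk>
  \<Longrightarrow> dcls S n (x \<oplus>\<^bsub>sp S n\<^esub> dd S n z) = dcls S n x"
  using dcls_eq_iff dd_closed abelian_monoid.a_closed[OF abelian_group.axioms(1)[OF sp_abelian]] by blast

lemma mem_dcls: "x \<in> carrier (sp S n) \<Longrightarrow> y \<in> dcls S n x \<longleftrightarrow> (\<exists>z\<in>carrier (sp S n). y = x \<oplus>\<^bsub>sp S n\<^esub> dd S n z)"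
proof -
  assume x: "x \<in> carrier (sp S n)"
  interpret V: abelian_group "sp S n" by (rule sp_abelian)
  have "y \<in> dcls S n x \<longleftrightarrow> y \<in> carrier (sp S n) \<and> dcls S n y = dcls S n x"
    unfolding dcls_def by (rule graded_submodule.mem_cl_iff[OF graded_submodule_dd x])
  also have "\<dots> \<longleftrightarrow> (\<exists>z\<in>carrier (sp S n). y = x \<oplus>\<^bsub>sp S n\<^esub> dd S n z)"
    using dcls_eq_iff[OF _ x] dd_closed x by (metis V.add.m_closed)
  finally show ?thesis .
qed

lemma dcls_self: "x \<in> carrier (sp S n) \<Longrightarrow> x \<in> dcls S n x"
proof -
  assume x: "x \<in> carrier (sp S n)"
  interpret d: endo K "sp S n" "dd S n" by (rule dd_endo)
  show ?thesis unfolding mem_dcls[OF x] using x by (intro bexI[of _ "\<zero>\<^bsub>sp S n\<^esub>"]) (auto simp: d.d.zero)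
qed

text \<open>The form in which an operation on the quotient, a union over representatives, is computed.\<close>

lemma UN_dcls:
  assumes "x \<in> carrier (sp S n)" "\<And>z. z \<in> carrier (sp S n) \<Longrightarrow> F (x \<oplus>\<^bsub>sp S n\<^esub> dd S n z) = F x"
  shows "(\<Union>y\<in>dcls S n x. F y) = F x"
  by (rule UN_const_eq[OF dcls_self[OF assms(1)]]) (use assms mem_dcls in auto)

lemma dcls_finsum: "(\<And>a. a \<in> A \<Longrightarrow> f a \<in> carrier (sp S n))
  \<Longrightarrow> dcls S n (\<Oplus>\<^bsub>sp S n\<^esub>a\<in>A. f a) = (\<Oplus>\<^bsub>dquot S n\<^esub>a\<in>A. dcls S n (f a))"
  by (rule lin_hom.sum[OF dcls_hom])

lemma lin_map_dquot:
  assumes lin: "lin_map K (sp S n) (sp S m) g" and G: "\<And>x. x \<in> carrier (sp S n) \<Longrightarrow> G (dcls S n x) = dcls S m (g x)"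
  shows "lin_map K (dquot S n) (dquot S m) G"
proof (rule lin_mapI)
  note c = lin_map_closed[OF lin]
  interpret V: module K "sp S n" by (rule sp_module)
  show "G X \<in> carrier (dquot S m)" if "X \<in> carrier (dquot S n)" for X
    using that G c by (auto simp: dquot_carrier)
  fix X Y assume "X \<in> carrier (dquot S n)" "Y \<in> carrier (dquot S n)"
  then obtain x y where xy: "x \<in> carrier (sp S n)" "X = dcls S n x" "y \<in> carrier (sp S n)" "Y = dcls S n y"
    by (auto simp: dquot_carrier)
  then show "G (X \<oplus>\<^bsub>dquot S n\<^esub> Y) = G X \<oplus>\<^bsub>dquot S m\<^esub> G Y"
    using c by (simp add: lin_map_add[OF dcls_lin, symmetric] G lin_map_add[OF lin])
next
  note c = lin_map_closed[OF lin]
  interpret V: module K "sp S n" by (rule sp_module)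
  fix k X assume k: "k \<in> carrier K" and "X \<in> carrier (dquot S n)"
  then obtain x where x: "x \<in> carrier (sp S n)" "X = dcls S n x" by (auto simp: dquot_carrier)
  then show "G (k \<odot>\<^bsub>dquot S n\<^esub> X) = k \<odot>\<^bsub>dquot S m\<^esub> G X"
    using c k by (simp add: lin_map_smult[OF dcls_lin, symmetric] G lin_map_smult[OF lin])
qed

lemma quot_act_dcls:
  assumes \<sigma>: "\<sigma> permutes {1..n}" and x: "x \<in> carrier (sp S n)"
  shows "quot_act S n \<sigma> (dcls S n x) = dcls S n (act S n \<sigma> x)"
  unfolding quot_act_def
  by (rule UN_dcls) (use assms in \<open>auto simp: lin_map_add[OF act_lin] dd_closed act_dd dcls_add_dd act_closed\<close>)

lemma quot_symm_seq:
  assumes sp: "sp S' = dquot S" and act: "act S' = quot_act S"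
  shows "symm_seq K S'"
proof (rule symm_seq.intro)
  show "superspace K (sp S' n)" for n by (simp add: sp dquot_superspace)
next
  fix \<sigma> and n :: nat assume \<sigma>: "\<sigma> permutes {1..n}"
  show "even_map K (sp S' n) (sp S' n) (act S' n \<sigma>)"
    unfolding even_map_def sp act dquot_hpart
  proof (intro conjI allI)
    show "lin_map K (dquot S n) (dquot S n) (quot_act S n \<sigma>)"
      by (rule lin_map_dquot[OF act_lin[OF \<sigma>] quot_act_dcls[OF \<sigma>]])
    show "quot_act S n \<sigma> ` dcls S n ` hpart (sp S n) p \<subseteq> dcls S n ` hpart (sp S n) p" for p
      using even_map_hpart[OF act_even[OF \<sigma>]] superspace.hpart_closed[OF superspace_sp]
      by (auto simp: quot_act_dcls[OF \<sigma>])
  qed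
next
  fix F and n :: nat assume "F \<in> carrier (sp S' n)"
  then obtain f where f: "f \<in> carrier (sp S n)" "F = dcls S n f" by (auto simp: sp dquot_carrier)
  show "act S' n id F = F" using f quot_act_dcls[OF permutes_id f(1)] by (simp add: act act_id)
next
  fix \<sigma> \<tau> F and n :: nat assume that: "\<sigma> permutes {1..n}" "\<tau> permutes {1..n}" and "F \<in> carrier (sp S' n)"
  then obtain f where f: "f \<in> carrier (sp S n)" "F = dcls S n f" by (auto simp: sp dquot_carrier)
  show "act S' n (\<sigma> \<circ> \<tau>) F = act S' n \<tau> (act S' n \<sigma> F)"
    using f that permutes_compose[OF that(2,1)] by (simp add: act quot_act_dcls act_closed act_comp)
qed

lemma dcls_signed: "x \<in> carrier (sp S n) \<Longrightarrow> dcls S n (signed (sp S n) p x) = signed (dquot S n) p (dcls S n x)"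
  by (rule lin_hom.signed[OF dcls_hom])

end

section \<open>The quotient of a conformal operad\<close>

lemma listset_iff: "xs \<in> listset As \<longleftrightarrow> length xs = length As \<and> (\<forall>i<length As. xs ! i \<in> As ! i)"
proof (induction As arbitrary: xs)
  case (Cons A As)
  show ?case
    by (cases xs) (auto simp: set_Cons_def Cons.IH nth_Cons split: nat.splits)
qed auto

lemma form_times_empty: "abelian_group V \<Longrightarrow> form_times V X R {#} = \<zero>\<^bsub>V\<^esub>"
  by (simp add: form_times_def var_times_def comm_monoid.finprod_one abelian_group.axioms(1) abelian_monoid.finsum_zero)

text \<open>Linear forms have no constant term, so the variables may be set to $0$ before the substitution.\<close>

lemma subst_forms_empty:
  assumes V: "abelian_group V" and fin: "finite {\<gamma>. \<exists>\<beta>. Q \<gamma> \<beta> \<noteq> \<zero>\<^bsub>V\<^esub>}"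
    and cl: "Q {#} {#} \<in> carrier V"
  shows "subst_forms V X Q {#} = Q {#} {#}"
proof -
  interpret V: abelian_group V by fact
  let ?A = "{\<gamma>. \<exists>\<beta>. Q \<gamma> \<beta> \<noteq> \<zero>\<^bsub>V\<^esub>}"
  let ?F = "\<lambda>\<gamma>. fold (\<lambda>i. form_times V (X i)) (sorted_list_of_multiset \<gamma>) (Q \<gamma>) {#}"
  have z: "?F \<gamma> = \<zero>\<^bsub>V\<^esub>" if "\<gamma> \<noteq> {#}" for \<gamma>
  proof -
    have "sorted_list_of_multiset \<gamma> \<noteq> []" using that by (metis mset.simps(1) mset_sorted_list_of_multiset)
    then obtain xs x where "sorted_list_of_multiset \<gamma> = xs @ [x]" by (metis rev_exhaust)
    then show ?thesis by (simp add: form_times_empty V)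
  qed
  have e: "?F {#} = Q {#} {#}" by simp
  show ?thesis
  proof (cases "{#} \<in> ?A")
    case True
    have "subst_forms V X Q {#} = ?F {#}"
      unfolding subst_forms_def by (rule finsum_single[OF V fin True]) (use z cl in auto)
    then show ?thesis using e by simp
  next
    case False
    then have "subst_forms V X Q {#} = \<zero>\<^bsub>V\<^esub>"
      unfolding subst_forms_def by (intro V.add.finprod_one_eqI) (metis z)
    then show ?thesis using False by auto
  qed
qed

lemma finite_msets_bounded:
  assumes "finite A" shows "finite {\<beta>. set_mset \<beta> \<subseteq> A \<and> (\<forall>v\<in>A. count \<beta> v \<le> N)}"
proof (rule finite_subset)
  show "{\<beta>. set_mset \<beta> \<subseteq> A \<and> (\<forall>v\<in>A. count \<beta> v \<le> N)} \<subseteq> (\<Union>k\<in>{..card A * N}. multisets_of_size A k)"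
  proof (clarsimp simp: multisets_of_size_def)
    fix \<beta> assume b: "set_mset \<beta> \<subseteq> A" "\<forall>v\<in>A. count \<beta> v \<le> N"
    have "size \<beta> = (\<Sum>v\<in>set_mset \<beta>. count \<beta> v)" by (rule size_multiset_overloaded_eq)
    also have "\<dots> \<le> (\<Sum>v\<in>A. count \<beta> v)" using b assms by (intro sum_mono2) auto
    also have "\<dots> \<le> card A * N" using sum_bounded_above[of A "count \<beta>" N] b by simp
    finally show "size \<beta> \<le> card A * N" .
  qed
  show "finite (\<Union>k\<in>{..card A * N}. multisets_of_size A k)"
    using assms by (auto intro: finite_multisets_of_size)
qed

lemma count_image_ge: "count A x \<le> count (image_mset f A) (f x)"
  by (induction A) auto

lemma count_block_part:
  assumes "i \<in> {1..length ms}" "r \<in> {1..ms ! (i - 1)}"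
  shows "count \<beta> (Inr (psum ms (i - 1) + r)) \<le> size (block_part ms i (mu_part \<beta>))"
proof -
  let ?j = "psum ms (i - 1) + r"
  have j: "psum ms (i - 1) < ?j \<and> ?j \<le> psum ms i" using psum_step[OF assms(1)] assms(2) by auto
  have "count \<beta> (Inr ?j) = count (filter_mset (\<lambda>v. \<not> isl v) \<beta>) (Inr ?j)" by simp
  also have "\<dots> \<le> count (mu_part \<beta>) (projr (Inr ?j :: nat + nat))"
    unfolding mu_part_def by (rule count_image_ge)
  also have "\<dots> = count (filter_mset (\<lambda>j. psum ms (i - 1) < j \<and> j \<le> psum ms i) (mu_part \<beta>)) ?j"
    using j by simp
  also have "\<dots> \<le> size (filter_mset (\<lambda>j. psum ms (i - 1) < j \<and> j \<le> psum ms i) (mu_part \<beta>))"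
    by (rule count_le_size)
  also have "\<dots> = size (block_part ms i (mu_part \<beta>))" by (simp add: block_part_def)
  finally show ?thesis .
qed

lemma length_block: "\<lbrakk>i \<in> {1..length ms}; length xs = sum_list ms\<rbrakk> \<Longrightarrow> length (block ms i xs) = ms ! (i - 1)"
  using psum_step[of i ms] psum_mono[of i "length ms" ms] by (auto simp: block_def psum_length)

lemma nth_block: "\<lbrakk>i \<in> {1..length ms}; length xs = sum_list ms; k < ms ! (i - 1)\<rbrakk>
  \<Longrightarrow> block ms i xs ! k = xs ! (psum ms (i - 1) + k) \<and> psum ms (i - 1) + k < sum_list ms"
  using psum_step[of i ms] psum_mono[of i "length ms" ms] by (auto simp: block_def psum_length)

lemma hargs_args: "(\<And>n. superspace K (sp S n)) \<Longrightarrow> hargs S ms ps gs \<Longrightarrow> args S ms gs"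
  using superspace.hpart_closed by (fastforce simp: hargs_def args_def)

lemma args_block:
  assumes "args S ls hs" "length ls = sum_list ms" "i \<in> {1..length ms}"
  shows "args S (block ms i ls) (block ms i hs)"
  using assms nth_block[of i ms ls] nth_block[of i ms hs] length_block[of i ms ls] length_block[of i ms hs]
  by (auto simp: args_def)

lemma args_update: "\<lbrakk>args S ms gs; i < length ms; x \<in> carrier (sp S (ms ! i))\<rbrakk> \<Longrightarrow> args S ms (gs[i := x])"
  by (auto simp: args_def nth_list_update)

context conformal_operad
begin

lemma ccomp_closed: "\<lbrakk>f \<in> carrier (sp P (length ms)); args P ms gs\<rbrakk> \<Longrightarrow> ccomp P ms f gs \<alpha> \<in> carrier (sp P (sum_list ms))"
  using ccomp_poly by (auto simp: mpolys_def)

lemma ccomp_zero_arg: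
  assumes "f \<in> carrier (sp P (length ms))" "args P ms gs" "i < length ms" "gs ! i = \<zero>\<^bsub>sp P (ms ! i)\<^esub>"
  shows "ccomp P ms f gs \<alpha> = \<zero>\<^bsub>sp P (sum_list ms)\<^esub>"
  using lin_hom.zero[OF lin_homI[OF superspace_sp superspace_sp ccomp_lin_right[OF assms(1-3), of \<alpha>]]]
    list_update_id[of gs i] assms(4) by metis

text \<open>With all variables $0$, sesquilinearity says that $\partial f$ gives an element of the image of
$\partial$, and that an argument $\partial g_i$ gives $0$.\<close>

lemma ccomp_zero_dd:
  assumes f: "f \<in> carrier (sp P (length ms))" and gs: "args P ms gs" and z: "z \<in> carrier (sp P (length ms))"
  shows "dcls P (sum_list ms) (ccomp P ms (f \<oplus>\<^bsub>sp P (length ms)\<^esub> dd P (length ms) z) gs {#}) =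
      dcls P (sum_list ms) (ccomp P ms f gs {#})"
proof -
  interpret V: abelian_group "sp P (sum_list ms)" by (rule sp_abelian)
  show ?thesis
    using f gs z lin_map_add[OF ccomp_lin_left[OF gs], of f "dd P (length ms) z" "{#}"]
    by (simp add: dd_closed ccomp_closed ccomp_dd_left form_times_empty sp_abelian dcls_add_dd)
qed

lemma ccomp_arg_dd:
  assumes f: "f \<in> carrier (sp P (length ms))" and gs: "args P ms gs" and i: "i < length ms"
    and z: "z \<in> carrier (sp P (ms ! i))"
  shows "ccomp P ms f (gs[i := gs ! i \<oplus>\<^bsub>sp P (ms ! i)\<^esub> dd P (ms ! i) z]) {#} = ccomp P ms f gs {#}"
proof -
  interpret V: abelian_group "sp P (sum_list ms)" by (rule sp_abelian)
  have gi: "gs ! i \<in> carrier (sp P (ms ! i))" "length gs = length ms" using gs i by (auto simp: args_def)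
  have "ccomp P ms f (gs[i := dd P (ms ! i) z]) {#} = \<zero>\<^bsub>sp P (sum_list ms)\<^esub>"
    using ccomp_dd_right[OF f args_update[OF gs i z], of "Suc i" "{#}"] i gi
    by (simp add: var_times_def neg_zero sp_abelian)
  then show ?thesis
    using lin_map_add[OF ccomp_lin_right[OF f gs i] gi(1) dd_closed[OF z], of "{#}"]
    by (simp add: ccomp_closed f gs)
qed

lemma opcomp_dcls:
  assumes f: "f \<in> carrier (sp P (length ms))" and gs: "args P ms gs"
  shows "opcomp (quot_operad P) ms (dcls P (length ms) f) (map2 (dcls P) ms gs) =
          dcls P (sum_list ms) (ccomp P ms f gs {#})"
proof -
  have len: "length gs = length ms" using gs by (simp add: args_def)
  have ls: "gs' \<in> listset (map2 (dcls P) ms gs) \<longleftrightarrow>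
    length gs' = length ms \<and> (\<forall>i<length ms. \<exists>z\<in>carrier (sp P (ms ! i)). gs' ! i = gs ! i \<oplus>\<^bsub>sp P (ms ! i)\<^esub> dd P (ms ! i) z)" for gs'
    using gs by (auto simp: listset_iff len args_def mem_dcls)
  \<comment> \<open>the representatives of the arguments are exchanged one at a time, from left to right\<close>
  have inner: "ccomp P ms f' gs' {#} = ccomp P ms f' gs {#}"
    if f': "f' \<in> carrier (sp P (length ms))" and gs': "gs' \<in> listset (map2 (dcls P) ms gs)" for f' gs'
  proof -
    have len': "length gs' = length ms" using gs' ls by simp
    have "args P ms (take k gs' @ drop k gs) \<and> ccomp P ms f' (take k gs' @ drop k gs) {#} = ccomp P ms f' gs {#}"
      if "k \<le> length ms" for k
      using that
    proof (induction k)
      case (Suc k)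
      define hs where "hs = take k gs' @ drop k gs"
      have k: "k < length ms" using Suc by simp
      obtain z where z: "z \<in> carrier (sp P (ms ! k))" "gs' ! k = gs ! k \<oplus>\<^bsub>sp P (ms ! k)\<^esub> dd P (ms ! k) z"
        using gs' ls k by auto
      have hk: "hs ! k = gs ! k" "take (Suc k) gs' @ drop (Suc k) gs = hs[k := gs' ! k]"
        using k len len' by (auto simp: hs_def nth_append take_Suc_conv_app_nth list_update_append Cons_nth_drop_Suc[symmetric])
      have IH: "args P ms hs" "ccomp P ms f' hs {#} = ccomp P ms f' gs {#}"
        using Suc k by (auto simp: hs_def)
      have "gs' ! k \<in> carrier (sp P (ms ! k))"
        using z gs k dd_closed abelian_monoid.a_closed[OF abelian_group.axioms(1)[OF sp_abelian]] by (auto simp: args_def)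
      then show ?case unfolding hk(2) using args_update[OF IH(1) k] ccomp_arg_dd[OF f' IH(1) k z(1)] IH(2) z hk(1) by simp
    qed (use gs in auto)
    from this[of "length ms"] show ?thesis using len len' by simp
  qed
  have self: "gs \<in> listset (map2 (dcls P) ms gs)"
    unfolding listset_iff using gs by (auto simp: args_def dcls_self)
  have "opcomp (quot_operad P) ms (dcls P (length ms) f) (map2 (dcls P) ms gs) =
    (\<Union>f'\<in>dcls P (length ms) f. \<Union>gs'\<in>listset (map2 (dcls P) ms gs). dcls P (sum_list ms) (ccomp P ms f' gs' {#}))"
    by (simp add: quot_operad_def)
  also have "\<dots> = (\<Union>f'\<in>dcls P (length ms) f. dcls P (sum_list ms) (ccomp P ms f' gs {#}))"
  proof (rule SUP_cong[OF refl])
    fix f' assume "f' \<in> dcls P (length ms) f"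
    then have "f' \<in> carrier (sp P (length ms))" using f dd_closed
      by (auto simp: mem_dcls intro!: abelian_monoid.a_closed[OF abelian_group.axioms(1)[OF sp_abelian]])
    then show "(\<Union>gs'\<in>listset (map2 (dcls P) ms gs). dcls P (sum_list ms) (ccomp P ms f' gs' {#})) =
      dcls P (sum_list ms) (ccomp P ms f' gs {#})"
      by (intro UN_const_eq[OF self]) (simp only: inner)
  qed
  also have "\<dots> = dcls P (sum_list ms) (ccomp P ms f gs {#})"
    by (rule UN_dcls[OF f]) (rule ccomp_zero_dd[OF f gs])
  finally show ?thesis .
qed

text \<open>The nested composition is a polynomial in $\lambda_i$ and $\mu_j$ together: each inner composition
has finitely many nonzero coefficients, which bounds all exponents of the $\mu_j$. Only because of this
finiteness may its constant term be taken after the substitution of $\lambda_i + \Gamma_i$.\<close>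

lemma nested_comp_finite:
  assumes f: "f \<in> carrier (sp P (length ms))" and gs: "args P ms gs"
    and ls: "length ls = sum_list ms" and hs: "args P ls hs"
  shows "finite {\<gamma>. \<exists>\<beta>. nested_comp P ms ls f gs hs \<gamma> \<beta> \<noteq> \<zero>\<^bsub>sp P (sum_list ls)\<^esub>}"
    "nested_comp P ms ls f gs hs \<gamma>0 {#} \<in> carrier (sp P (sum_list ls))"
    "nested_comp P ms ls f gs hs \<gamma>0 {#} = ccomp P (block_sums ms ls) f
      (map (\<lambda>i. ccomp P (block ms i ls) (gs ! (i - 1)) (block ms i hs) {#}) [1..<Suc (length ms)]) \<gamma>0"
    "args P (block_sums ms ls) (map (\<lambda>i. ccomp P (block ms i ls) (gs ! (i - 1)) (block ms i hs) {#}) [1..<Suc (length ms)])"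
    "sum_list (block_sums ms ls) = sum_list ls"
proof -
  define R where "R i = ccomp P (block ms i ls) (gs ! (i - 1)) (block ms i hs)" for i
  define G where "G \<beta> = map (\<lambda>i. R i (block_part ms i (mu_part \<beta>))) [1..<Suc (length ms)]" for \<beta>
  have bl: "length (block_sums ms ls) = length ms" by (simp add: block_sums_def del: upt_Suc)
  have nb: "block_sums ms ls ! k = sum_list (block ms (Suc k) ls)" if "k < length ms" for k
    using that by (simp add: block_sums_def nth_append del: upt_Suc)
  have sum: "sum_list (block_sums ms ls) = sum_list ls"
  proof -
    have "sum_list (map (\<lambda>i. sum_list (block ms i ls)) [1..<Suc j]) = sum_list (take (psum ms j) ls)" if "j \<le> length ms" for j
      using that
    proof (induction j)
      case (Suc j)
      have "take (psum ms (Suc j)) ls = take (psum ms j) ls @ block ms (Suc j) ls"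
        using Suc by (simp add: block_def psum_Suc take_add)
      then show ?case using Suc by simp
    qed simp
    from this[of "length ms"] show ?thesis using ls by (simp add: block_sums_def psum_length)
  qed
  have Rp: "R i \<in> mpolys (sp P (sum_list (block ms i ls))) {1..length (block ms i ls)}" if i: "i \<in> {1..length ms}" for i
    unfolding R_def
  proof (rule ccomp_poly)
    have "i - 1 < length ms" using i by auto
    then show "gs ! (i - 1) \<in> carrier (sp P (length (block ms i ls)))"
      using gs length_block[OF i ls] by (auto simp: args_def)
    show "args P (block ms i ls) (block ms i hs)" by (rule args_block[OF hs ls i])
  qed
  have Gargs: "args P (block_sums ms ls) (G \<beta>)" for \<beta>
    using Rp by (auto simp: args_def bl nb G_def mpolys_def nth_append simp del: upt_Suc)
  have f': "f \<in> carrier (sp P (length (block_sums ms ls)))" using f bl by simp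
  have nc: "nested_comp P ms ls f gs hs \<gamma> \<beta> =
    (if set_mset \<beta> \<subseteq> Inr ` {1..sum_list ms} then ccomp P (block_sums ms ls) f (G \<beta>) \<gamma> else \<zero>\<^bsub>sp P (sum_list ls)\<^esub>)" for \<gamma> \<beta>
    by (simp add: nested_comp_def G_def R_def)
  have be: "block_part ms i (mu_part {#}) = {#}" for i by (simp add: block_part_def mu_part_def)
  show "nested_comp P ms ls f gs hs \<gamma>0 {#} = ccomp P (block_sums ms ls) f
      (map (\<lambda>i. ccomp P (block ms i ls) (gs ! (i - 1)) (block ms i hs) {#}) [1..<Suc (length ms)]) \<gamma>0"
    by (simp add: nc G_def R_def be del: upt_Suc)
  show "args P (block_sums ms ls) (map (\<lambda>i. ccomp P (block ms i ls) (gs ! (i - 1)) (block ms i hs) {#}) [1..<Suc (length ms)])"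
    using Gargs[of "{#}"] by (simp add: G_def R_def be del: upt_Suc)
  show "nested_comp P ms ls f gs hs \<gamma>0 {#} \<in> carrier (sp P (sum_list ls))"
    using ccomp_closed[OF f' Gargs] by (simp add: nc sum)
  show "sum_list (block_sums ms ls) = sum_list ls" by (rule sum)
  define B where "B = {\<beta>. set_mset \<beta> \<subseteq> Inr ` {1..sum_list ms} \<and>
    (\<forall>i\<in>{1..length ms}. R i (block_part ms i (mu_part \<beta>)) \<noteq> \<zero>\<^bsub>sp P (sum_list (block ms i ls))\<^esub>)}"
  have Bmem: "\<beta> \<in> B" if nz: "nested_comp P ms ls f gs hs \<gamma> \<beta> \<noteq> \<zero>\<^bsub>sp P (sum_list ls)\<^esub>" for \<gamma> \<beta>
  proof -
    have s: "set_mset \<beta> \<subseteq> Inr ` {1..sum_list ms}" using nz nc by metis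
    then have nz': "ccomp P (block_sums ms ls) f (G \<beta>) \<gamma> \<noteq> \<zero>\<^bsub>sp P (sum_list (block_sums ms ls))\<^esub>" using nz nc sum by simp
    have "R i (block_part ms i (mu_part \<beta>)) \<noteq> \<zero>\<^bsub>sp P (sum_list (block ms i ls))\<^esub>" if i: "i \<in> {1..length ms}" for i
    proof
      assume z: "R i (block_part ms i (mu_part \<beta>)) = \<zero>\<^bsub>sp P (sum_list (block ms i ls))\<^esub>"
      have "i - 1 < length ms" using i by auto
      then have "G \<beta> ! (i - 1) = \<zero>\<^bsub>sp P (block_sums ms ls ! (i - 1))\<^esub>"
        using z nb[of "i - 1"] i by (simp add: G_def nth_append del: upt_Suc)
      then show False using ccomp_zero_arg[OF f' Gargs, of "i - 1"] nz' \<open>i - 1 < length ms\<close> bl by simp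
    qed
    then show ?thesis using s by (simp add: B_def)
  qed
  \<comment> \<open>a common bound for the total degrees of all monomials that occur in one of the inner compositions\<close>
  define N where "N = (\<Sum>i\<in>{1..length ms}. \<Sum>\<alpha>\<in>{\<alpha>. R i \<alpha> \<noteq> \<zero>\<^bsub>sp P (sum_list (block ms i ls))\<^esub>}. size \<alpha>)"
  have "B \<subseteq> {\<beta>. set_mset \<beta> \<subseteq> Inr ` {1..sum_list ms} \<and> (\<forall>v\<in>Inr ` {1..sum_list ms}. count \<beta> v \<le> N)}"
  proof (intro subsetI CollectI conjI ballI)
    fix \<beta> v assume b: "\<beta> \<in> B" and v: "v \<in> (Inr ` {1..sum_list ms} :: (nat + nat) set)"
    then obtain j where j: "j \<in> {1..sum_list ms}" "v = Inr j" by auto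
    obtain i r where ir: "i \<in> {1..length ms}" "r \<in> {1..ms ! (i - 1)}" "j = psum ms (i - 1) + r"
      using block_index[OF j(1)] .
    let ?\<alpha> = "block_part ms i (mu_part \<beta>)"
    have fin: "finite {\<alpha>. R i \<alpha> \<noteq> \<zero>\<^bsub>sp P (sum_list (block ms i ls))\<^esub>}" using Rp[OF ir(1)] by (simp add: mpolys_def)
    have "count \<beta> v \<le> size ?\<alpha>" using count_block_part[OF ir(1,2)] ir j by simp
    also have "\<dots> \<le> (\<Sum>\<alpha>\<in>{\<alpha>. R i \<alpha> \<noteq> \<zero>\<^bsub>sp P (sum_list (block ms i ls))\<^esub>}. size \<alpha>)"
      by (rule member_le_sum[OF _ _ fin]) (use b ir in \<open>auto simp: B_def\<close>)
    also have "\<dots> \<le> N" unfolding N_def by (rule member_le_sum) (use ir in auto)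
    finally show "count \<beta> v \<le> N" .
  qed (auto simp: B_def)
  then have finB: "finite B" by (rule finite_subset) (rule finite_msets_bounded, simp)
  show "finite {\<gamma>. \<exists>\<beta>. nested_comp P ms ls f gs hs \<gamma> \<beta> \<noteq> \<zero>\<^bsub>sp P (sum_list ls)\<^esub>}"
  proof (rule finite_subset)
    show "{\<gamma>. \<exists>\<beta>. nested_comp P ms ls f gs hs \<gamma> \<beta> \<noteq> \<zero>\<^bsub>sp P (sum_list ls)\<^esub>} \<subseteq>
      (\<Union>\<beta>\<in>B. {\<gamma>. ccomp P (block_sums ms ls) f (G \<beta>) \<gamma> \<noteq> \<zero>\<^bsub>sp P (sum_list ls)\<^esub>})"
    proof (rule subsetI, clarsimp)
      fix \<gamma> \<beta> assume nz: "nested_comp P ms ls f gs hs \<gamma> \<beta> \<noteq> \<zero>\<^bsub>sp P (sum_list ls)\<^esub>"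
      then have "ccomp P (block_sums ms ls) f (G \<beta>) \<gamma> \<noteq> \<zero>\<^bsub>sp P (sum_list ls)\<^esub>" using nc by metis
      then show "\<exists>\<beta>\<in>B. ccomp P (block_sums ms ls) f (G \<beta>) \<gamma> \<noteq> \<zero>\<^bsub>sp P (sum_list ls)\<^esub>" using Bmem[OF nz] by blast
    qed
    show "finite (\<Union>\<beta>\<in>B. {\<gamma>. ccomp P (block_sums ms ls) f (G \<beta>) \<gamma> \<noteq> \<zero>\<^bsub>sp P (sum_list ls)\<^esub>})"
      using finB ccomp_poly[OF f' Gargs] by (auto simp: mpolys_def sum)
  qed
qed

lemma ccomp_assoc_zero:
  assumes f: "f \<in> carrier (sp P (length ms))" and gs: "hargs P ms ps gs"
    and ls: "length ls = sum_list ms" and hs: "hargs P ls qs hs"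
  shows "ccomp P ls (ccomp P ms f gs {#}) hs {#} =
    signed (sp P (sum_list ls)) (assoc_sign ms ps qs) (ccomp P (block_sums ms ls) f
      (map (\<lambda>i. ccomp P (block ms i ls) (gs ! (i - 1)) (block ms i hs) {#}) [1..<Suc (length ms)]) {#})"
proof -
  note n = nested_comp_finite[OF f hargs_args[OF superspace_sp gs] ls hargs_args[OF superspace_sp hs]]
  show ?thesis
    using ccomp_assoc[OF f gs ls hs, of "{#}"] subst_forms_empty[OF sp_abelian n(1) n(2)] n(3)[of "{#}"]
    by (simp add: lam_part_def mu_part_def del: upt_Suc)
qed

lemma hargs_quot:
  assumes sp: "sp S' = dquot P" and "hargs S' ms ps Gs"
  obtains gs where "hargs P ms ps gs" "Gs = map2 (dcls P) ms gs"
proof -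
  from assms have len: "length ps = length ms" "length Gs = length ms"
    and G: "\<And>i. i < length ms \<Longrightarrow> \<exists>g. g \<in> hpart (sp P (ms ! i)) (ps ! i) \<and> Gs ! i = dcls P (ms ! i) g"
    by (auto simp: hargs_def dquot_hpart)
  define gs where "gs = map (\<lambda>i. SOME g. g \<in> hpart (sp P (ms ! i)) (ps ! i) \<and> Gs ! i = dcls P (ms ! i) g) [0..<length ms]"
  have "gs ! i \<in> hpart (sp P (ms ! i)) (ps ! i) \<and> Gs ! i = dcls P (ms ! i) (gs ! i)" if "i < length ms" for i
    using someI_ex[OF G[OF that]] that by (simp add: gs_def)
  moreover have lgs: "length gs = length ms" by (simp add: gs_def)
  moreover have "Gs = map2 (dcls P) ms gs"
    by (rule nth_equalityI) (simp_all add: len lgs calculation)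
  ultimately show ?thesis using that[of gs] len by (simp add: hargs_def)
qed

lemma args_quot:
  assumes sp: "sp S' = dquot P" and "args S' ms Gs"
  obtains gs where "args P ms gs" "Gs = map2 (dcls P) ms gs"
proof -
  from assms have len: "length Gs = length ms"
    and G: "\<And>i. i < length ms \<Longrightarrow> \<exists>g. g \<in> carrier (sp P (ms ! i)) \<and> Gs ! i = dcls P (ms ! i) g"
    by (auto simp: args_def dquot_carrier)
  define gs where "gs = map (\<lambda>i. SOME g. g \<in> carrier (sp P (ms ! i)) \<and> Gs ! i = dcls P (ms ! i) g) [0..<length ms]"
  have "gs ! i \<in> carrier (sp P (ms ! i)) \<and> Gs ! i = dcls P (ms ! i) (gs ! i)" if "i < length ms" for i
    using someI_ex[OF G[OF that]] that by (simp add: gs_def)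
  moreover have lgs: "length gs = length ms" by (simp add: gs_def)
  moreover have "Gs = map2 (dcls P) ms gs"
    by (rule nth_equalityI) (simp_all add: len lgs calculation)
  ultimately show ?thesis using that[of gs] len by (simp add: args_def)
qed

lemma args_length: "args S ms gs \<Longrightarrow> length gs = length ms"
  by (simp add: args_def)

lemma block_map2: "block ms i (map2 F ls hs) = map2 F (block ms i ls) (block ms i hs)"
  by (simp add: block_def take_map drop_map take_zip drop_zip)

lemma inv_perm_index:
  fixes n :: nat
  assumes "\<sigma> permutes {1..n}" "i \<in> {1..n}" shows "inv_into UNIV \<sigma> i - 1 < n"
proof -
  have "inv_into UNIV \<sigma> i \<in> {1..n}"
    by (rule iffD2[OF permutes_in_image[OF permutes_inv[OF assms(1)]] assms(2)])
  then have "1 \<le> inv_into UNIV \<sigma> i \<and> inv_into UNIV \<sigma> i \<le> n" by simp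
  then show ?thesis by arith
qed

lemma tensor_perm_map2:
  assumes "\<sigma> permutes {1..length xs}" "length ys = length xs"
  shows "tensor_perm \<sigma> (map2 F xs ys) = map2 F (tensor_perm \<sigma> xs) (tensor_perm \<sigma> ys)"
  using assms inv_perm_index[OF assms(1)]
  by (intro nth_equalityI) (auto simp: tensor_perm_def nth_append simp del: upt_Suc)

lemma tensor_perm_length: "length (tensor_perm \<sigma> xs) = length xs"
  by (simp add: tensor_perm_def del: upt_Suc)

lemma sum_list_tensor_perm:
  assumes "\<sigma> permutes {1..length ms}" shows "sum_list (tensor_perm \<sigma> ms) = sum_list (ms :: nat list)"
proof -
  let ?\<tau> = "inv_into UNIV \<sigma>"
  have "sum_list (tensor_perm \<sigma> ms) = (\<Sum>i\<in>{1..length ms}. ms ! (?\<tau> i - 1))"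
    by (simp add: tensor_perm_def sum_list_distinct_conv_sum_set atLeastLessThanSuc_atLeastAtMost del: upt_Suc)
  also have "\<dots> = (\<Sum>i\<in>{1..length ms}. ms ! (i - 1))"
    using sum.permute[OF permutes_inv[OF assms], of "\<lambda>i. ms ! (i - 1)"] by (simp add: o_def)
  also have "\<dots> = sum_list ms" using psum_sum[of "length ms" ms] by (simp add: psum_length)
  finally show ?thesis .
qed

lemma tensor_perm_args:
  assumes "\<sigma> permutes {1..length ms}" "args S ms gs" shows "args S (tensor_perm \<sigma> ms) (tensor_perm \<sigma> gs)"
  using assms inv_perm_index[OF assms(1)]
  by (auto simp: args_def tensor_perm_def nth_append simp del: upt_Suc)

text \<open>Every operad axiom for the quotient is, on representatives, the constant term of the same axiom for
the conformal operad.\<close>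

lemma quot_linear_operad: "linear_operad K (quot_operad P)"
proof -
  let ?Q = "quot_operad P"
  have sp: "sp ?Q = dquot P" and act: "act ?Q = quot_act P" by (simp_all add: quot_operad_def)
  interpret Q: symm_seq K ?Q by (rule quot_symm_seq[OF sp act])
  have oc: "opcomp ?Q ms (dcls P n f) (map2 (dcls P) ms gs) = dcls P k (ccomp P ms f gs {#})"
    if "n = length ms" "k = sum_list ms" "f \<in> carrier (sp P n)" "args P ms gs" for ms n k f gs
    using opcomp_dcls that by simp
  show ?thesis
  proof (unfold_locales)
    fix ms Gs assume "args ?Q ms Gs"
    then obtain gs where gs: "args P ms gs" "Gs = map2 (dcls P) ms gs" by (rule args_quot[OF sp])
    show "lin_map K (sp ?Q (length ms)) (sp ?Q (sum_list ms)) (\<lambda>f. opcomp ?Q ms f Gs)"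
      unfolding sp gs(2) by (rule lin_map_dquot[OF ccomp_lin_left[OF gs(1)] opcomp_dcls[OF _ gs(1)]])
  next
    fix F ms Gs i assume "F \<in> carrier (sp ?Q (length ms))" "args ?Q ms Gs" and i: "i < length ms"
    then obtain f where f: "f \<in> carrier (sp P (length ms))" "F = dcls P (length ms) f"
      by (auto simp: sp dquot_carrier)
    obtain gs where gs: "args P ms gs" "Gs = map2 (dcls P) ms gs"
      by (rule args_quot[OF sp \<open>args ?Q ms Gs\<close>])
    show "lin_map K (sp ?Q (ms ! i)) (sp ?Q (sum_list ms)) (\<lambda>x. opcomp ?Q ms F (Gs[i := x]))"
      unfolding sp
    proof (rule lin_map_dquot[OF ccomp_lin_right[OF f(1) gs(1) i, of "{#}"]])
      fix x assume x: "x \<in> carrier (sp P (ms ! i))"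
      have "Gs[i := dcls P (ms ! i) x] = map2 (dcls P) ms (gs[i := x])"
        unfolding gs(2) using i args_length[OF gs(1)]
        by (intro nth_equalityI) (auto simp: nth_list_update)
      then show "opcomp ?Q ms F (Gs[i := dcls P (ms ! i) x]) = dcls P (sum_list ms) (ccomp P ms f (gs[i := x]) {#})"
        using opcomp_dcls[OF f(1) args_update[OF gs(1) i x]] f by simp
    qed
  next
    fix F ms p ps Gs assume F: "F \<in> hpart (sp ?Q (length ms)) p" and "hargs ?Q ms ps Gs"
    obtain f where f: "f \<in> hpart (sp P (length ms)) p" "F = dcls P (length ms) f"
      using F by (auto simp: sp dquot_hpart)
    obtain gs where gs: "hargs P ms ps gs" "Gs = map2 (dcls P) ms gs"
      by (rule hargs_quot[OF sp \<open>hargs ?Q ms ps Gs\<close>])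
    have "f \<in> carrier (sp P (length ms))" using f superspace.hpart_closed[OF superspace_sp] by blast
    then have "opcomp ?Q ms F Gs = dcls P (sum_list ms) (ccomp P ms f gs {#})"
      using opcomp_dcls hargs_args[OF superspace_sp gs(1)] f gs by simp
    then show "opcomp ?Q ms F Gs \<in> hpart (sp ?Q (sum_list ms)) (p + sum_list ps)"
      using ccomp_parity[OF f(1) gs(1)] by (auto simp: sp dquot_hpart)
  next
    fix F assume "F \<in> carrier (sp ?Q 0)"
    then obtain f where f: "f \<in> carrier (sp P 0)" "F = dcls P 0 f" by (auto simp: sp dquot_carrier)
    then show "opcomp ?Q [] F [] = F" using opcomp_dcls[of f "[]" "[]"] by (simp add: args_def ccomp_nullary)
  next
    fix F ms ps Gs ls qs Hs
    assume F: "F \<in> carrier (sp ?Q (length ms))" and G: "hargs ?Q ms ps Gs"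
      and ls: "length ls = sum_list ms" and H: "hargs ?Q ls qs Hs"
    obtain f where f: "f \<in> carrier (sp P (length ms))" "F = dcls P (length ms) f"
      using F by (auto simp: sp dquot_carrier)
    obtain gs where gs: "hargs P ms ps gs" "Gs = map2 (dcls P) ms gs" by (rule hargs_quot[OF sp G])
    obtain hs where hs: "hargs P ls qs hs" "Hs = map2 (dcls P) ls hs" by (rule hargs_quot[OF sp H])
    note ga = hargs_args[OF superspace_sp gs(1)] and ha = hargs_args[OF superspace_sp hs(1)]
    note n = nested_comp_finite[OF f(1) ga ls ha]
    let ?R = "\<lambda>i. ccomp P (block ms i ls) (gs ! (i - 1)) (block ms i hs) {#}"
    have fc: "ccomp P ms f gs {#} \<in> carrier (sp P (sum_list ms))" by (rule ccomp_closed[OF f(1) ga])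
    have "opcomp ?Q ls (opcomp ?Q ms F Gs) Hs = dcls P (sum_list ls) (ccomp P ls (ccomp P ms f gs {#}) hs {#})"
      unfolding f(2) gs(2) hs(2) opcomp_dcls[OF f(1) ga]
      by (rule oc) (use ls fc ha in auto)
    also have "\<dots> = dcls P (sum_list ls) (signed (sp P (sum_list ls)) (assoc_sign ms ps qs)
      (ccomp P (block_sums ms ls) f (map ?R [1..<Suc (length ms)]) {#}))"
      by (simp only: ccomp_assoc_zero[OF f(1) gs(1) ls hs(1)])
    also have "\<dots> = signed (dquot P (sum_list ls)) (assoc_sign ms ps qs)
      (dcls P (sum_list ls) (ccomp P (block_sums ms ls) f (map ?R [1..<Suc (length ms)]) {#}))"
      using n(2,3)[of "{#}"] by (intro dcls_signed) simp
    also have "dcls P (sum_list ls) (ccomp P (block_sums ms ls) f (map ?R [1..<Suc (length ms)]) {#}) =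
      opcomp ?Q (block_sums ms ls) F (map2 (dcls P) (block_sums ms ls) (map ?R [1..<Suc (length ms)]))"
      unfolding f(2) by (rule oc[symmetric]) (use n(4,5) f(1) in \<open>auto simp: block_sums_def simp del: upt_Suc\<close>)
    also have "map2 (dcls P) (block_sums ms ls) (map ?R [1..<Suc (length ms)]) =
      map (\<lambda>i. opcomp ?Q (block ms i ls) (Gs ! (i - 1)) (block ms i Hs)) [1..<Suc (length ms)]"
    proof (rule nth_equalityI)
      fix k assume "k < length (map2 (dcls P) (block_sums ms ls) (map ?R [1..<Suc (length ms)]))"
      then have k: "k < length ms" by (simp add: block_sums_def del: upt_Suc)
      let ?i = "Suc k"
      have i: "?i \<in> {1..length ms}" using k by simp
      have lb: "length (block ms ?i ls) = ms ! k" using length_block[OF i ls] by simp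
      have g: "gs ! k \<in> carrier (sp P (ms ! k))" using ga k by (simp add: args_def)
      have "opcomp ?Q (block ms ?i ls) (Gs ! k) (block ms ?i Hs) = dcls P (sum_list (block ms ?i ls)) (?R ?i)"
        unfolding gs(2) hs(2) block_map2
        using oc[OF lb[symmetric] refl g args_block[OF ha ls i]] k args_length[OF ga] by simp
      then show "map2 (dcls P) (block_sums ms ls) (map ?R [1..<Suc (length ms)]) ! k =
        map (\<lambda>i. opcomp ?Q (block ms i ls) (Gs ! (i - 1)) (block ms i Hs)) [1..<Suc (length ms)] ! k"
        using k by (simp add: block_sums_def nth_append del: upt_Suc)
    qed (simp add: block_sums_def del: upt_Suc)
    finally show "opcomp ?Q ls (opcomp ?Q ms F Gs) Hs = signed (sp ?Q (sum_list ls)) (assoc_sign ms ps qs)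
      (opcomp ?Q (block_sums ms ls) F (map (\<lambda>i. opcomp ?Q (block ms i ls) (Gs ! (i - 1)) (block ms i Hs)) [1..<Suc (length ms)]))"
      unfolding sp .
  next
    fix F ms ps Gs \<sigma> \<tau>s
    assume F: "F \<in> carrier (sp ?Q (length ms))" and G: "hargs ?Q ms ps Gs" and \<sigma>: "\<sigma> permutes {1..length ms}"
      and len: "length \<tau>s = length ms" and \<tau>: "\<And>i. i < length ms \<Longrightarrow> (\<tau>s ! i) permutes {1..ms ! i}"
    obtain f where f: "f \<in> carrier (sp P (length ms))" "F = dcls P (length ms) f"
      using F by (auto simp: sp dquot_carrier)
    obtain gs where gs: "hargs P ms ps gs" "Gs = map2 (dcls P) ms gs" by (rule hargs_quot[OF sp G])
    note ga = hargs_args[OF superspace_sp gs(1)]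
    note bp = block_perm_permutes[OF \<sigma> len \<tau>]
    note st = sum_list_tensor_perm[OF \<sigma>]
    note ta = tensor_perm_args[OF \<sigma> ga]
    have aa: "args P ms (act_args P ms \<tau>s gs)"
      using ga \<tau> by (auto simp: args_def act_args_def nth_append act_closed simp del: upt_Suc)
    have "act_args ?Q ms \<tau>s Gs = map2 (dcls P) ms (act_args P ms \<tau>s gs)"
      unfolding gs(2) using ga \<tau>
      by (intro nth_equalityI) (auto simp: args_def act_args_def act quot_act_dcls nth_append simp del: upt_Suc)
    then have "opcomp ?Q ms (act ?Q (length ms) \<sigma> F) (act_args ?Q ms \<tau>s Gs) =
      dcls P (sum_list ms) (ccomp P ms (act P (length ms) \<sigma> f) (act_args P ms \<tau>s gs) {#})"
      using opcomp_dcls[OF act_closed[OF \<sigma> f(1)] aa] by (simp add: act f quot_act_dcls[OF \<sigma>])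
    also have "\<dots> = dcls P (sum_list ms) (signed (sp P (sum_list ms)) (koszul \<sigma> ps)
            (act P (sum_list ms) (block_perm \<sigma> ms \<tau>s)
               (ccomp P (tensor_perm \<sigma> ms) f (tensor_perm \<sigma> gs) {#})))"
      using ccomp_equivariant[OF f(1) gs(1) \<sigma> len \<tau>, of "{#}"] by simp
    also have "\<dots> = signed (dquot P (sum_list ms)) (koszul \<sigma> ps)
        (quot_act P (sum_list ms) (block_perm \<sigma> ms \<tau>s)
          (dcls P (sum_list ms) (ccomp P (tensor_perm \<sigma> ms) f (tensor_perm \<sigma> gs) {#})))"
    proof -
      have "ccomp P (tensor_perm \<sigma> ms) f (tensor_perm \<sigma> gs) {#} \<in> carrier (sp P (sum_list ms))"
        using ccomp_closed[OF _ ta, of f] f(1) st by (simp add: tensor_perm_length)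
      then show ?thesis using act_closed[OF bp] by (simp add: dcls_signed quot_act_dcls[OF bp])
    qed
    also have "dcls P (sum_list ms) (ccomp P (tensor_perm \<sigma> ms) f (tensor_perm \<sigma> gs) {#}) =
      opcomp ?Q (tensor_perm \<sigma> ms) F (tensor_perm \<sigma> Gs)"
      unfolding f(2) gs(2) tensor_perm_map2[OF \<sigma> args_length[OF ga]]
      by (rule oc[symmetric]) (use st ta f(1) in \<open>simp_all add: tensor_perm_length\<close>)
    finally show "opcomp ?Q ms (act ?Q (length ms) \<sigma> F) (act_args ?Q ms \<tau>s Gs) =
          signed (sp ?Q (sum_list ms)) (koszul \<sigma> ps)
            (act ?Q (sum_list ms) (block_perm \<sigma> ms \<tau>s) (opcomp ?Q (tensor_perm \<sigma> ms) F (tensor_perm \<sigma> Gs)))"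
      unfolding sp act .
  qed
qed

text \<open>The left unit law is given at $\lambda = -\partial$ and needed at $\lambda = 0$; modulo the image of
$\partial$ there is no difference.\<close>

lemma quot_operad_unit:
  assumes U: "is_conformal_unit P U" shows "is_operad_unit (quot_operad P) U"
proof -
  let ?Q = "quot_operad P"
  have sp: "sp ?Q = dquot P" by (simp add: quot_operad_def)
  from U obtain u where u: "u \<in> carrier (sp P 1)" "U = dcls P 1 u" by (auto simp: is_conformal_unit_def dquot_carrier)
  have uU: "u \<in> U" using u dcls_self by simp
  have U1: "eval_neg (sp P n) (dd P n) (\<lambda>a. ccomp P [n] u [f] (replicate_mset a 1)) = f"
    and U2: "ccomp P (replicate n 1) f (replicate n u) {#} = f" if "f \<in> carrier (sp P n)" for n f
    using U uU that by (auto simp: is_conformal_unit_def)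
  have "opcomp ?Q (replicate n 1) F (replicate n U) = F \<and> opcomp ?Q [n] U [F] = F"
    if F: "F \<in> carrier (dquot P n)" for n F
  proof -
    obtain f where f: "f \<in> carrier (sp P n)" "F = dcls P n f" using F by (auto simp: dquot_carrier)
    have a1: "args P (replicate n 1) (replicate n u)" using u by (simp add: args_def)
    have a2: "args P [n] [f]" using f by (simp add: args_def)
    have "opcomp ?Q (replicate n 1) F (replicate n U) = dcls P n (ccomp P (replicate n 1) f (replicate n u) {#})"
      using opcomp_dcls[OF _ a1, of f] f u by (simp add: sum_list_replicate zip_replicate)
    moreover have "opcomp ?Q [n] U [F] = dcls P n (ccomp P [n] u [f] {#})"
      using opcomp_dcls[OF _ a2, of u] f u by simp
    moreover have "dcls P n (ccomp P [n] u [f] {#}) = dcls P n f"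
    proof -
      interpret E: endo K "sp P n" "dd P n" by (rule dd_endo)
      let ?A = "\<lambda>a. ccomp P [n] u [f] (replicate_mset a 1)"
      have "ccomp P [n] u [f] \<in> mpolys (sp P n) {1}" using ccomp_poly[OF _ a2, of u] u by simp
      then have c: "?A a \<in> carrier (sp P n)" and fin: "finite {\<alpha>. ccomp P [n] u [f] \<alpha> \<noteq> \<zero>\<^bsub>sp P n\<^esub>}" for a
        by (auto simp: mpolys_def)
      have "finite {a. ?A a \<noteq> \<zero>\<^bsub>sp P n\<^esub>}"
      proof (rule finite_imageD)
        show "finite ((\<lambda>a. replicate_mset a (1 :: nat)) ` {a. ?A a \<noteq> \<zero>\<^bsub>sp P n\<^esub>})"
          by (rule finite_subset[OF _ fin]) auto
        show "inj_on (\<lambda>a. replicate_mset a (1 :: nat)) {a. ?A a \<noteq> \<zero>\<^bsub>sp P n\<^esub>}"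
          by (rule inj_onI) (metis size_replicate_mset)
      qed
      then obtain N where N: "\<forall>a\<in>{a. ?A a \<noteq> \<zero>\<^bsub>sp P n\<^esub>}. a \<le> N" using finite_nat_set_iff_bounded_le by blast
      have "?A \<in> up (sp P n)"
      proof (rule upI)
        fix a assume "N < a"
        show "?A a = \<zero>\<^bsub>sp P n\<^esub>"
        proof (rule ccontr)
          assume "?A a \<noteq> \<zero>\<^bsub>sp P n\<^esub>"
          then have "a \<le> N" using N by simp
          then show False using \<open>N < a\<close> by simp
        qed
      qed (rule c)
      then obtain z where z: "z \<in> carrier (sp P n)" "f = ?A 0 \<oplus>\<^bsub>sp P n\<^esub> dd P n z"
        using E.eval_mod[of ?A] U1[OF f(1)] by auto
      then show ?thesis using dcls_add_dd[OF c[of 0] z(1)] by simp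
    qed
    ultimately show ?thesis using U2[OF f(1)] f by simp
  qed
  then show ?thesis using u dcls_closed by (auto simp: is_operad_unit_def sp)
qed

end

declare One_nat_def [simp del]

section \<open>The quotient of a conformal pseudo operad\<close>

context conformal_pseudo_operad
begin

lemma cpcomp_closed: "\<lbrakk>i \<in> {1..n}; f \<in> carrier (sp P n); g \<in> carrier (sp P m)\<rbrakk>
  \<Longrightarrow> cpcomp P n m i f g a \<in> carrier (sp P (n + m - 1))"
  by (rule up_mem[OF cpcomp_poly])

lemma cpcomp_dd_zero:
  assumes "i \<in> {1..n}" "f \<in> carrier (sp P n)" "g \<in> carrier (sp P m)"
  shows "cpcomp P n m i (dd P n f) g 0 = dd P (n + m - 1) (cpcomp P n m i f g 0)"
    "cpcomp P n m i f (dd P m g) 0 = \<zero>\<^bsub>sp P (n + m - 1)\<^esub>"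
proof -
  interpret V: abelian_group "sp P (n + m - 1)" by (rule sp_abelian)
  show "cpcomp P n m i (dd P n f) g 0 = dd P (n + m - 1) (cpcomp P n m i f g 0)"
    using cpcomp_dd_left[OF assms, of 0] dd_closed[OF cpcomp_closed[OF assms, of 0]] by simp
  show "cpcomp P n m i f (dd P m g) 0 = \<zero>\<^bsub>sp P (n + m - 1)\<^esub>"
    using cpcomp_dd_right[OF assms, of 0] by (simp add: neg_zero sp_abelian)
qed

lemma pcomp_dcls:
  assumes i: "i \<in> {1..n}" and f: "f \<in> carrier (sp P n)" and g: "g \<in> carrier (sp P m)"
  shows "pcomp (quot_pseudo_operad P) n m i (dcls P n f) (dcls P m g) =
          dcls P (n + m - 1) (cpcomp P n m i f g 0)"
proof -
  interpret V: abelian_group "sp P (n + m - 1)" by (rule sp_abelian)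
  interpret Vn: abelian_group "sp P n" by (rule sp_abelian)
  have "(\<Union>g'\<in>dcls P m g. dcls P (n + m - 1) (cpcomp P n m i f' g' 0)) = dcls P (n + m - 1) (cpcomp P n m i f' g 0)"
    if f': "f' \<in> carrier (sp P n)" for f'
    by (rule UN_dcls[OF g])
      (simp add: lin_map_add[OF cpcomp_lin_right[OF i f'] g] dd_closed cpcomp_dd_zero[OF i f'] cpcomp_closed[OF i f' g])
  moreover have "f' \<in> carrier (sp P n)" if "f' \<in> dcls P n f" for f'
    using that f dd_closed by (auto simp: mem_dcls)
  ultimately have "pcomp (quot_pseudo_operad P) n m i (dcls P n f) (dcls P m g) =
    (\<Union>f'\<in>dcls P n f. dcls P (n + m - 1) (cpcomp P n m i f' g 0))"
    by (simp add: quot_pseudo_operad_def)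
  also have "\<dots> = dcls P (n + m - 1) (cpcomp P n m i f g 0)"
    by (rule UN_dcls[OF f])
      (simp add: lin_map_add[OF cpcomp_lin_left[OF i g] f] dd_closed cpcomp_dd_zero[OF i _ g] cpcomp_closed[OF i _ g] f dcls_add_dd)
  finally show ?thesis .
qed

text \<open>As for operads, the axioms are the constant terms of the conformal axioms.\<close>

lemma quot_linear_pseudo_operad: "linear_pseudo_operad K (quot_pseudo_operad P)"
proof -
  let ?Q = "quot_pseudo_operad P"
  have sp: "sp ?Q = dquot P" and act: "act ?Q = quot_act P" by (simp_all add: quot_pseudo_operad_def)
  interpret Q: symm_seq K ?Q by (rule quot_symm_seq[OF sp act])
  have hc: "x \<in> hpart (sp P n) p \<Longrightarrow> x \<in> carrier (sp P n)" for x n p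
    by (rule superspace.hpart_closed[OF superspace_sp])
  have pc: "pcomp ?Q n m i (dcls P n' f) (dcls P m' g) = dcls P k (cpcomp P n m i f g 0)"
    if "n' = n" "m' = m" "k = n + m - 1" "i \<in> {1..n}" "f \<in> carrier (sp P n)" "g \<in> carrier (sp P m)" for n n' m m' k i f g
    using pcomp_dcls that by simp
  show ?thesis
  proof (unfold_locales)
    fix i n m :: nat and G assume i: "i \<in> {1..n}" and "G \<in> carrier (sp ?Q m)"
    then obtain g where g: "g \<in> carrier (sp P m)" "G = dcls P m g" by (auto simp: sp dquot_carrier)
    show "lin_map K (sp ?Q n) (sp ?Q (n + m - 1)) (\<lambda>f. pcomp ?Q n m i f G)"
      unfolding sp g(2) by (rule lin_map_dquot[OF cpcomp_lin_left[OF i g(1)] pcomp_dcls[OF i _ g(1)]])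
  next
    fix i n m :: nat and F assume i: "i \<in> {1..n}" and "F \<in> carrier (sp ?Q n)"
    then obtain f where f: "f \<in> carrier (sp P n)" "F = dcls P n f" by (auto simp: sp dquot_carrier)
    show "lin_map K (sp ?Q m) (sp ?Q (n + m - 1)) (\<lambda>g. pcomp ?Q n m i F g)"
      unfolding sp f(2) by (rule lin_map_dquot[OF cpcomp_lin_right[OF i f(1)] pcomp_dcls[OF i f(1)]])
  next
    fix i n m :: nat and F p G q assume i: "i \<in> {1..n}" and F: "F \<in> hpart (sp ?Q n) p" and G: "G \<in> hpart (sp ?Q m) q"
    obtain f where f: "f \<in> hpart (sp P n) p" "F = dcls P n f" using F by (auto simp: sp dquot_hpart)
    obtain g where g: "g \<in> hpart (sp P m) q" "G = dcls P m g" using G by (auto simp: sp dquot_hpart)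
    show "pcomp ?Q n m i F G \<in> hpart (sp ?Q (n + m - 1)) (p + q)"
      using cpcomp_parity[OF i f(1) g(1)] pcomp_dcls[OF i hc[OF f(1)] hc[OF g(1)]] f g by (auto simp: sp dquot_hpart)
  next
    fix j i n m l :: nat and F G q H r
    assume ji: "1 \<le> j" "j < i" "i \<le> n" and F: "F \<in> carrier (sp ?Q n)" and G: "G \<in> hpart (sp ?Q m) q"
      and H: "H \<in> hpart (sp ?Q l) r"
    obtain f where f: "f \<in> carrier (sp P n)" "F = dcls P n f" using F by (auto simp: sp dquot_carrier)
    obtain g where g: "g \<in> hpart (sp P m) q" "G = dcls P m g" using G by (auto simp: sp dquot_hpart)
    obtain h where h: "h \<in> hpart (sp P l) r" "H = dcls P l h" using H by (auto simp: sp dquot_hpart)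
    note gc = hc[OF g(1)] and hcl = hc[OF h(1)]
    have i: "i \<in> {1..n}" and j: "j \<in> {1..n}" "j \<in> {1..n + m - 1}" "l + i - 1 \<in> {1..n + l - 1}" using ji by auto
    have ar: "n + m - 1 + l - 1 = n + m + l - 2" "n + l - 1 + m - 1 = n + m + l - 2" using ji by auto
    have cl: "cpcomp P (n + l - 1) m (l + i - 1) (cpcomp P n l j f h 0) g 0 \<in> carrier (sp P (n + m + l - 2))"
      using cpcomp_closed[OF j(3) cpcomp_closed[OF j(1) f(1) hcl] gc] ar by simp
    have "pcomp ?Q (n + m - 1) l j (pcomp ?Q n m i F G) H =
      dcls P (n + m + l - 2) (cpcomp P (n + m - 1) l j (cpcomp P n m i f g 0) h 0)"
      unfolding f g h pcomp_dcls[OF i f(1) gc]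
      by (rule pc) (use ar j hcl cpcomp_closed[OF i f(1) gc] in auto)
    also have "\<dots> = signed (dquot P (n + m + l - 2)) (q * r)
      (dcls P (n + m + l - 2) (cpcomp P (n + l - 1) m (l + i - 1) (cpcomp P n l j f h 0) g 0))"
      by (simp only: cpcomp_assoc_par[OF ji f(1) g(1) h(1)] dcls_signed[OF cl])
    also have "dcls P (n + m + l - 2) (cpcomp P (n + l - 1) m (l + i - 1) (cpcomp P n l j f h 0) g 0) =
      pcomp ?Q (n + l - 1) m (l + i - 1) (pcomp ?Q n l j F H) G"
      unfolding f g h pcomp_dcls[OF j(1) f(1) hcl]
      by (rule pc[symmetric]) (use ar j gc cpcomp_closed[OF j(1) f(1) hcl] in auto)
    finally show "pcomp ?Q (n + m - 1) l j (pcomp ?Q n m i F G) H =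
          signed (sp ?Q (n + m + l - 2)) (q * r) (pcomp ?Q (n + l - 1) m (l + i - 1) (pcomp ?Q n l j F H) G)"
      unfolding sp .
  next
    fix i n j m l :: nat and F G H
    assume ij: "1 \<le> i" "i \<le> n" "i \<le> j" "j < i + m" and F: "F \<in> carrier (sp ?Q n)" and G: "G \<in> carrier (sp ?Q m)"
      and H: "H \<in> carrier (sp ?Q l)"
    obtain f where f: "f \<in> carrier (sp P n)" "F = dcls P n f" using F by (auto simp: sp dquot_carrier)
    obtain g where g: "g \<in> carrier (sp P m)" "G = dcls P m g" using G by (auto simp: sp dquot_carrier)
    obtain h where h: "h \<in> carrier (sp P l)" "H = dcls P l h" using H by (auto simp: sp dquot_carrier)
    have i: "i \<in> {1..n}" "j \<in> {1..n + m - 1}" "j + 1 - i \<in> {1..m}" using ij by auto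
    have ar: "n + m - 1 + l - 1 = n + m + l - 2" "n + (m + l - 1) - 1 = n + m + l - 2" using ij by auto
    have c: "cpcomp P m l (j + 1 - i) g h 0 \<in> carrier (sp P (m + l - 1))"
      by (rule cpcomp_closed[OF i(3) g(1) h(1)])
    interpret V: abelian_group "sp P (n + m + l - 2)" by (rule sp_abelian)
    have e: "cpcomp P (n + m - 1) l j (cpcomp P n m i f g 0) h 0 =
      cpcomp P n (m + l - 1) i f (cpcomp P m l (j + 1 - i) g h 0) 0"
      \<comment> \<open>at $\lambda = \mu = 0$ only the summand with \<open>d = 0\<close> is left, with coefficient $1$\<close>
      using cpcomp_assoc_seq[OF ij f(1) g(1) h(1), of 0 0] cpcomp_closed[OF i(1) f(1) c, of 0] ar by simp
    have "pcomp ?Q (n + m - 1) l j (pcomp ?Q n m i F G) H =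
      dcls P (n + m + l - 2) (cpcomp P (n + m - 1) l j (cpcomp P n m i f g 0) h 0)"
      unfolding f g h pcomp_dcls[OF i(1) f(1) g(1)]
      by (rule pc) (use ar i h cpcomp_closed[OF i(1) f(1) g(1)] in auto)
    also have "\<dots> = pcomp ?Q n (m + l - 1) i F (pcomp ?Q m l (j + 1 - i) G H)"
      unfolding e f g h pcomp_dcls[OF i(3) g(1) h(1)] by (rule pc[symmetric]) (use ar i f c in auto)
    finally show "pcomp ?Q (n + m - 1) l j (pcomp ?Q n m i F G) H =
          pcomp ?Q n (m + l - 1) i F (pcomp ?Q m l (j + 1 - i) G H)" .
  next
    fix i n m :: nat and F G \<sigma> \<tau>
    assume i: "i \<in> {1..n}" and F: "F \<in> carrier (sp ?Q n)" and G: "G \<in> carrier (sp ?Q m)"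
      and \<sigma>: "\<sigma> permutes {1..n}" and \<tau>: "\<tau> permutes {1..m}"
    obtain f where f: "f \<in> carrier (sp P n)" "F = dcls P n f" using F by (auto simp: sp dquot_carrier)
    obtain g where g: "g \<in> carrier (sp P m)" "G = dcls P m g" using G by (auto simp: sp dquot_carrier)
    have si: "\<sigma> i \<in> {1..n}" using permutes_in_image[OF \<sigma>] i by blast
    show "pcomp ?Q n m i (act ?Q n \<sigma> F) (act ?Q m \<tau> G) =
          act ?Q (n + m - 1) (circ_perm n m i \<sigma> \<tau>) (pcomp ?Q n m (\<sigma> i) F G)"
      unfolding act f g quot_act_dcls[OF \<sigma> f(1)] quot_act_dcls[OF \<tau> g(1)] pcomp_dcls[OF si f(1) g(1)]
        pcomp_dcls[OF i act_closed[OF \<sigma> f(1)] act_closed[OF \<tau> g(1)]] cpcomp_equivariant[OF i f(1) g(1) \<sigma> \<tau>]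
      by (rule quot_act_dcls[symmetric, OF circ_perm_permutes[OF i \<sigma> \<tau>] cpcomp_closed[OF si f(1) g(1)]])
  qed
qed

end

section \<open>The direct sum of the spaces of invariants\<close>

lemma superspace_field: "superspace K V \<Longrightarrow> field K"
  by (simp add: superspace_def)

context symm_seq
begin

lemma inv_carrier: "f \<in> invariants S n \<Longrightarrow> f \<in> carrier (sp S n)"
  by (simp add: invariants_def)

lemma inv_act: "\<lbrakk>f \<in> invariants S n; \<sigma> permutes {1..n}\<rbrakk> \<Longrightarrow> act S n \<sigma> f = f"
  by (simp add: invariants_def)

lemma act_hom: "\<sigma> permutes {1..n} \<Longrightarrow> lin_hom K (sp S n) (sp S n) (act S n \<sigma>)"
  by (intro lin_homI superspace_sp even_map_lin act_even)

lemma inv_zero: "\<zero>\<^bsub>sp S n\<^esub> \<in> invariants S n"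
proof -
  interpret V: superspace K "sp S n" by (rule superspace_sp)
  show ?thesis by (auto simp: invariants_def lin_hom.zero[OF act_hom])
qed

lemma inv_add: "\<lbrakk>f \<in> invariants S n; g \<in> invariants S n\<rbrakk> \<Longrightarrow> f \<oplus>\<^bsub>sp S n\<^esub> g \<in> invariants S n"
proof -
  interpret V: superspace K "sp S n" by (rule superspace_sp)
  show "\<lbrakk>f \<in> invariants S n; g \<in> invariants S n\<rbrakk> \<Longrightarrow> f \<oplus>\<^bsub>sp S n\<^esub> g \<in> invariants S n"
    by (auto simp: invariants_def lin_hom.add[OF act_hom])
qed

lemma inv_neg: "f \<in> invariants S n \<Longrightarrow> \<ominus>\<^bsub>sp S n\<^esub> f \<in> invariants S n"
proof -
  interpret V: superspace K "sp S n" by (rule superspace_sp)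
  show "f \<in> invariants S n \<Longrightarrow> \<ominus>\<^bsub>sp S n\<^esub> f \<in> invariants S n"
    by (auto simp: invariants_def lin_hom.neg[OF act_hom])
qed

lemma inv_minus: "\<lbrakk>f \<in> invariants S n; g \<in> invariants S n\<rbrakk> \<Longrightarrow> f \<ominus>\<^bsub>sp S n\<^esub> g \<in> invariants S n"
  by (simp add: a_minus_def inv_add inv_neg)

lemma inv_signed: "f \<in> invariants S n \<Longrightarrow> signed (sp S n) p f \<in> invariants S n"
  by (simp add: signed_def inv_neg)

lemma inv_smult: "\<lbrakk>c \<in> carrier K; f \<in> invariants S n\<rbrakk> \<Longrightarrow> c \<odot>\<^bsub>sp S n\<^esub> f \<in> invariants S n"
proof -
  interpret V: superspace K "sp S n" by (rule superspace_sp)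
  show "\<lbrakk>c \<in> carrier K; f \<in> invariants S n\<rbrakk> \<Longrightarrow> c \<odot>\<^bsub>sp S n\<^esub> f \<in> invariants S n"
    by (auto simp: invariants_def lin_map_smult[OF lin_hom.lin[OF act_hom]])
qed

lemma inv_sum: "(\<And>a. a \<in> A \<Longrightarrow> f a \<in> invariants S n) \<Longrightarrow> (\<Oplus>\<^bsub>sp S n\<^esub>a\<in>A. f a) \<in> invariants S n"
proof (cases "finite A")
  interpret V: superspace K "sp S n" by (rule superspace_sp)
  case True
  then show "(\<And>a. a \<in> A \<Longrightarrow> f a \<in> invariants S n) \<Longrightarrow> ?thesis"
  proof (induction A rule: finite_induct)
    case (insert x F)
    then have "finsum (sp S n) f (insert x F) = f x \<oplus>\<^bsub>sp S n\<^esub> finsum (sp S n) f F"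
      by (intro V.finsum_insert) (auto intro: inv_carrier)
    with insert show ?case by (simp add: inv_add)
  qed (simp add: inv_zero)
next
  interpret V: superspace K "sp S n" by (rule superspace_sp)
  case False then show ?thesis by (simp add: inv_zero)
qed

lemma inv_hproj: "f \<in> invariants S n \<Longrightarrow> hproj (sp S n) p f \<in> invariants S n"
proof -
  interpret V: superspace K "sp S n" by (rule superspace_sp)
  show "f \<in> invariants S n \<Longrightarrow> hproj (sp S n) p f \<in> invariants S n"
    using hproj_even_map[OF superspace_sp superspace_sp act_even]
    by (auto simp: invariants_def V.hproj_closed)
qed

text \<open>A set \<open>A\<close> containing the support is given instead of the finiteness of the support itself, so that
the support of a family obtained from another one need not be computed.\<close>

lemma W_carrierI:
  assumes "\<And>n. n \<ge> -1 \<Longrightarrow> w n \<in> invariants S (ar n)" "\<And>n. \<not> n \<ge> -1 \<Longrightarrow> w n = undefined"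
    "finite A" "\<And>n. \<lbrakk>n \<ge> -1; n \<notin> A\<rbrakk> \<Longrightarrow> w n = \<zero>\<^bsub>sp S (ar n)\<^esub>"
  shows "w \<in> W_carrier S"
  using assms finite_subset[of "{n \<in> {-1..}. w n \<noteq> \<zero>\<^bsub>sp S (ar n)\<^esub>}" A]
  by (auto simp: W_carrier_def PiE_def extensional_def)

lemma W_mem: "\<lbrakk>w \<in> W_carrier S; n \<ge> -1\<rbrakk> \<Longrightarrow> w n \<in> invariants S (ar n)"
  by (auto simp: W_carrier_def)

lemma W_mem_carrier: "\<lbrakk>w \<in> W_carrier S; n \<ge> -1\<rbrakk> \<Longrightarrow> w n \<in> carrier (sp S (ar n))"
  by (rule inv_carrier[OF W_mem])

lemma W_ext: "\<lbrakk>v \<in> W_carrier S; w \<in> W_carrier S; \<And>n. n \<ge> -1 \<Longrightarrow> v n = w n\<rbrakk> \<Longrightarrow> v = w"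
  by (rule PiE_ext[of _ "{-1..}" "\<lambda>n. invariants S (ar n)"]) (auto simp: W_carrier_def)

lemma W_finite: "w \<in> W_carrier S \<Longrightarrow> finite {n \<in> {-1..}. w n \<noteq> \<zero>\<^bsub>sp S (ar n)\<^esub>}"
  by (simp add: W_carrier_def)

lemma W_support_bound:
  assumes "w \<in> W_carrier S" obtains A where "\<And>n. \<lbrakk>n \<ge> -1; n > A\<rbrakk> \<Longrightarrow> w n = \<zero>\<^bsub>sp S (ar n)\<^esub>"
proof -
  from W_finite[OF assms] obtain A where "\<forall>n\<in>{n \<in> {-1..}. w n \<noteq> \<zero>\<^bsub>sp S (ar n)\<^esub>}. n \<le> A"
    by (meson Max_ge)
  then show ?thesis using that[of A] by force
qed

lemma W_map2:
  assumes v: "v \<in> W_carrier S" and w: "w \<in> W_carrier S"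
    and F: "\<And>n x y. \<lbrakk>n \<ge> -1; x \<in> invariants S (ar n); y \<in> invariants S (ar n)\<rbrakk> \<Longrightarrow> F n x y \<in> invariants S (ar n)"
    and z: "\<And>n. n \<ge> -1 \<Longrightarrow> F n \<zero>\<^bsub>sp S (ar n)\<^esub> \<zero>\<^bsub>sp S (ar n)\<^esub> = \<zero>\<^bsub>sp S (ar n)\<^esub>"
  shows "(\<lambda>n\<in>{-1..}. F n (v n) (w n)) \<in> W_carrier S"
proof (rule W_carrierI)
  show "finite ({n \<in> {-1..}. v n \<noteq> \<zero>\<^bsub>sp S (ar n)\<^esub>} \<union> {n \<in> {-1..}. w n \<noteq> \<zero>\<^bsub>sp S (ar n)\<^esub>})"
    using W_finite[OF v] W_finite[OF w] by simp
qed (use v w W_mem F z in auto)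

lemma W_zero_mem: "(\<lambda>n\<in>{-1..}. \<zero>\<^bsub>sp S (ar n)\<^esub>) \<in> W_carrier S"
  by (rule W_carrierI[of _ "{}"]) (auto simp: inv_zero)

lemma W_add_mem: "\<lbrakk>v \<in> W_carrier S; w \<in> W_carrier S\<rbrakk> \<Longrightarrow> (\<lambda>n\<in>{-1..}. v n \<oplus>\<^bsub>sp S (ar n)\<^esub> w n) \<in> W_carrier S"
  using W_map2[of v w "\<lambda>n x y. x \<oplus>\<^bsub>sp S (ar n)\<^esub> y"] superspace_abelian[OF superspace_sp]
  by (auto simp: inv_add abelian_group.axioms(1) abelian_monoid.l_zero abelian_monoid.zero_closed)

lemma W_smult_mem: "\<lbrakk>c \<in> carrier K; w \<in> W_carrier S\<rbrakk> \<Longrightarrow> (\<lambda>n\<in>{-1..}. c \<odot>\<^bsub>sp S (ar n)\<^esub> w n) \<in> W_carrier S"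
  using W_map2[of w w "\<lambda>n x y. c \<odot>\<^bsub>sp S (ar n)\<^esub> x"] module.smult_r_null[OF superspace_module[OF superspace_sp]]
  by (auto simp: inv_smult)

lemma W_neg_mem: "w \<in> W_carrier S \<Longrightarrow> (\<lambda>n\<in>{-1..}. \<ominus>\<^bsub>sp S (ar n)\<^esub> w n) \<in> W_carrier S"
  using W_map2[of w w "\<lambda>n x y. \<ominus>\<^bsub>sp S (ar n)\<^esub> x"] neg_zero[OF superspace_abelian[OF superspace_sp]]
  by (auto simp: inv_neg)

lemma W_hproj_mem: "w \<in> W_carrier S \<Longrightarrow> (\<lambda>n\<in>{-1..}. hproj (sp S (ar n)) p (w n)) \<in> W_carrier S"
  using W_map2[of w w "\<lambda>n x y. hproj (sp S (ar n)) p x"]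
    lin_hom.zero[OF lin_homI[OF superspace_sp superspace_sp superspace.hproj_lin[OF superspace_sp]]]
  by (auto simp: inv_hproj)

lemma W_space_carrier: "carrier (W_space S) = W_carrier S"
  and W_space_zero: "\<zero>\<^bsub>W_space S\<^esub> = (\<lambda>n\<in>{-1..}. \<zero>\<^bsub>sp S (ar n)\<^esub>)"
  and W_space_add: "v \<oplus>\<^bsub>W_space S\<^esub> w = (\<lambda>n\<in>{-1..}. v n \<oplus>\<^bsub>sp S (ar n)\<^esub> w n)"
  and W_space_smult: "c \<odot>\<^bsub>W_space S\<^esub> w = (\<lambda>n\<in>{-1..}. c \<odot>\<^bsub>sp S (ar n)\<^esub> w n)"
  and W_space_hpart: "hpart (W_space S) p = {w \<in> W_carrier S. \<forall>n\<ge>-1. w n \<in> hpart (sp S (ar n)) p}"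
  by (simp_all add: W_space_def)

lemma W_add_cl: "\<lbrakk>v \<in> W_carrier S; w \<in> W_carrier S\<rbrakk> \<Longrightarrow> v \<oplus>\<^bsub>W_space S\<^esub> w \<in> W_carrier S"
  and W_smult_cl: "\<lbrakk>c \<in> carrier K; w \<in> W_carrier S\<rbrakk> \<Longrightarrow> c \<odot>\<^bsub>W_space S\<^esub> w \<in> W_carrier S"
  and W_zero_cl: "\<zero>\<^bsub>W_space S\<^esub> \<in> W_carrier S"
  by (simp_all add: W_space_add W_space_smult W_space_zero W_add_mem W_smult_mem W_zero_mem)

lemma W_at:
  assumes "k \<ge> -1"
  shows "\<zero>\<^bsub>W_space S\<^esub> k = \<zero>\<^bsub>sp S (ar k)\<^esub>"
  and "(v \<oplus>\<^bsub>W_space S\<^esub> w) k = v k \<oplus>\<^bsub>sp S (ar k)\<^esub> w k"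
  and "(c \<odot>\<^bsub>W_space S\<^esub> w) k = c \<odot>\<^bsub>sp S (ar k)\<^esub> w k"
  using assms by (simp_all add: W_space_add W_space_smult W_space_zero)

lemma W_module: "module K (W_space S)"
proof (rule moduleI)
  note [simp] = W_space_carrier W_add_cl W_smult_cl W_zero_cl W_at
  note c = W_mem_carrier
  show "cring K" using superspace_field[OF superspace_sp] by (intro domain.axioms(1) field.axioms(1))
  have ab: "abelian_group (sp S k)" for k by (rule superspace_abelian[OF superspace_sp])
  have am: "abelian_monoid (sp S k)" for k by (rule abelian_group.axioms(1)[OF ab])
  have md: "module K (sp S k)" for k by (rule superspace_module[OF superspace_sp])
  show "abelian_group (W_space S)"
  proof (rule abelian_groupI)
    fix x y z assume "x \<in> carrier (W_space S)" "y \<in> carrier (W_space S)" "z \<in> carrier (W_space S)"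
    then show "x \<oplus>\<^bsub>W_space S\<^esub> y \<oplus>\<^bsub>W_space S\<^esub> z = x \<oplus>\<^bsub>W_space S\<^esub> (y \<oplus>\<^bsub>W_space S\<^esub> z)"
      by (intro W_ext) (auto simp: c abelian_monoid.a_assoc[OF am])
  next
    fix x y assume "x \<in> carrier (W_space S)" "y \<in> carrier (W_space S)"
    then show "x \<oplus>\<^bsub>W_space S\<^esub> y = y \<oplus>\<^bsub>W_space S\<^esub> x"
      by (intro W_ext) (auto simp: c abelian_monoid.a_comm[OF am])
  next
    fix x assume "x \<in> carrier (W_space S)"
    then show "\<zero>\<^bsub>W_space S\<^esub> \<oplus>\<^bsub>W_space S\<^esub> x = x"
      by (intro W_ext) (auto simp: c abelian_monoid.l_zero[OF am])
  next
    fix x assume x: "x \<in> carrier (W_space S)"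
    have "(\<lambda>n\<in>{-1..}. \<ominus>\<^bsub>sp S (ar n)\<^esub> x n) \<oplus>\<^bsub>W_space S\<^esub> x = \<zero>\<^bsub>W_space S\<^esub>"
      using x by (intro W_ext) (auto simp: W_neg_mem c abelian_group.l_neg[OF ab])
    then show "\<exists>y\<in>carrier (W_space S). y \<oplus>\<^bsub>W_space S\<^esub> x = \<zero>\<^bsub>W_space S\<^esub>"
      using W_neg_mem x by (intro bexI[of _ "\<lambda>n\<in>{-1..}. \<ominus>\<^bsub>sp S (ar n)\<^esub> x n"]) simp_all
  qed (auto simp: W_zero_mem)
  show "\<And>a x. a \<in> carrier K \<Longrightarrow> x \<in> carrier (W_space S) \<Longrightarrow> a \<odot>\<^bsub>W_space S\<^esub> x \<in> carrier (W_space S)"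
    by auto
  note rs = ring.ring_simprules[OF cring.axioms(1)[OF \<open>cring K\<close>]]
  note ms = module.smult_l_distr[OF md] module.smult_r_distr[OF md] module.smult_assoc1[OF md] module.smult_one[OF md]
  show "(a \<oplus>\<^bsub>K\<^esub> b) \<odot>\<^bsub>W_space S\<^esub> x = a \<odot>\<^bsub>W_space S\<^esub> x \<oplus>\<^bsub>W_space S\<^esub> b \<odot>\<^bsub>W_space S\<^esub> x"
    if "a \<in> carrier K" "b \<in> carrier K" "x \<in> carrier (W_space S)" for a b x
    using that rs(1)[of a b] by (auto intro!: W_ext simp: c ms)
  show "a \<odot>\<^bsub>W_space S\<^esub> (x \<oplus>\<^bsub>W_space S\<^esub> y) = a \<odot>\<^bsub>W_space S\<^esub> x \<oplus>\<^bsub>W_space S\<^esub> a \<odot>\<^bsub>W_space S\<^esub> y"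
    if "a \<in> carrier K" "x \<in> carrier (W_space S)" "y \<in> carrier (W_space S)" for a x y
    using that by (auto intro!: W_ext simp: c ms)
  show "(a \<otimes>\<^bsub>K\<^esub> b) \<odot>\<^bsub>W_space S\<^esub> x = a \<odot>\<^bsub>W_space S\<^esub> (b \<odot>\<^bsub>W_space S\<^esub> x)"
    if "a \<in> carrier K" "b \<in> carrier K" "x \<in> carrier (W_space S)" for a b x
    using that rs(5)[of a b] by (auto intro!: W_ext simp: c ms)
  show "\<one>\<^bsub>K\<^esub> \<odot>\<^bsub>W_space S\<^esub> x = x" if "x \<in> carrier (W_space S)" for x
    using that rs(6) by (auto intro!: W_ext simp: c ms)
qed

lemma W_comp_lin: "n \<ge> -1 \<Longrightarrow> lin_map K (W_space S) (sp S (ar n)) (\<lambda>w. w n)"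
  by (rule lin_mapI) (auto simp: W_space_carrier W_space_add W_space_smult W_mem_carrier)

lemma W_comp_hom: "n \<ge> -1 \<Longrightarrow> lin_hom K (W_space S) (sp S (ar n)) (\<lambda>w. w n)"
  by (simp add: lin_hom_def lin_hom_axioms_def W_module superspace_module[OF superspace_sp] W_comp_lin)

lemma W_superspace: "superspace K (W_space S)"
proof (rule superspaceI)
  interpret W: module K "W_space S" by (rule W_module)
  have sup: "superspace K (sp S k)" for k by (rule superspace_sp)
  have wc: "v \<oplus>\<^bsub>W_space S\<^esub> w \<in> W_carrier S" if "v \<in> W_carrier S" "w \<in> W_carrier S" for v w
    using W.M.a_closed that by (simp add: W_space_carrier)
  show "field K" by (rule superspace_field[OF superspace_sp])
  show "module K (W_space S)" by (rule W_module)
  show "submodule (hpart (W_space S) p) K (W_space S)" for p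
  proof (rule W.submoduleI)
    show "hpart (W_space S) p \<subseteq> carrier (W_space S)" by (auto simp: W_space_hpart W_space_carrier)
    show "\<zero>\<^bsub>W_space S\<^esub> \<in> hpart (W_space S) p"
      by (auto simp: W_space_hpart W_space_zero W_zero_mem superspace.hpart_zero[OF sup])
    show "\<ominus>\<^bsub>W_space S\<^esub> a \<in> hpart (W_space S) p" if "a \<in> hpart (W_space S) p" for a
      using that lin_hom.neg[OF W_comp_hom, of _ a] W.M.a_inv_closed[of a]
      by (auto simp: W_space_hpart W_space_carrier superspace.hpart_neg[OF sup])
    show "a \<oplus>\<^bsub>W_space S\<^esub> b \<in> hpart (W_space S) p" if "a \<in> hpart (W_space S) p" "b \<in> hpart (W_space S) p" for a b
      using that wc[of a b] by (auto simp: W_space_hpart W_space_add superspace.hpart_add[OF sup])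
    show "a \<odot>\<^bsub>W_space S\<^esub> x \<in> hpart (W_space S) p" if "a \<in> carrier K" "x \<in> hpart (W_space S) p" for a x
      using that W_smult_mem[of a x] by (auto simp: W_space_hpart W_space_smult superspace.hpart_smult[OF sup])
  qed
  fix x
  show "x = \<zero>\<^bsub>W_space S\<^esub>" if "x \<in> hpart (W_space S) 0" "x \<in> hpart (W_space S) 1"
    using that superspace.hpart_both[OF sup, of _ _ 0]
    by (intro W_ext) (auto simp: W_space_hpart W_space_zero W_zero_mem)
  assume x: "x \<in> carrier (W_space S)"
  let ?p = "\<lambda>p. \<lambda>n\<in>{-1..}. hproj (sp S (ar n)) p (x n)"
  have "?p p \<in> hpart (W_space S) p" for p
    using x W_hproj_mem[of x p] by (auto simp: W_space_hpart W_space_carrier W_mem_carrier intro!: superspace.hproj_mem[OF sup])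
  moreover have "x = ?p 0 \<oplus>\<^bsub>W_space S\<^esub> ?p 1"
    using x W_hproj_mem[of x] superspace.hproj_01[OF sup, symmetric]
    by (intro W_ext wc) (auto simp: W_space_carrier W_at W_mem_carrier)
  ultimately show "\<exists>y\<in>hpart (W_space S) 0. \<exists>z\<in>hpart (W_space S) 1. x = y \<oplus>\<^bsub>W_space S\<^esub> z" by blast
qed

lemma W_inj_mem: "f \<in> invariants S (ar n) \<Longrightarrow> W_inj S n f \<in> W_carrier S"
  by (rule W_carrierI[of _ "{n}"]) (auto simp: W_inj_def inv_zero)

lemma W_inj_deg: "f \<in> invariants S (ar n) \<Longrightarrow> W_inj S n f \<in> W_deg S n"
  using W_inj_mem by (auto simp: W_deg_def) (auto simp: W_inj_def)

lemma W_inj_hpart: "\<lbrakk>f \<in> invariants S (ar n); f \<in> hpart (sp S (ar n)) p\<rbrakk> \<Longrightarrow> W_inj S n f \<in> hpart (W_space S) p"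
  using W_inj_mem superspace.hpart_zero[OF superspace_sp] by (auto simp: W_space_hpart) (auto simp: W_inj_def)

lemma W_inj_zero: "W_inj S n \<zero>\<^bsub>sp S (ar n)\<^esub> = \<zero>\<^bsub>W_space S\<^esub>"
  by (auto simp: W_inj_def W_space_zero)

lemma W_inj_low: "n < -1 \<Longrightarrow> W_inj S n f = \<zero>\<^bsub>W_space S\<^esub>"
  by (auto simp: W_inj_def W_space_zero)

lemma W_deg_carrier: "w \<in> W_deg S n \<Longrightarrow> w \<in> W_carrier S"
  by (simp add: W_deg_def)

lemma W_deg_inj: "w \<in> W_deg S n \<Longrightarrow> w = W_inj S n (w n)"
proof -
  assume w: "w \<in> W_deg S n"
  show ?thesis
  proof
    fix k show "w k = W_inj S n (w n) k"
      using w by (cases "k \<ge> -1") (auto simp: W_deg_def W_inj_def W_carrier_def PiE_def extensional_def)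
  qed
qed

lemma W_deg_submodule: "submodule (W_deg S n) K (W_space S)"
proof -
  interpret W: module K "W_space S" by (rule W_module)
  have am: "abelian_group (sp S k)" for k by (rule superspace_abelian[OF superspace_sp])
  show ?thesis
  proof (rule W.submoduleI)
    show "\<ominus>\<^bsub>W_space S\<^esub> a \<in> W_deg S n" if "a \<in> W_deg S n" for a
      using that lin_hom.neg[OF W_comp_hom, of _ a] W.M.a_inv_closed[of a]
      by (auto simp: W_deg_def W_space_carrier neg_zero am)
    show "a \<oplus>\<^bsub>W_space S\<^esub> b \<in> W_deg S n" if "a \<in> W_deg S n" "b \<in> W_deg S n" for a b
      using that W_add_mem[of a b]
      by (auto simp: W_deg_def W_space_add abelian_monoid.l_zero[OF abelian_group.axioms(1)[OF am]] abelian_monoid.zero_closed[OF abelian_group.axioms(1)[OF am]])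
    show "a \<odot>\<^bsub>W_space S\<^esub> x \<in> W_deg S n" if "a \<in> carrier K" "x \<in> W_deg S n" for a x
      using that W_smult_mem[of a x] module.smult_r_null[OF superspace_module[OF superspace_sp]]
      by (auto simp: W_deg_def W_space_smult)
  qed (auto simp: W_deg_def W_space_carrier W_space_zero W_zero_mem)
qed

lemma W_deg_low: "n < -1 \<Longrightarrow> W_deg S n = {\<zero>\<^bsub>W_space S\<^esub>}"
proof -
  assume n: "n < -1"
  have "w = \<zero>\<^bsub>W_space S\<^esub>" if "w \<in> W_deg S n" for w
    using that n by (intro W_ext) (auto simp: W_deg_def W_zero_mem W_space_zero)
  moreover have "\<zero>\<^bsub>W_space S\<^esub> \<in> W_deg S n" by (auto simp: W_deg_def W_zero_mem W_space_zero)
  ultimately show ?thesis by blast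
qed

lemma W_deg_super: "x \<in> W_deg S n \<Longrightarrow> \<exists>y\<in>W_deg S n \<inter> hpart (W_space S) 0. \<exists>z\<in>W_deg S n \<inter> hpart (W_space S) 1. x = y \<oplus>\<^bsub>W_space S\<^esub> z"
proof -
  assume x: "x \<in> W_deg S n"
  have sup: "superspace K (sp S k)" for k by (rule superspace_sp)
  have sp_zero_hpart: "hproj (sp S k) p \<zero>\<^bsub>sp S k\<^esub> = \<zero>\<^bsub>sp S k\<^esub>" for k p
    by (rule lin_hom.zero[OF lin_homI[OF superspace_sp superspace_sp superspace.hproj_lin[OF superspace_sp]]])
  let ?p = "\<lambda>p. \<lambda>n\<in>{-1..}. hproj (sp S (ar n)) p (x n)"
  have xc: "x \<in> W_carrier S" using x by (rule W_deg_carrier)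
  have "?p p \<in> W_deg S n \<inter> hpart (W_space S) p" for p
    using x W_hproj_mem[of x p] sp_zero_hpart
    by (auto simp: W_space_hpart W_deg_def W_mem_carrier intro!: superspace.hproj_mem[OF sup])
  moreover have "x = ?p 0 \<oplus>\<^bsub>W_space S\<^esub> ?p 1"
    using xc W_hproj_mem[of x] superspace.hproj_01[OF sup, symmetric]
    by (intro W_ext) (auto simp: W_add_cl W_at W_mem_carrier)
  ultimately show ?thesis by blast
qed

lemma W_decompose:
  assumes x: "x \<in> W_carrier S"
  shows "finite {n. W_inj S n (x n) \<noteq> \<zero>\<^bsub>W_space S\<^esub>}" (is "finite ?A")
    and "x = (\<Oplus>\<^bsub>W_space S\<^esub>n\<in>{n. W_inj S n (x n) \<noteq> \<zero>\<^bsub>W_space S\<^esub>}. W_inj S n (x n))"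
proof -
  interpret W: module K "W_space S" by (rule W_module)
  have "?A \<subseteq> {n \<in> {-1..}. x n \<noteq> \<zero>\<^bsub>sp S (ar n)\<^esub>}"
    using W_inj_zero W_inj_low by force
  then show fin: "finite ?A" using W_finite[OF x] by (rule finite_subset)
  have inj: "W_inj S n (x n) \<in> W_carrier S" for n
  proof (cases "n \<ge> -1")
    case True then show ?thesis using W_mem[OF x] W_inj_mem by blast
  qed (simp add: W_inj_low W_space_zero W_zero_mem)
  show "x = (\<Oplus>\<^bsub>W_space S\<^esub>n\<in>?A. W_inj S n (x n))"
  proof (rule W_ext[OF x])
    show "(\<Oplus>\<^bsub>W_space S\<^esub>n\<in>?A. W_inj S n (x n)) \<in> W_carrier S"
      using W.M.finsum_closed[of "\<lambda>n. W_inj S n (x n)" ?A] inj by (auto simp: W_space_carrier)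
    fix k :: int assume k: "k \<ge> -1"
    interpret V: abelian_group "sp S (ar k)" by (rule superspace_abelian[OF superspace_sp])
    have "(\<Oplus>\<^bsub>W_space S\<^esub>n\<in>?A. W_inj S n (x n)) k = (\<Oplus>\<^bsub>sp S (ar k)\<^esub>n\<in>?A. W_inj S n (x n) k)"
      by (rule lin_hom.sum[OF W_comp_hom[OF k]]) (simp add: W_space_carrier inj)
    also have "\<dots> = x k"
    proof (cases "k \<in> ?A")
      case True
      then show ?thesis using finsum_single[OF V.abelian_group_axioms fin True, of "\<lambda>n. W_inj S n (x n) k"] k W_mem_carrier[OF x k]
        by (auto simp: W_inj_def)
    next
      case False
      then have "W_inj S k (x k) k = \<zero>\<^bsub>W_space S\<^esub> k" by simp
      then have "x k = \<zero>\<^bsub>sp S (ar k)\<^esub>" using k by (simp add: W_inj_def W_at)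
      moreover have "(\<Oplus>\<^bsub>sp S (ar k)\<^esub>n\<in>?A. W_inj S n (x n) k) = \<zero>\<^bsub>sp S (ar k)\<^esub>"
        using False k by (intro V.add.finprod_one_eqI) (auto simp: W_inj_def)
      ultimately show ?thesis by simp
    qed
    finally show "x k = (\<Oplus>\<^bsub>W_space S\<^esub>n\<in>?A. W_inj S n (x n)) k" by simp
  qed
qed

lemma W_deg_direct_sum:
  assumes x: "x \<in> W_carrier S"
  shows "\<exists>!c. (\<forall>n. c n \<in> W_deg S n) \<and> finite {n. c n \<noteq> \<zero>\<^bsub>W_space S\<^esub>} \<and>
    x = (\<Oplus>\<^bsub>W_space S\<^esub>n\<in>{n. c n \<noteq> \<zero>\<^bsub>W_space S\<^esub>}. c n)"
proof (rule ex1I[of _ "\<lambda>n. W_inj S n (x n)"], intro conjI allI)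
  fix n show "W_inj S n (x n) \<in> W_deg S n"
  proof (cases "n \<ge> -1")
    case True then show ?thesis using W_mem[OF x] W_inj_deg by blast
  qed (use W_deg_low in \<open>auto simp: W_inj_low\<close>)
next
  fix c assume *: "(\<forall>n. c n \<in> W_deg S n) \<and> finite {n. c n \<noteq> \<zero>\<^bsub>W_space S\<^esub>} \<and>
    x = (\<Oplus>\<^bsub>W_space S\<^esub>n\<in>{n. c n \<noteq> \<zero>\<^bsub>W_space S\<^esub>}. c n)"
  let ?A = "{n. c n \<noteq> \<zero>\<^bsub>W_space S\<^esub>}"
  have cc: "c n \<in> W_carrier S" for n using * W_deg_carrier by blast
  show "c = (\<lambda>n. W_inj S n (x n))"
  proof
    fix k
    show "c k = W_inj S k (x k)"
    proof (cases "k \<ge> -1")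
      case True
      interpret V: abelian_group "sp S (ar k)" by (rule superspace_abelian[OF superspace_sp])
      have zo: "c n k = \<zero>\<^bsub>sp S (ar k)\<^esub>" if "n \<noteq> k" for n using * True that by (auto simp: W_deg_def)
      have "x k = (\<Oplus>\<^bsub>sp S (ar k)\<^esub>n\<in>?A. c n k)"
        using lin_hom.sum[OF W_comp_hom[OF True], of ?A c] * cc by (simp add: W_space_carrier)
      also have "\<dots> = c k k"
      proof (cases "k \<in> ?A")
        case A: True
        then show ?thesis using finsum_single[OF V.abelian_group_axioms _ A, of "\<lambda>n. c n k"] zo * W_mem_carrier[OF cc True] by simp
      next
        case False
        then have "c k k = \<zero>\<^bsub>sp S (ar k)\<^esub>" using True by (simp add: W_space_zero)
        moreover have "(\<Oplus>\<^bsub>sp S (ar k)\<^esub>n\<in>?A. c n k) = \<zero>\<^bsub>sp S (ar k)\<^esub>"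
          by (rule V.add.finprod_one_eqI) (metis False zo)
        ultimately show ?thesis by simp
      qed
      finally show ?thesis using W_deg_inj[of "c k" k] * by simp
    next
      case False
      then show ?thesis using * W_deg_low[of k] by (auto simp: W_inj_low)
    qed
  qed
qed (rule W_decompose[OF x])+

text \<open>Additive statements need only be checked on homogeneous elements of a single degree.\<close>

lemma W_induct_hpart [consumes 1, case_names zero inj add]:
  assumes x: "x \<in> hpart (W_space S) p"
    and zero: "Q \<zero>\<^bsub>W_space S\<^esub>"
    and inj: "\<And>n f. \<lbrakk>n \<ge> -1; f \<in> invariants S (ar n); f \<in> hpart (sp S (ar n)) p\<rbrakk> \<Longrightarrow> Q (W_inj S n f)"
    and add: "\<And>x y. \<lbrakk>x \<in> hpart (W_space S) p; y \<in> hpart (W_space S) p; Q x; Q y\<rbrakk> \<Longrightarrow> Q (x \<oplus>\<^bsub>W_space S\<^esub> y)"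
  shows "Q x"
proof -
  interpret W: superspace K "W_space S" by (rule W_superspace)
  have xc: "x \<in> W_carrier S" using x by (simp add: W_space_hpart)
  let ?A = "{n. W_inj S n (x n) \<noteq> \<zero>\<^bsub>W_space S\<^esub>}"
  have A: "n \<ge> -1" "x n \<in> invariants S (ar n)" "x n \<in> hpart (sp S (ar n)) p" if "n \<in> ?A" for n
  proof -
    show n: "n \<ge> -1" using that W_inj_low by force
    show "x n \<in> invariants S (ar n)" "x n \<in> hpart (sp S (ar n)) p" using n x W_mem[OF xc] by (auto simp: W_space_hpart)
  qed
  have "(\<Oplus>\<^bsub>W_space S\<^esub>n\<in>B. W_inj S n (x n)) \<in> hpart (W_space S) p \<and> Q (\<Oplus>\<^bsub>W_space S\<^esub>n\<in>B. W_inj S n (x n))"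
    if "finite B" "B \<subseteq> ?A" for B
    using that
  proof (induction B rule: finite_induct)
    case empty show ?case using zero by (simp add: W.hpart_zero)
  next
    case (insert n B)
    have n: "W_inj S n (x n) \<in> hpart (W_space S) p" using insert A W_inj_hpart by blast
    have "W_inj S m (x m) \<in> carrier (W_space S)" if "m \<in> insert n B" for m
      using that insert A(2) W_inj_mem unfolding W_space_carrier by blast
    then have "(\<Oplus>\<^bsub>W_space S\<^esub>n\<in>insert n B. W_inj S n (x n)) =
      W_inj S n (x n) \<oplus>\<^bsub>W_space S\<^esub> (\<Oplus>\<^bsub>W_space S\<^esub>n\<in>B. W_inj S n (x n))"
      using insert by (intro W.M.finsum_insert) auto
    then show ?case using insert n inj[of n "x n"] A[of n] add W.hpart_add by auto
  qed
  from this[OF W_decompose(1)[OF xc] subset_refl] show ?thesis using W_decompose(2)[OF xc] by simp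
qed

end

section \<open>Pre-Lie products\<close>

definition sgn_bit :: "bit \<Rightarrow> int" where
  "sgn_bit p = (if p = 1 then -1 else 1)"

lemma sgn_bit_add: "sgn_bit (p + q) = sgn_bit p * sgn_bit q"
  using bit_one_or[of p] bit_one_or[of q] by (auto simp: sgn_bit_def)

lemma sgn_bit_square: "sgn_bit p * sgn_bit p = 1"
  by (simp add: sgn_bit_def)

text \<open>The Jacobi identity for a pre-Lie product is a relation between twelve elements of an abelian group
with coefficients $\pm 1$. Written with \<open>lincomb\<close>, it becomes an identity between the integer
coefficients, which normalization of commutative ring expressions proves.\<close>

definition lincomb :: "('a, 'z) ring_scheme \<Rightarrow> nat \<Rightarrow> (nat \<Rightarrow> 'a) \<Rightarrow> (nat \<Rightarrow> int) \<Rightarrow> 'a" where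
  "lincomb V n x c = (\<Oplus>\<^bsub>V\<^esub>i\<in>{..<n}. [c i] \<cdot>\<^bsub>V\<^esub> x i)"

context abelian_group
begin

lemma int_mult_01: "[(0::int)] \<cdot> y = \<zero>" "y \<in> carrier G \<Longrightarrow> [(1::int)] \<cdot> y = y"
  by (simp_all add: add_pow_int_ge)

lemma lincomb_closed: "(\<And>i. x i \<in> carrier G) \<Longrightarrow> lincomb G n x c \<in> carrier G"
  unfolding lincomb_def by (intro finsum_closed) auto

lemma lincomb_add: "(\<And>i. x i \<in> carrier G) \<Longrightarrow> lincomb G n x c \<oplus> lincomb G n x d = lincomb G n x (\<lambda>i. c i + d i)"
  unfolding lincomb_def by (subst finsum_addf[symmetric]) (auto simp: add.int_pow_mult)

lemma lincomb_zero: "(\<And>i. x i \<in> carrier G) \<Longrightarrow> lincomb G n x (\<lambda>i. 0) = \<zero>"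
  unfolding lincomb_def by (intro add.finprod_one_eqI) (simp add: int_mult_01)

lemma lincomb_neg:
  assumes x: "\<And>i. x i \<in> carrier G" shows "\<ominus> lincomb G n x c = lincomb G n x (\<lambda>i. - c i)"
proof (rule minus_equality)
  show "lincomb G n x (\<lambda>i. - c i) \<oplus> lincomb G n x c = \<zero>"
    using lincomb_add[where c = "\<lambda>i. - c i" and d = c and n = n and x = x] lincomb_zero[of x n] x by simp
qed (auto intro: lincomb_closed x)

lemma lincomb_minus: "(\<And>i. x i \<in> carrier G) \<Longrightarrow> lincomb G n x c \<ominus> lincomb G n x d = lincomb G n x (\<lambda>i. c i - d i)"
  by (simp add: a_minus_def lincomb_neg lincomb_add)

lemma lincomb_signed: "(\<And>i. x i \<in> carrier G) \<Longrightarrow> signed G p (lincomb G n x c) = lincomb G n x (\<lambda>i. sgn_bit p * c i)"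
  by (simp add: signed_def sgn_bit_def lincomb_neg)

lemma lincomb_atom:
  assumes "\<And>i. x i \<in> carrier G" "k < n" shows "lincomb G n x (\<lambda>i. if i = k then 1 else 0) = x k"
  unfolding lincomb_def
  using finsum_single[OF abelian_group_axioms, of "{..<n}" k "\<lambda>i. [(if i = k then 1 else 0 :: int)] \<cdot> x i"] assms
  by (auto simp: int_mult_01)

text \<open>The super Jacobi identity for the commutator of a product whose associator is symmetric in
  its last two arguments: \<open>x 0\<close>, \<open>x 1\<close>, \<open>x 2\<close>, \<open>x 3\<close> are the products $(fg)h$, $f(gh)$, $(fh)g$,
  $f(hg)$, and the other two groups of four start from $(gf)h$ and $(hf)g$.\<close>

lemma pre_lie_jacobi:
  fixes x :: "nat \<Rightarrow> 'a" and p q r :: bit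
  assumes x: "\<And>i. x i \<in> carrier G"
    and 1: "x 0 \<ominus> x 1 = signed G (q * r) (x 2 \<ominus> x 3)"
    and 2: "x 4 \<ominus> x 5 = signed G (p * r) (x 6 \<ominus> x 7)"
    and 3: "x 8 \<ominus> x 9 = signed G (p * q) (x 10 \<ominus> x 11)"
  shows "(x 1 \<ominus> signed G (q * r) (x 3)) \<ominus> signed G (p * (q + r)) (x 6 \<ominus> signed G (q * r) (x 10)) =
    ((x 0 \<ominus> signed G (p * q) (x 4)) \<ominus> signed G ((p + q) * r) (x 9 \<ominus> signed G (p * q) (x 11))) \<oplus>
    signed G (p * q) ((x 5 \<ominus> signed G (p * r) (x 7)) \<ominus> signed G (q * (p + r)) (x 2 \<ominus> signed G (p * r) (x 8)))"
    (is "?L = ?R")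
proof -
  define e where "e k i = (if i = k then 1 else 0 :: int)" for k i :: nat
  define E where "E = lincomb G 12 x"
  have at: "x k = E (e k)" if "k < 12" for k
    using lincomb_atom[of x k 12, OF x that] by (simp add: E_def e_def[abs_def])
  have add: "E c \<oplus> E d = E (\<lambda>i. c i + d i)" and minus: "E c \<ominus> E d = E (\<lambda>i. c i - d i)"
    and sgn: "signed G p' (E c) = E (\<lambda>i. sgn_bit p' * c i)" for c d p'
    unfolding E_def using x by (auto intro: lincomb_add lincomb_minus lincomb_signed)
  define a b c where "a = sgn_bit (p * q)" and "b = sgn_bit (p * r)" and "c = sgn_bit (q * r)"
  have sq: "a * a = 1" "b * b = 1" "c * c = 1" by (simp_all add: a_def b_def c_def sgn_bit_square)
  have ss: "sgn_bit (p * q) = a" "sgn_bit (p * r) = b" "sgn_bit (q * r) = c" "sgn_bit (p * (q + r)) = a * b"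
     "sgn_bit ((p + q) * r) = b * c" "sgn_bit (q * (p + r)) = a * c"
    by (simp_all add: a_def b_def c_def distrib_left distrib_right sgn_bit_add mult.commute)
  have rel: "E (\<lambda>i. u i - v i) = \<zero>" if "E u = E v" for u v
    using that minus[of u v] lincomb_closed[of x 12 v, OF x] by (simp add: E_def a_minus_def r_neg)
  \<comment> \<open>the coefficients of the three given relations, as integer functions on the twelve indices\<close>
  define r1 r2 r3 where "r1 i = e 0 i - e 1 i - c * (e 2 i - e 3 i)"
    and "r2 i = e 4 i - e 5 i - b * (e 6 i - e 7 i)"
    and "r3 i = e 8 i - e 9 i - a * (e 10 i - e 11 i)" for i
  have r: "E r1 = \<zero>" "E r2 = \<zero>" "E r3 = \<zero>"
    using 1 2 3 unfolding r1_def r2_def r3_def by (auto simp: at minus sgn ss intro: rel)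
  define u where "u i = e 1 i - c * e 3 i - a * b * (e 6 i - c * e 10 i)" for i
  define v where "v i = e 0 i - a * e 4 i - b * c * (e 9 i - a * e 11 i) +
    a * ((e 5 i - b * e 7 i) - a * c * (e 2 i - b * e 8 i))" for i
  have L: "?L = E u" and R: "?R = E v"
    by (simp_all add: at minus add sgn ss u_def[abs_def] v_def[abs_def])
  \<comment> \<open>the two sides differ by a combination of the three relations, up to $a^2 = 1$\<close>
  have "u i = v i + (a * r2 i - r1 i - b * c * r3 i)" for i
  proof -
    have "u i - (v i + (a * r2 i - r1 i - b * c * r3 i)) = (a * a - 1) * c * (e 2 i - b * e 8 i)"
      by (simp add: u_def v_def r1_def r2_def r3_def algebra_simps)
    then show ?thesis by (simp add: sq)
  qed
  then have "u = (\<lambda>i. v i + (a * r2 i - r1 i - b * c * r3 i))" by auto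
  then have "E u = E v \<oplus> (signed G (p * q) (E r2) \<ominus> E r1 \<ominus> signed G (p * r) (signed G (q * r) (E r3)))"
    by (simp add: add minus sgn ss mult.assoc)
  also have "\<dots> = E v"
    using r lincomb_closed[of x 12 v, OF x] by (simp add: signed_def neg_zero abelian_group_axioms a_minus_def E_def)
  finally show ?thesis using L R by simp
qed

end

section \<open>Sums over the symmetric group\<close>

lemma nat_mult_closed: "abelian_group V \<Longrightarrow> x \<in> carrier V \<Longrightarrow> [(n::nat)] \<cdot>\<^bsub>V\<^esub> x \<in> carrier V"
proof -
  assume "abelian_group V" then interpret V: abelian_group V .
  show "x \<in> carrier V \<Longrightarrow> [n] \<cdot>\<^bsub>V\<^esub> x \<in> carrier V" by simp
qed

lemma nat_mult_smult:
  assumes "module K V" "x \<in> carrier V" shows "[(n::nat)] \<cdot>\<^bsub>V\<^esub> x = ([n] \<cdot>\<^bsub>K\<^esub> \<one>\<^bsub>K\<^esub>) \<odot>\<^bsub>V\<^esub> x"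
proof -
  interpret V: module K V by fact
  show ?thesis using assms(2) by (induction n) (auto simp: V.smult_l_distr)
qed

text \<open>The inverse is asserted for all modules at once, so that one scalar \<open>c\<close> serves for division by \<open>n\<close>
in several spaces.\<close>

lemma nat_inverse:
  assumes "field K" "char_zero K" "(n::nat) > 0"
  obtains c where "c \<in> carrier K" "\<And>V x. \<lbrakk>module K V; x \<in> carrier V\<rbrakk> \<Longrightarrow> c \<odot>\<^bsub>V\<^esub> ([n] \<cdot>\<^bsub>V\<^esub> x) = x"
proof -
  interpret field K by fact
  let ?n = "[n] \<cdot>\<^bsub>K\<^esub> \<one>\<^bsub>K\<^esub>"
  have n: "?n \<in> Units K" using assms(2,3) by (auto simp: char_zero_def field_Units)
  have "inv\<^bsub>K\<^esub> ?n \<odot>\<^bsub>V\<^esub> ([n] \<cdot>\<^bsub>V\<^esub> x) = x" if "module K V" "x \<in> carrier V" for V x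
  proof -
    interpret V: module K V by fact
    have "inv\<^bsub>K\<^esub> ?n \<odot>\<^bsub>V\<^esub> ([n] \<cdot>\<^bsub>V\<^esub> x) = (inv\<^bsub>K\<^esub> ?n \<otimes>\<^bsub>K\<^esub> ?n) \<odot>\<^bsub>V\<^esub> x"
      using that n V.smult_assoc1[of "inv\<^bsub>K\<^esub> ?n" ?n x]
      by (simp add: nat_mult_smult[OF that] Units_closed)
    then show ?thesis using n that by simp
  qed
  then show ?thesis using that n by blast
qed

lemma nat_mult_cancel:
  assumes "field K" "char_zero K" "module K V" "(n::nat) > 0" "x \<in> carrier V" "y \<in> carrier V"
    "[n] \<cdot>\<^bsub>V\<^esub> x = [n] \<cdot>\<^bsub>V\<^esub> y"
  shows "x = y"
  using nat_inverse[OF assms(1,2,4)] assms(3,5,6,7) by metis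

lemma nat_mult_mult:
  assumes "abelian_group V" "x \<in> carrier V" shows "[(n * m :: nat)] \<cdot>\<^bsub>V\<^esub> x = [n] \<cdot>\<^bsub>V\<^esub> ([m] \<cdot>\<^bsub>V\<^esub> x)"
proof -
  interpret V: abelian_group V by fact
  show ?thesis using V.add.nat_pow_pow[OF assms(2), of m n] V.add.nat_pow_pow[OF assms(2), of n m] by (simp add: mult.commute)
qed

lemma nat_mult_lin: "module K V \<Longrightarrow> lin_map K V V (\<lambda>x. [(n::nat)] \<cdot>\<^bsub>V\<^esub> x)"
proof -
  assume "module K V"
  then interpret V: module K V .
  show ?thesis
  proof (induction n)
    case 0 show ?case by (simp add: lin_map_0 V.module_axioms)
  next
    case (Suc n) show ?case using lin_map_plus[OF V.module_axioms Suc lin_map_id] by simp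
  qed
qed

lemma finsum_Times:
  assumes V: "abelian_group V" and fin: "finite A" "finite B" and f: "\<And>a b. \<lbrakk>a \<in> A; b \<in> B\<rbrakk> \<Longrightarrow> f (a, b) \<in> carrier V"
  shows "finsum V f (A \<times> B) = (\<Oplus>\<^bsub>V\<^esub>a\<in>A. \<Oplus>\<^bsub>V\<^esub>b\<in>B. f (a, b))"
proof -
  interpret V: abelian_group V by fact
  show ?thesis using fin(1) f
  proof (induction A rule: finite_induct)
    case (insert a A)
    have "insert a A \<times> B = Pair a ` B \<union> A \<times> B" by auto
    then have "finsum V f (insert a A \<times> B) = finsum V f (Pair a ` B) \<oplus>\<^bsub>V\<^esub> finsum V f (A \<times> B)"
      by (simp only:) (rule V.finsum_Un_disjoint; use insert fin in auto)
    also have "finsum V f (Pair a ` B) = (\<Oplus>\<^bsub>V\<^esub>b\<in>B. f (a, b))"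
      using insert by (intro V.finsum_reindex) (auto simp: inj_on_def)
    finally show ?case using insert by (subst V.finsum_insert) (auto intro!: V.finsum_closed)
  qed simp
qed

lemma finsum_bij:
  assumes V: "abelian_group V" and "bij_betw h A B" and f: "\<And>b. b \<in> B \<Longrightarrow> f b \<in> carrier V"
  shows "finsum V f B = (\<Oplus>\<^bsub>V\<^esub>a\<in>A. f (h a))"
proof -
  interpret V: abelian_group V by fact
  show ?thesis using V.finsum_reindex[of f h A] assms(2) f by (auto simp: bij_betw_def)
qed

abbreviation perms :: "nat \<Rightarrow> (nat \<Rightarrow> nat) set" where
  "perms k \<equiv> {\<sigma>. \<sigma> permutes {1..k}}"

lemma finite_perms: "finite (perms k)"
  by (rule finite_permutations) simp

lemma card_perms: "card (perms k) = fact k"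
  using card_permutations[of "{1..k}" k] by simp

definition symsum :: "('k, 'a, 'z) symm_seq_scheme \<Rightarrow> nat \<Rightarrow> 'a \<Rightarrow> 'a" where
  "symsum S k x = (\<Oplus>\<^bsub>sp S k\<^esub>\<sigma>\<in>perms k. act S k \<sigma> x)"

context symm_seq
begin

lemma S_ab: "abelian_group (sp S k)" and S_mod: "module K (sp S k)"
  by (rule superspace_abelian[OF superspace_sp], rule superspace_module[OF superspace_sp])

lemma act_cl: "\<lbrakk>\<sigma> permutes {1..k}; x \<in> carrier (sp S k)\<rbrakk> \<Longrightarrow> act S k \<sigma> x \<in> carrier (sp S k)"
  by (rule lin_hom.closed[OF act_hom])

lemma symsum_lin: "lin_map K (sp S k) (sp S k) (symsum S k)"
proof -
  have "lin_map K (sp S k) (sp S k) (\<lambda>x. \<Oplus>\<^bsub>sp S k\<^esub>\<sigma>\<in>perms k. act S k \<sigma> x)"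
    by (intro lin_map_sum S_mod) (auto intro: even_map_lin act_even)
  then show ?thesis by (simp add: symsum_def[abs_def])
qed

lemma symsum_hom: "lin_hom K (sp S k) (sp S k) (symsum S k)"
  by (intro lin_homI superspace_sp symsum_lin)

lemma symsum_closed: "x \<in> carrier (sp S k) \<Longrightarrow> symsum S k x \<in> carrier (sp S k)"
  by (rule lin_map_closed[OF symsum_lin])

lemma symsum_act:
  assumes \<tau>: "\<tau> permutes {1..k}" and x: "x \<in> carrier (sp S k)" shows "symsum S k (act S k \<tau> x) = symsum S k x"
proof -
  interpret V: abelian_group "sp S k" by (rule S_ab)
  have b: "bij_betw (\<lambda>\<sigma>. \<tau> \<circ> \<sigma>) (perms k) (perms k)"
  proof (rule bij_betwI[of _ _ _ "\<lambda>\<sigma>. inv_into UNIV \<tau> \<circ> \<sigma>"])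
    show "(\<circ>) \<tau> \<in> perms k \<rightarrow> perms k" "(\<circ>) (inv_into UNIV \<tau>) \<in> perms k \<rightarrow> perms k"
      using \<tau> by (auto intro: permutes_compose permutes_inv)
  qed (simp_all add: o_assoc permutes_inv_o[OF \<tau>])
  have "symsum S k x = (\<Oplus>\<^bsub>sp S k\<^esub>\<sigma>\<in>perms k. act S k (\<tau> \<circ> \<sigma>) x)"
    unfolding symsum_def by (rule finsum_bij[OF S_ab b]) (simp add: act_cl x)
  also have "\<dots> = symsum S k (act S k \<tau> x)"
    unfolding symsum_def using \<tau> x by (intro V.finsum_cong') (auto simp: act_comp act_cl)
  finally show ?thesis by simp
qed

lemma symsum_inv: assumes x: "x \<in> carrier (sp S k)" shows "symsum S k x \<in> invariants S k"
proof -
  interpret V: abelian_group "sp S k" by (rule S_ab)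
  have "act S k \<tau> (symsum S k x) = symsum S k x" if \<tau>: "\<tau> permutes {1..k}" for \<tau>
  proof -
    have b: "bij_betw (\<lambda>\<sigma>. \<sigma> \<circ> \<tau>) (perms k) (perms k)"
    proof (rule bij_betwI[of _ _ _ "\<lambda>\<sigma>. \<sigma> \<circ> inv_into UNIV \<tau>"])
      show "(\<lambda>\<sigma>. \<sigma> \<circ> \<tau>) \<in> perms k \<rightarrow> perms k" "(\<lambda>\<sigma>. \<sigma> \<circ> inv_into UNIV \<tau>) \<in> perms k \<rightarrow> perms k"
        using \<tau> by (auto intro: permutes_compose permutes_inv)
    qed (simp_all add: o_assoc[symmetric] permutes_inv_o[OF \<tau>])
    have "act S k \<tau> (symsum S k x) = (\<Oplus>\<^bsub>sp S k\<^esub>\<sigma>\<in>perms k. act S k \<tau> (act S k \<sigma> x))"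
      unfolding symsum_def by (rule lin_hom.sum[OF act_hom[OF \<tau>]]) (simp add: act_cl x)
    also have "\<dots> = (\<Oplus>\<^bsub>sp S k\<^esub>\<sigma>\<in>perms k. act S k (\<sigma> \<circ> \<tau>) x)"
      using \<tau> x by (intro V.finsum_cong') (auto simp: act_comp act_cl)
    also have "\<dots> = symsum S k x"
      unfolding symsum_def by (rule finsum_bij[OF S_ab b, symmetric]) (simp add: act_cl x)
    finally show ?thesis .
  qed
  then show ?thesis by (simp add: invariants_def symsum_closed x)
qed

lemma symsum_of_inv: assumes x: "x \<in> invariants S k" shows "symsum S k x = [(fact k :: nat)] \<cdot>\<^bsub>sp S k\<^esub> x"
proof -
  interpret V: abelian_group "sp S k" by (rule S_ab)
  have "symsum S k x = (\<Oplus>\<^bsub>sp S k\<^esub>\<sigma>\<in>perms k. x)"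
    unfolding symsum_def using x by (intro V.finsum_cong') (auto simp: inv_act inv_carrier)
  then show ?thesis using finsum_const_nat[OF S_ab finite_perms inv_carrier[OF x], of k] by (simp add: card_perms)
qed

text \<open>Each coset of the stabilizer of the first \<open>b\<close> positions contains exactly one shuffle.\<close>

lemma shuffle_sum:
  assumes b: "b \<le> k" and x: "x \<in> carrier (sp S k)" and y: "\<And>y. y \<in> young k b \<Longrightarrow> act S k y x = x"
  shows "[(fact b * fact (k - b) :: nat)] \<cdot>\<^bsub>sp S k\<^esub> (\<Oplus>\<^bsub>sp S k\<^esub>\<sigma>\<in>shuf k b. act S k (inv_into UNIV \<sigma>) x) = symsum S k x"
proof -
  interpret V: abelian_group "sp S k" by (rule S_ab)
  let ?i = "inv_into UNIV :: (nat \<Rightarrow> nat) \<Rightarrow> nat \<Rightarrow> nat"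
  have iy: "?i y \<in> young k b" if "y \<in> young k b" for y
    using that permutes_inv[of y "{1..k}"] image_inv_f_f[OF permutes_inj[of y "{1..k}"], of "{1..b}"] by (auto simp: young_def)
  have bi: "bij_betw ?i (perms k) (perms k)"
    by (rule bij_betwI[of _ _ _ ?i]) (auto intro: permutes_inv simp: permutes_inv_inv)
  have "symsum S k x = (\<Oplus>\<^bsub>sp S k\<^esub>\<pi>\<in>perms k. act S k (?i \<pi>) x)"
    unfolding symsum_def by (rule finsum_bij[OF S_ab bi]) (simp add: act_cl x)
  also have "\<dots> = (\<Oplus>\<^bsub>sp S k\<^esub>z\<in>shuf k b \<times> young k b. act S k (?i ((\<lambda>(\<sigma>, y). \<sigma> \<circ> y) z)) x)"
    by (rule finsum_bij[OF S_ab shuf_young_bij[OF b]]) (simp add: act_cl x permutes_inv)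
  also have "\<dots> = (\<Oplus>\<^bsub>sp S k\<^esub>z\<in>shuf k b \<times> young k b. act S k (?i (fst z)) x)"
  proof (rule V.finsum_cong'[OF refl])
    show "(\<lambda>z. act S k (?i (fst z)) x) \<in> shuf k b \<times> young k b \<rightarrow> carrier (sp S k)"
      by (auto simp: shuf_def act_cl x permutes_inv)
    fix z assume "z \<in> shuf k b \<times> young k b"
    then obtain \<sigma> y' where z: "z = (\<sigma>, y')" "\<sigma> permutes {1..k}" "y' permutes {1..k}" "y' \<in> young k b"
      by (auto simp: shuf_def young_def)
    have "?i (\<sigma> \<circ> y') = ?i y' \<circ> ?i \<sigma>" using z by (intro o_inv_distrib) (auto dest: permutes_bij)
    then show "act S k (?i ((\<lambda>(\<sigma>, y). \<sigma> \<circ> y) z)) x = act S k (?i (fst z)) x"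
      using z y[OF iy[OF z(4)]] by (simp add: act_comp permutes_inv x)
  qed
  also have "\<dots> = (\<Oplus>\<^bsub>sp S k\<^esub>\<sigma>\<in>shuf k b. \<Oplus>\<^bsub>sp S k\<^esub>y\<in>young k b. act S k (?i \<sigma>) x)"
    by (subst finsum_Times[OF S_ab finite_shuf finite_young]) (auto simp: shuf_def act_cl x permutes_inv)
  also have "\<dots> = (\<Oplus>\<^bsub>sp S k\<^esub>\<sigma>\<in>shuf k b. [(fact b * fact (k - b) :: nat)] \<cdot>\<^bsub>sp S k\<^esub> act S k (?i \<sigma>) x)"
  proof (rule V.finsum_cong'[OF refl])
    fix \<sigma> assume "\<sigma> \<in> shuf k b"
    then have "act S k (?i \<sigma>) x \<in> carrier (sp S k)" by (auto simp: shuf_def act_cl x permutes_inv)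
    then show "(\<Oplus>\<^bsub>sp S k\<^esub>y\<in>young k b. act S k (?i \<sigma>) x) = [(fact b * fact (k - b) :: nat)] \<cdot>\<^bsub>sp S k\<^esub> act S k (?i \<sigma>) x"
      using finsum_const_nat[OF S_ab finite_young] card_young[OF b] by simp
  qed (auto simp: shuf_def act_cl x permutes_inv)
  also have "\<dots> = [(fact b * fact (k - b) :: nat)] \<cdot>\<^bsub>sp S k\<^esub> (\<Oplus>\<^bsub>sp S k\<^esub>\<sigma>\<in>shuf k b. act S k (?i \<sigma>) x)"
    by (rule lin_hom.sum[OF lin_homI[OF superspace_sp superspace_sp nat_mult_lin[OF S_mod]], symmetric])
      (auto simp: shuf_def act_cl x permutes_inv)
  finally show ?thesis by simp
qed

end

section \<open>The product on the invariants of a pseudo operad\<close>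

context linear_pseudo_operad
begin

lemma pcomp_closed: "\<lbrakk>i \<in> {1..n}; f \<in> carrier (sp P n); g \<in> carrier (sp P m)\<rbrakk>
  \<Longrightarrow> pcomp P n m i f g \<in> carrier (sp P (n + m - 1))"
  by (rule lin_map_closed[OF pcomp_lin_left])

lemma ar_nat [simp]: "ar (int a - 1) = a"
  by (simp add: ar_def)

lemma ar_nat_sum [simp]: "ar (int a + int b - 2) = a + b - 1"
  by (simp add: ar_def)

lemma box_zero: "n < 0 \<or> m < -1 \<Longrightarrow> box P n m f g = \<zero>\<^bsub>sp P (ar (n + m))\<^esub>"
proof -
  interpret V: abelian_group "sp P (ar (n + m))" by (rule S_ab)
  assume "n < 0 \<or> m < -1"
  then have "shuffle_perms (m + 1) n = {}" by (auto simp: shuffle_perms_def)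
  then show ?thesis by (simp add: box_def)
qed

lemma shuffle_perms_permutes: "\<lbrakk>\<sigma> \<in> shuffle_perms (m + 1) n\<rbrakk> \<Longrightarrow> inv_into UNIV \<sigma> permutes {1..ar (n + m)}"
  by (intro permutes_inv) (simp add: shuffle_perms_def ar_def algebra_simps)

lemma box_lin_left:
  assumes "g \<in> carrier (sp P (ar m))" shows "lin_map K (sp P (ar n)) (sp P (ar (n + m))) (\<lambda>f. box P n m f g)"
proof (cases "n < 0 \<or> m < -1")
  case True then show ?thesis by (simp add: box_zero lin_map_0 S_mod)
next
  case False
  then have "ar n + ar m - 1 = ar (n + m)" "1 \<in> {1..ar n}" by (auto simp: ar_def)
  then show ?thesis
    unfolding box_def using pcomp_lin_left[of 1 "ar n" g "ar m"] assms
    by (intro lin_map_sum S_mod lin_map_compose[OF even_map_lin[OF act_even]] shuffle_perms_permutes) auto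
qed

lemma box_lin_right:
  assumes "f \<in> carrier (sp P (ar n))" shows "lin_map K (sp P (ar m)) (sp P (ar (n + m))) (\<lambda>g. box P n m f g)"
proof (cases "n < 0 \<or> m < -1")
  case True then show ?thesis by (simp add: box_zero lin_map_0 S_mod)
next
  case False
  then have "ar n + ar m - 1 = ar (n + m)" "1 \<in> {1..ar n}" by (auto simp: ar_def)
  then show ?thesis
    unfolding box_def using pcomp_lin_right[of 1 "ar n" f "ar m"] assms
    by (intro lin_map_sum S_mod lin_map_compose[OF even_map_lin[OF act_even]] shuffle_perms_permutes) auto
qed

lemma box_closed: "\<lbrakk>f \<in> carrier (sp P (ar n)); g \<in> carrier (sp P (ar m))\<rbrakk> \<Longrightarrow> box P n m f g \<in> carrier (sp P (ar (n + m)))"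
  by (rule lin_map_closed[OF box_lin_left])

lemma box_zero_arg:
  "g \<in> carrier (sp P (ar m)) \<Longrightarrow> box P n m \<zero>\<^bsub>sp P (ar n)\<^esub> g = \<zero>\<^bsub>sp P (ar (n + m))\<^esub>"
  "f \<in> carrier (sp P (ar n)) \<Longrightarrow> box P n m f \<zero>\<^bsub>sp P (ar m)\<^esub> = \<zero>\<^bsub>sp P (ar (n + m))\<^esub>"
  using lin_hom.zero[OF lin_homI[OF superspace_sp superspace_sp box_lin_left]]
    lin_hom.zero[OF lin_homI[OF superspace_sp superspace_sp box_lin_right]] by auto

lemma box_parity:
  assumes "f \<in> hpart (sp P (ar n)) p" "g \<in> hpart (sp P (ar m)) q"
  shows "box P n m f g \<in> hpart (sp P (ar (n + m))) (p + q)"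
proof (cases "n < 0 \<or> m < -1")
  case True then show ?thesis by (simp add: box_zero superspace.hpart_zero[OF superspace_sp])
next
  case False
  then have ar: "ar n + ar m - 1 = ar (n + m)" "1 \<in> {1..ar n}" by (auto simp: ar_def)
  show ?thesis
    unfolding box_def
    using pcomp_parity[OF ar(2) assms] ar
    by (intro superspace.hpart_sum_mem[OF superspace_sp] even_map_hpart[OF act_even] shuffle_perms_permutes) auto
qed

text \<open>For invariant arguments, the sum over shuffles is a multiple of the sum over all permutations, since
$f \circ_1 g$ is fixed by the Young subgroup, of order $b!\,(a-1)!$.\<close>

lemma box_scaled:
  assumes a: "1 \<le> a" and f: "f \<in> invariants P a" and g: "g \<in> invariants P b"
  shows "[(fact b * fact (a - 1) :: nat)] \<cdot>\<^bsub>sp P (a + b - 1)\<^esub> box P (int a - 1) (int b - 1) f g =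
    symsum P (a + b - 1) (pcomp P a b 1 f g)"
proof -
  let ?k = "a + b - 1"
  have k: "ar (int a - 1 + (int b - 1)) = ?k" "?k - b = a - 1" "b \<le> ?k" using a by (auto simp: ar_def)
  have sh: "shuffle_perms (int b - 1 + 1) (int a - 1) = shuf ?k b"
    using shuffle_perms_shuf[OF k(3)] k(2) a by (simp add: of_nat_diff)
  have x: "pcomp P a b 1 f g \<in> carrier (sp P ?k)" using a f g by (intro pcomp_closed) (auto intro: inv_carrier)
  have "act P ?k y (pcomp P a b 1 f g) = pcomp P a b 1 f g" if y: "y \<in> young ?k b" for y
  proof -
    have "y permutes {1..a + b - 1}" "y ` {1..b} = {1..b}" using y by (auto simp: young_def)
    then obtain \<sigma> \<tau> where st: "\<sigma> permutes {1..a}" "\<sigma> 1 = 1" "\<tau> permutes {1..b}" "circ_perm a b 1 \<sigma> \<tau> = y"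
      using young_circ_perm a by metis
    have "pcomp P a b 1 (act P a \<sigma> f) (act P b \<tau> g) = act P ?k y (pcomp P a b 1 f g)"
      using pcomp_equivariant[of 1 a f g b \<sigma> \<tau>] st a f g by (auto intro: inv_carrier)
    then show ?thesis using st f g by (simp add: inv_act)
  qed
  from shuffle_sum[OF k(3) x this] show ?thesis unfolding box_def k sh ar_nat by (simp add: k)
qed

text \<open>If \<open>f\<close> is invariant, then all partial compositions $f \circ_i g$ are related to the first one by
permutations, so they have the same symmetrization.\<close>

lemma pcomp_transpose:
  assumes f: "f \<in> invariants P a" and i: "i \<in> {1..a}" and g: "g \<in> carrier (sp P b)"
  shows "pcomp P a b 1 f g = act P (a + b - 1) (circ_perm a b 1 (transpose 1 i) id) (pcomp P a b i f g)"
    "circ_perm a b 1 (transpose 1 i) id permutes {1..a + b - 1}"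
proof -
  have 1: "1 \<in> {1..a}" using i by auto
  have t: "transpose 1 i permutes {1..a}" using 1 i by (intro permutes_swap_id) auto
  show "pcomp P a b 1 f g = act P (a + b - 1) (circ_perm a b 1 (transpose 1 i) id) (pcomp P a b i f g)"
    using pcomp_equivariant[OF 1 inv_carrier[OF f] g t permutes_id] by (simp add: inv_act[OF f t] act_id g)
  show "circ_perm a b 1 (transpose 1 i) id permutes {1..a + b - 1}"
    by (rule circ_perm_permutes[OF 1 t permutes_id])
qed

end

locale pseudo_operad_char0 = linear_pseudo_operad K P
  for K :: "('k, 'm) ring_scheme" and P :: "('k, 'a, 'z) linear_pseudo_operad_scheme" +
  assumes char0: "char_zero K"
begin

lemma field_K: "field K"
  by (rule superspace_field[OF superspace_sp])

lemma cancel: "\<lbrakk>(n::nat) > 0; x \<in> carrier (sp P k); y \<in> carrier (sp P k); [n] \<cdot>\<^bsub>sp P k\<^esub> x = [n] \<cdot>\<^bsub>sp P k\<^esub> y\<rbrakk> \<Longrightarrow> x = y"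
  by (rule nat_mult_cancel[OF field_K char0 S_mod])

text \<open>A nonzero multiple of the box product is a symmetrization, and one may divide by integers.\<close>

lemma box_inv:
  assumes "f \<in> invariants P (ar n)" "g \<in> invariants P (ar m)"
  shows "box P n m f g \<in> invariants P (ar (n + m))"
proof (cases "n < 0 \<or> m < -1")
  case True then show ?thesis by (simp add: box_zero inv_zero)
next
  case False
  define a b where "a = ar n" and "b = ar m"
  have nm: "n = int a - 1" "m = int b - 1" "1 \<le> a" "ar (n + m) = a + b - 1" using False by (auto simp: a_def b_def ar_def)
  define N :: nat where "N = fact b * fact (a - 1)"
  have fg: "f \<in> invariants P a" "g \<in> invariants P b" using assms by (auto simp: a_def b_def)
  have c: "box P n m f g \<in> carrier (sp P (a + b - 1))" using box_closed[OF assms[THEN inv_carrier]] nm(4) by simp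
  have sc: "[N] \<cdot>\<^bsub>sp P (a + b - 1)\<^esub> box P n m f g = symsum P (a + b - 1) (pcomp P a b 1 f g)"
    using box_scaled[OF nm(3) fg] by (simp add: nm N_def)
  have "symsum P (a + b - 1) (pcomp P a b 1 f g) \<in> invariants P (a + b - 1)"
    using nm(3) fg by (intro symsum_inv pcomp_closed) (auto intro: inv_carrier)
  then have i: "[N] \<cdot>\<^bsub>sp P (a + b - 1)\<^esub> box P n m f g \<in> invariants P (a + b - 1)" using sc by simp
  have "act P (a + b - 1) \<tau> (box P n m f g) = box P n m f g" if "\<tau> permutes {1..a + b - 1}" for \<tau>
  proof (rule cancel[of N])
    show "[N] \<cdot>\<^bsub>sp P (a + b - 1)\<^esub> act P (a + b - 1) \<tau> (box P n m f g) = [N] \<cdot>\<^bsub>sp P (a + b - 1)\<^esub> box P n m f g"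
      using lin_hom.nat_mult[OF act_hom[OF that] c, of N] inv_act[OF i that] by simp
  qed (use c that act_cl in \<open>auto simp: N_def\<close>)
  then show ?thesis using c nm by (simp add: invariants_def)
qed

text \<open>By \<open>box_scaled\<close> the product $(f \Box g) \Box h$ is, up to a factor, the symmetrization of $y \circ_1 h$
with \<open>y\<close> the symmetrization of $x = f \circ_1 g$. Symmetrizing \<open>x\<close> first moves the place where
\<open>h\<close> is inserted: the outcome is the sum over all places \<open>j\<close> of the symmetrization of $x \circ_j h$.
For $f \Box (g \Box h)$ only the places inside \<open>g\<close> occur, because $f \circ_1 (g \circ_j h) =
(f \circ_1 g) \circ_j h$ for these. Both formulas carry the same factor, so that their difference can be
taken.\<close>

lemma box_box_left:
  assumes a: "1 \<le> a" "1 \<le> a + b - 1" and f: "f \<in> invariants P a" and g: "g \<in> invariants P b" and h: "h \<in> invariants P c"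
    and x: "x = pcomp P a b 1 f g" and k: "k = a + b + c - 2" and m: "m = a + b - 1"
  shows "[(fact b * fact (a - 1) * fact c :: nat)] \<cdot>\<^bsub>sp P k\<^esub>
      box P (int m - 1) (int c - 1) (box P (int a - 1) (int b - 1) f g) h =
    (\<Oplus>\<^bsub>sp P k\<^esub>j\<in>{1..m}. symsum P k (pcomp P m c j x h))"
proof -
  interpret V: abelian_group "sp P k" by (rule S_ab)
  have k': "k = m + c - 1" using a k m by simp
  have mge: "1 \<le> m" using a m by simp
  define y where "y = box P (int a - 1) (int b - 1) f g"
  define M :: nat where "M = fact b * fact (a - 1)"
  have yi: "y \<in> invariants P m"
    using box_inv[of f "int a - 1" g "int b - 1"] f g mge by (simp add: y_def m)
  have xc: "x \<in> carrier (sp P m)" unfolding x m using a f g by (intro pcomp_closed) (auto intro: inv_carrier)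
  have My: "[M] \<cdot>\<^bsub>sp P m\<^esub> y = symsum P m x" using box_scaled[OF a(1) f g] by (simp add: y_def M_def m x)
  note hc = inv_carrier[OF h] and yc = inv_carrier[OF yi]
  define D where "D z = (\<Oplus>\<^bsub>sp P k\<^esub>j\<in>{1..m}. symsum P k (pcomp P m c j z h))" for z
  have pl: "lin_map K (sp P m) (sp P k) (\<lambda>z. symsum P k (pcomp P m c j z h))" if "j \<in> {1..m}" for j
    using lin_map_compose[OF symsum_lin, of "sp P m" k] pcomp_lin_left[OF that hc] k' by simp
  have Dl: "lin_map K (sp P m) (sp P k) D"
    unfolding D_def[abs_def] by (intro lin_map_sum S_mod pl)
  have Dh: "lin_hom K (sp P m) (sp P k) D" by (intro lin_homI superspace_sp Dl)
  \<comment> \<open>a permutation of \<open>z\<close> only permutes the summands of \<open>D z\<close>, up to permutations absorbed by the symmetrization\<close>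
  have Dact: "D (act P m \<sigma> z) = D z" if \<sigma>: "\<sigma> permutes {1..m}" and z: "z \<in> carrier (sp P m)" for \<sigma> z
  proof -
    have si: "\<sigma> j \<in> {1..m}" if "j \<in> {1..m}" for j using permutes_in_image[OF \<sigma>] that by blast
    have e: "symsum P k (pcomp P m c j (act P m \<sigma> z) h) = symsum P k (pcomp P m c (\<sigma> j) z h)" if j: "j \<in> {1..m}" for j
    proof -
      have "pcomp P m c j (act P m \<sigma> z) h = act P k (circ_perm m c j \<sigma> id) (pcomp P m c (\<sigma> j) z h)"
        using pcomp_equivariant[OF j z hc \<sigma> permutes_id] by (simp add: act_id hc k')
      then show ?thesis
        using symsum_act[of "circ_perm m c j \<sigma> id" k "pcomp P m c (\<sigma> j) z h"] circ_perm_permutes[OF j \<sigma> permutes_id, of c]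
          pcomp_closed[OF si[OF j] z hc] k' by simp
    qed
    have cl: "symsum P k (pcomp P m c j z h) \<in> carrier (sp P k)" if "j \<in> {1..m}" for j
      using symsum_closed pcomp_closed[OF that z hc] k' by simp
    have "D (act P m \<sigma> z) = (\<Oplus>\<^bsub>sp P k\<^esub>j\<in>{1..m}. symsum P k (pcomp P m c (\<sigma> j) z h))"
      unfolding D_def using e cl si by (intro V.finsum_cong') auto
    also have "\<dots> = D z"
      unfolding D_def by (rule finsum_bij[OF S_ab permutes_imp_bij[OF \<sigma>], symmetric]) (rule cl)
    finally show ?thesis .
  qed
  have Dinv: "D y = [m] \<cdot>\<^bsub>sp P k\<^esub> symsum P k (pcomp P m c 1 y h)"
  proof -
    have c1: "symsum P k (pcomp P m c 1 y h) \<in> carrier (sp P k)"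
      using symsum_closed pcomp_closed[OF _ yc hc, of 1] mge k' by simp
    have eqj: "symsum P k (pcomp P m c j y h) = symsum P k (pcomp P m c 1 y h)" if j: "j \<in> {1..m}" for j
      using pcomp_transpose[OF yi j hc] symsum_act[of _ k "pcomp P m c j y h"] pcomp_closed[OF j yc hc] k' by simp
    have "D y = (\<Oplus>\<^bsub>sp P k\<^esub>j\<in>{1..m}. symsum P k (pcomp P m c 1 y h))"
      unfolding D_def by (rule V.finsum_cong'[OF refl _ eqj]) (simp_all add: c1)
    then show ?thesis using finsum_const_nat[OF S_ab _ c1, of "{1..m}"] by simp
  qed
  have Dsym: "D (symsum P m x) = [(fact m :: nat)] \<cdot>\<^bsub>sp P k\<^esub> D x"
  proof -
    have "D (symsum P m x) = (\<Oplus>\<^bsub>sp P k\<^esub>\<sigma>\<in>perms m. D (act P m \<sigma> x))"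
      unfolding symsum_def by (rule lin_hom.sum[OF Dh]) (simp add: act_cl xc)
    also have "\<dots> = (\<Oplus>\<^bsub>sp P k\<^esub>\<sigma>\<in>perms m. D x)"
      using lin_map_closed[OF Dl xc] by (intro V.finsum_cong') (auto simp: Dact xc)
    also have "\<dots> = [(fact m :: nat)] \<cdot>\<^bsub>sp P k\<^esub> D x"
      using finsum_const_nat[OF S_ab finite_perms lin_map_closed[OF Dl xc]] by (simp add: card_perms)
    finally show ?thesis .
  qed
  define w where "w = box P (int m - 1) (int c - 1) y h"
  have wc: "w \<in> carrier (sp P k)"
    using box_closed[of y "int m - 1" h "int c - 1"] yc hc mge by (simp add: w_def k')
  have sw: "[(fact c * fact (m - 1) :: nat)] \<cdot>\<^bsub>sp P k\<^esub> w = symsum P k (pcomp P m c 1 y h)"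
    using box_scaled[OF mge yi h] by (simp add: w_def k')
  have fm: "(fact m :: nat) = m * fact (m - 1)" using mge by (simp add: fact_reduce)
  have "[(fact m * (M * fact c) :: nat)] \<cdot>\<^bsub>sp P k\<^esub> w = [(M * m * (fact c * fact (m - 1)) :: nat)] \<cdot>\<^bsub>sp P k\<^esub> w"
    by (simp add: fm algebra_simps)
  also have "\<dots> = [M] \<cdot>\<^bsub>sp P k\<^esub> ([m] \<cdot>\<^bsub>sp P k\<^esub> symsum P k (pcomp P m c 1 y h))"
    using wc by (simp only: nat_mult_mult[OF S_ab] nat_mult_closed[OF S_ab] sw[symmetric])
  also have "\<dots> = D ([M] \<cdot>\<^bsub>sp P m\<^esub> y)"
    using lin_hom.nat_mult[OF Dh yc, of M] Dinv by simp
  also have "\<dots> = [(fact m :: nat)] \<cdot>\<^bsub>sp P k\<^esub> D x" by (simp add: My Dsym)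
  finally have E0: "[(fact m * (M * fact c) :: nat)] \<cdot>\<^bsub>sp P k\<^esub> w = [(fact m :: nat)] \<cdot>\<^bsub>sp P k\<^esub> D x" .
  have "[(fact m :: nat)] \<cdot>\<^bsub>sp P k\<^esub> ([(M * fact c)] \<cdot>\<^bsub>sp P k\<^esub> w) = [(fact m :: nat)] \<cdot>\<^bsub>sp P k\<^esub> D x"
    by (rule trans[OF nat_mult_mult[OF S_ab wc, symmetric] E0])
  then have "[(M * fact c)] \<cdot>\<^bsub>sp P k\<^esub> w = D x"
    by (rule cancel[OF _ nat_mult_closed[OF S_ab wc] lin_map_closed[OF Dl xc], rotated]) simp
  then show ?thesis by (simp add: M_def w_def y_def D_def)
qed

lemma box_box_right:
  assumes a: "1 \<le> a" "1 \<le> b" and f: "f \<in> invariants P a" and g: "g \<in> invariants P b" and h: "h \<in> invariants P c"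
    and x: "x = pcomp P a b 1 f g" and k: "k = a + b + c - 2" and m: "m = a + b - 1"
  shows "[(fact b * fact (a - 1) * fact c :: nat)] \<cdot>\<^bsub>sp P k\<^esub>
      box P (int a - 1) (int (b + c - 1) - 1) f (box P (int b - 1) (int c - 1) g h) =
    (\<Oplus>\<^bsub>sp P k\<^esub>j\<in>{1..b}. symsum P k (pcomp P m c j x h))"
proof -
  interpret V: abelian_group "sp P k" by (rule S_ab)
  define l where "l = b + c - 1"
  have k': "k = a + l - 1" using a k m by (simp_all add: l_def)
  have 1: "1 \<in> {1..a}" "1 \<in> {1..b}" using a by auto
  define y where "y = box P (int b - 1) (int c - 1) g h"
  define M :: nat where "M = fact c * fact (b - 1)"
  have yi: "y \<in> invariants P l"
    using box_inv[of g "int b - 1" h "int c - 1"] g h a by (simp add: y_def l_def)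
  note fc = inv_carrier[OF f] and gc = inv_carrier[OF g] and hc = inv_carrier[OF h] and yc = inv_carrier[OF yi]
  define z where "z = pcomp P b c 1 g h"
  have zc: "z \<in> carrier (sp P l)" unfolding z_def l_def by (rule pcomp_closed[OF 1(2) gc hc])
  have My: "[M] \<cdot>\<^bsub>sp P l\<^esub> y = symsum P l z" using box_scaled[OF a(2) g h] by (simp add: y_def M_def l_def z_def)
  define D where "D v = symsum P k (pcomp P a l 1 f v)" for v
  have Dl: "lin_map K (sp P l) (sp P k) D"
    using lin_map_compose[OF symsum_lin, of "sp P l" k] pcomp_lin_right[OF 1(1) fc, of l] k' by (simp add: D_def[abs_def])
  have Dh: "lin_hom K (sp P l) (sp P k) D" by (intro lin_homI superspace_sp Dl)
  have Dact: "D (act P l \<sigma> v) = D v" if \<sigma>: "\<sigma> permutes {1..l}" and v: "v \<in> carrier (sp P l)" for \<sigma> v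
  proof -
    have "pcomp P a l 1 f (act P l \<sigma> v) = act P k (circ_perm a l 1 id \<sigma>) (pcomp P a l 1 f v)"
      using pcomp_equivariant[OF 1(1) fc v permutes_id \<sigma>] by (simp add: act_id fc k')
    then show ?thesis
      using symsum_act[of "circ_perm a l 1 id \<sigma>" k "pcomp P a l 1 f v"] circ_perm_permutes[OF 1(1) permutes_id \<sigma>]
        pcomp_closed[OF 1(1) fc v] k' by (simp add: D_def)
  qed
  have Dsym: "D (symsum P l z) = [(fact l :: nat)] \<cdot>\<^bsub>sp P k\<^esub> D z"
  proof -
    have "D (symsum P l z) = (\<Oplus>\<^bsub>sp P k\<^esub>\<sigma>\<in>perms l. D (act P l \<sigma> z))"
      unfolding symsum_def by (rule lin_hom.sum[OF Dh]) (simp add: act_cl zc)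
    also have "\<dots> = (\<Oplus>\<^bsub>sp P k\<^esub>\<sigma>\<in>perms l. D z)"
      using lin_map_closed[OF Dl zc] by (intro V.finsum_cong') (auto simp: Dact zc)
    also have "\<dots> = [(fact l :: nat)] \<cdot>\<^bsub>sp P k\<^esub> D z"
      using finsum_const_nat[OF S_ab finite_perms lin_map_closed[OF Dl zc]] by (simp add: card_perms)
    finally show ?thesis .
  qed
  have trm: "symsum P k (pcomp P m c j x h) = D z" if j: "j \<in> {1..b}" for j
  proof -
    have "pcomp P m c j x h = pcomp P a l 1 f (pcomp P b c j g h)"
      unfolding x m l_def using pcomp_assoc_seq[of 1 a j b f g h c] j a fc gc hc by simp
    moreover have "D z = D (pcomp P b c j g h)"
      unfolding z_def using pcomp_transpose[OF g j hc] Dact[of _ "pcomp P b c j g h"] pcomp_closed[OF j gc hc]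
      by (simp add: l_def)
    ultimately show ?thesis by (simp add: D_def)
  qed
  define w where "w = box P (int a - 1) (int l - 1) f y"
  have wc: "w \<in> carrier (sp P k)"
    using box_closed[of f "int a - 1" y "int l - 1"] fc yc a by (simp add: w_def k')
  have sw: "[(fact l * fact (a - 1) :: nat)] \<cdot>\<^bsub>sp P k\<^esub> w = D y"
    using box_scaled[OF a(1) f yi] by (simp add: w_def k' D_def)
  have Dzc: "D z \<in> carrier (sp P k)" by (rule lin_map_closed[OF Dl zc])
  have "[(fact l * (M * fact (a - 1)) :: nat)] \<cdot>\<^bsub>sp P k\<^esub> w = [(M * (fact l * fact (a - 1)) :: nat)] \<cdot>\<^bsub>sp P k\<^esub> w"
    by (simp add: algebra_simps)
  also have "\<dots> = [M] \<cdot>\<^bsub>sp P k\<^esub> D y"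
    using wc by (simp only: nat_mult_mult[OF S_ab] nat_mult_closed[OF S_ab] sw[symmetric])
  also have "\<dots> = D ([M] \<cdot>\<^bsub>sp P l\<^esub> y)" using lin_hom.nat_mult[OF Dh yc, of M] by simp
  also have "\<dots> = [(fact l :: nat)] \<cdot>\<^bsub>sp P k\<^esub> D z" by (simp add: My Dsym)
  finally have E0: "[(fact l * (M * fact (a - 1)) :: nat)] \<cdot>\<^bsub>sp P k\<^esub> w = [(fact l :: nat)] \<cdot>\<^bsub>sp P k\<^esub> D z" .
  have "[(fact l :: nat)] \<cdot>\<^bsub>sp P k\<^esub> ([(M * fact (a - 1))] \<cdot>\<^bsub>sp P k\<^esub> w) = [(fact l :: nat)] \<cdot>\<^bsub>sp P k\<^esub> D z"
    by (rule trans[OF nat_mult_mult[OF S_ab wc, symmetric] E0])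
  then have "[(M * fact (a - 1))] \<cdot>\<^bsub>sp P k\<^esub> w = D z"
    by (rule cancel[OF _ nat_mult_closed[OF S_ab wc] Dzc, rotated]) simp
  then have e: "[b] \<cdot>\<^bsub>sp P k\<^esub> ([(M * fact (a - 1))] \<cdot>\<^bsub>sp P k\<^esub> w) = [b] \<cdot>\<^bsub>sp P k\<^esub> D z" by simp
  have fe: "(fact b * fact (a - 1) * fact c :: nat) = b * (M * fact (a - 1))"
    using a by (simp add: M_def fact_reduce[of b])
  have "[(fact b * fact (a - 1) * fact c :: nat)] \<cdot>\<^bsub>sp P k\<^esub> w = [b] \<cdot>\<^bsub>sp P k\<^esub> D z"
    unfolding fe nat_mult_mult[OF S_ab wc, of b "M * fact (a - 1)"] by (rule e)
  also have "\<dots> = (\<Oplus>\<^bsub>sp P k\<^esub>j\<in>{1..b}. D z)" using finsum_const_nat[OF S_ab _ Dzc, of "{1..b}"] by simp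
  also have "\<dots> = (\<Oplus>\<^bsub>sp P k\<^esub>j\<in>{1..b}. symsum P k (pcomp P m c j x h))"
    using Dzc trm by (intro V.finsum_cong') auto
  finally show ?thesis by (simp add: w_def y_def l_def)
qed

definition associator :: "int \<Rightarrow> int \<Rightarrow> int \<Rightarrow> 'a \<Rightarrow> 'a \<Rightarrow> 'a \<Rightarrow> 'a" where
  "associator n m l f g h = box P (n + m) l (box P n m f g) h \<ominus>\<^bsub>sp P (ar (n + m + l))\<^esub> box P n (m + l) f (box P m l g h)"

lemma associator_closed:
  assumes "f \<in> carrier (sp P (ar n))" "g \<in> carrier (sp P (ar m))" "h \<in> carrier (sp P (ar l))"
  shows "associator n m l f g h \<in> carrier (sp P (ar (n + m + l)))"
proof -
  interpret V: abelian_group "sp P (ar (n + m + l))" by (rule S_ab)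
  have "box P n (m + l) f (box P m l g h) \<in> carrier (sp P (ar (n + (m + l))))"
    by (intro box_closed assms)
  moreover have "box P (n + m) l (box P n m f g) h \<in> carrier (sp P (ar (n + m + l)))"
    by (intro box_closed assms)
  ultimately show ?thesis unfolding associator_def by (intro V.minus_closed) (simp_all add: add.assoc)
qed

text \<open>The places inside \<open>g\<close> cancel. What is left are the parallel compositions, where \<open>g\<close> and \<open>h\<close> are
inserted in different places of \<open>f\<close>, namely in the first and in place \<open>i\<close>.\<close>

lemma associator_scaled:
  assumes a: "1 \<le> a" and f: "f \<in> invariants P a" and g: "g \<in> invariants P b" and h: "h \<in> invariants P c"
    and k: "k = a + b + c - 2"
  shows "[(fact b * fact (a - 1) * fact c :: nat)] \<cdot>\<^bsub>sp P k\<^esub> associator (int a - 1) (int b - 1) (int c - 1) f g h =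
    (\<Oplus>\<^bsub>sp P k\<^esub>i\<in>{2..a}. symsum P k (pcomp P (a + b - 1) c (b + i - 1) (pcomp P a b 1 f g) h))"
proof -
  interpret V: abelian_group "sp P k" by (rule S_ab)
  define m where "m = a + b - 1"
  define x where "x = pcomp P a b 1 f g"
  define n' m' l' where "n' = int a - 1" and "m' = int b - 1" and "l' = int c - 1"
  define L R where "L = box P (n' + m') l' (box P n' m' f g) h" and "R = box P n' (m' + l') f (box P m' l' g h)"
  define N :: nat where "N = fact b * fact (a - 1) * fact c"
  have ars: "ar n' = a" "ar m' = b" "ar l' = c" "ar (n' + m' + l') = k" by (auto simp: n'_def m'_def l'_def k ar_def)
  have nm: "n' + m' = int m - 1" using a by (simp add: n'_def m'_def m_def of_nat_diff)
  note fc = inv_carrier[OF f] and gc = inv_carrier[OF g] and hc = inv_carrier[OF h]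
  have Lc: "L \<in> carrier (sp P k)" using box_closed[OF box_closed, of f n' g m' h l'] fc gc hc by (simp add: L_def ars)
  have Rc: "R \<in> carrier (sp P k)" using box_closed[OF _ box_closed, of f n' g m' h l'] fc gc hc ars by (simp add: R_def add.assoc)
  have A: "associator n' m' l' f g h = L \<ominus>\<^bsub>sp P k\<^esub> R" by (simp add: associator_def L_def R_def ars)
  have split: "[N] \<cdot>\<^bsub>sp P k\<^esub> (L \<ominus>\<^bsub>sp P k\<^esub> R) = [N] \<cdot>\<^bsub>sp P k\<^esub> L \<ominus>\<^bsub>sp P k\<^esub> [N] \<cdot>\<^bsub>sp P k\<^esub> R"
    by (rule lin_hom.minus[OF lin_homI[OF superspace_sp superspace_sp nat_mult_lin[OF S_mod]] Lc Rc])
  have cl: "symsum P k (pcomp P m c j x h) \<in> carrier (sp P k)" if "j \<in> {1..m}" for j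
    using symsum_closed[OF pcomp_closed[OF that _ hc, of x]] pcomp_closed[OF _ fc gc, of 1] a k that by (simp add: m_def x_def)
  have NR: "[N] \<cdot>\<^bsub>sp P k\<^esub> R = (\<Oplus>\<^bsub>sp P k\<^esub>j\<in>{1..b}. symsum P k (pcomp P m c j x h))"
  proof (cases "b = 0")
    case True
    then have "box P m' l' g h = \<zero>\<^bsub>sp P (ar (m' + l'))\<^esub>" by (simp add: box_zero m'_def)
    then have "R = \<zero>\<^bsub>sp P k\<^esub>" using box_zero_arg(2)[of f n' "m' + l'"] fc ars by (simp add: R_def add.assoc)
    then show ?thesis using True by simp
  next
    case False
    then have "m' + l' = int (b + c - 1) - 1" by (simp add: m'_def l'_def of_nat_diff)
    then show ?thesis
      using box_box_right[OF a _ f g h x_def k m_def] False by (simp add: R_def N_def n'_def m'_def l'_def)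
  qed
  have img: "(\<lambda>i. b + i - 1) ` {2..a} = {b + 1..m}"
  proof -
    have "{b + 1..m} \<subseteq> (\<lambda>i. b + i - 1) ` {2..a}"
    proof
      fix j assume "j \<in> {b + 1..m}"
      then show "j \<in> (\<lambda>i. b + i - 1) ` {2..a}" using a by (intro image_eqI[of _ _ "j + 1 - b"]) (auto simp: m_def)
    qed
    then show ?thesis using a by (auto simp: m_def)
  qed
  have re: "(\<Oplus>\<^bsub>sp P k\<^esub>j\<in>{b + 1..m}. symsum P k (pcomp P m c j x h)) =
    (\<Oplus>\<^bsub>sp P k\<^esub>i\<in>{2..a}. symsum P k (pcomp P m c (b + i - 1) x h))"
  proof (rule finsum_bij[OF S_ab])
    show "bij_betw (\<lambda>i. b + i - 1) {2..a} {b + 1..m}"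
      unfolding bij_betw_def using img by (auto simp: inj_on_def)
  qed (auto intro: cl)
  have "[N] \<cdot>\<^bsub>sp P k\<^esub> (L \<ominus>\<^bsub>sp P k\<^esub> R) = (\<Oplus>\<^bsub>sp P k\<^esub>j\<in>{b + 1..m}. symsum P k (pcomp P m c j x h))"
  proof (cases "m = 0")
    case True
    then have ab: "a = 1" "b = 0" using a by (auto simp: m_def)
    have "L = \<zero>\<^bsub>sp P k\<^esub>" unfolding L_def nm using True box_zero[of "-1" l'] by (simp add: k l'_def ab) (simp add: ar_def nat_minus_as_int)
    then show ?thesis unfolding split NR using True ab by (simp add: a_minus_def neg_zero S_ab)
  next
    case False
    have "[N] \<cdot>\<^bsub>sp P k\<^esub> L = (\<Oplus>\<^bsub>sp P k\<^esub>j\<in>{1..m}. symsum P k (pcomp P m c j x h))"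
      using box_box_left[OF a _ f g h x_def k m_def] False by (simp add: m_def L_def N_def nm[unfolded m_def]) (simp add: n'_def m'_def l'_def)
    also have "{1..m} = {1..b} \<union> {b + 1..m}" using False a by (auto simp: m_def)
    also have "(\<Oplus>\<^bsub>sp P k\<^esub>j\<in>{1..b} \<union> {b + 1..m}. symsum P k (pcomp P m c j x h)) =
      (\<Oplus>\<^bsub>sp P k\<^esub>j\<in>{1..b}. symsum P k (pcomp P m c j x h)) \<oplus>\<^bsub>sp P k\<^esub> (\<Oplus>\<^bsub>sp P k\<^esub>j\<in>{b + 1..m}. symsum P k (pcomp P m c j x h))"
    proof (rule V.finsum_Un_disjoint)
      have "{1..b} \<subseteq> {1..m}" "{b + 1..m} \<subseteq> {1..m}" using a by (auto simp: m_def)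
      then show "(\<lambda>j. symsum P k (pcomp P m c j x h)) \<in> {1..b} \<rightarrow> carrier (sp P k)"
        "(\<lambda>j. symsum P k (pcomp P m c j x h)) \<in> {b + 1..m} \<rightarrow> carrier (sp P k)" using cl by blast+
    qed auto
    finally have NL: "[N] \<cdot>\<^bsub>sp P k\<^esub> L = [N] \<cdot>\<^bsub>sp P k\<^esub> R \<oplus>\<^bsub>sp P k\<^esub> (\<Oplus>\<^bsub>sp P k\<^esub>j\<in>{b + 1..m}. symsum P k (pcomp P m c j x h))"
      by (simp only: NR)
    have "(\<Oplus>\<^bsub>sp P k\<^esub>j\<in>{b + 1..m}. symsum P k (pcomp P m c j x h)) \<in> carrier (sp P k)"
      by (rule V.finsum_closed) (use cl in auto)
    moreover have "[N] \<cdot>\<^bsub>sp P k\<^esub> R \<in> carrier (sp P k)" by (rule nat_mult_closed[OF S_ab Rc])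
    ultimately show ?thesis unfolding split NL by (simp add: a_minus_def V.a_ac V.r_neg V.r_neg1 V.r_neg2)
  qed
  then show ?thesis unfolding A[symmetric] re by (simp add: N_def n'_def m'_def l'_def x_def m_def)
qed

text \<open>A transposition of the first and the \<open>i\<close>-th place of \<open>f\<close> exchanges the roles of \<open>g\<close> and
\<open>h\<close>; the sign comes from the axiom for parallel compositions.\<close>

lemma associator_term_symm:
  assumes i: "i \<in> {2..a}" and f: "f \<in> invariants P a"
    and g: "g \<in> hpart (sp P b) q" and h: "h \<in> hpart (sp P c) r" and k: "k = a + b + c - 2"
  shows "symsum P k (pcomp P (a + c - 1) b (c + i - 1) (pcomp P a c 1 f h) g) =
    signed (sp P k) (q * r) (symsum P k (pcomp P (a + b - 1) c (b + i - 1) (pcomp P a b 1 f g) h))"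
proof -
  have i1: "i \<in> {1..a}" "1 \<in> {1..a}" using i by auto
  note fc = inv_carrier[OF f] and gc = superspace.hpart_closed[OF superspace_sp g] and hc = superspace.hpart_closed[OF superspace_sp h]
  let ?m = "a + c - 1" and ?j = "c + i - 1"
  let ?\<sigma> = "transpose 1 i"
  let ?\<pi> = "circ_perm a c 1 ?\<sigma> id"
  have \<sigma>: "?\<sigma> permutes {1..a}" using i1 by (intro permutes_swap_id) auto
  have z: "pcomp P a c i f h \<in> carrier (sp P ?m)" by (rule pcomp_closed[OF i1(1) fc hc])
  note tr = pcomp_transpose[OF f i1(1) hc]
  have j: "?j \<in> {1..?m}" "b + i - 1 \<in> {1..a + b - 1}" "1 \<in> {1..?m}" using i by auto
  have pj: "?\<pi> ?j = 1"
    using circ_perm_outside[OF i1(2) \<sigma> i1(1), of c id] i by (simp add: add.commute)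
  have ks: "?m + b - 1 = k" "a + b - 1 + c - 1 = k" using i k by auto
  have "pcomp P ?m b ?j (pcomp P a c 1 f h) g =
    act P k (circ_perm ?m b ?j ?\<pi> id) (pcomp P ?m b 1 (pcomp P a c i f h) g)"
    using pcomp_equivariant[OF j(1) z gc tr(2) permutes_id] by (simp add: tr(1)[symmetric] act_id gc pj ks)
  then have "symsum P k (pcomp P ?m b ?j (pcomp P a c 1 f h) g) = symsum P k (pcomp P ?m b 1 (pcomp P a c i f h) g)"
    using symsum_act[of "circ_perm ?m b ?j ?\<pi> id" k] circ_perm_permutes[OF j(1) tr(2) permutes_id, of b] pcomp_closed[OF j(3) z gc]
    by (simp add: ks)
  also have "pcomp P ?m b 1 (pcomp P a c i f h) g = signed (sp P k) (q * r) (pcomp P (a + b - 1) c (b + i - 1) (pcomp P a b 1 f g) h)"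
  proof -
    have "a + c + b - 2 = k" using k by simp
    then show ?thesis using pcomp_assoc_par[of 1 i a f h c r g b q] i fc g h by (simp add: mult.commute)
  qed
  also have "symsum P k \<dots> = signed (sp P k) (q * r) (symsum P k (pcomp P (a + b - 1) c (b + i - 1) (pcomp P a b 1 f g) h))"
  proof (rule lin_hom.signed[OF symsum_hom])
    show "pcomp P (a + b - 1) c (b + i - 1) (pcomp P a b 1 f g) h \<in> carrier (sp P k)"
      using pcomp_closed[OF j(2) pcomp_closed[OF i1(2) fc gc] hc] ks by simp
  qed
  finally show ?thesis .
qed

text \<open>Up to a sign the associator is symmetric in its last two arguments, that is, \<open>box\<close> is a right pre-Lie
product. For \<open>f\<close> of degree $-1$ there are no places to insert anything, and both sides vanish.\<close>

lemma associator_symm: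
  assumes deg: "n \<ge> -1" "m \<ge> -1" "l \<ge> -1" and f: "f \<in> invariants P (ar n)"
    and g: "g \<in> invariants P (ar m)" "g \<in> hpart (sp P (ar m)) q"
    and h: "h \<in> invariants P (ar l)" "h \<in> hpart (sp P (ar l)) r"
  shows "associator n m l f g h = signed (sp P (ar (n + m + l))) (q * r) (associator n l m f h g)"
proof (cases "n = -1")
  case True
  have ac: "n + l + m = n + m + l" by simp
  interpret V: abelian_group "sp P (ar (n + (m + l)))" by (rule S_ab)
  have "box P n m' u v = \<zero>\<^bsub>sp P (ar (n + m'))\<^esub>" for m' u v using True by (simp add: box_zero)
  then have "associator n m l f g h = \<zero>\<^bsub>sp P (ar (n + m + l))\<^esub>" "associator n l m f h g = \<zero>\<^bsub>sp P (ar (n + m + l))\<^esub>"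
    using box_zero_arg(1)[of h l "n + m"] box_zero_arg(1)[of g m "n + l"] g h
    by (auto simp: associator_def inv_carrier a_minus_def neg_zero S_ab ac add.assoc add.commute[of l m])
  then show ?thesis by (simp add: signed_def neg_zero S_ab)
next
  case False
  define a b c where "a = ar n" and "b = ar m" and "c = ar l"
  define k where "k = a + b + c - 2"
  have e: "n = int a - 1" "m = int b - 1" "l = int c - 1" "1 \<le> a" "ar (n + m + l) = k" "n + l + m = n + m + l" "k = a + c + b - 2"
    using deg False by (auto simp: a_def b_def c_def ar_def k_def)
  have inv: "f \<in> invariants P a" "g \<in> invariants P b" "h \<in> invariants P c" using f g h by (auto simp: a_def b_def c_def)
  have hp: "g \<in> hpart (sp P b) q" "h \<in> hpart (sp P c) r" using g h by (auto simp: b_def c_def)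
  interpret V: abelian_group "sp P k" by (rule S_ab)
  define N :: nat where "N = fact b * fact (a - 1) * fact c"
  have N': "N = fact c * fact (a - 1) * fact b" by (simp add: N_def)
  note Ac = associator_closed[OF f[THEN inv_carrier] g(1)[THEN inv_carrier] h(1)[THEN inv_carrier], unfolded e(5)]
  note Ac' = associator_closed[OF f[THEN inv_carrier] h(1)[THEN inv_carrier] g(1)[THEN inv_carrier], unfolded e(6) e(5)]
  let ?t = "\<lambda>i. symsum P k (pcomp P (a + b - 1) c (b + i - 1) (pcomp P a b 1 f g) h)"
  have tc: "?t i \<in> carrier (sp P k)" if "i \<in> {2..a}" for i
  proof -
    have j: "b + i - 1 \<in> {1..a + b - 1}" "1 \<in> {1..a}" "a + b - 1 + c - 1 = k" using that by (auto simp: k_def)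
    have "pcomp P a b 1 f g \<in> carrier (sp P (a + b - 1))" using inv by (intro pcomp_closed[OF j(2)] inv_carrier)
    then show ?thesis using symsum_closed pcomp_closed[OF j(1) _ inv_carrier[OF inv(3)]] j(3) by simp
  qed
  have sg: "lin_hom K (sp P k) (sp P k) (signed (sp P k) (q * r))"
    by (intro lin_homI superspace_sp lin_map_signed S_mod lin_map_id)
  have "[N] \<cdot>\<^bsub>sp P k\<^esub> associator n l m f h g =
    (\<Oplus>\<^bsub>sp P k\<^esub>i\<in>{2..a}. symsum P k (pcomp P (a + c - 1) b (c + i - 1) (pcomp P a c 1 f h) g))"
    using associator_scaled[OF e(4) inv(1,3,2) e(7)] by (simp add: N' e)
  also have "\<dots> = (\<Oplus>\<^bsub>sp P k\<^esub>i\<in>{2..a}. signed (sp P k) (q * r) (?t i))"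
    using associator_term_symm[OF _ inv(1) hp k_def] tc lin_hom.closed[OF sg] by (intro V.finsum_cong') auto
  also have "\<dots> = signed (sp P k) (q * r) (\<Oplus>\<^bsub>sp P k\<^esub>i\<in>{2..a}. ?t i)"
    by (rule lin_hom.sum[OF sg tc, symmetric])
  also have "(\<Oplus>\<^bsub>sp P k\<^esub>i\<in>{2..a}. ?t i) = [N] \<cdot>\<^bsub>sp P k\<^esub> associator n m l f g h"
    using associator_scaled[OF e(4) inv k_def] by (simp add: N_def e)
  also have "signed (sp P k) (q * r) \<dots> = [N] \<cdot>\<^bsub>sp P k\<^esub> signed (sp P k) (q * r) (associator n m l f g h)"
    by (rule lin_hom.nat_mult[OF sg Ac])
  finally have "associator n l m f h g = signed (sp P k) (q * r) (associator n m l f g h)"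
    by (rule cancel[OF _ Ac' lin_hom.closed[OF sg Ac], rotated]) (simp add: N_def)
  then have "signed (sp P k) (q * r) (associator n l m f h g) = associator n m l f g h"
    using superspace.signed_signed[OF superspace_sp Ac] by (simp add: signed_def)
  then show ?thesis unfolding e(5) by (rule sym)
qed

end

section \<open>The graded Lie superalgebra of a pseudo operad\<close>

lemma finite_bit_UNIV: "finite (UNIV :: bit set)"
  by (simp add: bit_UNIV)

context linear_pseudo_operad
begin

lemma box_closed': "\<lbrakk>f \<in> carrier (sp P (ar n)); g \<in> carrier (sp P (ar m))\<rbrakk> \<Longrightarrow> box P m n g f \<in> carrier (sp P (ar (n + m)))"
  using box_closed[of g m f n] by (simp add: add.commute)

lemma box_brk_lin_left:
  assumes g: "g \<in> carrier (sp P (ar m))"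
  shows "lin_map K (sp P (ar n)) (sp P (ar (n + m))) (\<lambda>f. box_brk P n m f g)"
proof -
  have 1: "lin_map K (sp P (ar n)) (sp P (ar (n + m))) (\<lambda>f. box P n m (hproj (sp P (ar n)) p f) (hproj (sp P (ar m)) q g))" for p q
    by (intro lin_map_compose[OF box_lin_left] superspace.hproj_lin[OF superspace_sp] superspace.hproj_closed[OF superspace_sp] g)
  have "lin_map K (sp P (ar n)) (sp P (ar (m + n))) (\<lambda>f. box P m n (hproj (sp P (ar m)) q g) (hproj (sp P (ar n)) p f))" for p q
    by (intro lin_map_compose[OF box_lin_right] superspace.hproj_lin[OF superspace_sp] superspace.hproj_closed[OF superspace_sp] g)
  then have 2: "lin_map K (sp P (ar n)) (sp P (ar (n + m))) (\<lambda>f. box P m n (hproj (sp P (ar m)) q g) (hproj (sp P (ar n)) p f))" for p q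
    by (simp add: add.commute)
  show ?thesis unfolding box_brk_def Let_def
    by (intro lin_map_sum S_mod lin_map_minus lin_map_signed 1 2)
qed

lemma box_brk_lin_right:
  assumes f: "f \<in> carrier (sp P (ar n))"
  shows "lin_map K (sp P (ar m)) (sp P (ar (n + m))) (\<lambda>g. box_brk P n m f g)"
proof -
  have 1: "lin_map K (sp P (ar m)) (sp P (ar (n + m))) (\<lambda>g. box P n m (hproj (sp P (ar n)) p f) (hproj (sp P (ar m)) q g))" for p q
    by (intro lin_map_compose[OF box_lin_right] superspace.hproj_lin[OF superspace_sp] superspace.hproj_closed[OF superspace_sp] f)
  have "lin_map K (sp P (ar m)) (sp P (ar (m + n))) (\<lambda>g. box P m n (hproj (sp P (ar m)) q g) (hproj (sp P (ar n)) p f))" for p q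
    by (intro lin_map_compose[OF box_lin_left] superspace.hproj_lin[OF superspace_sp] superspace.hproj_closed[OF superspace_sp] f)
  then have 2: "lin_map K (sp P (ar m)) (sp P (ar (n + m))) (\<lambda>g. box P m n (hproj (sp P (ar m)) q g) (hproj (sp P (ar n)) p f))" for p q
    by (simp add: add.commute)
  show ?thesis unfolding box_brk_def Let_def
    by (intro lin_map_sum S_mod lin_map_minus lin_map_signed 1 2)
qed

lemma box_brk_closed: "\<lbrakk>f \<in> carrier (sp P (ar n)); g \<in> carrier (sp P (ar m))\<rbrakk> \<Longrightarrow> box_brk P n m f g \<in> carrier (sp P (ar (n + m)))"
  by (rule lin_map_closed[OF box_brk_lin_left])

lemma box_brk_zero_arg:
  "g \<in> carrier (sp P (ar m)) \<Longrightarrow> box_brk P n m \<zero>\<^bsub>sp P (ar n)\<^esub> g = \<zero>\<^bsub>sp P (ar (n + m))\<^esub>"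
  "f \<in> carrier (sp P (ar n)) \<Longrightarrow> box_brk P n m f \<zero>\<^bsub>sp P (ar m)\<^esub> = \<zero>\<^bsub>sp P (ar (n + m))\<^esub>"
  using lin_hom.zero[OF lin_homI[OF superspace_sp superspace_sp box_brk_lin_left]]
    lin_hom.zero[OF lin_homI[OF superspace_sp superspace_sp box_brk_lin_right]] by auto

text \<open>On homogeneous elements the bilinear extension has only one nonzero summand, the intended one.\<close>

lemma box_brk_homog:
  assumes f: "f \<in> hpart (sp P (ar n)) p" and g: "g \<in> hpart (sp P (ar m)) q"
  shows "box_brk P n m f g = box P n m f g \<ominus>\<^bsub>sp P (ar (n + m))\<^esub> signed (sp P (ar (n + m))) (p * q) (box P m n g f)"
proof -
  let ?V = "sp P (ar (n + m))"
  interpret V: superspace K ?V by (rule superspace_sp)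
  note fc = superspace.hpart_closed[OF superspace_sp f] and gc = superspace.hpart_closed[OF superspace_sp g]
  define T where "T p' q' = box P n m (hproj (sp P (ar n)) p' f) (hproj (sp P (ar m)) q' g) \<ominus>\<^bsub>?V\<^esub>
    signed ?V (p' * q') (box P m n (hproj (sp P (ar m)) q' g) (hproj (sp P (ar n)) p' f))" for p' q'
  note hp = superspace.hproj_closed[OF superspace_sp fc] superspace.hproj_closed[OF superspace_sp gc]
  have z: "T p' q' = \<zero>\<^bsub>?V\<^esub>" if "p' \<noteq> p \<or> q' \<noteq> q" for p' q'
    using that superspace.hproj_other[OF superspace_sp f, of p'] superspace.hproj_other[OF superspace_sp g, of q']
    by (auto simp: T_def box_zero_arg hp V.signed_zero a_minus_def neg_zero S_ab add.commute[of m n])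
  have Tc: "T p' q' \<in> carrier ?V" for p' q'
    unfolding T_def by (intro V.minus_closed V.signed_closed box_closed box_closed' hp)
  have "box_brk P n m f g = (\<Oplus>\<^bsub>?V\<^esub>p'\<in>UNIV. \<Oplus>\<^bsub>?V\<^esub>q'\<in>UNIV. T p' q')"
    by (simp add: box_brk_def T_def Let_def)
  also have "\<dots> = (\<Oplus>\<^bsub>?V\<^esub>q'\<in>UNIV. T p q')"
    by (rule finsum_single[OF S_ab]) (auto intro!: V.finsum_closed V.add.finprod_one_eqI simp: Tc z finite_bit_UNIV)
  also have "\<dots> = T p q" by (rule finsum_single[OF S_ab]) (auto simp: Tc z finite_bit_UNIV)
  finally show ?thesis
    by (simp add: T_def superspace.hproj_same[OF superspace_sp f] superspace.hproj_same[OF superspace_sp g])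
qed

lemma box_brk_parity:
  assumes f: "f \<in> hpart (sp P (ar n)) p" and g: "g \<in> hpart (sp P (ar m)) q"
  shows "box_brk P n m f g \<in> hpart (sp P (ar (n + m))) (p + q)"
  unfolding box_brk_homog[OF assms]
  using box_parity[OF f g] box_parity[OF g f]
  by (intro superspace.hpart_minus[OF superspace_sp] superspace.hpart_signed[OF superspace_sp]) (simp_all add: add.commute)

lemma box_brk_skew:
  assumes f: "f \<in> hpart (sp P (ar n)) p" and g: "g \<in> hpart (sp P (ar m)) q"
  shows "box_brk P n m f g = \<ominus>\<^bsub>sp P (ar (n + m))\<^esub> signed (sp P (ar (n + m))) (p * q) (box_brk P m n g f)"
proof -
  let ?V = "sp P (ar (n + m))"
  interpret V: superspace K ?V by (rule superspace_sp)
  note fc = superspace.hpart_closed[OF superspace_sp f] and gc = superspace.hpart_closed[OF superspace_sp g]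
  have c: "box P n m f g \<in> carrier ?V" "box P m n g f \<in> carrier ?V" by (rule box_closed[OF fc gc], rule box_closed'[OF fc gc])
  have e: "box_brk P m n g f = box P m n g f \<ominus>\<^bsub>?V\<^esub> signed ?V (p * q) (box P n m f g)"
    using box_brk_homog[OF g f] by (simp add: add.commute mult.commute)
  show ?thesis unfolding box_brk_homog[OF f g] e using c
    by (auto simp: signed_def a_minus_def V.M.minus_add V.M.a_comm)
qed

lemma box_brk_low: "n < -1 \<or> m < -1 \<or> (n < 0 \<and> m < 0) \<Longrightarrow> box_brk P n m f g = \<zero>\<^bsub>sp P (ar (n + m))\<^esub>"
proof -
  interpret V: superspace K "sp P (ar (n + m))" by (rule superspace_sp)
  assume "n < -1 \<or> m < -1 \<or> (n < 0 \<and> m < 0)"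
  then have "box P n m f' g' = \<zero>\<^bsub>sp P (ar (n + m))\<^esub>" "box P m n g' f' = \<zero>\<^bsub>sp P (ar (n + m))\<^esub>" for f' g'
    using box_zero[of n m] box_zero[of m n] by (auto simp: add.commute)
  then show ?thesis by (simp add: box_brk_def V.signed_zero a_minus_def neg_zero S_ab)
qed

end

context pseudo_operad_char0
begin

lemma box_brk_inv:
  assumes f: "f \<in> invariants P (ar n)" and g: "g \<in> invariants P (ar m)"
  shows "box_brk P n m f g \<in> invariants P (ar (n + m))"
proof -
  have 1: "box P n m (hproj (sp P (ar n)) p f) (hproj (sp P (ar m)) q g) \<in> invariants P (ar (n + m))" for p q
    by (intro box_inv inv_hproj f g)
  have "box P m n (hproj (sp P (ar m)) q g) (hproj (sp P (ar n)) p f) \<in> invariants P (ar (m + n))" for p q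
    by (intro box_inv inv_hproj f g)
  then have 2: "box P m n (hproj (sp P (ar m)) q g) (hproj (sp P (ar n)) p f) \<in> invariants P (ar (n + m))" for p q
    by (simp add: add.commute)
  show ?thesis unfolding box_brk_def Let_def by (intro inv_sum inv_minus inv_signed 1 2)
qed

text \<open>The case of \<open>pre_lie_jacobi\<close> where the twelve elements are the triple products of \<open>f\<close>, \<open>g\<close>
and \<open>h\<close>.\<close>

lemma box_brk_jacobi:
  assumes deg: "n \<ge> -1" "m \<ge> -1" "l \<ge> -1"
    and f: "f \<in> invariants P (ar n)" "f \<in> hpart (sp P (ar n)) p"
    and g: "g \<in> invariants P (ar m)" "g \<in> hpart (sp P (ar m)) q"
    and h: "h \<in> invariants P (ar l)" "h \<in> hpart (sp P (ar l)) r"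
  shows "box_brk P n (m + l) f (box_brk P m l g h) = box_brk P (n + m) l (box_brk P n m f g) h
    \<oplus>\<^bsub>sp P (ar (n + m + l))\<^esub> signed (sp P (ar (n + m + l))) (p * q) (box_brk P m (n + l) g (box_brk P n l f h))"
proof -
  let ?k = "ar (n + m + l)"
  let ?V = "sp P ?k"
  interpret V: superspace K ?V by (rule superspace_sp)
  note c = inv_carrier[OF f(1)] inv_carrier[OF g(1)] inv_carrier[OF h(1)]
  define x where "x i = (case i of 0 \<Rightarrow> box P (n + m) l (box P n m f g) h | Suc i1 \<Rightarrow>
    (case i1 of 0 \<Rightarrow> box P n (m + l) f (box P m l g h) | Suc i2 \<Rightarrow>
    (case i2 of 0 \<Rightarrow> box P (n + l) m (box P n l f h) g | Suc i3 \<Rightarrow>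
    (case i3 of 0 \<Rightarrow> box P n (l + m) f (box P l m h g) | Suc i4 \<Rightarrow>
    (case i4 of 0 \<Rightarrow> box P (m + n) l (box P m n g f) h | Suc i5 \<Rightarrow>
    (case i5 of 0 \<Rightarrow> box P m (n + l) g (box P n l f h) | Suc i6 \<Rightarrow>
    (case i6 of 0 \<Rightarrow> box P (m + l) n (box P m l g h) f | Suc i7 \<Rightarrow>
    (case i7 of 0 \<Rightarrow> box P m (l + n) g (box P l n h f) | Suc i8 \<Rightarrow>
    (case i8 of 0 \<Rightarrow> box P (l + n) m (box P l n h f) g | Suc i9 \<Rightarrow>
    (case i9 of 0 \<Rightarrow> box P l (n + m) h (box P n m f g) | Suc i10 \<Rightarrow>
    (case i10 of 0 \<Rightarrow> box P (l + m) n (box P l m h g) f | Suc i11 \<Rightarrow>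
    box P l (m + n) h (box P m n g f))))))))))))" for i :: nat
  have xs: "x 0 = box P (n + m) l (box P n m f g) h" "x 1 = box P n (m + l) f (box P m l g h)"
    "x 2 = box P (n + l) m (box P n l f h) g" "x 3 = box P n (l + m) f (box P l m h g)"
    "x 4 = box P (m + n) l (box P m n g f) h" "x 5 = box P m (n + l) g (box P n l f h)"
    "x 6 = box P (m + l) n (box P m l g h) f" "x 7 = box P m (l + n) g (box P l n h f)"
    "x 8 = box P (l + n) m (box P l n h f) g" "x 9 = box P l (n + m) h (box P n m f g)"
    "x 10 = box P (l + m) n (box P l m h g) f" "x 11 = box P l (m + n) h (box P m n g f)"
    by (simp_all add: x_def eval_nat_numeral One_nat_def)
  have L: "box P (n1 + n2) n3 (box P n1 n2 u v) w \<in> carrier ?V"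
    if "n1 + n2 + n3 = n + m + l" "u \<in> carrier (sp P (ar n1))" "v \<in> carrier (sp P (ar n2))" "w \<in> carrier (sp P (ar n3))" for n1 n2 n3 u v w
    using box_closed[OF box_closed[OF that(2,3)] that(4)] that(1) by simp
  have R: "box P n1 (n2 + n3) u (box P n2 n3 v w) \<in> carrier ?V"
    if "n1 + n2 + n3 = n + m + l" "u \<in> carrier (sp P (ar n1))" "v \<in> carrier (sp P (ar n2))" "w \<in> carrier (sp P (ar n3))" for n1 n2 n3 u v w
    using box_closed[OF that(2) box_closed[OF that(3,4)]] that(1) by (simp add: add.assoc)
  have xc: "x i \<in> carrier ?V" for i
    unfolding x_def by (simp split: nat.split add: L R c)
  have r1: "x 0 \<ominus>\<^bsub>?V\<^esub> x 1 = signed ?V (q * r) (x 2 \<ominus>\<^bsub>?V\<^esub> x 3)"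
    using associator_symm[OF deg f(1) g h] by (simp add: associator_def xs add.commute add.left_commute)
  have r2: "x 4 \<ominus>\<^bsub>?V\<^esub> x 5 = signed ?V (p * r) (x 6 \<ominus>\<^bsub>?V\<^esub> x 7)"
    using associator_symm[OF deg(2,1,3) g(1) f h] by (simp add: associator_def xs add.commute add.left_commute)
  have r3: "x 8 \<ominus>\<^bsub>?V\<^esub> x 9 = signed ?V (p * q) (x 10 \<ominus>\<^bsub>?V\<^esub> x 11)"
    using associator_symm[OF deg(3,1,2) h(1) f g] by (simp add: associator_def xs add.commute add.left_commute)
  have ll: "box P (n1 + n2) n3 (box P n1 n2 u v \<ominus>\<^bsub>sp P (ar (n1 + n2))\<^esub> signed (sp P (ar (n1 + n2))) s (box P n2 n1 v u)) w =
     box P (n1 + n2) n3 (box P n1 n2 u v) w \<ominus>\<^bsub>?V\<^esub> signed ?V s (box P (n2 + n1) n3 (box P n2 n1 v u) w)"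
    if "n1 + n2 + n3 = n + m + l" "u \<in> carrier (sp P (ar n1))" "v \<in> carrier (sp P (ar n2))" "w \<in> carrier (sp P (ar n3))" for n1 n2 n3 u v w s
  proof -
    interpret h: lin_hom K "sp P (ar (n1 + n2))" ?V "\<lambda>y. box P (n1 + n2) n3 y w"
      using lin_homI[OF superspace_sp superspace_sp box_lin_left[OF that(4), of "n1 + n2"]] that(1) by simp
    have cc: "box P n1 n2 u v \<in> carrier (sp P (ar (n1 + n2)))" "box P n2 n1 v u \<in> carrier (sp P (ar (n1 + n2)))"
      by (rule box_closed[OF that(2,3)], rule box_closed'[OF that(2,3)])
    show ?thesis using cc superspace.signed_closed[OF superspace_sp cc(2)]
      by (simp add: h.minus h.signed add.commute[of n2 n1])
  qed
  have rr: "box P n3 (n1 + n2) w (box P n1 n2 u v \<ominus>\<^bsub>sp P (ar (n1 + n2))\<^esub> signed (sp P (ar (n1 + n2))) s (box P n2 n1 v u)) =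
     box P n3 (n1 + n2) w (box P n1 n2 u v) \<ominus>\<^bsub>?V\<^esub> signed ?V s (box P n3 (n2 + n1) w (box P n2 n1 v u))"
    if "n3 + (n1 + n2) = n + m + l" "u \<in> carrier (sp P (ar n1))" "v \<in> carrier (sp P (ar n2))" "w \<in> carrier (sp P (ar n3))" for n1 n2 n3 u v w s
  proof -
    interpret h: lin_hom K "sp P (ar (n1 + n2))" ?V "\<lambda>y. box P n3 (n1 + n2) w y"
      using lin_homI[OF superspace_sp superspace_sp box_lin_right[OF that(4), of "n1 + n2"]] that(1) by simp
    have cc: "box P n1 n2 u v \<in> carrier (sp P (ar (n1 + n2)))" "box P n2 n1 v u \<in> carrier (sp P (ar (n1 + n2)))"
      by (rule box_closed[OF that(2,3)], rule box_closed'[OF that(2,3)])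
    show ?thesis using cc superspace.signed_closed[OF superspace_sp cc(2)]
      by (simp add: h.minus h.signed add.commute[of n2 n1])
  qed
  have T1: "box_brk P n (m + l) f (box_brk P m l g h) = (x 1 \<ominus>\<^bsub>?V\<^esub> signed ?V (q * r) (x 3)) \<ominus>\<^bsub>?V\<^esub>
    signed ?V (p * (q + r)) (x 6 \<ominus>\<^bsub>?V\<^esub> signed ?V (q * r) (x 10))"
  proof -
    have 1: "n + (m + l) = n + m + l" "m + l + n = n + m + l" by simp_all
    have "box_brk P n (m + l) f (box_brk P m l g h) = box P n (m + l) f (box_brk P m l g h) \<ominus>\<^bsub>?V\<^esub>
      signed ?V (p * (q + r)) (box P (m + l) n (box_brk P m l g h) f)"
      using box_brk_homog[OF f(2) box_brk_parity[OF g(2) h(2)]] unfolding 1 .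
    then show ?thesis unfolding box_brk_homog[OF g(2) h(2)] rr[OF 1(1) c(2,3,1)] ll[OF 1(2) c(2,3,1)] xs .
  qed
  have T2: "box_brk P (n + m) l (box_brk P n m f g) h = (x 0 \<ominus>\<^bsub>?V\<^esub> signed ?V (p * q) (x 4)) \<ominus>\<^bsub>?V\<^esub>
    signed ?V ((p + q) * r) (x 9 \<ominus>\<^bsub>?V\<^esub> signed ?V (p * q) (x 11))"
  proof -
    have 1: "l + (n + m) = n + m + l" by simp
    have "box_brk P (n + m) l (box_brk P n m f g) h = box P (n + m) l (box_brk P n m f g) h \<ominus>\<^bsub>?V\<^esub>
      signed ?V ((p + q) * r) (box P l (n + m) h (box_brk P n m f g))"
      using box_brk_homog[OF box_brk_parity[OF f(2) g(2)] h(2)] .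
    then show ?thesis unfolding box_brk_homog[OF f(2) g(2)] rr[OF 1 c(1,2,3)] ll[OF refl c(1,2,3)] xs .
  qed
  have T3: "box_brk P m (n + l) g (box_brk P n l f h) = (x 5 \<ominus>\<^bsub>?V\<^esub> signed ?V (p * r) (x 7)) \<ominus>\<^bsub>?V\<^esub>
    signed ?V (q * (p + r)) (x 2 \<ominus>\<^bsub>?V\<^esub> signed ?V (p * r) (x 8))"
  proof -
    have 1: "m + (n + l) = n + m + l" "n + l + m = n + m + l" by simp_all
    have "box_brk P m (n + l) g (box_brk P n l f h) = box P m (n + l) g (box_brk P n l f h) \<ominus>\<^bsub>?V\<^esub>
      signed ?V (q * (p + r)) (box P (n + l) m (box_brk P n l f h) g)"
      using box_brk_homog[OF g(2) box_brk_parity[OF f(2) h(2)]] unfolding 1 .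
    then show ?thesis unfolding box_brk_homog[OF f(2) h(2)] rr[OF 1(1) c(1,3,2)] ll[OF 1(2) c(1,3,2)] xs .
  qed
  show ?thesis unfolding T1 T2 T3 by (rule V.M.pre_lie_jacobi[OF xc r1 r2 r3])
qed

end

section \<open>Assembling the degrees\<close>

lemma W_alg_simps:
  "carrier (W_alg P) = carrier (W_space P)" "zero (W_alg P) = zero (W_space P)"
  "add (W_alg P) = add (W_space P)" "smult (W_alg P) = smult (W_space P)"
  "hpart (W_alg P) = hpart (W_space P)" "deg (W_alg P) = W_deg P"
  "brk (W_alg P) = (\<lambda>v w. \<lambda>k\<in>{-1..}. \<Oplus>\<^bsub>sp P (ar k)\<^esub>n\<in>{-1..k + 1}. box_brk P n (k - n) (v n) (w (k - n)))"
  by (simp_all add: W_alg_def superspace.defs graded_lsa.defs)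

text \<open>A graded Lie superalgebra is a superspace with further components. The following lemmas transfer
notions that depend only on the fields of the underlying module.\<close>

lemma finsum_fields:
  "\<lbrakk>carrier W = carrier V; zero W = zero V; add W = add V\<rbrakk> \<Longrightarrow> finsum W f A = finsum V f A"
  by (simp add: finsum_def finprod_def)

lemma a_inv_fields:
  "\<lbrakk>carrier W = carrier V; zero W = zero V; add W = add V\<rbrakk> \<Longrightarrow> a_inv W = a_inv V"
  by (intro ext) (simp add: a_inv_def m_inv_def)

lemma submodule_fields:
  "\<lbrakk>carrier W = carrier V; zero W = zero V; add W = add V; smult W = smult V\<rbrakk> \<Longrightarrow> submodule H K W \<longleftrightarrow> submodule H K V"
  by (simp add: submodule_def submodule_axioms_def subgroup_def m_inv_def)

lemma W_alg_finsum: "finsum (W_alg P) f A = finsum (W_space P) f A"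
  by (rule finsum_fields) (simp_all add: W_alg_simps)

lemma W_alg_a_inv: "a_inv (W_alg P) = a_inv (W_space P)"
  by (rule a_inv_fields) (simp_all add: W_alg_simps)

lemma W_alg_signed: "signed (W_alg P) = signed (W_space P)"
  unfolding signed_def[abs_def] W_alg_a_inv ..

lemma superspace_cong:
  assumes "superspace K V" "carrier W = carrier V" "zero W = zero V" "add W = add V" "smult W = smult V" "hpart W = hpart V"
  shows "superspace K W"
  by (rule superspace_image(1)[of K V W "\<lambda>x. x"])
    (use assms superspace.hproj_other[OF assms(1)] lin_hom.zero[OF lin_homI[OF assms(1,1) superspace.hproj_lin[OF assms(1)]]] in auto)

lemma lin_map_fields:
  "\<lbrakk>carrier W = carrier V; add W = add V; smult W = smult V\<rbrakk> \<Longrightarrow> lin_map K W W F \<longleftrightarrow> lin_map K V V F"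
  by (simp add: lin_map_def)

context symm_seq
begin

lemma W_lin_mapI:
  assumes V: "module K V" and mem: "\<And>x. x \<in> carrier V \<Longrightarrow> F x \<in> W_carrier S"
    and lin: "\<And>k. k \<ge> -1 \<Longrightarrow> lin_map K V (sp S (ar k)) (\<lambda>x. F x k)"
  shows "lin_map K V (W_space S) F"
proof (rule lin_mapI)
  interpret V: module K V by (rule V)
  show "F x \<in> carrier (W_space S)" if "x \<in> carrier V" for x using mem that by (simp add: W_space_carrier)
  show "F (x \<oplus>\<^bsub>V\<^esub> y) = F x \<oplus>\<^bsub>W_space S\<^esub> F y" if "x \<in> carrier V" "y \<in> carrier V" for x y
    using that by (intro W_ext mem W_add_cl) (auto simp: W_at lin_map_add[OF lin])
  show "F (c \<odot>\<^bsub>V\<^esub> x) = c \<odot>\<^bsub>W_space S\<^esub> F x" if "c \<in> carrier K" "x \<in> carrier V" for c x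
    using that by (intro W_ext mem W_smult_cl) (auto simp: W_at lin_map_smult[OF lin])
qed

lemma W_lin_eq_hpart:
  assumes U: "module K U" and F: "lin_map K (W_space S) U F" and G: "lin_map K (W_space S) U G"
    and eq: "\<And>n f. \<lbrakk>n \<ge> -1; f \<in> invariants S (ar n); f \<in> hpart (sp S (ar n)) p\<rbrakk> \<Longrightarrow> F (W_inj S n f) = G (W_inj S n f)"
    and x: "x \<in> hpart (W_space S) p"
  shows "F x = G x"
proof -
  interpret W: superspace K "W_space S" by (rule W_superspace)
  have hF: "lin_hom K (W_space S) U F" and hG: "lin_hom K (W_space S) U G"
    using U F G by (auto simp: lin_hom_def lin_hom_axioms_def W_module)
  show ?thesis using x
    by (induction rule: W_induct_hpart)
      (auto simp: lin_hom.zero[OF hF] lin_hom.zero[OF hG] lin_map_add[OF F] lin_map_add[OF G] W.hpart_closed eq)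
qed

lemma W_lin_eq:
  assumes U: "module K U" and F: "lin_map K (W_space S) U F" and G: "lin_map K (W_space S) U G"
    and eq: "\<And>n p f. \<lbrakk>n \<ge> -1; f \<in> invariants S (ar n); f \<in> hpart (sp S (ar n)) p\<rbrakk> \<Longrightarrow> F (W_inj S n f) = G (W_inj S n f)"
    and x: "x \<in> carrier (W_space S)"
  shows "F x = G x"
proof -
  interpret W: superspace K "W_space S" by (rule W_superspace)
  have h: "F y = G y" if "y \<in> hpart (W_space S) p" for y p
    by (rule W_lin_eq_hpart[OF U F G eq that])
  show ?thesis using W.hproj_01[OF x] lin_map_add[OF F] lin_map_add[OF G] h W.hproj_mem[OF x] W.hproj_closed[OF x] by metis
qed

lemma W_inj_at: "k \<ge> -1 \<Longrightarrow> W_inj S n f k = (if k = n then f else \<zero>\<^bsub>sp S (ar k)\<^esub>)"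
  by (simp add: W_inj_def)

end

context pseudo_operad_char0
begin

abbreviation "B \<equiv> brk (W_alg P)"

lemma B_at: "k \<ge> -1 \<Longrightarrow> B v w k = (\<Oplus>\<^bsub>sp P (ar k)\<^esub>n\<in>{-1..k + 1}. box_brk P n (k - n) (v n) (w (k - n)))"
  by (simp add: W_alg_simps)

lemma B_mem:
  assumes v: "v \<in> W_carrier P" and w: "w \<in> W_carrier P" shows "B v w \<in> W_carrier P"
proof -
  obtain a where a: "\<And>n. \<lbrakk>n \<ge> -1; n > a\<rbrakk> \<Longrightarrow> v n = \<zero>\<^bsub>sp P (ar n)\<^esub>" using W_support_bound[OF v] by metis
  obtain b where b: "\<And>n. \<lbrakk>n \<ge> -1; n > b\<rbrakk> \<Longrightarrow> w n = \<zero>\<^bsub>sp P (ar n)\<^esub>" using W_support_bound[OF w] by metis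
  show ?thesis
  proof (rule W_carrierI)
    show "finite {-1..a + b}" by simp
    show "B v w k \<in> invariants P (ar k)" if k: "k \<ge> -1" for k
      unfolding B_at[OF k]
    proof (rule inv_sum)
      fix n assume "n \<in> {-1..k + 1}"
      then show "box_brk P n (k - n) (v n) (w (k - n)) \<in> invariants P (ar k)"
        using box_brk_inv[OF W_mem[OF v, of n] W_mem[OF w, of "k - n"]] by simp
    qed
    show "B v w k = undefined" if "\<not> k \<ge> -1" for k using that by (simp add: W_alg_simps)
    show "B v w k = \<zero>\<^bsub>sp P (ar k)\<^esub>" if k: "k \<ge> -1" "k \<notin> {-1..a + b}" for k
    proof -
      interpret V: abelian_group "sp P (ar k)" by (rule S_ab)
      show ?thesis unfolding B_at[OF k(1)]
      proof (rule V.add.finprod_one_eqI)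
        fix n assume n: "n \<in> {-1..k + 1}"
        have "n > a \<or> k - n > b" using k by auto
        then show "box_brk P n (k - n) (v n) (w (k - n)) = \<zero>\<^bsub>sp P (ar k)\<^esub>"
        proof
          assume "n > a"
          then show ?thesis using a[of n] n box_brk_zero_arg(1)[OF W_mem_carrier[OF w], of "k - n" n] by simp
        next
          assume "k - n > b"
          then show ?thesis using b[of "k - n"] n box_brk_zero_arg(2)[OF W_mem_carrier[OF v], of n "k - n"] by simp
        qed
      qed
    qed
  qed
qed

lemma B_lin_left: assumes w: "w \<in> W_carrier P" shows "lin_map K (W_space P) (W_space P) (\<lambda>v. B v w)"
proof (rule W_lin_mapI[OF W_module])
  show "\<And>x. x \<in> carrier (W_space P) \<Longrightarrow> B x w \<in> W_carrier P" using B_mem w by (simp add: W_space_carrier)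
  fix k :: int assume k: "k \<ge> -1"
  show "lin_map K (W_space P) (sp P (ar k)) (\<lambda>v. B v w k)"
    unfolding B_at[OF k]
  proof (rule lin_map_sum[OF S_mod _ W_module])
    fix n assume "n \<in> {-1..k + 1}"
    then show "lin_map K (W_space P) (sp P (ar k)) (\<lambda>v. box_brk P n (k - n) (v n) (w (k - n)))"
      using lin_map_compose[OF box_brk_lin_left W_comp_lin, OF W_mem_carrier[OF w], of "k - n" n] by simp
  qed
qed

lemma B_lin_right: assumes v: "v \<in> W_carrier P" shows "lin_map K (W_space P) (W_space P) (\<lambda>w. B v w)"
proof (rule W_lin_mapI[OF W_module])
  show "\<And>x. x \<in> carrier (W_space P) \<Longrightarrow> B v x \<in> W_carrier P" using B_mem v by (simp add: W_space_carrier)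
  fix k :: int assume k: "k \<ge> -1"
  show "lin_map K (W_space P) (sp P (ar k)) (\<lambda>w. B v w k)"
    unfolding B_at[OF k]
  proof (rule lin_map_sum[OF S_mod _ W_module])
    fix n assume "n \<in> {-1..k + 1}"
    then show "lin_map K (W_space P) (sp P (ar k)) (\<lambda>w. box_brk P n (k - n) (v n) (w (k - n)))"
      using lin_map_compose[OF box_brk_lin_right W_comp_lin, OF W_mem_carrier[OF v], of n "k - n"] by simp
  qed
qed

lemma B_inj:
  assumes n: "n \<ge> -1" "m \<ge> -1" and f: "f \<in> invariants P (ar n)" and g: "g \<in> invariants P (ar m)"
  shows "B (W_inj P n f) (W_inj P m g) = W_inj P (n + m) (box_brk P n m f g)"
proof (rule W_ext)
  show "B (W_inj P n f) (W_inj P m g) \<in> W_carrier P" by (intro B_mem W_inj_mem f g)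
  show "W_inj P (n + m) (box_brk P n m f g) \<in> W_carrier P" by (intro W_inj_mem box_brk_inv f g)
  fix k :: int assume k: "k \<ge> -1"
  interpret V: abelian_group "sp P (ar k)" by (rule S_ab)
  have t: "box_brk P i (k - i) (W_inj P n f i) (W_inj P m g (k - i)) = (if i = n \<and> k = n + m then box_brk P n m f g else \<zero>\<^bsub>sp P (ar k)\<^esub>)"
    if i: "i \<in> {-1..k + 1}" for i
  proof -
    have W: "W_inj P n f i \<in> carrier (sp P (ar i))" "W_inj P m g (k - i) \<in> carrier (sp P (ar (k - i)))"
      using i by (auto intro!: W_mem_carrier W_inj_mem f g)
    consider "i = n" "k = n + m" | "i \<noteq> n" | "k - i \<noteq> m" by force
    then show ?thesis
    proof cases
      case 1 then show ?thesis using i by (simp add: W_inj_at)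
    next
      case 2 then show ?thesis using i box_brk_zero_arg(1)[OF W(2), of i] by (simp add: W_inj_at)
    next
      case 3 then show ?thesis using i box_brk_zero_arg(2)[OF W(1), of "k - i"] by (auto simp: W_inj_at)
    qed
  qed
  have bc: "box_brk P n m f g \<in> carrier (sp P (ar (n + m)))" by (intro box_brk_closed inv_carrier f g)
  have "B (W_inj P n f) (W_inj P m g) k = (\<Oplus>\<^bsub>sp P (ar k)\<^esub>i\<in>{-1..k + 1}. if i = n \<and> k = n + m then box_brk P n m f g else \<zero>\<^bsub>sp P (ar k)\<^esub>)"
    unfolding B_at[OF k] using bc t by (intro V.finsum_cong') auto
  also have "\<dots> = (if k = n + m then box_brk P n m f g else \<zero>\<^bsub>sp P (ar k)\<^esub>)"
  proof (cases "k = n + m")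
    case True
    then show ?thesis using n bc
      by (subst finsum_single[OF S_ab, of _ n]) auto
  qed (simp add: V.finsum_zero)
  finally show "B (W_inj P n f) (W_inj P m g) k = W_inj P (n + m) (box_brk P n m f g) k" using k by (simp add: W_inj_at)
qed

lemma B_hom_left: "w \<in> W_carrier P \<Longrightarrow> lin_hom K (W_space P) (W_space P) (\<lambda>v. B v w)"
  and B_hom_right: "v \<in> W_carrier P \<Longrightarrow> lin_hom K (W_space P) (W_space P) (B v)"
  by (simp_all add: lin_hom_def lin_hom_axioms_def W_module B_lin_left B_lin_right)

lemma B_parity:
  assumes x: "x \<in> hpart (W_space P) p" and y: "y \<in> hpart (W_space P) q" shows "B x y \<in> hpart (W_space P) (p + q)"
proof -
  have c: "x \<in> W_carrier P" "y \<in> W_carrier P" using x y by (auto simp: W_space_hpart)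
  have "B x y k \<in> hpart (sp P (ar k)) (p + q)" if k: "k \<ge> -1" for k
    unfolding B_at[OF k]
  proof (rule superspace.hpart_sum_mem[OF superspace_sp])
    fix n assume "n \<in> {-1..k + 1}"
    then show "box_brk P n (k - n) (x n) (y (k - n)) \<in> hpart (sp P (ar k)) (p + q)"
      using box_brk_parity[of "x n" n p "y (k - n)" "k - n" q] x y by (auto simp: W_space_hpart)
  qed
  then show ?thesis using B_mem[OF c] by (simp add: W_space_hpart)
qed

lemma W_inj_hom:
  assumes f: "f \<in> invariants P (ar n)" and g: "g \<in> invariants P (ar n)"
  shows "W_inj P n (f \<oplus>\<^bsub>sp P (ar n)\<^esub> g) = W_inj P n f \<oplus>\<^bsub>W_space P\<^esub> W_inj P n g"
    "W_inj P n (\<ominus>\<^bsub>sp P (ar n)\<^esub> f) = \<ominus>\<^bsub>W_space P\<^esub> W_inj P n f"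
    "W_inj P n (signed (sp P (ar n)) p f) = signed (W_space P) p (W_inj P n f)"
proof -
  have ab: "abelian_group (sp P k)" for k by (rule S_ab)
  interpret W: module K "W_space P" by (rule W_module)
  note i = W_inj_mem[OF f] W_inj_mem[OF g]
  have z: "\<zero>\<^bsub>sp P k\<^esub> \<oplus>\<^bsub>sp P k\<^esub> \<zero>\<^bsub>sp P k\<^esub> = \<zero>\<^bsub>sp P k\<^esub>" for k
    using abelian_group.axioms(1)[OF ab] by (simp add: abelian_monoid.l_zero abelian_monoid.zero_closed)
  show "W_inj P n (f \<oplus>\<^bsub>sp P (ar n)\<^esub> g) = W_inj P n f \<oplus>\<^bsub>W_space P\<^esub> W_inj P n g"
    by (rule W_ext[OF W_inj_mem[OF inv_add[OF f g]] W_add_cl[OF i]]) (simp add: W_at W_inj_at z)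
  show n: "W_inj P n (\<ominus>\<^bsub>sp P (ar n)\<^esub> f) = \<ominus>\<^bsub>W_space P\<^esub> W_inj P n f"
  proof (rule W_ext[OF W_inj_mem[OF inv_neg[OF f]]])
    show "\<ominus>\<^bsub>W_space P\<^esub> W_inj P n f \<in> W_carrier P" using W.M.a_inv_closed i by (simp add: W_space_carrier)
    show "W_inj P n (\<ominus>\<^bsub>sp P (ar n)\<^esub> f) k = (\<ominus>\<^bsub>W_space P\<^esub> W_inj P n f) k" if "k \<ge> -1" for k
      using that lin_hom.neg[OF W_comp_hom[OF that], of "W_inj P n f"] i by (simp add: W_inj_at W_space_carrier neg_zero ab)
  qed
  show "W_inj P n (signed (sp P (ar n)) p f) = signed (W_space P) p (W_inj P n f)" by (simp add: signed_def n)
qed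

lemma B_skew:
  assumes x: "x \<in> hpart (W_space P) p" and y: "y \<in> hpart (W_space P) q"
  shows "B x y = \<ominus>\<^bsub>W_space P\<^esub> signed (W_space P) (p * q) (B y x)"
proof -
  interpret W: superspace K "W_space P" by (rule W_superspace)
  have c: "x \<in> W_carrier P" "y \<in> W_carrier P" using x y by (auto simp: W_space_hpart)
  show ?thesis
  proof (rule W_lin_eq_hpart[OF W_module _ _ _ x, where F = "\<lambda>x. B x y"])
    show "lin_map K (W_space P) (W_space P) (\<lambda>x. B x y)" by (rule B_lin_left[OF c(2)])
    show "lin_map K (W_space P) (W_space P) (\<lambda>x. \<ominus>\<^bsub>W_space P\<^esub> signed (W_space P) (p * q) (B y x))"
      by (intro lin_map_neg lin_map_signed W_module B_lin_right c)
    fix n f assume f: "-1 \<le> n" "f \<in> invariants P (ar n)" "f \<in> hpart (sp P (ar n)) p"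
    show "B (W_inj P n f) y = \<ominus>\<^bsub>W_space P\<^esub> signed (W_space P) (p * q) (B y (W_inj P n f))"
    proof (rule W_lin_eq_hpart[OF W_module _ _ _ y, where F = "B (W_inj P n f)"])
      show "lin_map K (W_space P) (W_space P) (B (W_inj P n f))" by (rule B_lin_right[OF W_inj_mem[OF f(2)]])
      show "lin_map K (W_space P) (W_space P) (\<lambda>y. \<ominus>\<^bsub>W_space P\<^esub> signed (W_space P) (p * q) (B y (W_inj P n f)))"
        by (intro lin_map_neg lin_map_signed W_module B_lin_left W_inj_mem f)
      fix m g assume g: "-1 \<le> m" "g \<in> invariants P (ar m)" "g \<in> hpart (sp P (ar m)) q"
      have i: "box_brk P m n g f \<in> invariants P (ar (n + m))" using box_brk_inv[OF g(2) f(2)] by (simp add: add.commute)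
      have "B (W_inj P m g) (W_inj P n f) = W_inj P (n + m) (box_brk P m n g f)"
        using B_inj[OF g(1) f(1) g(2) f(2)] by (simp add: add.commute)
      then show "B (W_inj P n f) (W_inj P m g) = \<ominus>\<^bsub>W_space P\<^esub> signed (W_space P) (p * q) (B (W_inj P m g) (W_inj P n f))"
        unfolding B_inj[OF f(1) g(1) f(2) g(2)] box_brk_skew[OF f(3) g(3)]
        using W_inj_hom(2)[OF inv_signed[OF i] i] W_inj_hom(3)[OF i i] by simp
    qed
  qed
qed

text \<open>For elements of a single degree each, all sums in the brackets have one summand.\<close>

lemma B_jacobi_inj:
  assumes f: "-1 \<le> n" "f \<in> invariants P (ar n)" "f \<in> hpart (sp P (ar n)) p"
    and g: "-1 \<le> m" "g \<in> invariants P (ar m)" "g \<in> hpart (sp P (ar m)) q"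
    and h: "-1 \<le> l" "h \<in> invariants P (ar l)" "h \<in> hpart (sp P (ar l)) r"
  defines "x \<equiv> W_inj P n f" and "y \<equiv> W_inj P m g" and "z \<equiv> W_inj P l h"
  shows "B x (B y z) = B (B x y) z \<oplus>\<^bsub>W_space P\<^esub> signed (W_space P) (p * q) (B y (B x z))"
proof -
  interpret W: superspace K "W_space P" by (rule W_superspace)
  have c: "x \<in> W_carrier P" "y \<in> W_carrier P" "z \<in> W_carrier P" by (simp_all add: x_def y_def z_def W_inj_mem f g h)
  have low: "B (W_inj P i u) v = \<zero>\<^bsub>W_space P\<^esub>" "B v (W_inj P i u) = \<zero>\<^bsub>W_space P\<^esub>" if "i < -1" "v \<in> W_carrier P" for i u v
    using lin_hom.zero[OF B_hom_left[OF that(2)]] lin_hom.zero[OF B_hom_right[OF that(2)]] by (simp_all add: W_inj_low that)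
  have BL: "B (W_inj P (i + j) (box_brk P i j u v)) (W_inj P k w) = W_inj P (i + j + k) (box_brk P (i + j) k (box_brk P i j u v) w)"
    if i: "-1 \<le> i" "-1 \<le> j" "-1 \<le> k" "u \<in> invariants P (ar i)" "v \<in> invariants P (ar j)" "w \<in> invariants P (ar k)" for i j k u v w
  proof (cases "-1 \<le> i + j")
    case True then show ?thesis using B_inj[OF True i(3) box_brk_inv[OF i(4,5)] i(6)] by simp
  next
    case False
    then have "box_brk P (i + j) k (box_brk P i j u v) w = \<zero>\<^bsub>sp P (ar (i + j + k))\<^esub>" by (intro box_brk_low) auto
    then show ?thesis using low(1)[of "i + j" "W_inj P k w"] False i by (simp add: W_inj_zero W_inj_mem)
  qed
  have BR: "B (W_inj P k w) (W_inj P (i + j) (box_brk P i j u v)) = W_inj P (k + (i + j)) (box_brk P k (i + j) w (box_brk P i j u v))"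
    if i: "-1 \<le> i" "-1 \<le> j" "-1 \<le> k" "u \<in> invariants P (ar i)" "v \<in> invariants P (ar j)" "w \<in> invariants P (ar k)" for i j k u v w
  proof (cases "-1 \<le> i + j")
    case True then show ?thesis using B_inj[OF i(3) True i(6) box_brk_inv[OF i(4,5)]] by simp
  next
    case False
    then have "box_brk P k (i + j) w (box_brk P i j u v) = \<zero>\<^bsub>sp P (ar (k + (i + j)))\<^esub>" by (intro box_brk_low) auto
    then show ?thesis using low(2)[of "i + j" "W_inj P k w"] False i by (simp add: W_inj_zero W_inj_mem)
  qed
  let ?k = "n + m + l"
  have e: "n + (m + l) = ?k" "m + (n + l) = ?k" by simp_all
  have i1: "box_brk P (n + m) l (box_brk P n m f g) h \<in> invariants P (ar ?k)" by (intro box_brk_inv f g h)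
  have i2: "box_brk P m (n + l) g (box_brk P n l f h) \<in> invariants P (ar ?k)"
    using box_brk_inv[OF g(2) box_brk_inv[OF f(2) h(2)]] unfolding e .
  have "B x (B y z) = W_inj P ?k (box_brk P n (m + l) f (box_brk P m l g h))"
    unfolding x_def y_def z_def B_inj[OF g(1) h(1) g(2) h(2)] BR[OF g(1) h(1) f(1) g(2) h(2) f(2)] e ..
  also have "\<dots> = W_inj P ?k (box_brk P (n + m) l (box_brk P n m f g) h) \<oplus>\<^bsub>W_space P\<^esub>
    signed (W_space P) (p * q) (W_inj P ?k (box_brk P m (n + l) g (box_brk P n l f h)))"
    unfolding box_brk_jacobi[OF f(1) g(1) h(1) f(2,3) g(2,3) h(2,3)]
    using W_inj_hom(1)[OF i1 inv_signed[OF i2]] W_inj_hom(3)[OF i2 i2] by simp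
  also have "W_inj P ?k (box_brk P (n + m) l (box_brk P n m f g) h) = B (B x y) z"
    unfolding x_def y_def z_def B_inj[OF f(1) g(1) f(2) g(2)] BL[OF f(1) g(1) h(1) f(2) g(2) h(2)] ..
  also have "W_inj P ?k (box_brk P m (n + l) g (box_brk P n l f h)) = B y (B x z)"
    unfolding x_def y_def z_def B_inj[OF f(1) h(1) f(2) h(2)] BR[OF f(1) h(1) g(1) f(2) h(2) g(2)] e ..
  finally show ?thesis .
qed

lemma B_jacobi:
  assumes x: "x \<in> hpart (W_space P) p" and y: "y \<in> hpart (W_space P) q" and z: "z \<in> carrier (W_space P)"
  shows "B x (B y z) = B (B x y) z \<oplus>\<^bsub>W_space P\<^esub> signed (W_space P) (p * q) (B y (B x z))"
proof -
  interpret W: superspace K "W_space P" by (rule W_superspace)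
  have c: "x \<in> W_carrier P" "y \<in> W_carrier P" "z \<in> W_carrier P" using x y z by (auto simp: W_space_hpart W_space_carrier)
  note lin = lin_map_plus lin_map_signed W_module B_lin_left B_lin_right lin_map_compose[OF B_lin_left B_lin_left]
    lin_map_compose[OF B_lin_left B_lin_right] lin_map_compose[OF B_lin_right B_lin_left] lin_map_compose[OF B_lin_right B_lin_right] B_mem W_inj_mem
  show ?thesis
  proof (rule W_lin_eq_hpart[OF W_module _ _ _ x, where F = "\<lambda>x. B x (B y z)"])
    show "lin_map K (W_space P) (W_space P) (\<lambda>x. B x (B y z))" by (intro lin c)
    show "lin_map K (W_space P) (W_space P) (\<lambda>x. B (B x y) z \<oplus>\<^bsub>W_space P\<^esub> signed (W_space P) (p * q) (B y (B x z)))"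
      by (intro lin c)
    fix n f assume f: "-1 \<le> n" "f \<in> invariants P (ar n)" "f \<in> hpart (sp P (ar n)) p"
    let ?x = "W_inj P n f"
    show "B ?x (B y z) = B (B ?x y) z \<oplus>\<^bsub>W_space P\<^esub> signed (W_space P) (p * q) (B y (B ?x z))"
    proof (rule W_lin_eq_hpart[OF W_module _ _ _ y, where F = "\<lambda>y. B ?x (B y z)"])
      show "lin_map K (W_space P) (W_space P) (\<lambda>y. B ?x (B y z))" by (intro lin c f)
      show "lin_map K (W_space P) (W_space P) (\<lambda>y. B (B ?x y) z \<oplus>\<^bsub>W_space P\<^esub> signed (W_space P) (p * q) (B y (B ?x z)))"
        by (intro lin c f)
      fix m g assume g: "-1 \<le> m" "g \<in> invariants P (ar m)" "g \<in> hpart (sp P (ar m)) q"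
      let ?y = "W_inj P m g"
      show "B ?x (B ?y z) = B (B ?x ?y) z \<oplus>\<^bsub>W_space P\<^esub> signed (W_space P) (p * q) (B ?y (B ?x z))"
      proof (rule W_lin_eq[OF W_module _ _ _ z, where F = "\<lambda>z. B ?x (B ?y z)"])
        show "lin_map K (W_space P) (W_space P) (\<lambda>z. B ?x (B ?y z))" by (intro lin c f g)
        show "lin_map K (W_space P) (W_space P) (\<lambda>z. B (B ?x ?y) z \<oplus>\<^bsub>W_space P\<^esub> signed (W_space P) (p * q) (B ?y (B ?x z)))"
          by (intro lin c f g)
      qed (rule B_jacobi_inj[OF f g])
    qed
  qed
qed

lemma B_deg:
  assumes x: "x \<in> W_deg P m" and y: "y \<in> W_deg P n" shows "B x y \<in> W_deg P (m + n)"
proof -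
  have c: "x \<in> W_carrier P" "y \<in> W_carrier P" using x y by (auto intro: W_deg_carrier)
  have z: "\<zero>\<^bsub>W_space P\<^esub> \<in> W_deg P (m + n)"
    using subgroup.one_closed[OF submodule.axioms(1)[OF W_deg_submodule, of "m + n"]] by simp
  show ?thesis
  proof (cases "-1 \<le> m \<and> -1 \<le> n")
    case True
    then have i: "x m \<in> invariants P (ar m)" "y n \<in> invariants P (ar n)" using W_mem c by auto
    have "B x y = W_inj P (m + n) (box_brk P m n (x m) (y n))"
      using W_deg_inj[OF x] W_deg_inj[OF y] B_inj[of m n "x m" "y n"] True i by simp
    then show ?thesis using W_inj_deg[OF box_brk_inv[OF i]] by simp
  next
    case False
    then have "x = \<zero>\<^bsub>W_space P\<^esub> \<or> y = \<zero>\<^bsub>W_space P\<^esub>" using x y W_deg_low[of m] W_deg_low[of n] by auto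
    then have "B x y = \<zero>\<^bsub>W_space P\<^esub>" using lin_hom.zero[OF B_hom_left[OF c(2)]] lin_hom.zero[OF B_hom_right[OF c(1)]] by auto
    then show ?thesis using z by simp
  qed
qed

theorem W_alg_graded_lsa: "graded_lsa K (W_alg P)"
proof -
  note s = W_alg_simps(1-6) W_alg_a_inv W_alg_signed W_alg_finsum
  have lm: "lin_map K (W_alg P) (W_alg P) F \<longleftrightarrow> lin_map K (W_space P) (W_space P) F" for F
    by (rule lin_map_fields) (simp_all add: s)
  have sm: "submodule H K (W_alg P) \<longleftrightarrow> submodule H K (W_space P)" for H
    by (rule submodule_fields) (simp_all add: s)
  show ?thesis
  proof (rule graded_lsa.intro)
    show "superspace K (W_alg P)" by (rule superspace_cong[OF W_superspace]) (simp_all add: s)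
    show "graded_lsa_axioms K (W_alg P)"
    proof (rule graded_lsa_axioms.intro)
      show "lin_map K (W_alg P) (W_alg P) (\<lambda>x. B x y)" if "y \<in> carrier (W_alg P)" for y
        unfolding lm using that by (intro B_lin_left) (simp add: s W_space_carrier)
      show "lin_map K (W_alg P) (W_alg P) (B x)" if "x \<in> carrier (W_alg P)" for x
        unfolding lm using that by (intro B_lin_right) (simp add: s W_space_carrier)
      show "B x y \<in> hpart (W_alg P) (p + q)" if "x \<in> hpart (W_alg P) p" "y \<in> hpart (W_alg P) q" for x p y q
        using that unfolding s by (rule B_parity)
      show "B x y = \<ominus>\<^bsub>W_alg P\<^esub> signed (W_alg P) (p * q) (B y x)"
        if "x \<in> hpart (W_alg P) p" "y \<in> hpart (W_alg P) q" for x p y q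
        using that unfolding s by (rule B_skew)
      show "B x (B y z) = B (B x y) z \<oplus>\<^bsub>W_alg P\<^esub> signed (W_alg P) (p * q) (B y (B x z))"
        if "x \<in> hpart (W_alg P) p" "y \<in> hpart (W_alg P) q" "z \<in> carrier (W_alg P)" for x p y q z
        using that unfolding s by (rule B_jacobi)
      show "submodule (deg (W_alg P) n) K (W_alg P)" for n unfolding sm s by (rule W_deg_submodule)
      show "\<exists>y\<in>deg (W_alg P) n \<inter> hpart (W_alg P) 0. \<exists>z\<in>deg (W_alg P) n \<inter> hpart (W_alg P) 1. x = y \<oplus>\<^bsub>W_alg P\<^esub> z"
        if "x \<in> deg (W_alg P) n" for x n using that unfolding s by (rule W_deg_super)
      show "\<exists>!c. (\<forall>n. c n \<in> deg (W_alg P) n) \<and> finite {n. c n \<noteq> \<zero>\<^bsub>W_alg P\<^esub>} \<and>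
          x = (\<Oplus>\<^bsub>W_alg P\<^esub>n\<in>{n. c n \<noteq> \<zero>\<^bsub>W_alg P\<^esub>}. c n)" if "x \<in> carrier (W_alg P)" for x
        using that unfolding s W_space_carrier by (rule W_deg_direct_sum)
      show "deg (W_alg P) n = {\<zero>\<^bsub>W_alg P\<^esub>}" if "n < -1" for n using that unfolding s by (rule W_deg_low)
      show "B x y \<in> deg (W_alg P) (m + n)" if "x \<in> deg (W_alg P) m" "y \<in> deg (W_alg P) n" for x m y n
        using that unfolding s by (rule B_deg)
    qed
  qed
qed

end

section \<open>The action as a bracket in a semidirect product\<close>

definition sprod :: "('k, 'a, 'z) superspace_scheme \<Rightarrow> ('k, 'a \<times> 'a) superspace" where
  "sprod V = \<lparr>carrier = carrier V \<times> carrier V, mult = undefined, one = undefined, zero = (\<zero>\<^bsub>V\<^esub>, \<zero>\<^bsub>V\<^esub>),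
     add = (\<lambda>x y. (fst x \<oplus>\<^bsub>V\<^esub> fst y, snd x \<oplus>\<^bsub>V\<^esub> snd y)),
     smult = (\<lambda>c x. (c \<odot>\<^bsub>V\<^esub> fst x, c \<odot>\<^bsub>V\<^esub> snd x)), hpart = (\<lambda>p. hpart V p \<times> hpart V p)\<rparr>"

lemma sprod_simps:
  "carrier (sprod V) = carrier V \<times> carrier V" "\<zero>\<^bsub>sprod V\<^esub> = (\<zero>\<^bsub>V\<^esub>, \<zero>\<^bsub>V\<^esub>)"
  "x \<oplus>\<^bsub>sprod V\<^esub> y = (fst x \<oplus>\<^bsub>V\<^esub> fst y, snd x \<oplus>\<^bsub>V\<^esub> snd y)"
  "c \<odot>\<^bsub>sprod V\<^esub> x = (c \<odot>\<^bsub>V\<^esub> fst x, c \<odot>\<^bsub>V\<^esub> snd x)" "hpart (sprod V) p = hpart V p \<times> hpart V p"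
  by (simp_all add: sprod_def)

lemma sprod_superspace:
  assumes "superspace K V" shows "superspace K (sprod V)"
proof -
  interpret V: superspace K V by fact
  note [simp] = sprod_simps
  have m: "module K (sprod V)"
  proof (rule moduleI)
    show "abelian_group (sprod V)"
    proof (rule abelian_groupI)
      fix x assume "x \<in> carrier (sprod V)"
      then show "\<exists>y\<in>carrier (sprod V). y \<oplus>\<^bsub>sprod V\<^esub> x = \<zero>\<^bsub>sprod V\<^esub>"
        by (intro bexI[of _ "(\<ominus>\<^bsub>V\<^esub> fst x, \<ominus>\<^bsub>V\<^esub> snd x)"]) (auto simp: V.M.l_neg)
    qed (auto simp: V.M.a_ac)
  qed (auto simp: V.smult_l_distr V.smult_r_distr V.smult_assoc1 domain.axioms(1)[OF field.axioms(1)[OF V.field_axioms]])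
  interpret W: module K "sprod V" by (rule m)
  show ?thesis
  proof (rule superspaceI[OF V.field_axioms m])
    show "submodule (hpart (sprod V) p) K (sprod V)" for p
    proof (rule W.submoduleI)
      fix a assume a: "a \<in> hpart (sprod V) p"
      then have "\<ominus>\<^bsub>sprod V\<^esub> a = (\<ominus>\<^bsub>V\<^esub> fst a, \<ominus>\<^bsub>V\<^esub> snd a)"
        by (intro W.M.minus_equality) (auto simp: V.M.l_neg V.hpart_closed)
      then show "\<ominus>\<^bsub>sprod V\<^esub> a \<in> hpart (sprod V) p" using a by (auto simp: V.hpart_neg)
    qed (auto simp: V.hpart_closed V.hpart_zero V.hpart_add V.hpart_smult)
    show "x = \<zero>\<^bsub>sprod V\<^esub>" if "x \<in> hpart (sprod V) 0" "x \<in> hpart (sprod V) 1" for x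
      using that V.hpart_both[of _ 0] by auto
    show "\<exists>y\<in>hpart (sprod V) 0. \<exists>z\<in>hpart (sprod V) 1. x = y \<oplus>\<^bsub>sprod V\<^esub> z" if "x \<in> carrier (sprod V)" for x
      using that V.hproj_01[of "fst x"] V.hproj_01[of "snd x"]
      by (intro bexI[of _ "(hproj V 0 (fst x), hproj V 0 (snd x))"] bexI[of _ "(hproj V 1 (fst x), hproj V 1 (snd x))"])
        (auto simp: V.hproj_mem)
  qed
qed

lemma fst_even: "even_map K (sprod V) V fst" and snd_even: "even_map K (sprod V) V snd"
  by (auto simp: even_map_def sprod_simps intro!: lin_mapI)

lemma sprod_lin_map: "\<lbrakk>lin_map K U V f; lin_map K U V g\<rbrakk> \<Longrightarrow> lin_map K U (sprod V) (\<lambda>x. (f x, g x))"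
  by (rule lin_mapI) (auto simp: sprod_simps lin_map_closed lin_map_add lin_map_smult)

context
  fixes K :: "('k, 'm) ring_scheme" and V :: "('k, 'a, 'z) superspace_scheme"
  assumes V: "superspace K V"
begin

lemma fst_hom: "lin_hom K (sprod V) V fst" and snd_hom: "lin_hom K (sprod V) V snd"
  by (intro lin_homI sprod_superspace V even_map_lin fst_even, intro lin_homI sprod_superspace V even_map_lin snd_even)

lemma sprod_minus: "\<lbrakk>x \<in> carrier (sprod V); y \<in> carrier (sprod V)\<rbrakk> \<Longrightarrow> x \<ominus>\<^bsub>sprod V\<^esub> y = (fst x \<ominus>\<^bsub>V\<^esub> fst y, snd x \<ominus>\<^bsub>V\<^esub> snd y)"
  by (intro prod_eqI) (simp_all add: lin_hom.minus[OF fst_hom] lin_hom.minus[OF snd_hom])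

lemma sprod_signed: "x \<in> carrier (sprod V) \<Longrightarrow> signed (sprod V) p x = (signed V p (fst x), signed V p (snd x))"
  by (intro prod_eqI) (simp_all add: lin_hom.signed[OF fst_hom] lin_hom.signed[OF snd_hom])

lemma sprod_sum: "(\<And>a. a \<in> A \<Longrightarrow> f a \<in> carrier (sprod V)) \<Longrightarrow>
  (\<Oplus>\<^bsub>sprod V\<^esub>a\<in>A. f a) = (\<Oplus>\<^bsub>V\<^esub>a\<in>A. fst (f a), \<Oplus>\<^bsub>V\<^esub>a\<in>A. snd (f a))"
  by (intro prod_eqI) (simp_all add: lin_hom.sum[OF fst_hom] lin_hom.sum[OF snd_hom])

lemma sprod_hproj: "x \<in> carrier (sprod V) \<Longrightarrow> hproj (sprod V) p x = (hproj V p (fst x), hproj V p (snd x))"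
  by (intro prod_eqI) (simp_all add: hproj_even_map[OF sprod_superspace[OF V] V fst_even] hproj_even_map[OF sprod_superspace[OF V] V snd_even])

end

text \<open>The two substitutions for the variable that occur in the action: $f \cdot g = f \circ^i_0 g$ and
$f * g = f \circ^i_{-\partial} g$.\<close>

definition dot :: "('k, 'a, 'z) conformal_pseudo_operad_scheme \<Rightarrow> nat \<Rightarrow> nat \<Rightarrow> nat \<Rightarrow> 'a \<Rightarrow> 'a \<Rightarrow> 'a" where
  "dot P n m i f g = cpcomp P n m i f g 0"

definition star :: "('k, 'a, 'z) conformal_pseudo_operad_scheme \<Rightarrow> nat \<Rightarrow> nat \<Rightarrow> nat \<Rightarrow> 'a \<Rightarrow> 'a \<Rightarrow> 'a" where
  "star P n m i f g = eval_neg (sp P (n + m - 1)) (dd P (n + m - 1)) (cpcomp P n m i f g)"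

text \<open>The second components form a copy of the spaces of \<open>P\<close> on which the first components act from the
left through \<open>star\<close> and from the right through \<open>dot\<close>. The product of two second components is $0$.\<close>

definition semidirect :: "('k, 'a, 'z) conformal_pseudo_operad_scheme \<Rightarrow> ('k, 'a \<times> 'a) linear_pseudo_operad" where
  "semidirect P = \<lparr>sp = (\<lambda>n. sprod (sp P n)), act = (\<lambda>n \<sigma> x. (act P n \<sigma> (fst x), act P n \<sigma> (snd x))),
     pcomp = (\<lambda>n m i x y. (dot P n m i (fst x) (fst y),
        star P n m i (fst x) (snd y) \<oplus>\<^bsub>sp P (n + m - 1)\<^esub> dot P n m i (snd x) (fst y)))\<rparr>"

context conformal_pseudo_operad
begin

lemma dot_lin_left: "\<lbrakk>i \<in> {1..n}; g \<in> carrier (sp P m)\<rbrakk> \<Longrightarrow> lin_map K (sp P n) (sp P (n + m - 1)) (\<lambda>f. dot P n m i f g)"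
  and dot_lin_right: "\<lbrakk>i \<in> {1..n}; f \<in> carrier (sp P n)\<rbrakk> \<Longrightarrow> lin_map K (sp P m) (sp P (n + m - 1)) (dot P n m i f)"
  by (simp_all add: dot_def[abs_def] cpcomp_lin_left cpcomp_lin_right)

lemma star_lin_left: "\<lbrakk>i \<in> {1..n}; g \<in> carrier (sp P m)\<rbrakk> \<Longrightarrow> lin_map K (sp P n) (sp P (n + m - 1)) (\<lambda>f. star P n m i f g)"
  unfolding star_def by (rule endo.eval_lin_map[OF dd_endo sp_module]) (auto simp: cpcomp_poly cpcomp_lin_left)

lemma star_lin_right: "\<lbrakk>i \<in> {1..n}; f \<in> carrier (sp P n)\<rbrakk> \<Longrightarrow> lin_map K (sp P m) (sp P (n + m - 1)) (star P n m i f)"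
  unfolding star_def[abs_def] by (rule endo.eval_lin_map[OF dd_endo sp_module]) (auto simp: cpcomp_poly cpcomp_lin_right)

lemma dot_closed: "\<lbrakk>i \<in> {1..n}; f \<in> carrier (sp P n); g \<in> carrier (sp P m)\<rbrakk> \<Longrightarrow> dot P n m i f g \<in> carrier (sp P (n + m - 1))"
  and star_closed: "\<lbrakk>i \<in> {1..n}; f \<in> carrier (sp P n); g \<in> carrier (sp P m)\<rbrakk> \<Longrightarrow> star P n m i f g \<in> carrier (sp P (n + m - 1))"
  by (rule lin_map_closed[OF dot_lin_left], assumption+, rule lin_map_closed[OF star_lin_left])

lemma dot_parity: "\<lbrakk>i \<in> {1..n}; f \<in> hpart (sp P n) p; g \<in> hpart (sp P m) q\<rbrakk> \<Longrightarrow> dot P n m i f g \<in> hpart (sp P (n + m - 1)) (p + q)"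
  by (simp add: dot_def cpcomp_parity)

lemma dd_hpart: "x \<in> hpart (sp P n) p \<Longrightarrow> dd P n x \<in> hpart (sp P n) p"
  by (rule even_map_hpart[OF dd_even])

lemma star_parity:
  assumes "i \<in> {1..n}" "f \<in> hpart (sp P n) p" "g \<in> hpart (sp P m) q"
  shows "star P n m i f g \<in> hpart (sp P (n + m - 1)) (p + q)"
proof -
  interpret V: superspace K "sp P (n + m - 1)" by (rule superspace_sp)
  have "((\<lambda>x. \<ominus>\<^bsub>sp P (n + m - 1)\<^esub> dd P (n + m - 1) x) ^^ a) y \<in> hpart (sp P (n + m - 1)) r"
    if "y \<in> hpart (sp P (n + m - 1)) r" for a y r
    using that by (induction a) (auto intro: V.hpart_neg dd_hpart)
  then show ?thesis unfolding star_def eval_neg_def by (intro V.hpart_sum_mem) (auto intro: cpcomp_parity[OF assms])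
qed

lemma dot_act: "\<lbrakk>i \<in> {1..n}; f \<in> carrier (sp P n); g \<in> carrier (sp P m); \<sigma> permutes {1..n}; \<tau> permutes {1..m}\<rbrakk>
  \<Longrightarrow> dot P n m i (act P n \<sigma> f) (act P m \<tau> g) = act P (n + m - 1) (circ_perm n m i \<sigma> \<tau>) (dot P n m (\<sigma> i) f g)"
  by (simp add: dot_def cpcomp_equivariant)

lemma star_act:
  assumes i: "i \<in> {1..n}" and f: "f \<in> carrier (sp P n)" and g: "g \<in> carrier (sp P m)"
    and \<sigma>: "\<sigma> permutes {1..n}" and \<tau>: "\<tau> permutes {1..m}"
  shows "star P n m i (act P n \<sigma> f) (act P m \<tau> g) = act P (n + m - 1) (circ_perm n m i \<sigma> \<tau>) (star P n m (\<sigma> i) f g)"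
proof -
  have c: "circ_perm n m i \<sigma> \<tau> permutes {1..n + m - 1}" by (rule circ_perm_permutes[OF i \<sigma> \<tau>])
  have si: "\<sigma> i \<in> {1..n}" using permutes_in_image[OF \<sigma>] i by blast
  have "cpcomp P n m i (act P n \<sigma> f) (act P m \<tau> g) =
    (\<lambda>a. act P (n + m - 1) (circ_perm n m i \<sigma> \<tau>) (cpcomp P n m (\<sigma> i) f g a))"
    by (rule ext) (rule cpcomp_equivariant[OF i f g \<sigma> \<tau>])
  then show ?thesis
    unfolding star_def using eval_map[OF dd_endo dd_endo act_lin[OF c] act_dd[OF c] cpcomp_poly[OF si f g]] by simp
qed

lemma dot_dd_left: "\<lbrakk>i \<in> {1..n}; f \<in> carrier (sp P n); g \<in> carrier (sp P m)\<rbrakk> \<Longrightarrow>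
    dot P n m i (dd P n f) g = dd P (n + m - 1) (dot P n m i f g)"
  and dot_dd_right: "\<lbrakk>i \<in> {1..n}; f \<in> carrier (sp P n); g \<in> carrier (sp P m)\<rbrakk> \<Longrightarrow>
    dot P n m i f (dd P m g) = \<zero>\<^bsub>sp P (n + m - 1)\<^esub>"
  by (simp_all add: dot_def cpcomp_dd_zero)

text \<open>Under \<open>star\<close> the roles of the two arguments are exchanged: $(\partial+\lambda)$ vanishes at
$\lambda = -\partial$, and the factor $-\lambda$ becomes $\partial$.\<close>

lemma star_dd_left:
  assumes "i \<in> {1..n}" "f \<in> carrier (sp P n)" "g \<in> carrier (sp P m)"
  shows "star P n m i (dd P n f) g = \<zero>\<^bsub>sp P (n + m - 1)\<^esub>"
proof -
  interpret E: endo K "sp P (n + m - 1)" "dd P (n + m - 1)" by (rule dd_endo)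
  let ?Q = "cpcomp P n m i f g"
  note Q = cpcomp_poly[OF assms]
  have "cpcomp P n m i (dd P n f) g = (\<lambda>a. shift (sp P (n + m - 1)) ?Q a \<oplus>\<^bsub>sp P (n + m - 1)\<^esub> dd P (n + m - 1) (?Q a))"
    by (rule ext) (simp only: cpcomp_dd_left[OF assms] shift_def)
  then have "star P n m i (dd P n f) g = \<ominus>\<^bsub>sp P (n + m - 1)\<^esub> dd P (n + m - 1) (star P n m i f g) \<oplus>\<^bsub>sp P (n + m - 1)\<^esub>
    dd P (n + m - 1) (star P n m i f g)"
    unfolding star_def using Q by (simp add: E.eval_add E.up_shift E.up_map[OF E.d.lin_hom_axioms] E.eval_shift E.eval_d)
  then show ?thesis using dd_closed[OF star_closed[OF assms]] by (simp add: E.V.M.l_neg)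
qed

lemma star_dd_right:
  assumes "i \<in> {1..n}" "f \<in> carrier (sp P n)" "g \<in> carrier (sp P m)"
  shows "star P n m i f (dd P m g) = dd P (n + m - 1) (star P n m i f g)"
proof -
  interpret E: endo K "sp P (n + m - 1)" "dd P (n + m - 1)" by (rule dd_endo)
  let ?Q = "cpcomp P n m i f g"
  note Q = cpcomp_poly[OF assms]
  have "cpcomp P n m i f (dd P m g) = (\<lambda>a. \<ominus>\<^bsub>sp P (n + m - 1)\<^esub> shift (sp P (n + m - 1)) ?Q a)"
    by (rule ext) (simp only: cpcomp_dd_right[OF assms] shift_def)
  then have "star P n m i f (dd P m g) = \<ominus>\<^bsub>sp P (n + m - 1)\<^esub> (\<ominus>\<^bsub>sp P (n + m - 1)\<^esub> dd P (n + m - 1) (star P n m i f g))"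
    unfolding star_def using Q by (simp add: E.eval_neg' E.up_shift E.eval_shift)
  then show ?thesis using dd_closed[OF star_closed[OF assms]] by simp
qed

lemma dcls_star:
  assumes "i \<in> {1..n}" "f \<in> carrier (sp P n)" "g \<in> carrier (sp P m)"
  shows "dcls P (n + m - 1) (star P n m i f g) = dcls P (n + m - 1) (dot P n m i f g)"
proof -
  obtain z where z: "z \<in> carrier (sp P (n + m - 1))"
     "star P n m i f g = dot P n m i f g \<oplus>\<^bsub>sp P (n + m - 1)\<^esub> dd P (n + m - 1) z"
    using endo.eval_mod[OF dd_endo cpcomp_poly[OF assms]] by (auto simp: star_def dot_def)
  show ?thesis unfolding z(2) by (rule dcls_add_dd[OF dot_closed[OF assms] z(1)])
qed

lemma dot_eval:
  assumes i: "i \<in> {1..n}" and g: "g \<in> carrier (sp P m)" and Q: "Q \<in> up (sp P n)"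
  shows "dot P n m i (eval_neg (sp P n) (dd P n) Q) g = eval_neg (sp P (n + m - 1)) (dd P (n + m - 1)) (\<lambda>a. dot P n m i (Q a) g)"
  by (rule eval_map[where f = "\<lambda>x. dot P n m i x g" and d = "dd P n" and d' = "dd P (n + m - 1)",
      OF dd_endo dd_endo dot_lin_left[OF i g] dot_dd_left[OF i _ g] Q])

lemma star_eval:
  assumes i: "i \<in> {1..n}" and f: "f \<in> carrier (sp P n)" and Q: "Q \<in> up (sp P m)"
  shows "star P n m i f (eval_neg (sp P m) (dd P m) Q) = eval_neg (sp P (n + m - 1)) (dd P (n + m - 1)) (\<lambda>a. star P n m i f (Q a))"
  by (rule eval_map[where f = "star P n m i f" and d = "dd P m" and d' = "dd P (n + m - 1)",
      OF dd_endo dd_endo star_lin_right[OF i f] star_dd_right[OF i f] Q])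

lemma dot_assoc_par:
  assumes "1 \<le> j" "j < i" "i \<le> n" "f \<in> carrier (sp P n)" "g \<in> hpart (sp P m) q" "h \<in> hpart (sp P l) r"
  shows "dot P (n + m - 1) l j (dot P n m i f g) h = signed (sp P (n + m + l - 2)) (q * r) (dot P (n + l - 1) m (l + i - 1) (dot P n l j f h) g)"
  unfolding dot_def by (rule cpcomp_assoc_par[OF assms])

text \<open>These are the parallel axiom at $\lambda = 0$ and $\mu = -\partial$ or vice versa. Such a substitution
is allowed since \<open>dot\<close> commutes with $\partial$ in its first argument.\<close>

lemma star_dot_par:
  assumes ji: "1 \<le> j" "j < i" "i \<le> n" and f: "f \<in> carrier (sp P n)" and g: "g \<in> hpart (sp P m) q" and h: "h \<in> hpart (sp P l) r"
  shows "star P (n + m - 1) l j (dot P n m i f g) h = signed (sp P (n + m + l - 2)) (q * r) (dot P (n + l - 1) m (l + i - 1) (star P n l j f h) g)"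
    "dot P (n + m - 1) l j (star P n m i f g) h = signed (sp P (n + m + l - 2)) (q * r) (star P (n + l - 1) m (l + i - 1) (dot P n l j f h) g)"
proof -
  let ?k = "n + m + l - 2"
  have ks: "n + m - 1 + l - 1 = ?k" "n + l - 1 + m - 1 = ?k" using ji by auto
  have ix: "j \<in> {1..n}" "j \<in> {1..n + m - 1}" "i \<in> {1..n}" "l + i - 1 \<in> {1..n + l - 1}" using ji by auto
  note gc = superspace.hpart_closed[OF superspace_sp g] and hc = superspace.hpart_closed[OF superspace_sp h]
  have sg: "signed (sp P ?k) (q * r) (eval_neg (sp P ?k) (dd P ?k) R) = eval_neg (sp P ?k) (dd P ?k) (\<lambda>a. signed (sp P ?k) (q * r) (R a))"
    if "R \<in> up (sp P ?k)" for R
    by (rule eval_map[OF dd_endo dd_endo lin_map_signed[OF sp_module lin_map_id] _ that])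
      (rule lin_hom.signed[OF lin_homI[OF superspace_sp superspace_sp dd_lin], symmetric])
  have upd: "(\<lambda>a. dot P (n + l - 1) m (l + i - 1) (cpcomp P n l j f h a) g) \<in> up (sp P ?k)"
    using endo.up_map[OF dd_endo lin_homI[OF superspace_sp superspace_sp dot_lin_left[OF ix(4) gc]] cpcomp_poly[OF ix(1) f hc]] ks by simp
  have "star P (n + m - 1) l j (dot P n m i f g) h = eval_neg (sp P ?k) (dd P ?k) (cpcomp P (n + m - 1) l j (dot P n m i f g) h)"
    by (simp add: star_def ks)
  also have "cpcomp P (n + m - 1) l j (dot P n m i f g) h = (\<lambda>b. signed (sp P ?k) (q * r) (dot P (n + l - 1) m (l + i - 1) (cpcomp P n l j f h b) g))"
    unfolding dot_def by (rule ext) (rule cpcomp_assoc_par[OF ji f g h])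
  also have "eval_neg (sp P ?k) (dd P ?k) \<dots> = signed (sp P ?k) (q * r) (dot P (n + l - 1) m (l + i - 1) (star P n l j f h) g)"
    unfolding sg[OF upd, symmetric] star_def using dot_eval[OF ix(4) gc cpcomp_poly[OF ix(1) f hc]] ks by simp
  finally show "star P (n + m - 1) l j (dot P n m i f g) h = signed (sp P ?k) (q * r) (dot P (n + l - 1) m (l + i - 1) (star P n l j f h) g)" .
  have ups: "cpcomp P (n + l - 1) m (l + i - 1) (dot P n l j f h) g \<in> up (sp P ?k)"
    using cpcomp_poly[OF ix(4) dot_closed[OF ix(1) f hc] gc] ks by simp
  have "dot P (n + m - 1) l j (star P n m i f g) h = eval_neg (sp P ?k) (dd P ?k) (\<lambda>a. dot P (n + m - 1) l j (cpcomp P n m i f g a) h)"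
    unfolding star_def using dot_eval[OF ix(2) hc cpcomp_poly[OF ix(3) f gc]] ks by simp
  also have "(\<lambda>a. dot P (n + m - 1) l j (cpcomp P n m i f g a) h) =
    (\<lambda>a. signed (sp P ?k) (q * r) (cpcomp P (n + l - 1) m (l + i - 1) (dot P n l j f h) g a))"
    unfolding dot_def by (rule ext) (rule cpcomp_assoc_par[OF ji f g h])
  also have "eval_neg (sp P ?k) (dd P ?k) \<dots> = signed (sp P ?k) (q * r) (star P (n + l - 1) m (l + i - 1) (dot P n l j f h) g)"
    unfolding sg[OF ups, symmetric] star_def ks ..
  finally show "dot P (n + m - 1) l j (star P n m i f g) h = signed (sp P ?k) (q * r) (star P (n + l - 1) m (l + i - 1) (dot P n l j f h) g)" .
qed

lemma assoc_seq:
  assumes ij: "1 \<le> i" "i \<le> n" "i \<le> j" "j < i + m" and f: "f \<in> carrier (sp P n)" and g: "g \<in> carrier (sp P m)" and h: "h \<in> carrier (sp P l)"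
  shows "dot P (n + m - 1) l j (dot P n m i f g) h = dot P n (m + l - 1) i f (dot P m l (j + 1 - i) g h)"
    "dot P (n + m - 1) l j (star P n m i f g) h = star P n (m + l - 1) i f (dot P m l (j + 1 - i) g h)"
    "star P (n + m - 1) l j (dot P n m i f g) h = star P n (m + l - 1) i f (star P m l (j + 1 - i) g h)"
proof -
  let ?k = "n + m + l - 2"
  have ks: "n + m - 1 + l - 1 = ?k" "n + (m + l - 1) - 1 = ?k" using ij by auto
  have ix: "i \<in> {1..n}" "j \<in> {1..n + m - 1}" "j + 1 - i \<in> {1..m}" using ij by auto
  interpret V: abelian_group "sp P ?k" by (rule sp_abelian)
  interpret E: endo K "sp P ?k" "dd P ?k" by (rule dd_endo)
  let ?G = "cpcomp P m l (j + 1 - i) g h"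
  define A where "A d c = cpcomp P n (m + l - 1) i f (?G d) c" for d c
  have Gc: "?G d \<in> carrier (sp P (m + l - 1))" for d by (rule cpcomp_closed[OF ix(3) g h])
  have Au: "A d \<in> up (sp P ?k)" for d unfolding A_def[abs_def] using cpcomp_poly[OF ix(1) f Gc] ks by simp
  have Ac: "A d c \<in> carrier (sp P ?k)" for d c by (rule up_mem[OF Au])
  have cp: "cpcomp P (n + m - 1) l j (cpcomp P n m i f g a) h b = (\<Oplus>\<^bsub>sp P ?k\<^esub>d\<in>{..b}. [((a + b - d) choose a)] \<cdot>\<^bsub>sp P ?k\<^esub> A d (a + b - d))" for a b
    using cpcomp_assoc_seq[OF ij f g h, of a b] by (simp add: A_def)
  have cp0: "cpcomp P (n + m - 1) l j (cpcomp P n m i f g a) h 0 = A 0 a" for a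
    using cp[of a 0] Ac by simp
  show "dot P (n + m - 1) l j (dot P n m i f g) h = dot P n (m + l - 1) i f (dot P m l (j + 1 - i) g h)"
    unfolding dot_def using cp0[of 0] by (simp add: A_def)
  have "dot P (n + m - 1) l j (star P n m i f g) h = eval_neg (sp P ?k) (dd P ?k) (\<lambda>a. dot P (n + m - 1) l j (cpcomp P n m i f g a) h)"
    unfolding star_def using dot_eval[OF ix(2) h cpcomp_poly[OF ix(1) f g]] ks by simp
  also have "\<dots> = star P n (m + l - 1) i f (dot P m l (j + 1 - i) g h)"
    unfolding dot_def cp0 star_def A_def ks ..
  finally show "dot P (n + m - 1) l j (star P n m i f g) h = star P n (m + l - 1) i f (dot P m l (j + 1 - i) g h)" .
  obtain N where N: "\<And>d. d > N \<Longrightarrow> ?G d = \<zero>\<^bsub>sp P (m + l - 1)\<^esub>" using up_bound[OF cpcomp_poly[OF ix(3) g h]] by metis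
  have A0: "A d c = \<zero>\<^bsub>sp P ?k\<^esub>" if "d > N" for d c
    using lin_hom.zero[OF lin_homI[OF superspace_sp superspace_sp cpcomp_lin_right[OF ix(1) f, where m = "m + l - 1" and a = c]]] N[OF that] ks by (simp add: A_def)
  have "star P n (m + l - 1) i f (star P m l (j + 1 - i) g h) = eval_neg (sp P ?k) (dd P ?k) (\<lambda>d. star P n (m + l - 1) i f (?G d))"
    unfolding star_def[of P m l] using star_eval[OF ix(1) f cpcomp_poly[OF ix(3) g h]] ks by simp
  also have "\<dots> = eval_neg (sp P ?k) (dd P ?k) (\<lambda>d. eval_neg (sp P ?k) (dd P ?k) (A d))"
    unfolding star_def A_def[abs_def] ks ..
  also have "\<dots> = (\<Oplus>\<^bsub>sp P ?k\<^esub>d\<in>{..N}. (E.nd ^^ d) (eval_neg (sp P ?k) (dd P ?k) (A d)))"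
  proof (rule E.eval_upto)
    fix d assume "N < d"
    then have "A d = (\<lambda>c. \<zero>\<^bsub>sp P ?k\<^esub>)" using A0 by blast
    then show "eval_neg (sp P ?k) (dd P ?k) (A d) = \<zero>\<^bsub>sp P ?k\<^esub>" by (simp add: E.eval_zero)
  qed (simp add: E.eval_closed Au)
  also have "\<dots> = (\<Oplus>\<^bsub>sp P ?k\<^esub>d\<in>{..N}. eval_neg (sp P ?k) (dd P ?k) ((shift (sp P ?k) ^^ d) (A d)))"
    using Au by (intro V.finsum_cong') (auto simp: E.eval_shift_pow E.eval_closed E.up_shift_pow E.nd_pow_closed)
  also have "\<dots> = eval_neg (sp P ?k) (dd P ?k) (\<lambda>b. \<Oplus>\<^bsub>sp P ?k\<^esub>d\<in>{..N}. (shift (sp P ?k) ^^ d) (A d) b)"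
    by (rule E.eval_sum[symmetric]) (auto intro: E.up_shift_pow Au)
  also have "(\<lambda>b. \<Oplus>\<^bsub>sp P ?k\<^esub>d\<in>{..N}. (shift (sp P ?k) ^^ d) (A d) b) = cpcomp P (n + m - 1) l j (dot P n m i f g) h"
  proof
    fix b
    have "(\<Oplus>\<^bsub>sp P ?k\<^esub>d\<in>{..N}. (shift (sp P ?k) ^^ d) (A d) b) = (\<Oplus>\<^bsub>sp P ?k\<^esub>d\<in>{..b}. A d (b - d))"
      by (rule V.add.finprod_mono_neutral_cong) (auto simp: E.shift_pow Ac A0 Pi_def)
    also have "\<dots> = (\<Oplus>\<^bsub>sp P ?k\<^esub>d\<in>{..b}. [((0 + b - d) choose 0)] \<cdot>\<^bsub>sp P ?k\<^esub> A d (0 + b - d))"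
      by (rule V.finsum_cong') (auto simp: Ac)
    also have "\<dots> = cpcomp P (n + m - 1) l j (dot P n m i f g) h b" unfolding dot_def cp[of 0 b] ..
    finally show "(\<Oplus>\<^bsub>sp P ?k\<^esub>d\<in>{..N}. (shift (sp P ?k) ^^ d) (A d) b) = cpcomp P (n + m - 1) l j (dot P n m i f g) h b" .
  qed
  finally show "star P (n + m - 1) l j (dot P n m i f g) h = star P n (m + l - 1) i f (star P m l (j + 1 - i) g h)"
    by (simp add: star_def ks)
qed

abbreviation "R \<equiv> semidirect P"

lemma R_simps: "sp R n = sprod (sp P n)" "act R n \<sigma> x = (act P n \<sigma> (fst x), act P n \<sigma> (snd x))"
  "pcomp R n m i x y = (dot P n m i (fst x) (fst y),
        star P n m i (fst x) (snd y) \<oplus>\<^bsub>sp P (n + m - 1)\<^esub> dot P n m i (snd x) (fst y))"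
  by (simp_all add: semidirect_def)

lemma R_symm_seq: "symm_seq K R"
proof (rule symm_seq.intro)
  show "superspace K (sp R n)" for n unfolding R_simps by (rule sprod_superspace[OF superspace_sp])
  show "even_map K (sp R n) (sp R n) (act R n \<sigma>)" if \<sigma>: "\<sigma> permutes {1..n}" for n :: nat and \<sigma>
    unfolding even_map_def R_simps[abs_def]
  proof (intro conjI allI)
    show "lin_map K (sprod (sp P n)) (sprod (sp P n)) (\<lambda>x. (act P n \<sigma> (fst x), act P n \<sigma> (snd x)))"
      by (intro sprod_lin_map lin_map_compose[OF act_lin[OF \<sigma>]] even_map_lin[OF fst_even] even_map_lin[OF snd_even])
  qed (auto simp: sprod_simps intro: even_map_hpart[OF act_even[OF \<sigma>]])
qed (auto simp: R_simps sprod_simps act_id act_comp)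

lemma R_pseudo: "linear_pseudo_operad K R"
proof -
  interpret R: symm_seq K R by (rule R_symm_seq)
  have hc: "x \<in> hpart (sp P n) p \<Longrightarrow> x \<in> carrier (sp P n)" for x n p
    by (rule superspace.hpart_closed[OF superspace_sp])
  note fl = even_map_lin[OF fst_even] and sl = even_map_lin[OF snd_even]
  show ?thesis
  proof (unfold_locales)
    fix i n m :: nat and y assume i: "i \<in> {1..n}" and y: "y \<in> carrier (sp R m)"
    then show "lin_map K (sp R n) (sp R (n + m - 1)) (\<lambda>x. pcomp R n m i x y)"
      unfolding R_simps sprod_simps
      by (intro sprod_lin_map lin_map_plus sp_module lin_map_compose[OF dot_lin_left fl] lin_map_compose[OF dot_lin_left sl]
         lin_map_compose[OF star_lin_left fl] i) auto
  next
    fix i n m :: nat and x assume i: "i \<in> {1..n}" and x: "x \<in> carrier (sp R n)"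
    then show "lin_map K (sp R m) (sp R (n + m - 1)) (\<lambda>y. pcomp R n m i x y)"
      unfolding R_simps sprod_simps
      by (intro sprod_lin_map lin_map_plus sp_module lin_map_compose[OF dot_lin_right fl] lin_map_compose[OF star_lin_right sl] i) auto
  next
    fix i n m :: nat and x p y q assume i: "i \<in> {1..n}" and x: "x \<in> hpart (sp R n) p" and y: "y \<in> hpart (sp R m) q"
    then show "pcomp R n m i x y \<in> hpart (sp R (n + m - 1)) (p + q)"
      unfolding R_simps sprod_simps
      by (auto intro!: superspace.hpart_add[OF superspace_sp] dot_parity star_parity)
  next
    fix j i n m l :: nat and x y q z r
    assume ji: "1 \<le> j" "j < i" "i \<le> n" and x: "x \<in> carrier (sp R n)" and y: "y \<in> hpart (sp R m) q" and z: "z \<in> hpart (sp R l) r"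
    let ?k = "n + m + l - 2"
    have ks: "n + m - 1 + l - 1 = ?k" "n + l - 1 + m - 1 = ?k" using ji by auto
    have ix: "j \<in> {1..n}" "j \<in> {1..n + m - 1}" "i \<in> {1..n}" "l + i - 1 \<in> {1..n + l - 1}" using ji by auto
    obtain f u g v h w where e: "x = (f, u)" "y = (g, v)" "z = (h, w)" by (metis surj_pair)
    have c: "f \<in> carrier (sp P n)" "u \<in> carrier (sp P n)" "g \<in> hpart (sp P m) q" "v \<in> hpart (sp P m) q"
      "h \<in> hpart (sp P l) r" "w \<in> hpart (sp P l) r" using x y z by (auto simp: e R_simps sprod_simps)
    note cc = hc[OF c(3)] hc[OF c(4)] hc[OF c(5)] hc[OF c(6)]
    interpret V: superspace K "sp P ?k" by (rule superspace_sp)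
    have cl: "dot P (n + l - 1) m (l + i - 1) (dot P n l j f h) g \<in> carrier (sp P ?k)"
      "star P (n + l - 1) m (l + i - 1) (dot P n l j f h) v \<in> carrier (sp P ?k)"
      "dot P (n + l - 1) m (l + i - 1) (star P n l j f w) g \<in> carrier (sp P ?k)"
      "dot P (n + l - 1) m (l + i - 1) (dot P n l j u h) g \<in> carrier (sp P ?k)"
      using dot_closed[OF ix(4) dot_closed[OF ix(1) c(1) cc(3)] cc(1)] star_closed[OF ix(4) dot_closed[OF ix(1) c(1) cc(3)] cc(2)]
        dot_closed[OF ix(4) star_closed[OF ix(1) c(1) cc(4)] cc(1)] dot_closed[OF ix(4) dot_closed[OF ix(1) c(2) cc(3)] cc(1)] ks by simp_all
    have sg: "lin_hom K (sp P ?k) (sp P ?k) (signed (sp P ?k) (q * r))"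
      by (intro lin_homI superspace_sp lin_map_signed sp_module lin_map_id)
    have L: "pcomp R (n + m - 1) l j (pcomp R n m i x y) z = (dot P (n + m - 1) l j (dot P n m i f g) h,
      star P (n + m - 1) l j (dot P n m i f g) w \<oplus>\<^bsub>sp P ?k\<^esub> (dot P (n + m - 1) l j (star P n m i f v) h \<oplus>\<^bsub>sp P ?k\<^esub> dot P (n + m - 1) l j (dot P n m i u g) h))"
      using lin_map_add[OF dot_lin_left[OF ix(2) cc(3)] star_closed[OF ix(3) c(1) cc(2)] dot_closed[OF ix(3) c(2) cc(1)]]
      by (simp add: R_simps e ks)
    have Rr: "pcomp R (n + l - 1) m (l + i - 1) (pcomp R n l j x z) y = (dot P (n + l - 1) m (l + i - 1) (dot P n l j f h) g,
      star P (n + l - 1) m (l + i - 1) (dot P n l j f h) v \<oplus>\<^bsub>sp P ?k\<^esub>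
      (dot P (n + l - 1) m (l + i - 1) (star P n l j f w) g \<oplus>\<^bsub>sp P ?k\<^esub> dot P (n + l - 1) m (l + i - 1) (dot P n l j u h) g))"
      using lin_map_add[OF dot_lin_left[OF ix(4) cc(1)] star_closed[OF ix(1) c(1) cc(4)] dot_closed[OF ix(1) c(2) cc(3)]]
      by (simp add: R_simps e ks)
    show "pcomp R (n + m - 1) l j (pcomp R n m i x y) z = signed (sp R ?k) (q * r) (pcomp R (n + l - 1) m (l + i - 1) (pcomp R n l j x z) y)"
      unfolding L Rr dot_assoc_par[OF ji c(1,3,5)] dot_assoc_par[OF ji c(2,3,5)] star_dot_par(1)[OF ji c(1,3,6)] star_dot_par(2)[OF ji c(1,4,5)]
      using cl by (simp add: R_simps sprod_signed[OF superspace_sp] sprod_simps lin_hom.add[OF sg] V.signed_closed V.M.a_ac)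
  next
    fix i n j m l :: nat and x y z
    assume ij: "1 \<le> i" "i \<le> n" "i \<le> j" "j < i + m" and x: "x \<in> carrier (sp R n)" and y: "y \<in> carrier (sp R m)" and z: "z \<in> carrier (sp R l)"
    let ?k = "n + m + l - 2"
    have ks: "n + m - 1 + l - 1 = ?k" "n + (m + l - 1) - 1 = ?k" using ij by auto
    have ix: "i \<in> {1..n}" "j \<in> {1..n + m - 1}" "j + 1 - i \<in> {1..m}" using ij by auto
    obtain f u g v h w where e: "x = (f, u)" "y = (g, v)" "z = (h, w)" by (metis surj_pair)
    have c: "f \<in> carrier (sp P n)" "u \<in> carrier (sp P n)" "g \<in> carrier (sp P m)" "v \<in> carrier (sp P m)"
      "h \<in> carrier (sp P l)" "w \<in> carrier (sp P l)" using x y z by (auto simp: e R_simps sprod_simps)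
    interpret V: superspace K "sp P ?k" by (rule superspace_sp)
    have cl: "star P n (m + l - 1) i f (star P m l (j + 1 - i) g w) \<in> carrier (sp P ?k)"
      "star P n (m + l - 1) i f (dot P m l (j + 1 - i) v h) \<in> carrier (sp P ?k)"
      "dot P n (m + l - 1) i u (dot P m l (j + 1 - i) g h) \<in> carrier (sp P ?k)"
      using star_closed[OF ix(1) c(1) star_closed[OF ix(3) c(3,6)]] star_closed[OF ix(1) c(1) dot_closed[OF ix(3) c(4,5)]]
        dot_closed[OF ix(1) c(2) dot_closed[OF ix(3) c(3,5)]] ks by simp_all
    have L: "pcomp R (n + m - 1) l j (pcomp R n m i x y) z = (dot P (n + m - 1) l j (dot P n m i f g) h,
      star P (n + m - 1) l j (dot P n m i f g) w \<oplus>\<^bsub>sp P ?k\<^esub> (dot P (n + m - 1) l j (star P n m i f v) h \<oplus>\<^bsub>sp P ?k\<^esub> dot P (n + m - 1) l j (dot P n m i u g) h))"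
      using lin_map_add[OF dot_lin_left[OF ix(2) c(5)] star_closed[OF ix(1) c(1,4)] dot_closed[OF ix(1) c(2,3)]]
      by (simp add: R_simps e ks)
    have Rr: "pcomp R n (m + l - 1) i x (pcomp R m l (j + 1 - i) y z) = (dot P n (m + l - 1) i f (dot P m l (j + 1 - i) g h),
      (star P n (m + l - 1) i f (star P m l (j + 1 - i) g w) \<oplus>\<^bsub>sp P ?k\<^esub> star P n (m + l - 1) i f (dot P m l (j + 1 - i) v h)) \<oplus>\<^bsub>sp P ?k\<^esub>
      dot P n (m + l - 1) i u (dot P m l (j + 1 - i) g h))"
      using lin_map_add[OF star_lin_right[OF ix(1) c(1)] star_closed[OF ix(3) c(3,6)] dot_closed[OF ix(3) c(4,5)]]
      by (simp add: R_simps e ks)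
    show "pcomp R (n + m - 1) l j (pcomp R n m i x y) z = pcomp R n (m + l - 1) i x (pcomp R m l (j + 1 - i) y z)"
      unfolding L Rr assoc_seq(1)[OF ij c(1,3,5)] assoc_seq(3)[OF ij c(1,3,6)] assoc_seq(2)[OF ij c(1,4,5)] assoc_seq(1)[OF ij c(2,3,5)]
      using cl by (simp add: V.M.a_ac)
  next
    fix i n m :: nat and x y \<sigma> \<tau>
    assume i: "i \<in> {1..n}" and x: "x \<in> carrier (sp R n)" and y: "y \<in> carrier (sp R m)"
      and \<sigma>: "\<sigma> permutes {1..n}" and \<tau>: "\<tau> permutes {1..m}"
    obtain f u g v where e: "x = (f, u)" "y = (g, v)" by (metis surj_pair)
    have c: "f \<in> carrier (sp P n)" "u \<in> carrier (sp P n)" "g \<in> carrier (sp P m)" "v \<in> carrier (sp P m)"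
      using x y by (auto simp: e R_simps sprod_simps)
    have si: "\<sigma> i \<in> {1..n}" using permutes_in_image[OF \<sigma>] i by blast
    note cp = circ_perm_permutes[OF i \<sigma> \<tau>]
    show "pcomp R n m i (act R n \<sigma> x) (act R m \<tau> y) = act R (n + m - 1) (circ_perm n m i \<sigma> \<tau>) (pcomp R n m (\<sigma> i) x y)"
      using lin_map_add[OF act_lin[OF cp] star_closed[OF si c(1,4)] dot_closed[OF si c(2,3)]]
      by (simp add: R_simps e dot_act[OF i c(1,3) \<sigma> \<tau>] dot_act[OF i c(2,3) \<sigma> \<tau>] star_act[OF i c(1,4) \<sigma> \<tau>])
  qed
qed

end

section \<open>Transport of structure\<close>

text \<open>All axioms but that of a superspace can be pulled back along a bijection that is compatible with the
structure.\<close>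

lemma graded_lsa_transport:
  assumes L: "superspace K L" and M: "graded_lsa K M" and lin: "lin_map K L M \<phi>"
    and bij: "bij_betw \<phi> (carrier L) (carrier M)" and hp: "\<And>p. \<phi> ` hpart L p = hpart M p"
    and dg: "\<And>n. \<phi> ` deg L n = deg M n" and dgc: "\<And>n. deg L n \<subseteq> carrier L"
    and bc: "\<And>x y. \<lbrakk>x \<in> carrier L; y \<in> carrier L\<rbrakk> \<Longrightarrow> brk L x y \<in> carrier L"
    and br: "\<And>x y. \<lbrakk>x \<in> carrier L; y \<in> carrier L\<rbrakk> \<Longrightarrow> \<phi> (brk L x y) = brk M (\<phi> x) (\<phi> y)"
  shows "graded_lsa K L"
proof -
  interpret L: superspace K L by fact
  interpret M: graded_lsa K M by fact
  interpret phi: lin_hom K L M \<phi> by (rule lin_homI[OF L M.superspace_axioms lin])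
  have inj: "x = y" if "x \<in> carrier L" "y \<in> carrier L" "\<phi> x = \<phi> y" for x y
    using bij that by (auto simp: bij_betw_def inj_on_def)
  have surj: "\<phi> ` carrier L = carrier M" using bij by (simp add: bij_betw_def)
  define \<psi> where "\<psi> = inv_into (carrier L) \<phi>"
  have psi: "\<psi> y \<in> carrier L" "\<phi> (\<psi> y) = y" if "y \<in> carrier M" for y
    using that surj by (auto simp: \<psi>_def inv_into_into f_inv_into_f)
  have psi_phi: "\<psi> (\<phi> x) = x" if "x \<in> carrier L" for x using inj psi phi.closed that by blast
  have psi_lin: "lin_map K M L \<psi>"
    by (rule lin_mapI) (auto intro!: inj simp: psi phi.add lin_map_smult[OF lin])
  have phi_hp: "\<phi> x \<in> hpart M p \<longleftrightarrow> x \<in> hpart L p" if "x \<in> carrier L" for x p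
    using that hp[of p] inj L.hpart_closed by (auto simp: image_iff; blast)
  have phi_dg: "\<phi> x \<in> deg M n \<longleftrightarrow> x \<in> deg L n" if "x \<in> carrier L" for x n
    using that dg[of n] inj dgc[of n] by (auto simp: image_iff; blast)
  have hL: "x \<in> hpart L p \<Longrightarrow> x \<in> carrier L" for x p by (rule L.hpart_closed)
  have dL: "x \<in> deg L n \<Longrightarrow> x \<in> carrier L" for x n using dgc by blast
  have dM: "x \<in> deg M n \<Longrightarrow> x \<in> carrier M" for x n using M.submoduleE(1)[OF M.deg_submodule] by blast
  show ?thesis
  proof (rule graded_lsa.intro[OF L graded_lsa_axioms.intro])
    show "lin_map K L L (\<lambda>x. brk L x y)" if y: "y \<in> carrier L" for y
      by (rule lin_mapI)
        (auto intro!: inj simp: bc y br phi.add lin_map_smult[OF lin] lin_map_add[OF M.brk_lin_left] lin_map_smult[OF M.brk_lin_left] phi.closed)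
    show "lin_map K L L (brk L x)" if x: "x \<in> carrier L" for x
      by (rule lin_mapI)
        (auto intro!: inj simp: bc x br phi.add lin_map_smult[OF lin] lin_map_add[OF M.brk_lin_right] lin_map_smult[OF M.brk_lin_right] phi.closed)
    show "brk L x y \<in> hpart L (p + q)" if x: "x \<in> hpart L p" "y \<in> hpart L q" for x p y q
      using x phi_hp[OF bc, of x y "p + q"] M.brk_parity[of "\<phi> x" p "\<phi> y" q] by (simp add: br hL phi_hp)
    show "brk L x y = \<ominus>\<^bsub>L\<^esub> signed L (p * q) (brk L y x)" if x: "x \<in> hpart L p" "y \<in> hpart L q" for x p y q
    proof (rule inj)
      note c = hL[OF x(1)] hL[OF x(2)]
      show "brk L x y \<in> carrier L" "\<ominus>\<^bsub>L\<^esub> signed L (p * q) (brk L y x) \<in> carrier L" using c by (auto simp: bc L.signed_closed)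
      show "\<phi> (brk L x y) = \<phi> (\<ominus>\<^bsub>L\<^esub> signed L (p * q) (brk L y x))"
        using c M.brk_skew[of "\<phi> x" p "\<phi> y" q] x by (simp add: phi.neg phi.signed L.signed_closed bc br phi_hp)
    qed
    show "brk L x (brk L y z) = brk L (brk L x y) z \<oplus>\<^bsub>L\<^esub> signed L (p * q) (brk L y (brk L x z))"
      if x: "x \<in> hpart L p" "y \<in> hpart L q" "z \<in> carrier L" for x p y q z
    proof (rule inj)
      note c = hL[OF x(1)] hL[OF x(2)] x(3)
      show "brk L x (brk L y z) \<in> carrier L" using c by (simp add: bc)
      show "brk L (brk L x y) z \<oplus>\<^bsub>L\<^esub> signed L (p * q) (brk L y (brk L x z)) \<in> carrier L" using c by (simp add: bc L.signed_closed)
      show "\<phi> (brk L x (brk L y z)) = \<phi> (brk L (brk L x y) z \<oplus>\<^bsub>L\<^esub> signed L (p * q) (brk L y (brk L x z)))"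
        using c M.brk_jacobi[of "\<phi> x" p "\<phi> y" q "\<phi> z"] x by (simp add: phi.add phi.signed L.signed_closed bc br phi_hp phi.closed)
    qed
    show "submodule (deg L n) K L" for n
    proof (rule L.submoduleI)
      note sm = M.submoduleE[OF M.deg_submodule[of n]]
      show "deg L n \<subseteq> carrier L" by (rule dgc)
      have "\<zero>\<^bsub>M\<^esub> \<in> deg M n" using subgroup.one_closed[OF submodule.axioms(1)[OF M.deg_submodule[of n]]] by simp
      then show "\<zero>\<^bsub>L\<^esub> \<in> deg L n" using phi_dg[of "\<zero>\<^bsub>L\<^esub>" n] by (simp add: phi.zero)
      show "\<ominus>\<^bsub>L\<^esub> a \<in> deg L n" if "a \<in> deg L n" for a
        using sm(3)[of "\<phi> a"] phi_dg[of "\<ominus>\<^bsub>L\<^esub> a" n] phi_dg[of a n] dL[OF that] that by (simp add: phi.neg)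
      show "a \<oplus>\<^bsub>L\<^esub> b \<in> deg L n" if "a \<in> deg L n" "b \<in> deg L n" for a b
        using sm(5)[of "\<phi> a" "\<phi> b"] phi_dg[of "a \<oplus>\<^bsub>L\<^esub> b" n] phi_dg[of a n] phi_dg[of b n] dL[OF that(1)] dL[OF that(2)] that by (simp add: phi.add)
      show "a \<odot>\<^bsub>L\<^esub> x \<in> deg L n" if "a \<in> carrier K" "x \<in> deg L n" for a x
        using sm(4)[of a "\<phi> x"] phi_dg[of "a \<odot>\<^bsub>L\<^esub> x" n] phi_dg[of x n] dL[OF that(2)] that by (simp add: lin_map_smult[OF lin])
    qed
    show "\<exists>y\<in>deg L n \<inter> hpart L 0. \<exists>z\<in>deg L n \<inter> hpart L 1. x = y \<oplus>\<^bsub>L\<^esub> z" if x: "x \<in> deg L n" for x n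
    proof -
      obtain y z where yz: "y \<in> deg M n \<inter> hpart M 0" "z \<in> deg M n \<inter> hpart M 1" "\<phi> x = y \<oplus>\<^bsub>M\<^esub> z"
        using M.deg_super[of "\<phi> x" n] x phi_dg[OF dL[OF x]] by blast
      have c: "y \<in> carrier M" "z \<in> carrier M" using yz dM by auto
      have "x = \<psi> y \<oplus>\<^bsub>L\<^esub> \<psi> z" using psi_phi[OF dL[OF x]] yz(3) lin_map_add[OF psi_lin c] by simp
      moreover have "\<psi> y \<in> deg L n \<inter> hpart L 0" "\<psi> z \<in> deg L n \<inter> hpart L 1"
        using yz c phi_dg[OF psi(1)] phi_hp[OF psi(1)] psi(2) by auto
      ultimately show ?thesis by blast
    qed
    show "\<exists>!c. (\<forall>n. c n \<in> deg L n) \<and> finite {n. c n \<noteq> \<zero>\<^bsub>L\<^esub>} \<and> x = (\<Oplus>\<^bsub>L\<^esub>n\<in>{n. c n \<noteq> \<zero>\<^bsub>L\<^esub>}. c n)"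
      if x: "x \<in> carrier L" for x
    proof -
      let ?Q = "\<lambda>c. (\<forall>n. c n \<in> deg M n) \<and> finite {n. c n \<noteq> \<zero>\<^bsub>M\<^esub>} \<and> \<phi> x = (\<Oplus>\<^bsub>M\<^esub>n\<in>{n. c n \<noteq> \<zero>\<^bsub>M\<^esub>}. c n)"
      have ex: "\<exists>!c. ?Q c" by (rule M.deg_direct_sum[OF phi.closed[OF x]])
      then obtain c where c: "?Q c" and u: "\<forall>c'. ?Q c' \<longrightarrow> c' = c" by (rule ex1E)
      have cM: "c n \<in> carrier M" for n using c dM by blast
      have psi0: "\<psi> \<zero>\<^bsub>M\<^esub> = \<zero>\<^bsub>L\<^esub>" using psi_phi[of "\<zero>\<^bsub>L\<^esub>"] by (simp add: phi.zero)
      have nz: "\<psi> (c n) \<noteq> \<zero>\<^bsub>L\<^esub> \<longleftrightarrow> c n \<noteq> \<zero>\<^bsub>M\<^esub>" for n using psi0 psi(2)[OF cM, of n] phi.zero by metis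
      show ?thesis
      proof (rule ex1I[of _ "\<lambda>n. \<psi> (c n)"], intro conjI allI)
        show "\<psi> (c n) \<in> deg L n" for n using phi_dg[OF psi(1)[OF cM]] psi(2)[OF cM] c by simp
        show "finite {n. \<psi> (c n) \<noteq> \<zero>\<^bsub>L\<^esub>}" using c by (simp add: nz)
        have "x = \<psi> (\<Oplus>\<^bsub>M\<^esub>n\<in>{n. c n \<noteq> \<zero>\<^bsub>M\<^esub>}. c n)" using psi_phi[OF x] c by simp
        also have "\<dots> = (\<Oplus>\<^bsub>L\<^esub>n\<in>{n. c n \<noteq> \<zero>\<^bsub>M\<^esub>}. \<psi> (c n))"
          by (rule lin_hom.sum[OF lin_homI[OF M.superspace_axioms L psi_lin]]) (rule cM)
        finally show "x = (\<Oplus>\<^bsub>L\<^esub>n\<in>{n. \<psi> (c n) \<noteq> \<zero>\<^bsub>L\<^esub>}. \<psi> (c n))" by (simp add: nz)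
      next
        fix d assume d: "(\<forall>n. d n \<in> deg L n) \<and> finite {n. d n \<noteq> \<zero>\<^bsub>L\<^esub>} \<and> x = (\<Oplus>\<^bsub>L\<^esub>n\<in>{n. d n \<noteq> \<zero>\<^bsub>L\<^esub>}. d n)"
        have dc: "d n \<in> carrier L" for n using d dL by blast
        have nz': "\<phi> (d n) \<noteq> \<zero>\<^bsub>M\<^esub> \<longleftrightarrow> d n \<noteq> \<zero>\<^bsub>L\<^esub>" for n using inj[OF dc, of "\<zero>\<^bsub>L\<^esub>" n] phi.zero by auto
        have "\<phi> x = (\<Oplus>\<^bsub>M\<^esub>n\<in>{n. d n \<noteq> \<zero>\<^bsub>L\<^esub>}. \<phi> (d n))" using d phi.sum[of "{n. d n \<noteq> \<zero>\<^bsub>L\<^esub>}" d] dc by simp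
        then have 1: "\<phi> x = (\<Oplus>\<^bsub>M\<^esub>n\<in>{n. \<phi> (d n) \<noteq> \<zero>\<^bsub>M\<^esub>}. \<phi> (d n))" unfolding nz' .
        have 2: "\<phi> (d n) \<in> deg M n" for n using conjunct1[OF d] phi_dg[OF dc] by blast
        have 3: "finite {n. \<phi> (d n) \<noteq> \<zero>\<^bsub>M\<^esub>}" unfolding nz' by (rule conjunct1[OF conjunct2[OF d]])
        have "(\<lambda>n. \<phi> (d n)) = c" by (rule u[rule_format]) (intro conjI allI 1 2 3)
        then have e: "\<phi> (d n) = c n" for n by (rule fun_cong)
        show "d = (\<lambda>n. \<psi> (c n))"
        proof
          fix n show "d n = \<psi> (c n)" using psi_phi[OF dc[of n]] unfolding e by (rule sym)
        qed
      qed
    qed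
    show "deg L n = {\<zero>\<^bsub>L\<^esub>}" if that': "n < -1" for n
    proof -
      have d: "x \<in> deg L n \<longleftrightarrow> \<phi> x = \<zero>\<^bsub>M\<^esub>" if "x \<in> carrier L" for x
        using phi_dg[OF that, of n] unfolding M.deg_lower[OF that'] by simp
      have "x = \<zero>\<^bsub>L\<^esub>" if "x \<in> deg L n" for x
        using that inj[OF dL[OF that] L.M.zero_closed] d[OF dL[OF that]] phi.zero by metis
      moreover have "\<zero>\<^bsub>L\<^esub> \<in> deg L n" using d[OF L.M.zero_closed] phi.zero by metis
      ultimately show ?thesis by blast
    qed
    show "brk L x y \<in> deg L (m + n)" if x: "x \<in> deg L m" "y \<in> deg L n" for x m y n
    proof -
      note c = dL[OF x(1)] dL[OF x(2)]
      have "brk M (\<phi> x) (\<phi> y) \<in> deg M (m + n)" using x phi_dg[OF c(1)] phi_dg[OF c(2)] by (intro M.deg_brk) blast+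
      then show ?thesis using br[OF c] phi_dg[OF bc[OF c]] by metis
    qed
  qed
qed

section \<open>The values of the lambda bracket at zero\<close>

locale conformal_pseudo_operad_char0 = conformal_pseudo_operad K P
  for K :: "('k, 'm) ring_scheme" and P :: "('k, 'a, 'z) conformal_pseudo_operad_scheme" +
  assumes char0: "char_zero K"
begin

sublocale R: pseudo_operad_char0 K "semidirect P"
  by (intro pseudo_operad_char0.intro pseudo_operad_char0_axioms.intro R_pseudo char0)

sublocale Qt: pseudo_operad_char0 K "quot_pseudo_operad P"
  by (intro pseudo_operad_char0.intro pseudo_operad_char0_axioms.intro quot_linear_pseudo_operad char0)

abbreviation "Q \<equiv> quot_pseudo_operad P"

lemma Q_simps: "sp Q = dquot P" "act Q = quot_act P"
  by (simp_all add: quot_pseudo_operad_def)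

text \<open>The box products formed with \<open>dot\<close> and with \<open>star\<close>. The first is the box product of the first
components in the semidirect product and represents that of the quotient; both are values of
$f \Box_\lambda g$, see \<open>cbox_values\<close>.\<close>

definition dbox :: "int \<Rightarrow> int \<Rightarrow> 'a \<Rightarrow> 'a \<Rightarrow> 'a" where
  "dbox n m f g = (\<Oplus>\<^bsub>sp P (ar (n + m))\<^esub>\<sigma>\<in>shuffle_perms (m + 1) n.
     act P (ar (n + m)) (inv_into UNIV \<sigma>) (dot P (ar n) (ar m) 1 f g))"

definition sbox :: "int \<Rightarrow> int \<Rightarrow> 'a \<Rightarrow> 'a \<Rightarrow> 'a" where
  "sbox n m f g = (\<Oplus>\<^bsub>sp P (ar (n + m))\<^esub>\<sigma>\<in>shuffle_perms (m + 1) n.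
     act P (ar (n + m)) (inv_into UNIV \<sigma>) (star P (ar n) (ar m) 1 f g))"

lemma shuffle_cases:
  obtains "shuffle_perms (m + 1) n = {}" | "1 \<in> {1..ar n}" "ar n + ar m - 1 = ar (n + m)"
proof (cases "n < 0 \<or> m < -1")
  case True
  then have "shuffle_perms (m + 1) n = {}" by (auto simp: shuffle_perms_def)
  then show ?thesis by (rule that(1))
next
  case False
  then show ?thesis by (intro that(2)) (auto simp: ar_def)
qed

lemmas shuffle_inv_permutes = R.shuffle_perms_permutes
lemmas act_compose_lin = sp_module lin_map_compose[OF act_lin]

lemmas finsum_sp_empty = abelian_monoid.finsum_empty[OF abelian_group.axioms(1)[OF sp_abelian]]

lemma finite_shuffles: "finite (shuffle_perms m n)"
  by (rule finite_subset[OF _ finite_permutations[of "{1..nat (m + n)}"]]) (auto simp: shuffle_perms_def)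

lemma dbox_lin_left: "g \<in> carrier (sp P (ar m)) \<Longrightarrow> lin_map K (sp P (ar n)) (sp P (ar (n + m))) (\<lambda>f. dbox n m f g)"
proof (cases rule: shuffle_cases[of m n])
  assume g: "g \<in> carrier (sp P (ar m))" and c: "1 \<in> {1..ar n}" "ar n + ar m - 1 = ar (n + m)"
  show ?thesis unfolding dbox_def using dot_lin_left[OF c(1) g] c(2)
    by (intro lin_map_sum act_compose_lin shuffle_inv_permutes) auto
qed (simp add: dbox_def lin_map_0 sp_module finsum_sp_empty)

lemma dbox_lin_right: "f \<in> carrier (sp P (ar n)) \<Longrightarrow> lin_map K (sp P (ar m)) (sp P (ar (n + m))) (dbox n m f)"
proof (cases rule: shuffle_cases[of m n])
  assume f: "f \<in> carrier (sp P (ar n))" and c: "1 \<in> {1..ar n}" "ar n + ar m - 1 = ar (n + m)"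
  show ?thesis unfolding dbox_def[abs_def] using dot_lin_right[OF c(1) f, of "ar m"] c(2)
    by (intro lin_map_sum act_compose_lin shuffle_inv_permutes) auto
qed (simp add: dbox_def[abs_def] lin_map_0 sp_module finsum_sp_empty)

lemma sbox_lin_left: "g \<in> carrier (sp P (ar m)) \<Longrightarrow> lin_map K (sp P (ar n)) (sp P (ar (n + m))) (\<lambda>f. sbox n m f g)"
proof (cases rule: shuffle_cases[of m n])
  assume g: "g \<in> carrier (sp P (ar m))" and c: "1 \<in> {1..ar n}" "ar n + ar m - 1 = ar (n + m)"
  show ?thesis unfolding sbox_def using star_lin_left[OF c(1) g] c(2)
    by (intro lin_map_sum act_compose_lin shuffle_inv_permutes) auto
qed (simp add: sbox_def lin_map_0 sp_module finsum_sp_empty)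

lemma sbox_lin_right: "f \<in> carrier (sp P (ar n)) \<Longrightarrow> lin_map K (sp P (ar m)) (sp P (ar (n + m))) (sbox n m f)"
proof (cases rule: shuffle_cases[of m n])
  assume f: "f \<in> carrier (sp P (ar n))" and c: "1 \<in> {1..ar n}" "ar n + ar m - 1 = ar (n + m)"
  show ?thesis unfolding sbox_def[abs_def] using star_lin_right[OF c(1) f, of "ar m"] c(2)
    by (intro lin_map_sum act_compose_lin shuffle_inv_permutes) auto
qed (simp add: sbox_def[abs_def] lin_map_0 sp_module finsum_sp_empty)

lemma dbox_closed: "\<lbrakk>f \<in> carrier (sp P (ar n)); g \<in> carrier (sp P (ar m))\<rbrakk> \<Longrightarrow> dbox n m f g \<in> carrier (sp P (ar (n + m)))"
  and sbox_closed: "\<lbrakk>f \<in> carrier (sp P (ar n)); g \<in> carrier (sp P (ar m))\<rbrakk> \<Longrightarrow> sbox n m f g \<in> carrier (sp P (ar (n + m)))"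
  by (rule lin_map_closed[OF dbox_lin_left], assumption+, rule lin_map_closed[OF sbox_lin_left])

lemma box_lin_zero:
  "g \<in> carrier (sp P (ar m)) \<Longrightarrow> dbox n m \<zero>\<^bsub>sp P (ar n)\<^esub> g = \<zero>\<^bsub>sp P (ar (n + m))\<^esub>"
  "f \<in> carrier (sp P (ar n)) \<Longrightarrow> dbox n m f \<zero>\<^bsub>sp P (ar m)\<^esub> = \<zero>\<^bsub>sp P (ar (n + m))\<^esub>"
  "g \<in> carrier (sp P (ar m)) \<Longrightarrow> sbox n m \<zero>\<^bsub>sp P (ar n)\<^esub> g = \<zero>\<^bsub>sp P (ar (n + m))\<^esub>"
  "f \<in> carrier (sp P (ar n)) \<Longrightarrow> sbox n m f \<zero>\<^bsub>sp P (ar m)\<^esub> = \<zero>\<^bsub>sp P (ar (n + m))\<^esub>"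
  by (rule lin_hom.zero[OF lin_homI[OF superspace_sp superspace_sp dbox_lin_left]] lin_hom.zero[OF lin_homI[OF superspace_sp superspace_sp dbox_lin_right]]
    lin_hom.zero[OF lin_homI[OF superspace_sp superspace_sp sbox_lin_left]] lin_hom.zero[OF lin_homI[OF superspace_sp superspace_sp sbox_lin_right]]; assumption)+

lemma box_dd:
  assumes f: "f \<in> carrier (sp P (ar n))" and g: "g \<in> carrier (sp P (ar m))"
  shows "sbox n m (dd P (ar n) f) g = \<zero>\<^bsub>sp P (ar (n + m))\<^esub>" "dbox n m f (dd P (ar m) g) = \<zero>\<^bsub>sp P (ar (n + m))\<^esub>"
proof -
  interpret V: abelian_group "sp P (ar (n + m))" by (rule sp_abelian)
  have az: "act P (ar (n + m)) (inv_into UNIV \<sigma>) \<zero>\<^bsub>sp P (ar (n + m))\<^esub> = \<zero>\<^bsub>sp P (ar (n + m))\<^esub>"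
    if "\<sigma> \<in> shuffle_perms (m + 1) n" for \<sigma> by (rule lin_hom.zero[OF act_hom[OF shuffle_inv_permutes[OF that]]])
  show "sbox n m (dd P (ar n) f) g = \<zero>\<^bsub>sp P (ar (n + m))\<^esub>"
  proof (cases rule: shuffle_cases[of m n])
    case 2 then show ?thesis unfolding sbox_def using star_dd_left[OF 2(1) f g] az by (intro V.add.finprod_one_eqI) simp
  qed (simp add: sbox_def)
  show "dbox n m f (dd P (ar m) g) = \<zero>\<^bsub>sp P (ar (n + m))\<^esub>"
  proof (cases rule: shuffle_cases[of m n])
    case 2 then show ?thesis unfolding dbox_def using dot_dd_right[OF 2(1) f g] az by (intro V.add.finprod_one_eqI) simp
  qed (simp add: dbox_def)
qed

lemma box_R:
  assumes x: "f \<in> carrier (sp P (ar n))" "u \<in> carrier (sp P (ar n))" and y: "g \<in> carrier (sp P (ar m))" "v \<in> carrier (sp P (ar m))"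
  shows "box R n m (f, u) (g, v) = (dbox n m f g, sbox n m f v \<oplus>\<^bsub>sp P (ar (n + m))\<^esub> dbox n m u g)"
proof (cases rule: shuffle_cases[of m n])
  case 1
  then show ?thesis by (simp add: box_def dbox_def sbox_def R_simps sprod_simps abelian_monoid.finsum_empty[OF abelian_group.axioms(1)[OF R.S_ab]]
     superspace_abelian[OF sprod_superspace[OF superspace_sp]] abelian_group.axioms(1) abelian_monoid.finsum_empty sp_abelian abelian_monoid.l_zero abelian_monoid.zero_closed)
next
  case 2
  let ?V = "sp P (ar (n + m))"
  interpret V: abelian_group ?V by (rule sp_abelian)
  note c = dot_closed[OF 2(1) x(1) y(1)] star_closed[OF 2(1) x(1) y(2)] dot_closed[OF 2(1) x(2) y(1)]
  have ac: "act P (ar (n + m)) (inv_into UNIV \<sigma>) z \<in> carrier ?V" if "\<sigma> \<in> shuffle_perms (m + 1) n" "z \<in> carrier ?V" for \<sigma> z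
    by (rule act_closed[OF shuffle_inv_permutes[OF that(1)] that(2)])
  have aa: "act P (ar (n + m)) (inv_into UNIV \<sigma>) (z \<oplus>\<^bsub>?V\<^esub> z') = act P (ar (n + m)) (inv_into UNIV \<sigma>) z \<oplus>\<^bsub>?V\<^esub> act P (ar (n + m)) (inv_into UNIV \<sigma>) z'"
    if "\<sigma> \<in> shuffle_perms (m + 1) n" "z \<in> carrier ?V" "z' \<in> carrier ?V" for \<sigma> z z'
    by (rule lin_map_add[OF act_lin[OF shuffle_inv_permutes[OF that(1)]] that(2,3)])
  have "box R n m (f, u) (g, v) = (\<Oplus>\<^bsub>?V\<^esub>\<sigma>\<in>shuffle_perms (m + 1) n. act P (ar (n + m)) (inv_into UNIV \<sigma>) (dot P (ar n) (ar m) 1 f g),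
    \<Oplus>\<^bsub>?V\<^esub>\<sigma>\<in>shuffle_perms (m + 1) n. act P (ar (n + m)) (inv_into UNIV \<sigma>) (star P (ar n) (ar m) 1 f v \<oplus>\<^bsub>?V\<^esub> dot P (ar n) (ar m) 1 u g))"
    unfolding box_def R_simps 2(2) using c ac by (subst sprod_sum[OF superspace_sp]) (auto simp: sprod_simps 2(2))
  also have "(\<Oplus>\<^bsub>?V\<^esub>\<sigma>\<in>shuffle_perms (m + 1) n. act P (ar (n + m)) (inv_into UNIV \<sigma>) (star P (ar n) (ar m) 1 f v \<oplus>\<^bsub>?V\<^esub> dot P (ar n) (ar m) 1 u g)) =
    (\<Oplus>\<^bsub>?V\<^esub>\<sigma>\<in>shuffle_perms (m + 1) n. act P (ar (n + m)) (inv_into UNIV \<sigma>) (star P (ar n) (ar m) 1 f v) \<oplus>\<^bsub>?V\<^esub>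
      act P (ar (n + m)) (inv_into UNIV \<sigma>) (dot P (ar n) (ar m) 1 u g))"
    using c ac aa 2(2) by (intro V.finsum_cong') auto
  also have "\<dots> = sbox n m f v \<oplus>\<^bsub>?V\<^esub> dbox n m u g"
    unfolding sbox_def dbox_def using c ac 2(2) by (intro V.finsum_addf) auto
  finally show ?thesis by (simp add: dbox_def)
qed

lemma box_Q:
  assumes f: "f \<in> carrier (sp P (ar n))" and g: "g \<in> carrier (sp P (ar m))"
  shows "box Q n m (dcls P (ar n) f) (dcls P (ar m) g) = dcls P (ar (n + m)) (dbox n m f g)"
    "dcls P (ar (n + m)) (sbox n m f g) = dcls P (ar (n + m)) (dbox n m f g)"
proof -
  interpret D: abelian_group "dquot P (ar (n + m))" by (rule superspace_abelian[OF dquot_superspace])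
  have fs: "dcls P (ar (n + m)) (\<Oplus>\<^bsub>sp P (ar (n + m))\<^esub>\<sigma>\<in>shuffle_perms (m + 1) n. act P (ar (n + m)) (inv_into UNIV \<sigma>) z) =
    (\<Oplus>\<^bsub>dquot P (ar (n + m))\<^esub>\<sigma>\<in>shuffle_perms (m + 1) n. quot_act P (ar (n + m)) (inv_into UNIV \<sigma>) (dcls P (ar (n + m)) z))"
    if z: "z \<in> carrier (sp P (ar (n + m)))" for z
  proof -
    have "dcls P (ar (n + m)) (\<Oplus>\<^bsub>sp P (ar (n + m))\<^esub>\<sigma>\<in>shuffle_perms (m + 1) n. act P (ar (n + m)) (inv_into UNIV \<sigma>) z) =
      (\<Oplus>\<^bsub>dquot P (ar (n + m))\<^esub>\<sigma>\<in>shuffle_perms (m + 1) n. dcls P (ar (n + m)) (act P (ar (n + m)) (inv_into UNIV \<sigma>) z))"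
      by (rule dcls_finsum) (simp add: act_closed shuffle_inv_permutes z)
    also have "\<dots> = (\<Oplus>\<^bsub>dquot P (ar (n + m))\<^esub>\<sigma>\<in>shuffle_perms (m + 1) n. quot_act P (ar (n + m)) (inv_into UNIV \<sigma>) (dcls P (ar (n + m)) z))"
    proof (rule D.finsum_cong'[OF refl])
      fix \<sigma> assume s: "\<sigma> \<in> shuffle_perms (m + 1) n"
      show "dcls P (ar (n + m)) (act P (ar (n + m)) (inv_into UNIV \<sigma>) z) = quot_act P (ar (n + m)) (inv_into UNIV \<sigma>) (dcls P (ar (n + m)) z)"
        by (rule quot_act_dcls[OF shuffle_inv_permutes[OF s] z, symmetric])
    qed (auto simp: quot_act_dcls[OF shuffle_inv_permutes z] dcls_closed act_closed shuffle_inv_permutes z)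
    finally show ?thesis .
  qed
  show "box Q n m (dcls P (ar n) f) (dcls P (ar m) g) = dcls P (ar (n + m)) (dbox n m f g)"
  proof (cases rule: shuffle_cases[of m n])
    case 1 then show ?thesis using lin_hom.zero[OF dcls_hom, of "ar (n + m)"]
      by (simp add: box_def dbox_def Q_simps abelian_monoid.finsum_empty[OF abelian_group.axioms(1)[OF sp_abelian]])
  next
    case 2
    then have d: "dot P (ar n) (ar m) 1 f g \<in> carrier (sp P (ar (n + m)))" using dot_closed[OF 2(1) f g] by simp
    show ?thesis unfolding dbox_def fs[OF d] box_def using pcomp_dcls[OF 2(1) f g] 2(2) by (simp add: Q_simps dot_def)
  qed
  show "dcls P (ar (n + m)) (sbox n m f g) = dcls P (ar (n + m)) (dbox n m f g)"
  proof (cases rule: shuffle_cases[of m n])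
    case 1 then show ?thesis by (simp add: sbox_def dbox_def finsum_sp_empty)
  next
    case 2
    then have c: "dot P (ar n) (ar m) 1 f g \<in> carrier (sp P (ar (n + m)))" "star P (ar n) (ar m) 1 f g \<in> carrier (sp P (ar (n + m)))"
      using dot_closed[OF 2(1) f g] star_closed[OF 2(1) f g] by simp_all
    show ?thesis unfolding dbox_def sbox_def fs[OF c(1)] fs[OF c(2)] using dcls_star[OF 2(1) f g] 2(2) by simp
  qed
qed

text \<open>The product $f \Box_\lambda g$ is formed with $-\lambda-\partial$ in place of the variable. So its value
at $\lambda = 0$ belongs to \<open>star\<close>, and its value at $\lambda = -\partial$ belongs to \<open>dot\<close>.\<close>

lemma cbox_values:
  assumes f: "f \<in> carrier (sp P (ar n))" and g: "g \<in> carrier (sp P (ar m))"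
  shows "cbox P n m f g 0 = sbox n m f g" "eval_neg (sp P (ar (n + m))) (dd P (ar (n + m))) (cbox P n m f g) = dbox n m f g"
    "cbox P n m f g \<in> up (sp P (ar (n + m)))"
proof -
  let ?V = "sp P (ar (n + m))" and ?d = "dd P (ar (n + m))"
  interpret E: endo K ?V ?d by (rule dd_endo)
  let ?S = "subst_neg ?V ?d (cpcomp P (ar n) (ar m) 1 f g)"
  have "cbox P n m f g 0 = sbox n m f g \<and> eval_neg ?V ?d (cbox P n m f g) = dbox n m f g \<and> cbox P n m f g \<in> up ?V"
  proof (cases rule: shuffle_cases[of m n])
    case 1 then show ?thesis by (simp add: cbox_def[abs_def] sbox_def dbox_def E.eval_zero E.up_zero)
  next
    case 2
    then have Q: "cpcomp P (ar n) (ar m) 1 f g \<in> up ?V" using cpcomp_poly[OF 2(1) f g] by simp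
    have up: "(\<lambda>a. act P (ar (n + m)) (inv_into UNIV \<sigma>) (?S a)) \<in> up ?V" if "\<sigma> \<in> shuffle_perms (m + 1) n" for \<sigma>
      by (rule E.up_map[OF act_hom[OF shuffle_inv_permutes[OF that]] E.subst_neg_up[OF Q]])
    have ev: "eval_neg ?V ?d (\<lambda>a. act P (ar (n + m)) (inv_into UNIV \<sigma>) (?S a)) = act P (ar (n + m)) (inv_into UNIV \<sigma>) (dot P (ar n) (ar m) 1 f g)"
      if s: "\<sigma> \<in> shuffle_perms (m + 1) n" for \<sigma>
      using eval_map[OF dd_endo dd_endo act_lin[OF shuffle_inv_permutes[OF s]] act_dd[OF shuffle_inv_permutes[OF s]] E.subst_neg_up[OF Q]] E.eval_subst_neg[OF Q]
      by (simp add: dot_def)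
    have "cbox P n m f g 0 = sbox n m f g"
      unfolding cbox_def sbox_def star_def E.subst_neg_0[OF Q] 2(2) ..
    moreover have "eval_neg ?V ?d (cbox P n m f g) = (\<Oplus>\<^bsub>?V\<^esub>\<sigma>\<in>shuffle_perms (m + 1) n. eval_neg ?V ?d (\<lambda>a. act P (ar (n + m)) (inv_into UNIV \<sigma>) (?S a)))"
      unfolding cbox_def[abs_def] by (rule E.eval_sum[OF finite_shuffles up])
    moreover have "\<dots> = dbox n m f g"
      unfolding dbox_def using ev dot_closed[OF 2(1) f g] 2(2) act_closed[OF shuffle_inv_permutes] by (intro E.V.M.finsum_cong') auto
    moreover have "cbox P n m f g \<in> up ?V" unfolding cbox_def[abs_def] by (rule E.up_sum[OF finite_shuffles up])
    ultimately show ?thesis by simp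
  qed
  then show "cbox P n m f g 0 = sbox n m f g" "eval_neg ?V ?d (cbox P n m f g) = dbox n m f g" "cbox P n m f g \<in> up ?V" by auto
qed

text \<open>\<open>dbrk\<close> is the commutator for \<open>dbox\<close>. In \<open>sbrk\<close> the two terms are of different kinds, as in
$[f_\lambda g]$ at $\lambda = 0$.\<close>

definition dbrk :: "int \<Rightarrow> int \<Rightarrow> 'a \<Rightarrow> 'a \<Rightarrow> 'a" where
  "dbrk n m f g = (\<Oplus>\<^bsub>sp P (ar (n + m))\<^esub>p\<in>UNIV. \<Oplus>\<^bsub>sp P (ar (n + m))\<^esub>q\<in>UNIV.
     dbox n m (hproj (sp P (ar n)) p f) (hproj (sp P (ar m)) q g) \<ominus>\<^bsub>sp P (ar (n + m))\<^esub>
     signed (sp P (ar (n + m))) (p * q) (dbox m n (hproj (sp P (ar m)) q g) (hproj (sp P (ar n)) p f)))"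

definition sbrk :: "int \<Rightarrow> int \<Rightarrow> 'a \<Rightarrow> 'a \<Rightarrow> 'a" where
  "sbrk n m f g = (\<Oplus>\<^bsub>sp P (ar (n + m))\<^esub>p\<in>UNIV. \<Oplus>\<^bsub>sp P (ar (n + m))\<^esub>q\<in>UNIV.
     sbox n m (hproj (sp P (ar n)) p f) (hproj (sp P (ar m)) q g) \<ominus>\<^bsub>sp P (ar (n + m))\<^esub>
     signed (sp P (ar (n + m))) (p * q) (dbox m n (hproj (sp P (ar m)) q g) (hproj (sp P (ar n)) p f)))"

lemma sp_hproj_closed: "f \<in> carrier (sp P n) \<Longrightarrow> hproj (sp P n) p f \<in> carrier (sp P n)"
  by (rule superspace.hproj_closed[OF superspace_sp])

lemma sp_hproj_zero: "hproj (sp P n) p \<zero>\<^bsub>sp P n\<^esub> = \<zero>\<^bsub>sp P n\<^esub>"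
  by (rule lin_hom.zero[OF lin_homI[OF superspace_sp superspace_sp superspace.hproj_lin[OF superspace_sp]]])

lemma dbox_closed': "\<lbrakk>f \<in> carrier (sp P (ar n)); g \<in> carrier (sp P (ar m))\<rbrakk> \<Longrightarrow> dbox m n g f \<in> carrier (sp P (ar (n + m)))"
  using dbox_closed[of g m f n] by (simp add: add.commute)

lemma brk_summands_closed:
  assumes f: "f \<in> carrier (sp P (ar n))" and g: "g \<in> carrier (sp P (ar m))"
  shows "dbox n m (hproj (sp P (ar n)) p f) (hproj (sp P (ar m)) q g) \<ominus>\<^bsub>sp P (ar (n + m))\<^esub>
     signed (sp P (ar (n + m))) s (dbox m n (hproj (sp P (ar m)) q g) (hproj (sp P (ar n)) p f)) \<in> carrier (sp P (ar (n + m)))"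
    "sbox n m (hproj (sp P (ar n)) p f) (hproj (sp P (ar m)) q g) \<ominus>\<^bsub>sp P (ar (n + m))\<^esub>
     signed (sp P (ar (n + m))) s (dbox m n (hproj (sp P (ar m)) q g) (hproj (sp P (ar n)) p f)) \<in> carrier (sp P (ar (n + m)))"
proof -
  interpret V: superspace K "sp P (ar (n + m))" by (rule superspace_sp)
  show "dbox n m (hproj (sp P (ar n)) p f) (hproj (sp P (ar m)) q g) \<ominus>\<^bsub>sp P (ar (n + m))\<^esub>
     signed (sp P (ar (n + m))) s (dbox m n (hproj (sp P (ar m)) q g) (hproj (sp P (ar n)) p f)) \<in> carrier (sp P (ar (n + m)))"
    by (intro V.M.minus_closed V.signed_closed dbox_closed dbox_closed' sp_hproj_closed f g)
  show "sbox n m (hproj (sp P (ar n)) p f) (hproj (sp P (ar m)) q g) \<ominus>\<^bsub>sp P (ar (n + m))\<^esub>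
     signed (sp P (ar (n + m))) s (dbox m n (hproj (sp P (ar m)) q g) (hproj (sp P (ar n)) p f)) \<in> carrier (sp P (ar (n + m)))"
    by (intro V.M.minus_closed V.signed_closed sbox_closed dbox_closed' sp_hproj_closed f g)
qed

lemma cbox_brk_zero:
  assumes f: "f \<in> carrier (sp P (ar n))" and g: "g \<in> carrier (sp P (ar m))"
  shows "cbox_brk P n m f g 0 = sbrk n m f g"
proof -
  have "subst_neg (sp P (ar (n + m))) (dd P (ar (n + m))) (cbox P m n g' f') 0 = dbox m n g' f'"
    if "f' \<in> carrier (sp P (ar n))" "g' \<in> carrier (sp P (ar m))" for f' g'
    using cbox_values(2,3)[OF that(2,1)] endo.subst_neg_0[OF dd_endo, of _ "ar (n + m)"] by (simp add: add.commute)
  then show ?thesis unfolding cbox_brk_def sbrk_def Let_def using cbox_values(1) sp_hproj_closed f g by simp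
qed

text \<open>The bracket of an element \<open>(f, 0)\<close> with \<open>(0, g)\<close> in the semidirect product is the action of
\<open>f\<close> on \<open>g\<close>, and elements \<open>(f, 0)\<close> form a subalgebra.\<close>

lemma box_brk_R:
  assumes f: "f \<in> carrier (sp P (ar n))" and g: "g \<in> carrier (sp P (ar m))"
  shows "box_brk R n m (f, \<zero>\<^bsub>sp P (ar n)\<^esub>) (\<zero>\<^bsub>sp P (ar m)\<^esub>, g) = (\<zero>\<^bsub>sp P (ar (n + m))\<^esub>, sbrk n m f g)"
    "box_brk R n m (f, \<zero>\<^bsub>sp P (ar n)\<^esub>) (g, \<zero>\<^bsub>sp P (ar m)\<^esub>) = (dbrk n m f g, \<zero>\<^bsub>sp P (ar (n + m))\<^esub>)"
proof -
  let ?V = "sp P (ar (n + m))"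
  interpret V: superspace K ?V by (rule superspace_sp)
  have z: "\<zero>\<^bsub>sp P k\<^esub> \<in> carrier (sp P k)" for k
    using abelian_monoid.zero_closed[OF abelian_group.axioms(1)[OF sp_abelian]] .
  have zz: "\<zero>\<^bsub>?V\<^esub> \<ominus>\<^bsub>?V\<^esub> signed ?V s \<zero>\<^bsub>?V\<^esub> = \<zero>\<^bsub>?V\<^esub>" for s by (simp add: V.signed_zero a_minus_def neg_zero sp_abelian)
  have h: "hproj (sprod (sp P k)) p (a, b) = (hproj (sp P k) p a, hproj (sp P k) p b)" if "a \<in> carrier (sp P k)" "b \<in> carrier (sp P k)" for k p a b
    using sprod_hproj[OF superspace_sp, of "(a, b)" k p] that by (simp add: R_simps sprod_simps)
  have b1: "box R n m (a, \<zero>\<^bsub>sp P (ar n)\<^esub>) (\<zero>\<^bsub>sp P (ar m)\<^esub>, b) = (\<zero>\<^bsub>?V\<^esub>, sbox n m a b)"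
    "box R m n (\<zero>\<^bsub>sp P (ar m)\<^esub>, b) (a, \<zero>\<^bsub>sp P (ar n)\<^esub>) = (\<zero>\<^bsub>?V\<^esub>, dbox m n b a)"
    "box R n m (a, \<zero>\<^bsub>sp P (ar n)\<^esub>) (b, \<zero>\<^bsub>sp P (ar m)\<^esub>) = (dbox n m a b, \<zero>\<^bsub>?V\<^esub>)"
    "box R m n (b, \<zero>\<^bsub>sp P (ar m)\<^esub>) (a, \<zero>\<^bsub>sp P (ar n)\<^esub>) = (dbox m n b a, \<zero>\<^bsub>?V\<^esub>)"
    if "a \<in> carrier (sp P (ar n))" "b \<in> carrier (sp P (ar m))" for a b
    using that box_R[of a n "\<zero>\<^bsub>sp P (ar n)\<^esub>" "\<zero>\<^bsub>sp P (ar m)\<^esub>" m b] box_R[of "\<zero>\<^bsub>sp P (ar m)\<^esub>" m b a n "\<zero>\<^bsub>sp P (ar n)\<^esub>"]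
      box_R[of a n "\<zero>\<^bsub>sp P (ar n)\<^esub>" b m "\<zero>\<^bsub>sp P (ar m)\<^esub>"] box_R[of b m "\<zero>\<^bsub>sp P (ar m)\<^esub>" a n "\<zero>\<^bsub>sp P (ar n)\<^esub>"]
    by (simp_all add: z box_lin_zero sbox_closed dbox_closed dbox_closed' add.commute[of m n])
  note c = brk_summands_closed[OF f g]
  have mm: "(a, b) \<ominus>\<^bsub>sprod ?V\<^esub> signed (sprod ?V) s (a', b') = (a \<ominus>\<^bsub>?V\<^esub> signed ?V s a', b \<ominus>\<^bsub>?V\<^esub> signed ?V s b')"
    if "a \<in> carrier ?V" "b \<in> carrier ?V" "a' \<in> carrier ?V" "b' \<in> carrier ?V" for a b a' b' s
    using that sprod_signed[OF superspace_sp, of "(a', b')" "ar (n + m)" s] sprod_minus[OF superspace_sp, of "(a, b)" "ar (n + m)"]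
    by (simp add: sprod_simps V.signed_closed)
  have ps: "(\<Oplus>\<^bsub>sprod ?V\<^esub>p\<in>(UNIV :: bit set). \<Oplus>\<^bsub>sprod ?V\<^esub>q\<in>(UNIV :: bit set). (a p q, b p q)) =
    (\<Oplus>\<^bsub>?V\<^esub>p\<in>(UNIV :: bit set). \<Oplus>\<^bsub>?V\<^esub>q\<in>(UNIV :: bit set). a p q, \<Oplus>\<^bsub>?V\<^esub>p\<in>(UNIV :: bit set). \<Oplus>\<^bsub>?V\<^esub>q\<in>(UNIV :: bit set). b p q)"
    if "\<And>p q. a p q \<in> carrier ?V" "\<And>p q. b p q \<in> carrier ?V" for a b
    using that by (simp add: sprod_sum[OF superspace_sp] sprod_simps V.M.finsum_closed)
  have "box_brk R n m (f, \<zero>\<^bsub>sp P (ar n)\<^esub>) (\<zero>\<^bsub>sp P (ar m)\<^esub>, g) =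
    (\<Oplus>\<^bsub>sprod ?V\<^esub>p\<in>UNIV. \<Oplus>\<^bsub>sprod ?V\<^esub>q\<in>UNIV. (\<zero>\<^bsub>?V\<^esub>, sbox n m (hproj (sp P (ar n)) p f) (hproj (sp P (ar m)) q g) \<ominus>\<^bsub>sp P (ar (n + m))\<^esub>
     signed (sp P (ar (n + m))) (p * q) (dbox m n (hproj (sp P (ar m)) q g) (hproj (sp P (ar n)) p f))))"
    unfolding box_brk_def Let_def h[OF f z] h[OF z g] sp_hproj_zero b1(1,2)[OF sp_hproj_closed[OF f] sp_hproj_closed[OF g]] R_simps
    by (simp add: mm sbox_closed dbox_closed' sp_hproj_closed f g zz)
  also have "\<dots> = (\<zero>\<^bsub>?V\<^esub>, sbrk n m f g)"
    by (subst ps) (simp_all add: c sbrk_def)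
  finally show "box_brk R n m (f, \<zero>\<^bsub>sp P (ar n)\<^esub>) (\<zero>\<^bsub>sp P (ar m)\<^esub>, g) = (\<zero>\<^bsub>sp P (ar (n + m))\<^esub>, sbrk n m f g)" .
  have "box_brk R n m (f, \<zero>\<^bsub>sp P (ar n)\<^esub>) (g, \<zero>\<^bsub>sp P (ar m)\<^esub>) =
    (\<Oplus>\<^bsub>sprod ?V\<^esub>p\<in>UNIV. \<Oplus>\<^bsub>sprod ?V\<^esub>q\<in>UNIV. (dbox n m (hproj (sp P (ar n)) p f) (hproj (sp P (ar m)) q g) \<ominus>\<^bsub>sp P (ar (n + m))\<^esub>
     signed (sp P (ar (n + m))) (p * q) (dbox m n (hproj (sp P (ar m)) q g) (hproj (sp P (ar n)) p f)), \<zero>\<^bsub>?V\<^esub>))"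
    unfolding box_brk_def Let_def h[OF f z] h[OF g z] sp_hproj_zero b1(3,4)[OF sp_hproj_closed[OF f] sp_hproj_closed[OF g]] R_simps
    by (simp add: mm dbox_closed dbox_closed' sp_hproj_closed f g zz)
  also have "\<dots> = (dbrk n m f g, \<zero>\<^bsub>?V\<^esub>)"
    by (subst ps) (simp_all add: c dbrk_def)
  finally show "box_brk R n m (f, \<zero>\<^bsub>sp P (ar n)\<^esub>) (g, \<zero>\<^bsub>sp P (ar m)\<^esub>) = (dbrk n m f g, \<zero>\<^bsub>sp P (ar (n + m))\<^esub>)" .
qed

lemma box_brk_Q:
  assumes f: "f \<in> carrier (sp P (ar n))" and g: "g \<in> carrier (sp P (ar m))"
  shows "box_brk Q n m (dcls P (ar n) f) (dcls P (ar m) g) = dcls P (ar (n + m)) (dbrk n m f g)"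
    "dcls P (ar (n + m)) (sbrk n m f g) = dcls P (ar (n + m)) (dbrk n m f g)"
proof -
  let ?V = "sp P (ar (n + m))" and ?D = "dquot P (ar (n + m))"
  interpret V: superspace K ?V by (rule superspace_sp)
  interpret c: lin_hom K ?V ?D "dcls P (ar (n + m))" by (rule dcls_hom)
  note cl = brk_summands_closed[OF f g]
  have h: "hproj (dquot P k) p (dcls P k a) = dcls P k (hproj (sp P k) p a)" if "a \<in> carrier (sp P k)" for k p a
    using hproj_even_map[OF superspace_sp dquot_superspace dcls_even that] by simp
  have ds: "dcls P (ar (n + m)) (\<Oplus>\<^bsub>?V\<^esub>p\<in>(UNIV :: bit set). \<Oplus>\<^bsub>?V\<^esub>q\<in>(UNIV :: bit set). a p q) =
    (\<Oplus>\<^bsub>?D\<^esub>p\<in>(UNIV :: bit set). \<Oplus>\<^bsub>?D\<^esub>q\<in>(UNIV :: bit set). dcls P (ar (n + m)) (a p q))" if "\<And>p q. a p q \<in> carrier ?V" for a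
    using that by (simp add: c.sum V.M.finsum_closed)
  have bq: "box Q m n (dcls P (ar m) b) (dcls P (ar n) a) = dcls P (ar (n + m)) (dbox m n b a)"
    if "a \<in> carrier (sp P (ar n))" "b \<in> carrier (sp P (ar m))" for a b
    using box_Q(1)[OF that(2,1)] by (simp add: add.commute)
  have t: "dcls P (ar (n + m)) (x \<ominus>\<^bsub>?V\<^esub> signed ?V s y) = dcls P (ar (n + m)) x \<ominus>\<^bsub>?D\<^esub> signed ?D s (dcls P (ar (n + m)) y)"
    if "x \<in> carrier ?V" "y \<in> carrier ?V" for x y s using that by (simp add: c.minus c.signed V.signed_closed)
  show "box_brk Q n m (dcls P (ar n) f) (dcls P (ar m) g) = dcls P (ar (n + m)) (dbrk n m f g)"
    unfolding dbrk_def ds[OF cl(1)] box_brk_def Let_def Q_simps h[OF f] h[OF g] box_Q(1)[OF sp_hproj_closed[OF f] sp_hproj_closed[OF g]] bq[OF sp_hproj_closed[OF f] sp_hproj_closed[OF g]]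
    by (simp add: t dbox_closed dbox_closed' sp_hproj_closed f g)
  show "dcls P (ar (n + m)) (sbrk n m f g) = dcls P (ar (n + m)) (dbrk n m f g)"
    unfolding dbrk_def sbrk_def ds[OF cl(1)] ds[OF cl(2)]
    by (simp add: t dbox_closed dbox_closed' sbox_closed sp_hproj_closed f g box_Q(2))
qed

text \<open>This is why the action depends only on the class of \<open>f\<close>.\<close>

lemma sbrk_dd:
  assumes f: "f \<in> carrier (sp P (ar n))" and g: "g \<in> carrier (sp P (ar m))"
  shows "sbrk n m (dd P (ar n) f) g = \<zero>\<^bsub>sp P (ar (n + m))\<^esub>"
proof -
  let ?V = "sp P (ar (n + m))"
  interpret V: superspace K ?V by (rule superspace_sp)
  have h: "hproj (sp P (ar n)) p (dd P (ar n) f) = dd P (ar n) (hproj (sp P (ar n)) p f)" for p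
    using hproj_even_map[OF superspace_sp superspace_sp dd_even f] by simp
  have "dbox m n b (dd P (ar n) a) = \<zero>\<^bsub>?V\<^esub>" if "a \<in> carrier (sp P (ar n))" "b \<in> carrier (sp P (ar m))" for a b
    using box_dd(2)[OF that(2,1)] by (simp add: add.commute)
  then show ?thesis
    unfolding sbrk_def h using box_dd(1) sp_hproj_closed f g by (simp add: V.signed_zero a_minus_def neg_zero sp_abelian)
qed

end

context symm_seq
begin

text \<open>A choice in every degree with given properties, made such that the support does not grow: in the
degrees where \<open>Z\<close> holds, $0$ is chosen.\<close>

lemma W_lift:
  assumes fin: "finite {n \<in> {-1..}. \<not> Z n}"
    and ex: "\<And>n. n \<ge> -1 \<Longrightarrow> \<exists>g\<in>invariants S (ar n). A n g"
    and z: "\<And>n. \<lbrakk>n \<ge> -1; Z n\<rbrakk> \<Longrightarrow> A n \<zero>\<^bsub>sp S (ar n)\<^esub>"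
  shows "\<exists>w\<in>W_carrier S. \<forall>n\<ge>-1. A n (w n) \<and> (Z n \<longrightarrow> w n = \<zero>\<^bsub>sp S (ar n)\<^esub>)"
proof -
  obtain g where g: "\<And>n. n \<ge> -1 \<Longrightarrow> g n \<in> invariants S (ar n) \<and> A n (g n)" using ex by metis
  define w where "w = (\<lambda>n\<in>{-1..}. if Z n then \<zero>\<^bsub>sp S (ar n)\<^esub> else g n)"
  show ?thesis
  proof (rule bexI[of _ w])
    show "w \<in> W_carrier S" by (rule W_carrierI[OF _ _ fin]) (auto simp: w_def g inv_zero)
  qed (auto simp: w_def g z)
qed

end

context conformal_pseudo_operad_char0
begin

section \<open>Brackets of elements of several degrees\<close>

text \<open>Families \<open>v\<close> of invariants enter the semidirect product as \<open>(v, 0)\<close> and as \<open>(0, v)\<close>.\<close>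

definition in_fst :: "(int \<Rightarrow> 'a) \<Rightarrow> int \<Rightarrow> 'a \<times> 'a" where
  "in_fst v = (\<lambda>k\<in>{-1..}. (v k, \<zero>\<^bsub>sp P (ar k)\<^esub>))"

definition in_snd :: "(int \<Rightarrow> 'a) \<Rightarrow> int \<Rightarrow> 'a \<times> 'a" where
  "in_snd w = (\<lambda>k\<in>{-1..}. (\<zero>\<^bsub>sp P (ar k)\<^esub>, w k))"

definition W_fst :: "(int \<Rightarrow> 'a \<times> 'a) \<Rightarrow> int \<Rightarrow> 'a" where
  "W_fst z = (\<lambda>k\<in>{-1..}. fst (z k))"

definition W_snd :: "(int \<Rightarrow> 'a \<times> 'a) \<Rightarrow> int \<Rightarrow> 'a" where
  "W_snd z = (\<lambda>k\<in>{-1..}. snd (z k))"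

lemma sp_zero_closed: "\<zero>\<^bsub>sp P k\<^esub> \<in> carrier (sp P k)"
  using abelian_monoid.zero_closed[OF abelian_group.axioms(1)[OF sp_abelian]] .

lemma inv_R: "x \<in> invariants R k \<longleftrightarrow> fst x \<in> invariants P k \<and> snd x \<in> invariants P k"
  by (auto simp: invariants_def R_simps sprod_simps prod_eq_iff mem_Times_iff)

lemma in_at: "k \<ge> -1 \<Longrightarrow> in_fst v k = (v k, \<zero>\<^bsub>sp P (ar k)\<^esub>)" "k \<ge> -1 \<Longrightarrow> in_snd v k = (\<zero>\<^bsub>sp P (ar k)\<^esub>, v k)"
  "k \<ge> -1 \<Longrightarrow> W_fst z k = fst (z k)" "k \<ge> -1 \<Longrightarrow> W_snd z k = snd (z k)"
  by (simp_all add: in_fst_def in_snd_def W_fst_def W_snd_def)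

lemma in_fst_mem: assumes v: "v \<in> W_carrier P" shows "in_fst v \<in> W_carrier R"
  by (rule R.W_carrierI[OF _ _ W_finite[OF v]]) (use W_mem[OF v] in \<open>auto simp: in_fst_def inv_R inv_zero R_simps sprod_simps\<close>)

lemma in_snd_mem: assumes v: "v \<in> W_carrier P" shows "in_snd v \<in> W_carrier R"
  by (rule R.W_carrierI[OF _ _ W_finite[OF v]]) (use W_mem[OF v] in \<open>auto simp: in_snd_def inv_R inv_zero R_simps sprod_simps\<close>)

lemma W_fst_mem: assumes z: "z \<in> W_carrier R" shows "W_fst z \<in> W_carrier P"
  by (rule W_carrierI[OF _ _ R.W_finite[OF z]]) (use R.W_mem[OF z] in \<open>auto simp: W_fst_def inv_R R_simps sprod_simps\<close>)

lemma W_snd_mem: assumes z: "z \<in> W_carrier R" shows "W_snd z \<in> W_carrier P"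
  by (rule W_carrierI[OF _ _ R.W_finite[OF z]]) (use R.W_mem[OF z] in \<open>auto simp: W_snd_def inv_R R_simps sprod_simps\<close>)

lemma in_fst_lin: "lin_map K (W_space P) (W_space R) in_fst"
proof (rule R.W_lin_mapI[OF W_module])
  show "in_fst x \<in> W_carrier R" if "x \<in> carrier (W_space P)" for x using that in_fst_mem by (simp add: W_space_carrier)
  show "lin_map K (W_space P) (sp R (ar k)) (\<lambda>x. in_fst x k)" if "k \<ge> -1" for k
    unfolding in_at(1)[OF that] R_simps by (intro sprod_lin_map W_comp_lin that lin_map_0 sp_module)
qed

lemma in_snd_lin: "lin_map K (W_space P) (W_space R) in_snd"
proof (rule R.W_lin_mapI[OF W_module])
  show "in_snd x \<in> W_carrier R" if "x \<in> carrier (W_space P)" for x using that in_snd_mem by (simp add: W_space_carrier)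
  show "lin_map K (W_space P) (sp R (ar k)) (\<lambda>x. in_snd x k)" if "k \<ge> -1" for k
    unfolding in_at(2)[OF that] R_simps by (intro sprod_lin_map W_comp_lin that lin_map_0 sp_module)
qed

lemma W_snd_lin: "lin_map K (W_space R) (W_space P) W_snd"
proof (rule W_lin_mapI[OF R.W_module])
  show "W_snd x \<in> W_carrier P" if "x \<in> carrier (W_space R)" for x using that W_snd_mem by (simp add: R.W_space_carrier)
  show "lin_map K (W_space R) (sp P (ar k)) (\<lambda>x. W_snd x k)" if "k \<ge> -1" for k
    unfolding in_at(4)[OF that] using R.W_comp_lin[OF that] unfolding R_simps by (rule lin_map_compose[OF even_map_lin[OF snd_even]])
qed

lemma W_snd_hom: "lin_hom K (W_space R) (W_space P) W_snd"
  by (intro lin_homI R.W_superspace W_superspace W_snd_lin)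

lemma sp_zero_hpart: "\<zero>\<^bsub>sp P k\<^esub> \<in> hpart (sp P k) p"
  by (rule superspace.hpart_zero[OF superspace_sp])

lemma in_hpart: "v \<in> hpart (W_space P) p \<Longrightarrow> in_fst v \<in> hpart (W_space R) p" "v \<in> hpart (W_space P) p \<Longrightarrow> in_snd v \<in> hpart (W_space R) p"
  "z \<in> hpart (W_space R) p \<Longrightarrow> W_snd z \<in> hpart (W_space P) p"
  using in_fst_mem in_snd_mem W_snd_mem by (auto simp: W_space_hpart R.W_space_hpart in_at R_simps sprod_simps sp_zero_hpart mem_Times_iff)

lemma in_deg: "v \<in> W_deg P n \<Longrightarrow> in_fst v \<in> W_deg R n" "v \<in> W_deg P n \<Longrightarrow> in_snd v \<in> W_deg R n"
  "z \<in> W_deg R n \<Longrightarrow> W_snd z \<in> W_deg P n"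
  using in_fst_mem in_snd_mem W_snd_mem by (auto simp: W_deg_def in_at R_simps sprod_simps)

lemma W_snd_in_snd: "w \<in> W_carrier P \<Longrightarrow> W_snd (in_snd w) = w"
  by (rule W_ext) (auto simp: W_snd_mem in_snd_mem in_at)

text \<open>The action and the bracket of representatives, read off from brackets in the semidirect product. All
their properties are thus properties of \<open>R.B\<close>.\<close>

definition W_action :: "(int \<Rightarrow> 'a) \<Rightarrow> (int \<Rightarrow> 'a) \<Rightarrow> int \<Rightarrow> 'a" where
  "W_action v w = W_snd (R.B (in_fst v) (in_snd w))"

definition W_dot_brk :: "(int \<Rightarrow> 'a) \<Rightarrow> (int \<Rightarrow> 'a) \<Rightarrow> int \<Rightarrow> 'a" where
  "W_dot_brk v w = W_fst (R.B (in_fst v) (in_fst w))"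

lemma W_action_mem: "\<lbrakk>v \<in> W_carrier P; w \<in> W_carrier P\<rbrakk> \<Longrightarrow> W_action v w \<in> W_carrier P"
  unfolding W_action_def by (intro W_snd_mem R.B_mem in_fst_mem in_snd_mem)

lemma W_dot_brk_mem: "\<lbrakk>v \<in> W_carrier P; w \<in> W_carrier P\<rbrakk> \<Longrightarrow> W_dot_brk v w \<in> W_carrier P"
  unfolding W_dot_brk_def by (intro W_fst_mem R.B_mem in_fst_mem)

lemma W_action_lin_left: "w \<in> W_carrier P \<Longrightarrow> lin_map K (W_space P) (W_space P) (\<lambda>v. W_action v w)"
  unfolding W_action_def by (intro lin_map_compose[OF W_snd_lin] lin_map_compose[OF R.B_lin_left] in_fst_lin in_snd_mem)

lemma W_action_lin_right: "v \<in> W_carrier P \<Longrightarrow> lin_map K (W_space P) (W_space P) (W_action v)"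
  unfolding W_action_def[abs_def] by (intro lin_map_compose[OF W_snd_lin] lin_map_compose[OF R.B_lin_right] in_snd_lin in_fst_mem)

lemma W_action_hpart: "\<lbrakk>v \<in> hpart (W_space P) p; w \<in> hpart (W_space P) q\<rbrakk> \<Longrightarrow> W_action v w \<in> hpart (W_space P) (p + q)"
  unfolding W_action_def by (intro in_hpart R.B_parity)

lemma W_action_deg: "\<lbrakk>v \<in> W_deg P m; w \<in> W_deg P n\<rbrakk> \<Longrightarrow> W_action v w \<in> W_deg P (m + n)"
  unfolding W_action_def by (intro in_deg R.B_deg)

lemma sums_closed:
  assumes v: "v \<in> W_carrier P" and w: "w \<in> W_carrier P" and n: "n \<in> {-1..k + 1}"
  shows "sbrk n (k - n) (v n) (w (k - n)) \<in> carrier (sp P (ar k))" "dbrk n (k - n) (v n) (w (k - n)) \<in> carrier (sp P (ar k))"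
proof -
  interpret V: superspace K "sp P (ar k)" by (rule superspace_sp)
  have c: "v n \<in> carrier (sp P (ar n))" "w (k - n) \<in> carrier (sp P (ar (k - n)))"
    using n W_mem_carrier[OF v] W_mem_carrier[OF w] by auto
  note b = brk_summands_closed[OF c]
  show "sbrk n (k - n) (v n) (w (k - n)) \<in> carrier (sp P (ar k))" "dbrk n (k - n) (v n) (w (k - n)) \<in> carrier (sp P (ar k))"
    unfolding sbrk_def dbrk_def using b by (auto intro!: V.M.finsum_closed)
qed

lemma B_in_at:
  assumes v: "v \<in> W_carrier P" and w: "w \<in> W_carrier P" and k: "k \<ge> -1"
  shows "R.B (in_fst v) (in_snd w) k = (\<zero>\<^bsub>sp P (ar k)\<^esub>, \<Oplus>\<^bsub>sp P (ar k)\<^esub>n\<in>{-1..k + 1}. sbrk n (k - n) (v n) (w (k - n)))"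
    "R.B (in_fst v) (in_fst w) k = (\<Oplus>\<^bsub>sp P (ar k)\<^esub>n\<in>{-1..k + 1}. dbrk n (k - n) (v n) (w (k - n)), \<zero>\<^bsub>sp P (ar k)\<^esub>)"
proof -
  let ?V = "sp P (ar k)"
  interpret V: abelian_group ?V by (rule sp_abelian)
  interpret D: abelian_group "sprod ?V" by (rule superspace_abelian[OF sprod_superspace[OF superspace_sp]])
  have c: "v n \<in> carrier (sp P (ar n))" "w (k - n) \<in> carrier (sp P (ar (k - n)))" "-1 \<le> n" "-1 \<le> k - n" if "n \<in> {-1..k + 1}" for n
    using that W_mem_carrier[OF v] W_mem_carrier[OF w] by auto
  have "R.B (in_fst v) (in_snd w) k = (\<Oplus>\<^bsub>sprod ?V\<^esub>n\<in>{-1..k + 1}. (\<zero>\<^bsub>?V\<^esub>, sbrk n (k - n) (v n) (w (k - n))))"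
    unfolding R.B_at[OF k] R_simps
  proof (rule D.finsum_cong'[OF refl])
    fix n assume n: "n \<in> {-1..k + 1}"
    show "box_brk R n (k - n) (in_fst v n) (in_snd w (k - n)) = (\<zero>\<^bsub>?V\<^esub>, sbrk n (k - n) (v n) (w (k - n)))"
      using box_brk_R(1)[OF c(1,2)[OF n]] c(3,4)[OF n] by (simp add: in_at)
  qed (auto simp: sprod_simps sums_closed[OF v w])
  then show "R.B (in_fst v) (in_snd w) k = (\<zero>\<^bsub>?V\<^esub>, \<Oplus>\<^bsub>?V\<^esub>n\<in>{-1..k + 1}. sbrk n (k - n) (v n) (w (k - n)))"
    by (subst (asm) sprod_sum[OF superspace_sp]) (auto simp: sprod_simps sums_closed[OF v w])
  have "R.B (in_fst v) (in_fst w) k = (\<Oplus>\<^bsub>sprod ?V\<^esub>n\<in>{-1..k + 1}. (dbrk n (k - n) (v n) (w (k - n)), \<zero>\<^bsub>?V\<^esub>))"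
    unfolding R.B_at[OF k] R_simps
  proof (rule D.finsum_cong'[OF refl])
    fix n assume n: "n \<in> {-1..k + 1}"
    show "box_brk R n (k - n) (in_fst v n) (in_fst w (k - n)) = (dbrk n (k - n) (v n) (w (k - n)), \<zero>\<^bsub>?V\<^esub>)"
      using box_brk_R(2)[OF c(1,2)[OF n]] c(3,4)[OF n] by (simp add: in_at)
  qed (auto simp: sprod_simps sums_closed[OF v w])
  then show "R.B (in_fst v) (in_fst w) k = (\<Oplus>\<^bsub>?V\<^esub>n\<in>{-1..k + 1}. dbrk n (k - n) (v n) (w (k - n)), \<zero>\<^bsub>?V\<^esub>)"
    by (subst (asm) sprod_sum[OF superspace_sp]) (auto simp: sprod_simps sums_closed[OF v w])
qed

lemma W_action_brk_at:
  assumes v: "v \<in> W_carrier P" and w: "w \<in> W_carrier P" and k: "k \<ge> -1"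
  shows "W_action v w k = (\<Oplus>\<^bsub>sp P (ar k)\<^esub>n\<in>{-1..k + 1}. sbrk n (k - n) (v n) (w (k - n)))"
    "W_dot_brk v w k = (\<Oplus>\<^bsub>sp P (ar k)\<^esub>n\<in>{-1..k + 1}. dbrk n (k - n) (v n) (w (k - n)))"
  by (simp_all add: W_action_def W_dot_brk_def in_at k B_in_at[OF assms])

lemma B_in:
  assumes v: "v \<in> W_carrier P" and w: "w \<in> W_carrier P"
  shows "R.B (in_fst v) (in_snd w) = in_snd (W_action v w)" "R.B (in_fst v) (in_fst w) = in_fst (W_dot_brk v w)"
  by (rule R.W_ext; simp add: R.B_mem in_fst_mem in_snd_mem W_action_mem W_dot_brk_mem assms in_at B_in_at[OF assms] W_action_brk_at[OF assms])+

lemma lambda_brk_zero: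
  assumes v: "v \<in> W_carrier P" and w: "w \<in> W_carrier P"
  shows "lambda_brk P v w 0 = W_action v w"
proof
  fix k
  show "lambda_brk P v w 0 k = W_action v w k"
  proof (cases "k \<ge> -1")
    case True
    interpret V: abelian_group "sp P (ar k)" by (rule sp_abelian)
    have "lambda_brk P v w 0 k = (\<Oplus>\<^bsub>sp P (ar k)\<^esub>n\<in>{-1..k + 1}. cbox_brk P n (k - n) (v n) (w (k - n)) 0)"
      using True by (simp add: lambda_brk_def)
    also have "\<dots> = W_action v w k" unfolding W_action_brk_at(1)[OF v w True]
    proof (rule V.finsum_cong'[OF refl])
      fix n assume "n \<in> {-1..k + 1}"
      then show "cbox_brk P n (k - n) (v n) (w (k - n)) 0 = sbrk n (k - n) (v n) (w (k - n))"
        by (intro cbox_brk_zero W_mem_carrier v w) auto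
    qed (auto simp: sums_closed[OF v w])
    finally show ?thesis .
  next
    case False then show ?thesis by (simp add: lambda_brk_def W_action_def W_snd_def)
  qed
qed

text \<open>The second component of the Jacobi identity for \<open>(x, 0)\<close>, \<open>(y, 0)\<close> and \<open>(0, w)\<close>.\<close>

lemma W_action_jacobi:
  assumes x: "x \<in> hpart (W_space P) p" and y: "y \<in> hpart (W_space P) q" and w: "w \<in> W_carrier P"
  shows "W_action x (W_action y w) = W_action (W_dot_brk x y) w \<oplus>\<^bsub>W_space P\<^esub> signed (W_space P) (p * q) (W_action y (W_action x w))"
proof -
  interpret s: lin_hom K "W_space R" "W_space P" W_snd by (rule W_snd_hom)
  interpret R': superspace K "W_space R" by (rule R.W_superspace)
  have c: "x \<in> W_carrier P" "y \<in> W_carrier P" using x y by (auto simp: W_space_hpart)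
  note m = c w W_action_mem W_dot_brk_mem
  have pc: "in_snd z \<in> carrier (W_space R)" if "z \<in> W_carrier P" for z using that in_snd_mem by (simp add: R.W_space_carrier)
  have "R.B (in_fst x) (R.B (in_fst y) (in_snd w)) = R.B (R.B (in_fst x) (in_fst y)) (in_snd w) \<oplus>\<^bsub>W_space R\<^esub> signed (W_space R) (p * q) (R.B (in_fst y) (R.B (in_fst x) (in_snd w)))"
    by (intro R.B_jacobi in_hpart x y pc w)
  then have "in_snd (W_action x (W_action y w)) = in_snd (W_action (W_dot_brk x y) w) \<oplus>\<^bsub>W_space R\<^esub> signed (W_space R) (p * q) (in_snd (W_action y (W_action x w)))"
    by (simp add: B_in m)
  then have "W_snd (in_snd (W_action x (W_action y w))) = W_snd (in_snd (W_action (W_dot_brk x y) w)) \<oplus>\<^bsub>W_space P\<^esub> signed (W_space P) (p * q) (W_snd (in_snd (W_action y (W_action x w))))"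
    by (simp add: s.add s.signed pc m R'.signed_closed)
  then show ?thesis by (simp add: W_snd_in_snd m)
qed

lemma in_inj: "n \<ge> -1 \<Longrightarrow> in_fst (W_inj P n f) = W_inj R n (f, \<zero>\<^bsub>sp P (ar n)\<^esub>)" "n \<ge> -1 \<Longrightarrow> in_snd (W_inj P n f) = W_inj R n (\<zero>\<^bsub>sp P (ar n)\<^esub>, f)"
  by (auto simp: in_fst_def in_snd_def W_inj_def R_simps sprod_simps restrict_def)

lemma W_action_inj:
  assumes n: "m \<ge> -1" "n \<ge> -1" and f: "f \<in> invariants P (ar m)" and g: "g \<in> invariants P (ar n)"
  shows "W_action (W_inj P m f) (W_inj P n g) = W_inj P (m + n) (sbrk m n f g)"
proof -
  have i: "(f, \<zero>\<^bsub>sp P (ar m)\<^esub>) \<in> invariants R (ar m)" "(\<zero>\<^bsub>sp P (ar n)\<^esub>, g) \<in> invariants R (ar n)"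
    using f g by (auto simp: inv_R inv_zero)
  show ?thesis
    unfolding W_action_def in_inj(1)[OF n(1)] in_inj(2)[OF n(2)] R.B_inj[OF n i] box_brk_R(1)[OF inv_carrier[OF f] inv_carrier[OF g]]
    by (auto simp: W_snd_def W_inj_def R_simps sprod_simps restrict_def)
qed

lemma sbrk_homog:
  assumes f: "f \<in> hpart (sp P (ar m)) p" and g: "g \<in> hpart (sp P (ar n)) q"
  shows "sbrk m n f g = sbox m n f g \<ominus>\<^bsub>sp P (ar (m + n))\<^esub> signed (sp P (ar (m + n))) (p * q) (dbox n m g f)"
proof -
  let ?V = "sp P (ar (m + n))"
  interpret V: superspace K ?V by (rule superspace_sp)
  have c: "f \<in> carrier (sp P (ar m))" "g \<in> carrier (sp P (ar n))" using f g superspace.hpart_closed[OF superspace_sp] by blast+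
  have h: "(f, \<zero>\<^bsub>sp P (ar m)\<^esub>) \<in> hpart (sp R (ar m)) p" "(\<zero>\<^bsub>sp P (ar n)\<^esub>, g) \<in> hpart (sp R (ar n)) q"
    using f g by (simp_all add: R_simps sprod_simps sp_zero_hpart)
  have b: "box R m n (f, \<zero>\<^bsub>sp P (ar m)\<^esub>) (\<zero>\<^bsub>sp P (ar n)\<^esub>, g) = (\<zero>\<^bsub>?V\<^esub>, sbox m n f g)"
    "box R n m (\<zero>\<^bsub>sp P (ar n)\<^esub>, g) (f, \<zero>\<^bsub>sp P (ar m)\<^esub>) = (\<zero>\<^bsub>?V\<^esub>, dbox n m g f)"
    using box_R[of f m "\<zero>\<^bsub>sp P (ar m)\<^esub>" "\<zero>\<^bsub>sp P (ar n)\<^esub>" n g] box_R[of "\<zero>\<^bsub>sp P (ar n)\<^esub>" n g f m "\<zero>\<^bsub>sp P (ar m)\<^esub>"] c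
    by (simp_all add: sp_zero_closed box_lin_zero sbox_closed dbox_closed dbox_closed' add.commute[of n m])
  have s: "snd (x \<ominus>\<^bsub>sprod ?V\<^esub> signed (sprod ?V) r y) = snd x \<ominus>\<^bsub>?V\<^esub> signed ?V r (snd y)"
    if "x \<in> carrier (sprod ?V)" "y \<in> carrier (sprod ?V)" for x y r
    using that superspace.signed_closed[OF sprod_superspace[OF superspace_sp]]
    by (simp add: lin_hom.minus[OF snd_hom[OF superspace_sp]] lin_hom.signed[OF snd_hom[OF superspace_sp]])
  have "sbrk m n f g = snd (box_brk R m n (f, \<zero>\<^bsub>sp P (ar m)\<^esub>) (\<zero>\<^bsub>sp P (ar n)\<^esub>, g))" by (simp add: box_brk_R(1)[OF c])
  also have "\<dots> = sbox m n f g \<ominus>\<^bsub>?V\<^esub> signed ?V (p * q) (dbox n m g f)"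
    unfolding R.box_brk_homog[OF h] b R_simps by (subst s) (simp_all add: sprod_simps sbox_closed dbox_closed' c)
  finally show ?thesis .
qed

lemma W_action_dd:
  assumes v: "v \<in> W_carrier P" and w: "w \<in> W_carrier P" and d: "W_dd P v \<in> W_carrier P"
  shows "W_action (W_dd P v) w = \<zero>\<^bsub>W_space P\<^esub>"
proof (rule W_ext)
  show "W_action (W_dd P v) w \<in> W_carrier P" by (rule W_action_mem[OF d w])
  show "\<zero>\<^bsub>W_space P\<^esub> \<in> W_carrier P" by (rule W_zero_cl)
  fix k :: int assume k: "k \<ge> -1"
  interpret V: abelian_group "sp P (ar k)" by (rule sp_abelian)
  have "sbrk n (k - n) (W_dd P v n) (w (k - n)) = \<zero>\<^bsub>sp P (ar k)\<^esub>" if "n \<in> {-1..k + 1}" for n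
    using that sbrk_dd[OF W_mem_carrier[OF v] W_mem_carrier[OF w], of n "k - n"] by (simp add: W_dd_def)
  then show "W_action (W_dd P v) w k = \<zero>\<^bsub>W_space P\<^esub> k"
    unfolding W_action_brk_at(1)[OF d w k] W_at[OF k] by (intro V.add.finprod_one_eqI) simp
qed

section \<open>The quotient map\<close>

definition W_proj :: "(int \<Rightarrow> 'a) \<Rightarrow> int \<Rightarrow> 'a set" where
  "W_proj v = (\<lambda>n\<in>{-1..}. dcls P (ar n) (v n))"

lemma dcls_inv: "f \<in> invariants P k \<Longrightarrow> dcls P k f \<in> invariants Q k"
  by (auto simp: invariants_def Q_simps dcls_closed quot_act_dcls)

lemma dcls_zero: "dcls P k \<zero>\<^bsub>sp P k\<^esub> = \<zero>\<^bsub>dquot P k\<^esub>"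
  by (rule lin_hom.zero[OF dcls_hom])

lemma W_proj_mem: assumes v: "v \<in> W_carrier P" shows "W_proj v \<in> W_carrier Q"
  by (rule Qt.W_carrierI[OF _ _ W_finite[OF v]]) (use W_mem[OF v] in \<open>auto simp: W_proj_def dcls_inv Q_simps dcls_zero\<close>)

lemma W_proj_lin: "lin_map K (W_space P) (W_space Q) W_proj"
proof (rule Qt.W_lin_mapI[OF W_module])
  show "W_proj x \<in> W_carrier Q" if "x \<in> carrier (W_space P)" for x using that W_proj_mem by (simp add: W_space_carrier)
  show "lin_map K (W_space P) (sp Q (ar k)) (\<lambda>x. W_proj x k)" if "k \<ge> -1" for k
  proof -
    have "lin_map K (W_space P) (dquot P (ar k)) (\<lambda>x. dcls P (ar k) (x k))"
      by (intro lin_map_compose[OF dcls_lin] W_comp_lin that)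
    then show ?thesis using that by (simp add: W_proj_def Q_simps)
  qed
qed

lemma W_proj_hom: "lin_hom K (W_space P) (W_space Q) W_proj"
  by (intro lin_homI W_superspace Qt.W_superspace W_proj_lin)

lemma W_proj_even: "even_map K (W_space P) (W_space Q) W_proj"
  unfolding even_map_def using W_proj_lin W_proj_mem
  by (auto simp: W_space_hpart Qt.W_space_hpart) (simp add: W_proj_def Q_simps dquot_hpart)

lemma W_proj_deg: "v \<in> W_deg P n \<Longrightarrow> W_proj v \<in> W_deg Q n"
  using W_proj_mem[OF W_deg_carrier] by (simp add: W_deg_def W_proj_def Q_simps dcls_zero)

text \<open>The action of \<open>v\<close> on \<open>w\<close> and their bracket differ by an element of the image of $\partial$, and
both represent the bracket of the classes.\<close>

lemma W_proj_brk:
  assumes v: "v \<in> W_carrier P" and w: "w \<in> W_carrier P"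
  shows "W_proj (W_action v w) = Qt.B (W_proj v) (W_proj w)" "W_proj (W_dot_brk v w) = Qt.B (W_proj v) (W_proj w)"
proof -
  have "W_proj (W_action v w) k = Qt.B (W_proj v) (W_proj w) k \<and> W_proj (W_dot_brk v w) k = Qt.B (W_proj v) (W_proj w) k" if k: "k \<ge> -1" for k
  proof -
    interpret D: abelian_group "dquot P (ar k)" by (rule superspace_abelian[OF dquot_superspace])
    have c: "v n \<in> carrier (sp P (ar n))" "w (k - n) \<in> carrier (sp P (ar (k - n)))" "-1 \<le> n" "-1 \<le> k - n" if "n \<in> {-1..k + 1}" for n
      using that W_mem_carrier[OF v] W_mem_carrier[OF w] by auto
    note s = sums_closed[OF v w]
    have "Qt.B (W_proj v) (W_proj w) k = (\<Oplus>\<^bsub>dquot P (ar k)\<^esub>n\<in>{-1..k + 1}. dcls P (ar k) (dbrk n (k - n) (v n) (w (k - n))))"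
      unfolding Qt.B_at[OF k] Q_simps
    proof (rule D.finsum_cong'[OF refl])
      fix n assume n: "n \<in> {-1..k + 1}"
      show "box_brk Q n (k - n) (W_proj v n) (W_proj w (k - n)) = dcls P (ar k) (dbrk n (k - n) (v n) (w (k - n)))"
        using box_brk_Q(1)[OF c(1,2)[OF n]] c(3,4)[OF n] by (simp add: W_proj_def)
    qed (auto simp: dcls_closed s)
    moreover have "W_proj (W_dot_brk v w) k = (\<Oplus>\<^bsub>dquot P (ar k)\<^esub>n\<in>{-1..k + 1}. dcls P (ar k) (dbrk n (k - n) (v n) (w (k - n))))"
      using k by (simp add: W_proj_def W_action_brk_at[OF v w k]) (intro dcls_finsum s, simp)
    moreover have "W_proj (W_action v w) k = (\<Oplus>\<^bsub>dquot P (ar k)\<^esub>n\<in>{-1..k + 1}. dcls P (ar k) (sbrk n (k - n) (v n) (w (k - n))))"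
      using k by (simp add: W_proj_def W_action_brk_at[OF v w k]) (intro dcls_finsum s, simp)
    moreover have "\<dots> = (\<Oplus>\<^bsub>dquot P (ar k)\<^esub>n\<in>{-1..k + 1}. dcls P (ar k) (dbrk n (k - n) (v n) (w (k - n))))"
    proof (rule D.finsum_cong'[OF refl])
      fix n assume n: "n \<in> {-1..k + 1}"
      show "dcls P (ar k) (sbrk n (k - n) (v n) (w (k - n))) = dcls P (ar k) (dbrk n (k - n) (v n) (w (k - n)))"
        using box_brk_Q(2)[OF c(1,2)[OF n]] by simp
    qed (auto simp: dcls_closed s)
    ultimately show ?thesis by simp
  qed
  then show "W_proj (W_action v w) = Qt.B (W_proj v) (W_proj w)" "W_proj (W_dot_brk v w) = Qt.B (W_proj v) (W_proj w)"
    by (auto intro!: Qt.W_ext W_proj_mem W_action_mem W_dot_brk_mem Qt.B_mem v w)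
qed

lemma symsum_Q: "x \<in> carrier (sp P k) \<Longrightarrow> symsum Q k (dcls P k x) = dcls P k (symsum P k x)"
proof -
  assume x: "x \<in> carrier (sp P k)"
  interpret D: abelian_group "dquot P k" by (rule superspace_abelian[OF dquot_superspace])
  have "dcls P k (symsum P k x) = (\<Oplus>\<^bsub>dquot P k\<^esub>\<sigma>\<in>perms k. dcls P k (act P k \<sigma> x))"
    unfolding symsum_def by (rule dcls_finsum) (simp add: act_closed x)
  also have "\<dots> = symsum Q k (dcls P k x)" unfolding symsum_def Q_simps
    by (rule D.finsum_cong'[OF refl]) (auto simp: quot_act_dcls x dcls_closed act_closed)
  finally show ?thesis by simp
qed

lemma symsum_dd: "x \<in> carrier (sp P k) \<Longrightarrow> symsum P k (dd P k x) = dd P k (symsum P k x)"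
proof -
  assume x: "x \<in> carrier (sp P k)"
  interpret V: abelian_group "sp P k" by (rule sp_abelian)
  have "dd P k (symsum P k x) = (\<Oplus>\<^bsub>sp P k\<^esub>\<sigma>\<in>perms k. dd P k (act P k \<sigma> x))"
    unfolding symsum_def by (rule lin_hom.sum[OF lin_homI[OF superspace_sp superspace_sp dd_lin]]) (simp add: act_closed x)
  also have "\<dots> = symsum P k (dd P k x)" unfolding symsum_def
    by (rule V.finsum_cong'[OF refl]) (auto simp: act_dd x dd_closed act_closed)
  finally show ?thesis by simp
qed

text \<open>Take any representative, symmetrize it and divide by the order of the symmetric group. This is where
characteristic $0$ makes the map from $\widetilde W$ to $W$ surjective.\<close>

lemma inv_lift:
  assumes X: "X \<in> invariants Q k"
  shows "\<exists>f\<in>invariants P k. dcls P k f = X"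
proof -
  obtain c where c: "c \<in> carrier K" and cc: "\<And>(V :: ('k, 'a set) superspace) x. \<lbrakk>module K V; x \<in> carrier V\<rbrakk> \<Longrightarrow> c \<odot>\<^bsub>V\<^esub> ([(fact k :: nat)] \<cdot>\<^bsub>V\<^esub> x) = x"
    using nat_inverse[OF superspace_field[OF superspace_sp] char0, of "fact k"] by (metis fact_gt_zero)
  have Xc: "X \<in> carrier (dquot P k)" using Qt.inv_carrier[OF X] by (simp add: Q_simps)
  then obtain x where x: "x \<in> carrier (sp P k)" "X = dcls P k x" by (auto simp: dquot_carrier)
  have "dcls P k (c \<odot>\<^bsub>sp P k\<^esub> symsum P k x) = c \<odot>\<^bsub>dquot P k\<^esub> symsum Q k X"
    using lin_map_smult[OF dcls_lin c symsum_closed[OF x(1)]] symsum_Q[OF x(1)] x(2) by simp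
  also have "\<dots> = X" using Qt.symsum_of_inv[OF X] cc[OF superspace_module[OF dquot_superspace] Xc] by (simp add: Q_simps)
  finally show ?thesis using inv_smult[OF c symsum_inv[OF x(1)]] by blast
qed

text \<open>The same averaging, applied to a preimage under $\partial$. It shows that the map from
$\widetilde W/\partial\widetilde W$ to $W$ is injective.\<close>

lemma inv_dd:
  assumes f: "f \<in> invariants P k" and z: "z \<in> carrier (sp P k)" "f = dd P k z"
  shows "\<exists>g\<in>invariants P k. dd P k g = f"
proof -
  obtain c where c: "c \<in> carrier K" and cc: "\<And>(V :: ('k, 'a) superspace) x. \<lbrakk>module K V; x \<in> carrier V\<rbrakk> \<Longrightarrow> c \<odot>\<^bsub>V\<^esub> ([(fact k :: nat)] \<cdot>\<^bsub>V\<^esub> x) = x"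
    using nat_inverse[OF superspace_field[OF superspace_sp] char0, of "fact k"] by (metis fact_gt_zero)
  have "dd P k (c \<odot>\<^bsub>sp P k\<^esub> symsum P k z) = c \<odot>\<^bsub>sp P k\<^esub> symsum P k f"
    using lin_map_smult[OF dd_lin c symsum_closed[OF z(1)]] symsum_dd[OF z(1)] z(2) by simp
  also have "\<dots> = f" using symsum_of_inv[OF f] cc[OF sp_module inv_carrier[OF f]] by simp
  finally show ?thesis using inv_smult[OF c symsum_inv[OF z(1)]] by blast
qed

lemma W_proj_lift:
  assumes X: "X \<in> W_carrier Q"
  obtains v where "v \<in> W_carrier P" "W_proj v = X" "\<And>n. X \<in> W_deg Q n \<Longrightarrow> v \<in> W_deg P n"
proof -
  have "\<exists>g\<in>invariants P (ar n). dcls P (ar n) g = X n" if "n \<ge> -1" for n by (rule inv_lift[OF Qt.W_mem[OF X that]])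
  then have "\<exists>w\<in>W_carrier P. \<forall>n\<ge>-1. dcls P (ar n) (w n) = X n \<and> (X n = \<zero>\<^bsub>sp Q (ar n)\<^esub> \<longrightarrow> w n = \<zero>\<^bsub>sp P (ar n)\<^esub>)"
    by (intro W_lift) (use Qt.W_finite[OF X] in \<open>auto simp: Q_simps dcls_zero\<close>)
  then obtain v where v: "v \<in> W_carrier P" "\<And>n. n \<ge> -1 \<Longrightarrow> dcls P (ar n) (v n) = X n"
    "\<And>n. \<lbrakk>n \<ge> -1; X n = \<zero>\<^bsub>sp Q (ar n)\<^esub>\<rbrakk> \<Longrightarrow> v n = \<zero>\<^bsub>sp P (ar n)\<^esub>" by blast
  show ?thesis
  proof (rule that[OF v(1)])
    show "W_proj v = X" by (rule Qt.W_ext[OF W_proj_mem[OF v(1)] X]) (simp add: W_proj_def v(2))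
    show "v \<in> W_deg P n" if "X \<in> W_deg Q n" for n using that v by (simp add: W_deg_def)
  qed
qed

lemma W_dd_lin: "lin_map K (W_space P) (W_space P) (W_dd P)"
proof (rule W_lin_mapI[OF W_module])
  show "W_dd P x \<in> W_carrier P" if "x \<in> carrier (W_space P)" for x
  proof (rule W_carrierI[OF _ _ W_finite])
    show x: "x \<in> W_carrier P" using that by (simp add: W_space_carrier)
    show "W_dd P x n \<in> invariants P (ar n)" if "n \<ge> -1" for n
      using W_mem[OF x that] that by (auto simp: W_dd_def invariants_def dd_closed act_dd)
  qed (auto simp: W_dd_def lin_hom.zero[OF lin_homI[OF superspace_sp superspace_sp dd_lin]])
  show "lin_map K (W_space P) (sp P (ar k)) (\<lambda>x. W_dd P x k)" if "k \<ge> -1" for k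
    using that lin_map_compose[OF dd_lin W_comp_lin[OF that]] by (simp add: W_dd_def)
qed

lemma W_dd_mem: "v \<in> W_carrier P \<Longrightarrow> W_dd P v \<in> W_carrier P"
  using lin_map_closed[OF W_dd_lin] by (simp add: W_space_carrier)

lemma W_dd_even: "even_map K (W_space P) (W_space P) (W_dd P)"
  unfolding even_map_def using W_dd_lin W_dd_mem even_map_hpart[OF dd_even]
  by (auto simp: W_space_hpart) (simp add: W_dd_def)

lemma W_proj_zero_iff:
  assumes v: "v \<in> W_carrier P" shows "W_proj v = \<zero>\<^bsub>W_space Q\<^esub> \<longleftrightarrow> v \<in> W_dd P ` W_carrier P"
proof
  assume "v \<in> W_dd P ` W_carrier P"
  then obtain z where z: "z \<in> W_carrier P" "v = W_dd P z" by blast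
  show "W_proj v = \<zero>\<^bsub>W_space Q\<^esub>"
  proof (rule Qt.W_ext[OF W_proj_mem[OF v] Qt.W_zero_cl])
    fix n :: int assume n: "n \<ge> -1"
    interpret V: abelian_group "sp P (ar n)" by (rule sp_abelian)
    show "W_proj v n = \<zero>\<^bsub>W_space Q\<^esub> n"
      using n dcls_add_dd[OF sp_zero_closed W_mem_carrier[OF z(1) n]] dd_closed[OF W_mem_carrier[OF z(1) n]]
      by (simp add: W_proj_def z(2) W_dd_def Qt.W_at Q_simps dcls_zero)
  qed
next
  assume 0: "W_proj v = \<zero>\<^bsub>W_space Q\<^esub>"
  have "\<exists>g\<in>invariants P (ar n). dd P (ar n) g = v n" if n: "n \<ge> -1" for n
  proof -
    interpret V: abelian_group "sp P (ar n)" by (rule sp_abelian)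
    have "W_proj v n = \<zero>\<^bsub>dquot P (ar n)\<^esub>" using 0 Qt.W_at(1)[OF n] by (simp add: Q_simps)
    then have "dcls P (ar n) (v n) = dcls P (ar n) \<zero>\<^bsub>sp P (ar n)\<^esub>" using n by (simp add: W_proj_def dcls_zero)
    then obtain z where z: "z \<in> carrier (sp P (ar n))" "v n = \<zero>\<^bsub>sp P (ar n)\<^esub> \<oplus>\<^bsub>sp P (ar n)\<^esub> dd P (ar n) z"
      using dcls_eq_iff[OF W_mem_carrier[OF v n] sp_zero_closed] by blast
    then show ?thesis using inv_dd[OF W_mem[OF v n] z(1)] dd_closed[OF z(1)] by simp
  qed
  then have "\<exists>z\<in>W_carrier P. \<forall>n\<ge>-1. dd P (ar n) (z n) = v n \<and> (v n = \<zero>\<^bsub>sp P (ar n)\<^esub> \<longrightarrow> z n = \<zero>\<^bsub>sp P (ar n)\<^esub>)"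
    by (intro W_lift) (use W_finite[OF v] in \<open>auto simp: lin_hom.zero[OF lin_homI[OF superspace_sp superspace_sp dd_lin]]\<close>)
  then obtain z where z: "z \<in> W_carrier P" "\<And>n. n \<ge> -1 \<Longrightarrow> dd P (ar n) (z n) = v n" by blast
  have "v = W_dd P z" by (rule W_ext[OF v W_dd_mem[OF z(1)]]) (simp add: W_dd_def z(2))
  then show "v \<in> W_dd P ` W_carrier P" using z(1) by blast
qed

end

lemma minus_eq_zero_iff:
  assumes "abelian_group V" "x \<in> carrier V" "y \<in> carrier V"
  shows "x \<ominus>\<^bsub>V\<^esub> y = \<zero>\<^bsub>V\<^esub> \<longleftrightarrow> x = y"
proof -
  interpret V: abelian_group V by fact
  show ?thesis using assms(2,3) V.minus_equality[of x "\<ominus>\<^bsub>V\<^esub> y"] V.r_neg[of y] by (auto simp: a_minus_def)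
qed

context conformal_pseudo_operad_char0
begin

sublocale H: graded_submodule K "W_space P" "W_dd P ` W_carrier P"
  using graded_submodule_image[OF W_superspace W_dd_even] by (simp add: W_space_carrier)

lemma W_cls_cl: "W_cls P v = H.cl v"
  by (simp add: W_cls_def)

text \<open>The two quotients, of the direct sum by $\partial$ and componentwise in each arity, identify the same
elements.\<close>

lemma W_cls_eq_iff:
  assumes v: "v \<in> W_carrier P" and w: "w \<in> W_carrier P"
  shows "W_cls P v = W_cls P w \<longleftrightarrow> W_proj v = W_proj w"
proof -
  interpret c: lin_hom K "W_space P" "W_space Q" W_proj by (rule W_proj_hom)
  have vw: "v \<in> carrier (W_space P)" "w \<in> carrier (W_space P)" using v w by (simp_all add: W_space_carrier)
  then have d: "v \<ominus>\<^bsub>W_space P\<^esub> w \<in> W_carrier P" using H.M.minus_closed W_space_carrier by blast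
  have "W_cls P v = W_cls P w \<longleftrightarrow> W_proj (v \<ominus>\<^bsub>W_space P\<^esub> w) = \<zero>\<^bsub>W_space Q\<^esub>"
    unfolding W_cls_cl H.cl_eq_iff[OF vw] W_proj_zero_iff[OF d] ..
  also have "\<dots> \<longleftrightarrow> W_proj v = W_proj w"
    using minus_eq_zero_iff[OF module_abelian[OF Qt.W_module]] vw c.closed by (simp add: c.minus)
  finally show ?thesis .
qed

abbreviation "WL \<equiv> W_quot_alg P"

lemma WL_simps:
  "carrier WL = W_cls P ` W_carrier P" "zero WL = zero (squot (W_space P) (W_dd P ` W_carrier P))"
  "add WL = add (squot (W_space P) (W_dd P ` W_carrier P))" "smult WL = smult (squot (W_space P) (W_dd P ` W_carrier P))"
  "hpart WL p = W_cls P ` hpart (W_space P) p" "deg WL n = W_cls P ` W_deg P n"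
  "brk WL = (\<lambda>X Y. \<Union>v\<in>X. \<Union>w\<in>Y. W_cls P (lambda_brk P v w 0))"
  using H.squot_carrier H.squot_hpart
  by (simp_all add: W_quot_alg_def superspace.defs graded_lsa.defs W_cls_cl[abs_def] W_space_carrier)

lemma WL_superspace: "superspace K WL"
  by (rule superspace_cong[OF H.squot_superspace]) (simp_all add: W_quot_alg_def superspace.defs graded_lsa.defs)

lemma W_cls_lin: "lin_map K (W_space P) WL (W_cls P)"
  using even_map_lin[OF H.squot_even] unfolding W_cls_cl[abs_def]
  by (simp add: lin_map_def W_quot_alg_def superspace.defs graded_lsa.defs)

lemma mem_W_cls: "v \<in> W_carrier P \<Longrightarrow> v' \<in> W_cls P v \<longleftrightarrow> v' \<in> W_carrier P \<and> W_proj v' = W_proj v"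
  using H.mem_cl_iff[of v v'] W_cls_eq_iff[of v' v] by (auto simp: W_cls_cl W_space_carrier)

lemma WL_brk:
  assumes v: "v \<in> W_carrier P" and w: "w \<in> W_carrier P"
  shows "brk WL (W_cls P v) (W_cls P w) = W_cls P (W_action v w)"
proof -
  have e: "W_cls P (lambda_brk P v' w' 0) = W_cls P (W_action v w)" if "v' \<in> W_cls P v" "w' \<in> W_cls P w" for v' w'
    using that v w by (simp add: mem_W_cls lambda_brk_zero W_cls_eq_iff W_action_mem W_proj_brk)
  have self: "v \<in> W_cls P v" "w \<in> W_cls P w" using v w by (simp_all add: mem_W_cls)
  show ?thesis unfolding WL_simps(7) by (intro UN_const_eq[OF self(1)] UN_const_eq[OF self(2)] e)
qed

text \<open>The canonical map sends the class of a family to the family of classes; the choice of a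
representative does not matter by \<open>W_cls_eq_iff\<close>.\<close>

definition quot_map :: "(int \<Rightarrow> 'a) set \<Rightarrow> int \<Rightarrow> 'a set" where
  "quot_map X = W_proj (SOME v. v \<in> W_carrier P \<and> W_cls P v = X)"

lemma quot_map_cls: assumes v: "v \<in> W_carrier P" shows "quot_map (W_cls P v) = W_proj v"
proof -
  define u where "u = (SOME u. u \<in> W_carrier P \<and> W_cls P u = W_cls P v)"
  have "u \<in> W_carrier P \<and> W_cls P u = W_cls P v" unfolding u_def by (rule someI[of _ v]) (simp add: v)
  then have "W_proj u = W_proj v" using W_cls_eq_iff v by blast
  then show ?thesis by (simp add: quot_map_def u_def)
qed

lemma W_proj_image: "W_proj ` W_carrier P = W_carrier Q" "W_proj ` hpart (W_space P) p = hpart (W_space Q) p" "W_proj ` W_deg P n = W_deg Q n"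
proof -
  show "W_proj ` W_carrier P = W_carrier Q" using W_proj_mem W_proj_lift by blast
  show "W_proj ` W_deg P n = W_deg Q n"
  proof
    show "W_deg Q n \<subseteq> W_proj ` W_deg P n"
    proof
      fix X assume X: "X \<in> W_deg Q n"
      obtain v where "W_proj v = X" "\<And>n. X \<in> W_deg Q n \<Longrightarrow> v \<in> W_deg P n" using W_proj_lift[OF Qt.W_deg_carrier[OF X]] by metis
      then show "X \<in> W_proj ` W_deg P n" using X by blast
    qed
  qed (auto intro: W_proj_deg)
  show "W_proj ` hpart (W_space P) p = hpart (W_space Q) p"
  proof
    interpret W': superspace K "W_space Q" by (rule Qt.W_superspace)
    show "hpart (W_space Q) p \<subseteq> W_proj ` hpart (W_space P) p"
    proof
      fix X assume X: "X \<in> hpart (W_space Q) p"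
      then obtain v where v: "v \<in> W_carrier P" "W_proj v = X" using W_proj_lift W'.hpart_closed Qt.W_space_carrier by metis
      have vc: "v \<in> carrier (W_space P)" using v by (simp add: W_space_carrier)
      have "W_proj (hproj (W_space P) p v) = X"
        using hproj_even_map[OF W_superspace Qt.W_superspace W_proj_even vc] v(2) W'.hproj_same[OF X] by simp
      then show "X \<in> W_proj ` hpart (W_space P) p" using H.hproj_mem[OF vc] by blast
    qed
  qed (auto intro: even_map_hpart[OF W_proj_even])
qed

lemma quot_map_image: assumes "X \<subseteq> W_carrier P" shows "quot_map ` W_cls P ` X = W_proj ` X"
  using assms by (force simp: quot_map_cls)

lemma hpart_sub: "hpart (W_space P) p \<subseteq> W_carrier P"
  by (auto simp: W_space_hpart)

lemma deg_sub: "W_deg P n \<subseteq> W_carrier P"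
  by (auto simp: W_deg_def)

lemma quot_map_lin: "lin_map K WL (W_alg Q) quot_map"
proof (rule lin_mapI)
  note s = WL_simps(1) W_alg_simps
  note cc = W_space_carrier[symmetric]
  show "quot_map x \<in> carrier (W_alg Q)" if "x \<in> carrier WL" for x using that by (auto simp: s quot_map_cls W_proj_mem Qt.W_space_carrier)
  show "quot_map (x \<oplus>\<^bsub>WL\<^esub> y) = quot_map x \<oplus>\<^bsub>W_alg Q\<^esub> quot_map y" if x: "x \<in> carrier WL" "y \<in> carrier WL" for x y
  proof -
    obtain v w where v: "v \<in> W_carrier P" "x = W_cls P v" "w \<in> W_carrier P" "y = W_cls P w" using x by (auto simp: s)
    have c: "v \<in> carrier (W_space P)" "w \<in> carrier (W_space P)" using v by (simp_all add: W_space_carrier)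
    show ?thesis using lin_map_add[OF W_cls_lin c] lin_map_add[OF W_proj_lin c] quot_map_cls[OF W_add_cl[OF v(1,3)]]
      by (simp add: v quot_map_cls s)
  qed
  show "quot_map (a \<odot>\<^bsub>WL\<^esub> x) = a \<odot>\<^bsub>W_alg Q\<^esub> quot_map x" if x: "a \<in> carrier K" "x \<in> carrier WL" for a x
  proof -
    obtain v where v: "v \<in> W_carrier P" "x = W_cls P v" using x by (auto simp: s)
    have c: "v \<in> carrier (W_space P)" using v by (simp_all add: W_space_carrier)
    show ?thesis using lin_map_smult[OF W_cls_lin x(1) c] lin_map_smult[OF W_proj_lin x(1) c] quot_map_cls[OF W_smult_cl[OF x(1) v(1)]]
      by (simp add: v quot_map_cls s)
  qed
qed

lemma quot_map_bij: "bij_betw quot_map (carrier WL) (carrier (W_alg Q))"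
  unfolding bij_betw_def
proof
  show "inj_on quot_map (carrier WL)" by (rule inj_onI) (unfold WL_simps(1), elim imageE, simp only: quot_map_cls W_cls_eq_iff)
  show "quot_map ` carrier WL = carrier (W_alg Q)"
    by (simp add: WL_simps(1) W_alg_simps quot_map_image W_proj_image Qt.W_space_carrier)
qed

lemma quot_map_hpart: "quot_map ` hpart WL p = hpart (W_alg Q) p"
  by (simp add: WL_simps(5) W_alg_simps quot_map_image[OF hpart_sub] W_proj_image)

lemma quot_map_deg: "quot_map ` deg WL n = deg (W_alg Q) n"
  by (simp add: WL_simps(6) W_alg_simps quot_map_image[OF deg_sub] W_proj_image)

lemma quot_map_brk: "\<lbrakk>x \<in> carrier WL; y \<in> carrier WL\<rbrakk> \<Longrightarrow> quot_map (brk WL x y) = Qt.B (quot_map x) (quot_map y)"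
  by (auto simp: WL_simps(1) WL_brk quot_map_cls W_action_mem W_proj_brk)

text \<open>The quotient of the Lie conformal superalgebra inherits the axioms from $W$ along the canonical
isomorphism.\<close>

lemma WL_graded_lsa: "graded_lsa K WL"
proof (rule graded_lsa_transport[OF WL_superspace Qt.W_alg_graded_lsa quot_map_lin quot_map_bij quot_map_hpart quot_map_deg])
  show "deg WL n \<subseteq> carrier WL" for n using deg_sub by (auto simp: WL_simps(1,6))
  show "brk WL x y \<in> carrier WL" if "x \<in> carrier WL" "y \<in> carrier WL" for x y
    using that by (auto simp: WL_simps(1) WL_brk W_action_mem)
qed (rule quot_map_brk)

lemma quot_map_graded_lsa_hom: "graded_lsa_hom K WL (W_alg Q) quot_map"
  unfolding graded_lsa_hom_def even_map_def
  using WL_graded_lsa Qt.W_alg_graded_lsa quot_map_lin quot_map_hpart quot_map_deg quot_map_brk by simp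

lemma quot_map_bij_deg: "bij_betw quot_map (deg WL n) (deg (W_alg Q) n)"
  by (rule bij_betw_subset[OF quot_map_bij _ quot_map_deg]) (use deg_sub in \<open>auto simp: WL_simps(1,6)\<close>)

definition quot_action :: "(int \<Rightarrow> 'a set) \<Rightarrow> (int \<Rightarrow> 'a) \<Rightarrow> int \<Rightarrow> 'a" where
  "quot_action F = W_action (SOME v. v \<in> W_carrier P \<and> W_proj v = F)"

text \<open>Representatives of the same class differ by some $\partial z$, which acts by zero.\<close>

lemma W_action_cl_cong:
  assumes v: "v \<in> W_carrier P" and u: "u \<in> W_carrier P" and e: "W_proj u = W_proj v" and w: "w \<in> W_carrier P"
  shows "W_action u w = W_action v w"
proof -
  interpret c: lin_hom K "W_space P" "W_space Q" W_proj by (rule W_proj_hom)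
  interpret a: lin_hom K "W_space P" "W_space P" "\<lambda>v. W_action v w" by (intro lin_homI W_superspace W_action_lin_left w)
  have vw: "v \<in> carrier (W_space P)" "u \<in> carrier (W_space P)" using v u by (simp_all add: W_space_carrier)
  then have d: "u \<ominus>\<^bsub>W_space P\<^esub> v \<in> W_carrier P" using H.M.minus_closed W_space_carrier by blast
  have "W_proj (u \<ominus>\<^bsub>W_space P\<^esub> v) = \<zero>\<^bsub>W_space Q\<^esub>" using minus_eq_zero_iff[OF module_abelian[OF Qt.W_module]] vw c.closed by (simp add: c.minus e)
  then obtain z where z: "z \<in> W_carrier P" "u \<ominus>\<^bsub>W_space P\<^esub> v = W_dd P z" using W_proj_zero_iff[OF d] by blast
  have "W_action u w \<ominus>\<^bsub>W_space P\<^esub> W_action v w = \<zero>\<^bsub>W_space P\<^esub>"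
    using a.minus[OF vw(2,1)] W_action_dd[OF z(1) w] d z(2) by simp
  then show ?thesis using minus_eq_zero_iff[OF module_abelian[OF W_module]] a.closed vw by blast
qed

lemma quot_action_some:
  assumes F: "F \<in> W_carrier Q" obtains v where "v \<in> W_carrier P" "W_proj v = F" "quot_action F = W_action v"
proof -
  define v where "v = (SOME v. v \<in> W_carrier P \<and> W_proj v = F)"
  obtain v' where "v' \<in> W_carrier P \<and> W_proj v' = F" using W_proj_lift[OF F] by metis
  then have "v \<in> W_carrier P \<and> W_proj v = F" unfolding v_def by (rule someI[where P = "\<lambda>v. v \<in> W_carrier P \<and> W_proj v = F"])
  then show ?thesis using that[of v] unfolding quot_action_def v_def[symmetric] by blast
qed

lemma quot_action_cl: assumes v: "v \<in> W_carrier P" and w: "w \<in> W_carrier P" shows "quot_action (W_proj v) w = W_action v w"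
  using quot_action_some[OF W_proj_mem[OF v]] W_action_cl_cong[OF v _ _ w] by metis

lemma quot_action_deg: "\<lbrakk>F \<in> deg (W_alg Q) m; w \<in> W_deg P n\<rbrakk> \<Longrightarrow> quot_action F w \<in> W_deg P (m + n)"
proof -
  assume F: "F \<in> deg (W_alg Q) m" and w: "w \<in> W_deg P n"
  then obtain v where v: "v \<in> W_deg P m" "F = W_proj v" using W_proj_image(3)[of m] by (auto simp: W_alg_simps)
  show ?thesis using v w by (simp add: quot_action_cl W_deg_carrier W_action_deg)
qed

lemma quot_action_action: "lsa_action K (W_alg Q) (W_space P) quot_action"
  unfolding lsa_action_def
proof (intro conjI ballI allI)
  note s = W_alg_simps Qt.W_space_carrier W_space_carrier
  show "graded_lsa K (W_alg Q)" by (rule Qt.W_alg_graded_lsa)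
  show "superspace K (W_space P)" by (rule W_superspace)
  show "lin_map K (W_alg Q) (W_space P) (\<lambda>x. quot_action x w)" if "w \<in> carrier (W_space P)" for w
  proof (rule lin_mapI)
    have w: "w \<in> W_carrier P" using that by (simp add: s)
    show "quot_action x w \<in> carrier (W_space P)" if "x \<in> carrier (W_alg Q)" for x
    proof -
      have x': "x \<in> W_carrier Q" using that by (simp add: s)
      obtain v where "v \<in> W_carrier P" "quot_action x = W_action v" using quot_action_some[of x] x' by metis
      then show ?thesis by (simp add: s W_action_mem w)
    qed
    show "quot_action (x \<oplus>\<^bsub>W_alg Q\<^esub> y) w = quot_action x w \<oplus>\<^bsub>W_space P\<^esub> quot_action y w" if x: "x \<in> carrier (W_alg Q)" "y \<in> carrier (W_alg Q)" for x y
    proof -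
      obtain v u where v: "v \<in> W_carrier P" "x = W_proj v" "u \<in> W_carrier P" "y = W_proj u" using x unfolding s W_proj_image(1)[symmetric] by blast
      have c: "v \<in> carrier (W_space P)" "u \<in> carrier (W_space P)" using v by (simp_all add: s)
      have "x \<oplus>\<^bsub>W_alg Q\<^esub> y = W_proj (v \<oplus>\<^bsub>W_space P\<^esub> u)" using lin_map_add[OF W_proj_lin c] by (simp add: v s)
      then show ?thesis using lin_map_add[OF W_action_lin_left[OF w] c] by (simp add: v quot_action_cl w W_add_cl)
    qed
    show "quot_action (a \<odot>\<^bsub>W_alg Q\<^esub> x) w = a \<odot>\<^bsub>W_space P\<^esub> quot_action x w" if x: "a \<in> carrier K" "x \<in> carrier (W_alg Q)" for a x
    proof -
      obtain v where v: "v \<in> W_carrier P" "x = W_proj v" using x unfolding s W_proj_image(1)[symmetric] by blast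
      have c: "v \<in> carrier (W_space P)" using v by (simp_all add: s)
      have "a \<odot>\<^bsub>W_alg Q\<^esub> x = W_proj (a \<odot>\<^bsub>W_space P\<^esub> v)" using lin_map_smult[OF W_proj_lin x(1) c] by (simp add: v s)
      then show ?thesis using lin_map_smult[OF W_action_lin_left[OF w] x(1) c] by (simp add: v quot_action_cl w W_smult_cl x(1))
    qed
  qed
  show "lin_map K (W_space P) (W_space P) (quot_action x)" if x: "x \<in> carrier (W_alg Q)" for x
  proof -
    obtain v where "v \<in> W_carrier P" "quot_action x = W_action v" using quot_action_some[of x] x by (metis s(1,8))
    then show ?thesis by (simp add: W_action_lin_right)
  qed
  show "quot_action x w \<in> hpart (W_space P) (p + q)" if x: "x \<in> hpart (W_alg Q) p" and w: "w \<in> hpart (W_space P) q" for p q x w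
  proof -
    obtain v where v: "v \<in> hpart (W_space P) p" "x = W_proj v" using x unfolding s W_proj_image(2)[symmetric] by blast
    have c: "v \<in> W_carrier P" "w \<in> W_carrier P" using v w hpart_sub by blast+
    then show ?thesis using W_action_hpart[OF v(1) w] by (simp add: v quot_action_cl)
  qed
  show "quot_action (Qt.B x y) w = quot_action x (quot_action y w) \<ominus>\<^bsub>W_space P\<^esub> signed (W_space P) (p * q) (quot_action y (quot_action x w))"
    if x: "x \<in> hpart (W_alg Q) p" and y: "y \<in> hpart (W_alg Q) q" and w: "w \<in> carrier (W_space P)" for p q x y w
  proof -
    obtain v where v: "v \<in> hpart (W_space P) p" "x = W_proj v" using x unfolding s W_proj_image(2)[symmetric] by blast
    obtain u where u: "u \<in> hpart (W_space P) q" "y = W_proj u" using y unfolding s W_proj_image(2)[symmetric] by blast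
    have c: "v \<in> W_carrier P" "u \<in> W_carrier P" "w \<in> W_carrier P" using v u w hpart_sub by (auto simp: s)
    let ?a = "W_action (W_dot_brk v u) w" and ?b = "signed (W_space P) (p * q) (W_action u (W_action v w))"
    have ab: "?a \<in> carrier (W_space P)" "?b \<in> carrier (W_space P)"
      using c W_action_mem W_dot_brk_mem H.signed_closed[of "W_action u (W_action v w)" "p * q"] by (simp_all add: s)
    have "quot_action (Qt.B x y) w = ?a" using W_proj_brk(2)[OF c(1,2)] quot_action_cl[OF W_dot_brk_mem[OF c(1,2)] c(3)] by (simp add: v u)
    also have "?a = (?a \<oplus>\<^bsub>W_space P\<^esub> ?b) \<ominus>\<^bsub>W_space P\<^esub> ?b"
      using ab by (simp add: a_minus_def H.M.a_assoc H.M.r_neg)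
    also have "\<dots> = quot_action x (quot_action y w) \<ominus>\<^bsub>W_space P\<^esub> signed (W_space P) (p * q) (quot_action y (quot_action x w))"
      using W_action_jacobi[OF v(1) u(1) c(3)] by (simp add: v u quot_action_cl c W_action_mem)
    finally show ?thesis .
  qed
qed

lemma quot_action_phi:
  assumes v: "v \<in> W_carrier P" and w: "w \<in> W_carrier P"
  shows "quot_action (quot_map (W_cls P v)) w = lambda_brk P v w 0"
  by (simp add: quot_map_cls quot_action_cl lambda_brk_zero v w)

lemma quot_action_inj:
  assumes n: "m \<ge> -1" "n \<ge> -1" and f: "f \<in> invariants P (ar m)" "f \<in> hpart (sp P (ar m)) p"
    and g: "g \<in> invariants P (ar n)" "g \<in> hpart (sp P (ar n)) q"
  shows "quot_action (quot_map (W_cls P (W_inj P m f))) (W_inj P n g) = W_inj P (m + n)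
    (cbox P m n f g 0 \<ominus>\<^bsub>sp P (ar (m + n))\<^esub> signed (sp P (ar (m + n))) (p * q)
      (eval_neg (sp P (ar (m + n))) (dd P (ar (m + n))) (cbox P n m g f)))"
proof -
  note c = inv_carrier[OF f(1)] inv_carrier[OF g(1)]
  have "eval_neg (sp P (ar (m + n))) (dd P (ar (m + n))) (cbox P n m g f) = dbox n m g f"
    using cbox_values(2)[OF c(2,1)] by (simp add: add.commute)
  then show ?thesis
    using W_action_inj[OF n f(1) g(1)] sbrk_homog[OF f(2) g(2)] cbox_values(1)[OF c]
    by (simp add: quot_map_cls quot_action_cl W_inj_mem f(1) g(1))
qed

end

theorem proposition3p7:
  fixes K :: "('k, 'm) ring_scheme"
    and P :: "('k, 'a) conformal_operad"
    and Q :: "('k, 'b) conformal_pseudo_operad"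
  assumes "field K" and "char_zero K"
  shows
   "(conformal_operad K P \<longrightarrow>
       linear_operad K (quot_operad P) \<and>
       (\<forall>ms f gs. f \<in> carrier (sp P (length ms)) \<and> args P ms gs \<longrightarrow>
          opcomp (quot_operad P) ms (dcls P (length ms) f) (map2 (dcls P) ms gs) =
          dcls P (sum_list ms) (ccomp P ms f gs {#})) \<and>
       (\<forall>n \<sigma> f. \<sigma> permutes {1..n} \<and> f \<in> carrier (sp P n) \<longrightarrow>
          act (quot_operad P) n \<sigma> (dcls P n f) = dcls P n (act P n \<sigma> f)) \<and>
       (\<forall>U. is_conformal_unit P U \<longrightarrow> is_operad_unit (quot_operad P) U))
    \<and>
    (conformal_pseudo_operad K Q \<longrightarrow>
       linear_pseudo_operad K (quot_pseudo_operad Q) \<and>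
       (\<forall>n m i f g. i \<in> {1..n} \<and> f \<in> carrier (sp Q n) \<and> g \<in> carrier (sp Q m) \<longrightarrow>
          pcomp (quot_pseudo_operad Q) n m i (dcls Q n f) (dcls Q m g) =
          dcls Q (n + m - 1) (cpcomp Q n m i f g 0)) \<and>
       (\<forall>n \<sigma> f. \<sigma> permutes {1..n} \<and> f \<in> carrier (sp Q n) \<longrightarrow>
          act (quot_pseudo_operad Q) n \<sigma> (dcls Q n f) = dcls Q n (act Q n \<sigma> f)))
    \<and>
    (conformal_pseudo_operad K Q \<longrightarrow>
       (\<exists>\<phi>.
          graded_lsa_hom K (W_quot_alg Q) (W_alg (quot_pseudo_operad Q)) \<phi> \<and>
          \<phi> ` carrier (W_quot_alg Q) = carrier (W_alg (quot_pseudo_operad Q)) \<and>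
          (\<forall>w\<in>carrier (W_space Q). \<phi> (W_cls Q w) = (\<lambda>n\<in>{-1..}. dcls Q (ar n) (w n))) \<and>
          (\<forall>n\<ge>-1. n = 0 \<or> (\<forall>f\<in>carrier (sp Q (ar n)). dd Q (ar n) f = \<zero>\<^bsub>sp Q (ar n)\<^esub> \<longrightarrow> f = \<zero>\<^bsub>sp Q (ar n)\<^esub>) \<longrightarrow>
             bij_betw \<phi> (deg (W_quot_alg Q) n) (deg (W_alg (quot_pseudo_operad Q)) n)) \<and>
          (\<exists>\<rho>.
             lsa_action K (W_alg (quot_pseudo_operad Q)) (W_space Q) \<rho> \<and>
             (\<forall>m n. \<forall>F\<in>deg (W_alg (quot_pseudo_operad Q)) m. \<forall>w\<in>W_deg Q n. \<rho> F w \<in> W_deg Q (m + n)) \<and>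
             (\<forall>v\<in>carrier (W_space Q). \<forall>w\<in>carrier (W_space Q). \<rho> (\<phi> (W_cls Q v)) w = lambda_brk Q v w 0) \<and>
             (\<forall>m\<ge>-1. \<forall>n\<ge>-1. \<forall>p q. \<forall>F\<in>deg (W_alg (quot_pseudo_operad Q)) m.
                \<forall>f\<in>invariants Q (ar m) \<inter> hpart (sp Q (ar m)) p.
                \<forall>g\<in>invariants Q (ar n) \<inter> hpart (sp Q (ar n)) q.
                  \<phi> (W_cls Q (W_inj Q m f)) = F \<longrightarrow>
                  \<rho> F (W_inj Q n g) =
                  W_inj Q (m + n)
                    (cbox Q m n f g 0 \<ominus>\<^bsub>sp Q (ar (m + n))\<^esub>
                     signed (sp Q (ar (m + n))) (p * q)
                       (eval_neg (sp Q (ar (m + n))) (dd Q (ar (m + n))) (cbox Q n m g f)))))))"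
proof (intro conjI impI)
  assume P: "conformal_operad K P"
  interpret P: conformal_operad K P by (rule P)
  show "linear_operad K (quot_operad P)" by (rule P.quot_linear_operad)
  show "\<forall>ms f gs. f \<in> carrier (sp P (length ms)) \<and> args P ms gs \<longrightarrow>
      opcomp (quot_operad P) ms (dcls P (length ms) f) (map2 (dcls P) ms gs) = dcls P (sum_list ms) (ccomp P ms f gs {#})"
    using P.opcomp_dcls by blast
  show "\<forall>n \<sigma> f. \<sigma> permutes {1..n} \<and> f \<in> carrier (sp P n) \<longrightarrow> act (quot_operad P) n \<sigma> (dcls P n f) = dcls P n (act P n \<sigma> f)"
    using P.quot_act_dcls by (simp add: quot_operad_def)
  show "\<forall>U. is_conformal_unit P U \<longrightarrow> is_operad_unit (quot_operad P) U"
    using P.quot_operad_unit by blast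
next
  assume Q: "conformal_pseudo_operad K Q"
  interpret Q: conformal_pseudo_operad K Q by (rule Q)
  show "linear_pseudo_operad K (quot_pseudo_operad Q)" by (rule Q.quot_linear_pseudo_operad)
  show "\<forall>n m i f g. i \<in> {1..n} \<and> f \<in> carrier (sp Q n) \<and> g \<in> carrier (sp Q m) \<longrightarrow>
      pcomp (quot_pseudo_operad Q) n m i (dcls Q n f) (dcls Q m g) = dcls Q (n + m - 1) (cpcomp Q n m i f g 0)"
    using Q.pcomp_dcls by blast
  show "\<forall>n \<sigma> f. \<sigma> permutes {1..n} \<and> f \<in> carrier (sp Q n) \<longrightarrow> act (quot_pseudo_operad Q) n \<sigma> (dcls Q n f) = dcls Q n (act Q n \<sigma> f)"
    using Q.quot_act_dcls by (simp add: quot_pseudo_operad_def)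
next
  assume Q: "conformal_pseudo_operad K Q"
  interpret Q: conformal_pseudo_operad_char0 K Q
    by (intro conformal_pseudo_operad_char0.intro conformal_pseudo_operad_char0_axioms.intro Q assms)
  show "\<exists>\<phi>. graded_lsa_hom K (W_quot_alg Q) (W_alg (quot_pseudo_operad Q)) \<phi> \<and>
          \<phi> ` carrier (W_quot_alg Q) = carrier (W_alg (quot_pseudo_operad Q)) \<and>
          (\<forall>w\<in>carrier (W_space Q). \<phi> (W_cls Q w) = (\<lambda>n\<in>{-1..}. dcls Q (ar n) (w n))) \<and>
          (\<forall>n\<ge>-1. n = 0 \<or> (\<forall>f\<in>carrier (sp Q (ar n)). dd Q (ar n) f = \<zero>\<^bsub>sp Q (ar n)\<^esub> \<longrightarrow> f = \<zero>\<^bsub>sp Q (ar n)\<^esub>) \<longrightarrow>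
             bij_betw \<phi> (deg (W_quot_alg Q) n) (deg (W_alg (quot_pseudo_operad Q)) n)) \<and>
          (\<exists>\<rho>.
             lsa_action K (W_alg (quot_pseudo_operad Q)) (W_space Q) \<rho> \<and>
             (\<forall>m n. \<forall>F\<in>deg (W_alg (quot_pseudo_operad Q)) m. \<forall>w\<in>W_deg Q n. \<rho> F w \<in> W_deg Q (m + n)) \<and>
             (\<forall>v\<in>carrier (W_space Q). \<forall>w\<in>carrier (W_space Q). \<rho> (\<phi> (W_cls Q v)) w = lambda_brk Q v w 0) \<and>
             (\<forall>m\<ge>-1. \<forall>n\<ge>-1. \<forall>p q. \<forall>F\<in>deg (W_alg (quot_pseudo_operad Q)) m.
                \<forall>f\<in>invariants Q (ar m) \<inter> hpart (sp Q (ar m)) p.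
                \<forall>g\<in>invariants Q (ar n) \<inter> hpart (sp Q (ar n)) q.
                  \<phi> (W_cls Q (W_inj Q m f)) = F \<longrightarrow>
                  \<rho> F (W_inj Q n g) =
                  W_inj Q (m + n)
                    (cbox Q m n f g 0 \<ominus>\<^bsub>sp Q (ar (m + n))\<^esub>
                     signed (sp Q (ar (m + n))) (p * q)
                       (eval_neg (sp Q (ar (m + n))) (dd Q (ar (m + n))) (cbox Q n m g f)))))"
  proof (intro exI[of _ Q.quot_map] exI[of _ Q.quot_action] conjI allI impI ballI)
    show "graded_lsa_hom K (W_quot_alg Q) (W_alg (quot_pseudo_operad Q)) Q.quot_map" by (rule Q.quot_map_graded_lsa_hom)
    show "Q.quot_map ` carrier (W_quot_alg Q) = carrier (W_alg (quot_pseudo_operad Q))"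
      using Q.quot_map_bij by (simp add: bij_betw_def)
    show "Q.quot_map (W_cls Q w) = (\<lambda>n\<in>{-1..}. dcls Q (ar n) (w n))" if "w \<in> carrier (W_space Q)" for w
      using that Q.quot_map_cls by (simp add: Q.W_space_carrier Q.W_proj_def)
    show "bij_betw Q.quot_map (deg (W_quot_alg Q) n) (deg (W_alg (quot_pseudo_operad Q)) n)" for n by (rule Q.quot_map_bij_deg)
    show "lsa_action K (W_alg (quot_pseudo_operad Q)) (W_space Q) Q.quot_action" by (rule Q.quot_action_action)
    show "Q.quot_action F w \<in> W_deg Q (m + n)" if "F \<in> deg (W_alg (quot_pseudo_operad Q)) m" "w \<in> W_deg Q n" for m n F w
      using that by (rule Q.quot_action_deg)
    show "Q.quot_action (Q.quot_map (W_cls Q v)) w = lambda_brk Q v w 0" if "v \<in> carrier (W_space Q)" "w \<in> carrier (W_space Q)" for v w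
      using that Q.quot_action_phi by (simp add: Q.W_space_carrier)
  next
    fix m n :: int and p q F f g
    assume "-1 \<le> m" "-1 \<le> n" and f: "f \<in> invariants Q (ar m) \<inter> hpart (sp Q (ar m)) p"
      and g: "g \<in> invariants Q (ar n) \<inter> hpart (sp Q (ar n)) q" and F: "Q.quot_map (W_cls Q (W_inj Q m f)) = F"
    then show "Q.quot_action F (W_inj Q n g) = W_inj Q (m + n)
        (cbox Q m n f g 0 \<ominus>\<^bsub>sp Q (ar (m + n))\<^esub> signed (sp Q (ar (m + n))) (p * q)
          (eval_neg (sp Q (ar (m + n))) (dd Q (ar (m + n))) (cbox Q n m g f)))"
      using Q.quot_action_inj[of m n f p g q] by blast
  qed
qed

end
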